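(* Let $X$ be a compact Riemann surface of genus $g\ge2$ and $Q(X)$ its space of holomorphic quadratic differentials, with stratification $\{Q_i(X)\}$ as in the context. For $\phi\in Q(X)$ and $\psi_1,\psi_2\in T_\phi Q(X)\simeq Q(X)$ set $\langle\psi_1,\psi_2\rangle_\phi=\int_X\frac{\psi_1\overline{\psi_2}}{4|\phi|}$ (where defined), and let $\omega_\phi=\mathrm{Im}\langle\cdot,\cdot\rangle_\phi$. For each stratum $Q_i(X)\subset Q(X)$: (i) the pairing $\langle\psi_1,\psi_2\rangle_\phi$ is well-defined and positive-definite on the tangent bundle $TQ_i(X)$; (ii) the alternating form $\omega_\phi$ on $TQ_i(X)$ can be expressed as $\omega_\phi=\frac{i}{2}\partial\bar\partial N$, where $N:Q(X)\to\mathbb{R}$ is defined by $N(\phi)=\|\phi\|=\int_X|\phi|$ (restricted to $Q_i(X)$); in particular $\omega_\phi$ is closed, and thus (iii) the hermitian form $\langle\cdot,\cdot\rangle_\phi$ defines a Kähler structure on $Q_i(X)$.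
   Context: The integrand $\psi_1\overline{\psi_2}/(4|\phi|)$ is regarded as a complex-valued density on $X$: in a local coordinate $z=x+iy$ with $\phi=\phi(z)dz^2$ and $\psi_j=\psi_j(z)dz^2$ it is $\frac{\psi_1(z)\overline{\psi_2(z)}}{4|\phi(z)|}\,dx\,dy$. The pairing is complex linear in the first variable. The sign in (ii) is for the following way of evaluating $\partial\bar\partial N$ on tangent vectors: in holomorphic coordinates $\zeta_k$ on $Q_i(X)$, $\partial\bar\partial N(v,w)=-2i\,\mathrm{Im}\sum_{k,l}\frac{\partial^2N}{\partial\zeta_k\partial\bar\zeta_l}v_k\overline{w_l}$. Stratification. The symbol of a nonzero $\phi\in Q(X)$ is the list of multiplicities of its zeros together with a sign recording whether or not $\phi$ is the square of a holomorphic $1$-form. $\{Q_i(X)\}$ is a fixed complex analytic stratification of $Q(X)$ (a locally finite collection of locally closed complex submanifolds covering $Q(X)$, each stratum meeting the closure of another being contained in that closure, with closures and boundaries of strata complex analytic sets) such that each stratum is connected and $\mathbb{C}^*$-invariant; the symbol is constant on each stratum ($\{0\}$ being a stratum by itself, for which the assertions are vacuous); and if $q\in Q_i(X)$, $q\neq0$, $v\in T_qQ_i(X)$, then the meromorphic function $v/q$ has at most simple poles. Such stratifications exist. *)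

theory Defs
  imports "HOL-Complex_Analysis.Complex_Analysis" "HOL-Homology.Homology"
    "HOL-Library.Multiset"
begin

section \<open>Compact Riemann surfaces\<close>

text \<open>A chart is a pair of its domain and its coordinate function; the values of the coordinate
  function outside the domain are irrelevant.\<close>

type_synonym 'a chart = "'a set \<times> ('a \<Rightarrow> complex)"

definition chart_param :: "'a chart \<Rightarrow> complex \<Rightarrow> 'a" where
  "chart_param c = inv_into (fst c) (snd c)"

definition complex_atlas :: "'a topology \<Rightarrow> 'a chart set \<Rightarrow> bool" where
  "complex_atlas X A \<longleftrightarrow>
     (\<forall>c\<in>A. openin X (fst c) \<and> open (snd c ` fst c) \<and>
        homeomorphic_map (subtopology X (fst c)) (top_of_set (snd c ` fst c)) (snd c)) \<and>
     (\<Union>c\<in>A. fst c) = topspace X \<and>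
     (\<forall>c\<in>A. \<forall>d\<in>A. (snd d \<circ> chart_param c) holomorphic_on (snd c ` (fst c \<inter> fst d)))"

definition compact_riemann_surface :: "'a topology \<Rightarrow> 'a chart set \<Rightarrow> bool" where
  "compact_riemann_surface X A \<longleftrightarrow>
     complex_atlas X A \<and> Hausdorff_space X \<and> compact_space X \<and> connected_space X"

text \<open>The topological genus: the first integral homology is free abelian of rank \<open>2g\<close>.\<close>

definition has_genus :: "'a topology \<Rightarrow> nat \<Rightarrow> bool" where
  "has_genus X g \<longleftrightarrow> homology_group 1 X \<cong> free_Abelian_group {..<2 * g}"


section \<open>Holomorphic differentials and integrals of densities\<close>

text \<open>Differentials and densities are families \<open>f c p\<close>: the coefficient, at the point \<open>p\<close>, with
  respect to the chart \<open>c\<close>. Outside the atlas and the chart domains a differential is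
  set to \<open>0\<close>, so that equality of differentials is equality of functions.\<close>

type_synonym 'a differential = "'a chart \<Rightarrow> 'a \<Rightarrow> complex"

text \<open>The holomorphic \<open>k\<close>-differentials \<open>f(z) dz\<^sup>k\<close>: one-forms for \<open>k = 1\<close>, quadratic
  differentials for \<open>k = 2\<close>.\<close>

definition holomorphic_differentials :: "nat \<Rightarrow> 'a chart set \<Rightarrow> 'a differential set" where
  "holomorphic_differentials k A =
     {f. (\<forall>c\<in>A. (f c \<circ> chart_param c) holomorphic_on (snd c ` fst c)) \<and>
         (\<forall>c\<in>A. \<forall>d\<in>A. \<forall>p\<in>fst c \<inter> fst d.
            f c p = f d p * deriv (snd d \<circ> chart_param c) (snd c p) ^ k) \<and>
         (\<forall>c p. \<not> (c \<in> A \<and> p \<in> fst c) \<longrightarrow> f c p = 0)}"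

text \<open>For a density (whose coefficients transform with the squared modulus of the derivative of
  the coordinate change) on a compact surface, integrability amounts to integrability of its
  coefficient over every single chart.\<close>

definition surface_integrable ::
  "'a chart set \<Rightarrow> ('a chart \<Rightarrow> 'a \<Rightarrow> 'b::{banach, second_countable_topology}) \<Rightarrow> bool" where
  "surface_integrable A f \<longleftrightarrow>
     (\<forall>c\<in>A. set_integrable lborel (snd c ` fst c) (\<lambda>z. f c (chart_param c z)))"

definition chart_partition ::
  "'a topology \<Rightarrow> 'a chart set \<Rightarrow> 'a chart set \<Rightarrow> ('a chart \<Rightarrow> 'a set) \<Rightarrow> bool" where
  "chart_partition X A C E \<longleftrightarrow>
     finite C \<and> C \<subseteq> A \<and> disjoint_family_on E C \<and>
     (\<forall>c\<in>C. E c \<subseteq> fst c \<and> snd c ` E c \<in> sets borel) \<and> (\<Union>c\<in>C. E c) = topspace X"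

text \<open>The surface is cut into finitely many Borel pieces, each contained in a chart. Such a
  partition exists by compactness, and for integrable densities the value does not depend on it.\<close>

definition surface_integral ::
  "'a topology \<Rightarrow> 'a chart set \<Rightarrow> ('a chart \<Rightarrow> 'a \<Rightarrow> 'b::{banach, second_countable_topology}) \<Rightarrow> 'b"
  where
  "surface_integral X A f =
     (let P = (SOME P. chart_partition X A (fst P) (snd P))
      in \<Sum>c\<in>fst P. set_lebesgue_integral lborel (snd c ` snd P c) (\<lambda>z. f c (chart_param c z)))"

definition qd_norm :: "'a topology \<Rightarrow> 'a chart set \<Rightarrow> 'a differential \<Rightarrow> real" where
  "qd_norm X A \<phi> = surface_integral X A (\<lambda>c p. cmod (\<phi> c p))"

definition pairing_density ::
  "'a differential \<Rightarrow> 'a differential \<Rightarrow> 'a differential \<Rightarrow> 'a chart \<Rightarrow> 'a \<Rightarrow> complex" where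
  "pairing_density \<phi> \<psi>\<^sub>1 \<psi>\<^sub>2 =
     (\<lambda>c p. \<psi>\<^sub>1 c p * cnj (\<psi>\<^sub>2 c p) / (4 * complex_of_real (cmod (\<phi> c p))))"

definition pairing ::
  "'a topology \<Rightarrow> 'a chart set \<Rightarrow> 'a differential \<Rightarrow> 'a differential \<Rightarrow> 'a differential \<Rightarrow> complex"
  where
  "pairing X A \<phi> \<psi>\<^sub>1 \<psi>\<^sub>2 = surface_integral X A (pairing_density \<phi> \<psi>\<^sub>1 \<psi>\<^sub>2)"

text \<open>The order of vanishing does not depend on the chosen chart.\<close>

definition zero_order :: "'a chart set \<Rightarrow> 'a differential \<Rightarrow> 'a \<Rightarrow> int" where
  "zero_order A \<phi> p =
     (let c = (SOME c. c \<in> A \<and> p \<in> fst c) in zorder (\<lambda>z. \<phi> c (chart_param c z)) (snd c p))"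

definition symbol :: "'a topology \<Rightarrow> 'a chart set \<Rightarrow> 'a differential \<Rightarrow> int multiset \<times> bool" where
  "symbol X A \<phi> =
     (image_mset (zero_order A \<phi>) (mset_set {p \<in> topspace X. zero_order A \<phi> p > 0}),
      \<exists>\<omega>\<in>holomorphic_differentials 1 A. \<phi> = (\<lambda>c p. (\<omega> c p)\<^sup>2))"

definition quotient_at_most_simple_poles :: "'a chart set \<Rightarrow> 'a differential \<Rightarrow> 'a differential \<Rightarrow> bool"
  where
  "quotient_at_most_simple_poles A \<psi> \<phi> \<longleftrightarrow>
     \<psi> = (\<lambda>c p. 0) \<or>
     (\<forall>c\<in>A. \<forall>p\<in>fst c.
        zorder (\<lambda>z. \<psi> c (chart_param c z) / \<phi> c (chart_param c z)) (snd c p) \<ge> - 1)"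

text \<open>A basis \<open>e\<close> of the complex vector space \<open>Q(X)\<close> identifies it with \<open>\<complex>\<^sup>n\<close>; the
  complex manifold structure of \<open>Q(X)\<close>, and the identification of its tangent spaces with
  \<open>Q(X)\<close>, are those of \<open>\<complex>\<^sup>n\<close>.\<close>

definition qd_of :: "('n::finite \<Rightarrow> 'a differential) \<Rightarrow> complex^'n \<Rightarrow> 'a differential" where
  "qd_of e a = (\<lambda>c p. \<Sum>j\<in>UNIV. a $ j * e j c p)"

definition qd_basis :: "'a chart set \<Rightarrow> ('n::finite \<Rightarrow> 'a differential) \<Rightarrow> bool" where
  "qd_basis A e \<longleftrightarrow> bij_betw (qd_of e) UNIV (holomorphic_differentials 2 A)"


section \<open>Complex submanifolds, analytic sets and stratifications of \<open>\<complex>\<^sup>n\<close>\<close>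

definition holo_fun :: "(complex^'n::finite \<Rightarrow> complex) \<Rightarrow> (complex^'n) set \<Rightarrow> bool" where
  "holo_fun f U \<longleftrightarrow>
     open U \<and> (\<forall>x\<in>U. \<exists>D. (f has_derivative D) (at x) \<and> (\<forall>a v. D (a *s v) = a * D v))"

definition holo_map :: "(complex^'n::finite \<Rightarrow> complex^'m::finite) \<Rightarrow> (complex^'n) set \<Rightarrow> bool" where
  "holo_map F U \<longleftrightarrow> (\<forall>j. holo_fun (\<lambda>x. F x $ j) U)"

definition analytic_set :: "(complex^'n::finite) set \<Rightarrow> bool" where
  "analytic_set Z \<longleftrightarrow>
     (\<forall>x. \<exists>U \<F>. open U \<and> x \<in> U \<and> finite \<F> \<and> (\<forall>f\<in>\<F>. holo_fun f U) \<and>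
        Z \<inter> U = {y \<in> U. \<forall>f\<in>\<F>. f y = 0})"

text \<open>\<open>\<complex>\<^sup>K\<close> as a coordinate subspace of \<open>\<complex>\<^sup>n\<close>.\<close>

definition coord_subspace :: "'n set \<Rightarrow> (complex^'n::finite) set" where
  "coord_subspace K = {v. \<forall>j. j \<notin> K \<longrightarrow> v $ j = 0}"

text \<open>A biholomorphic map \<open>F\<close> from \<open>U\<close> onto an open set that straightens \<open>S \<inter> U\<close> to
  \<open>\<complex>\<^sup>K \<inter> F(U)\<close>. The components \<open>\<zeta>\<^sub>k = F\<^sub>k\<close>, \<open>k \<in> K\<close>, restrict to local holomorphic coordinates on
  \<open>S\<close>, and locally all holomorphic coordinates on \<open>S\<close> arise in this way.\<close>

definition adapted_chart ::
  "(complex^'n::finite) set \<Rightarrow> 'n set \<Rightarrow> (complex^'n) set \<Rightarrow> (complex^'n \<Rightarrow> complex^'n) \<Rightarrow> bool" where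
  "adapted_chart S K U F \<longleftrightarrow>
     open U \<and> open (F ` U) \<and> inj_on F U \<and> holo_map F U \<and> holo_map (inv_into U F) (F ` U) \<and>
     F ` (S \<inter> U) = F ` U \<inter> coord_subspace K"

text \<open>Embedded, hence locally closed, submanifolds.\<close>

definition complex_submanifold :: "(complex^'n::finite) set \<Rightarrow> bool" where
  "complex_submanifold S \<longleftrightarrow> (\<forall>q\<in>S. \<exists>K U F. q \<in> U \<and> adapted_chart S K U F)"

definition tangent_space :: "(complex^'n::finite) set \<Rightarrow> complex^'n \<Rightarrow> (complex^'n) set" where
  "tangent_space S q =
     {v. \<exists>\<gamma> :: real \<Rightarrow> complex^'n. \<gamma> 0 = q \<and> (\<forall>\<^sub>F t in nhds 0. \<gamma> t \<in> S) \<and>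
           (\<gamma> has_vector_derivative v) (at 0)}"

text \<open>The boundary of a stratum is its closure minus the stratum itself.\<close>

definition analytic_stratification :: "(complex^'n::finite) set set \<Rightarrow> bool" where
  "analytic_stratification \<S> \<longleftrightarrow>
     \<Union>\<S> = UNIV \<and>
     (\<forall>x. \<exists>U. open U \<and> x \<in> U \<and> finite {S \<in> \<S>. S \<inter> U \<noteq> {}}) \<and>
     (\<forall>S\<in>\<S>. complex_submanifold S) \<and>
     (\<forall>S\<in>\<S>. \<forall>T\<in>\<S>. S \<inter> closure T \<noteq> {} \<longrightarrow> S \<subseteq> closure T) \<and>
     (\<forall>S\<in>\<S>. analytic_set (closure S) \<and> analytic_set (closure S - S))"

definition qd_stratification ::
  "'a topology \<Rightarrow> 'a chart set \<Rightarrow> ('n::finite \<Rightarrow> 'a differential) \<Rightarrow> (complex^'n) set set \<Rightarrow> bool" where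
  "qd_stratification X A e \<S> \<longleftrightarrow>
     analytic_stratification \<S> \<and> {0} \<in> \<S> \<and>
     (\<forall>S\<in>\<S>. connected S) \<and>
     (\<forall>S\<in>\<S>. \<forall>a q. a \<noteq> 0 \<longrightarrow> q \<in> S \<longrightarrow> a *s q \<in> S) \<and>
     (\<forall>S\<in>\<S>. \<forall>q\<in>S. \<forall>r\<in>S. q \<noteq> 0 \<longrightarrow> r \<noteq> 0 \<longrightarrow>
        symbol X A (qd_of e q) = symbol X A (qd_of e r)) \<and>
     (\<forall>S\<in>\<S>. \<forall>q\<in>S. q \<noteq> 0 \<longrightarrow> (\<forall>v\<in>tangent_space S q.
        quotient_at_most_simple_poles A (qd_of e v) (qd_of e q)))"


section \<open>Calculus on submanifolds of \<open>\<complex>\<^sup>n\<close>\<close>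

definition dir_deriv ::
  "(complex^'n::finite \<Rightarrow> 'b::real_normed_vector) \<Rightarrow> complex^'n \<Rightarrow> complex^'n \<Rightarrow> 'b" where
  "dir_deriv f v x = vector_derivative (\<lambda>t. f (x + t *\<^sub>R v)) (at 0)"

text \<open>Differentiability classes \<open>C\<^sup>m\<close> of functions on a relatively open subset \<open>D\<close> of \<open>\<complex>\<^sup>K\<close>.\<close>

primrec C_upto ::
  "nat \<Rightarrow> 'n set \<Rightarrow> (complex^'n::finite) set \<Rightarrow> (complex^'n \<Rightarrow> 'b::real_normed_vector) \<Rightarrow> bool" where
  "C_upto 0 K D f \<longleftrightarrow> continuous_on D f"
| "C_upto (Suc m) K D f \<longleftrightarrow> continuous_on D f \<and>
     (\<forall>v\<in>coord_subspace K. (\<forall>x\<in>D. (\<lambda>t::real. f (x + t *\<^sub>R v)) differentiable (at 0)) \<and>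
        C_upto m K D (dir_deriv f v))"

definition C_infinity ::
  "'n set \<Rightarrow> (complex^'n::finite) set \<Rightarrow> (complex^'n \<Rightarrow> 'b::real_normed_vector) \<Rightarrow> bool" where
  "C_infinity K D f \<longleftrightarrow> (\<forall>m. C_upto m K D f)"

definition smooth_function ::
  "(complex^'n::finite) set \<Rightarrow> (complex^'n \<Rightarrow> 'b::real_normed_vector) \<Rightarrow> bool" where
  "smooth_function S f \<longleftrightarrow>
     (\<forall>K U F. adapted_chart S K U F \<longrightarrow> C_infinity K (F ` (S \<inter> U)) (f \<circ> inv_into U F))"

text \<open>The Wirtinger operators \<open>\<partial>/\<partial>\<zeta>\<^sub>k\<close> and \<open>\<partial>/\<partial>\<zeta>\<^sub>k\<close>-bar.\<close>

definition wirtinger :: "'n \<Rightarrow> (complex^'n::finite \<Rightarrow> complex) \<Rightarrow> complex^'n \<Rightarrow> complex" where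
  "wirtinger k f x = (dir_deriv f (axis k 1) x - \<i> * dir_deriv f (axis k \<i>) x) / 2"

definition wirtinger_bar :: "'n \<Rightarrow> (complex^'n::finite \<Rightarrow> complex) \<Rightarrow> complex^'n \<Rightarrow> complex" where
  "wirtinger_bar k f x = (dir_deriv f (axis k 1) x + \<i> * dir_deriv f (axis k \<i>) x) / 2"

text \<open>\<open>\<partial>\<partial>\<close>-bar of a real function \<open>f\<close> on a submanifold, evaluated at \<open>q\<close> on tangent vectors
  \<open>v\<close>, \<open>w\<close> in the coordinates \<open>\<zeta>\<^sub>k = F\<^sub>k\<close>, \<open>k \<in> K\<close>, with the convention
  \<open>-2i Im \<Sum> f\<^sub>k\<^sub>l v\<^sub>k w\<^sub>l\<close>-bar; here \<open>v\<^sub>k\<close> are the components of the image of \<open>v\<close> under the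
  differential of \<open>F\<close>.\<close>

definition del_delbar ::
  "'n set \<Rightarrow> (complex^'n::finite) set \<Rightarrow> (complex^'n \<Rightarrow> complex^'n) \<Rightarrow> (complex^'n \<Rightarrow> real) \<Rightarrow>
   complex^'n \<Rightarrow> complex^'n \<Rightarrow> complex^'n \<Rightarrow> complex" where
  "del_delbar K U F f q v w =
     - 2 * \<i> * complex_of_real (Im (\<Sum>k\<in>K. \<Sum>l\<in>K.
        wirtinger k (wirtinger_bar l (\<lambda>\<zeta>. complex_of_real (f (inv_into U F \<zeta>)))) (F q) *
        (dir_deriv F v q $ k) * cnj (dir_deriv F w q $ l)))"

text \<open>The coefficients, in the coordinates given by \<open>F\<close>, of a form \<open>h\<close> on pairs of tangent
  vectors.\<close>

definition pullback_form ::
  "(complex^'n::finite) set \<Rightarrow> (complex^'n \<Rightarrow> complex^'n) \<Rightarrow>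
   (complex^'n \<Rightarrow> complex^'n \<Rightarrow> complex^'n \<Rightarrow> 'b) \<Rightarrow> complex^'n \<Rightarrow> complex^'n \<Rightarrow> complex^'n \<Rightarrow> 'b" where
  "pullback_form U F h v w \<zeta> =
     h (inv_into U F \<zeta>) (dir_deriv (inv_into U F) v \<zeta>) (dir_deriv (inv_into U F) w \<zeta>)"

definition smooth_form ::
  "(complex^'n::finite) set \<Rightarrow>
   (complex^'n \<Rightarrow> complex^'n \<Rightarrow> complex^'n \<Rightarrow> 'b::real_normed_vector) \<Rightarrow> bool" where
  "smooth_form S h \<longleftrightarrow>
     (\<forall>K U F. adapted_chart S K U F \<longrightarrow>
        (\<forall>v\<in>coord_subspace K. \<forall>w\<in>coord_subspace K.
           C_infinity K (F ` (S \<inter> U)) (pullback_form U F h v w)))"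

text \<open>The exterior derivative of a two-form, evaluated on the constant vector fields \<open>u\<close>, \<open>v\<close>,
  \<open>w\<close> of a coordinate system, vanishes.\<close>

definition closed_two_form ::
  "(complex^'n::finite) set \<Rightarrow> (complex^'n \<Rightarrow> complex^'n \<Rightarrow> complex^'n \<Rightarrow> real) \<Rightarrow> bool" where
  "closed_two_form S \<omega> \<longleftrightarrow>
     smooth_form S \<omega> \<and>
     (\<forall>K U F. adapted_chart S K U F \<longrightarrow>
        (\<forall>\<zeta>\<in>F ` (S \<inter> U).
         \<forall>u\<in>coord_subspace K. \<forall>v\<in>coord_subspace K. \<forall>w\<in>coord_subspace K.
           dir_deriv (pullback_form U F \<omega> v w) u \<zeta>
         - dir_deriv (pullback_form U F \<omega> u w) v \<zeta>
         + dir_deriv (pullback_form U F \<omega> u v) w \<zeta> = 0))"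

definition positive_hermitian_on ::
  "(complex^'n::finite) set \<Rightarrow> (complex^'n \<Rightarrow> complex^'n \<Rightarrow> complex) \<Rightarrow> bool" where
  "positive_hermitian_on T h \<longleftrightarrow>
     (\<forall>u\<in>T. \<forall>v\<in>T. \<forall>w\<in>T. h (u + v) w = h u w + h v w) \<and>
     (\<forall>a. \<forall>v\<in>T. \<forall>w\<in>T. h (a *s v) w = a * h v w) \<and>
     (\<forall>v\<in>T. \<forall>w\<in>T. h w v = cnj (h v w)) \<and>
     (\<forall>v\<in>T. v \<noteq> 0 \<longrightarrow> Im (h v v) = 0 \<and> Re (h v v) > 0)"

definition kaehler_structure ::
  "(complex^'n::finite) set \<Rightarrow> (complex^'n \<Rightarrow> complex^'n \<Rightarrow> complex^'n \<Rightarrow> complex) \<Rightarrow> bool" where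
  "kaehler_structure S h \<longleftrightarrow>
     complex_submanifold S \<and>
     (\<forall>q\<in>S. positive_hermitian_on (tangent_space S q) (h q)) \<and>
     smooth_form S h \<and>
     closed_two_form S (\<lambda>q v w. Im (h q v w))"

end

theory Submission
  imports Defs
begin

text \<open>Near a point of a stratum the surface is cut into discs about the zeros of \<open>\<phi>\<close> and pieces without
  zeros. Since the symbol is constant, the number of zeros is constant, so each disc keeps exactly one
  zero and this zero moves holomorphically with \<open>\<phi>\<close>. A change of variables of the disc, holomorphic in
  the parameter, fixes the zero at the centre. Then \<open>\<phi> / \<phi>\<^sub>0\<close> is close to \<open>1\<close>, so that
  \<open>1 / \<bar>\<phi>\<bar>\<close> is \<open>1 / \<bar>\<phi>\<^sub>0\<bar>\<close> times the squared modulus of a holomorphic square root, and the integrand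
  \<open>\<psi>\<^sub>1 cnj \<psi>\<^sub>2 / (4 \<bar>\<phi>\<bar>)\<close> becomes a sum of products of holomorphic and antiholomorphic functions of
  the parameter. As \<open>\<psi> / \<phi>\<close> has at most simple poles, these are dominated by a multiple of
  \<open>1 / \<bar>w\<bar>\<close>, which is integrable; hence the pairing, and with it \<open>N(\<phi>) = 4 \<langle>\<phi>, \<phi>\<rangle>\<close>, is smooth.
  The Levi form of \<open>\<bar>\<phi>\<bar>\<close> is \<open>\<bar>\<psi>\<bar>\<^sup>2 / (4 \<bar>\<phi>\<bar>)\<close> away from the zeros, and the same domination allows
  differentiating \<open>N\<close> twice under the integral sign, which gives (ii). Thus \<open>\<omega>\<close> is \<open>d d\<^sup>c N\<close> up to a
  constant, and it is closed because partial derivatives commute. The stratum \<open>{0}\<close> is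
  the only one containing \<open>0\<close>, by the frontier condition.\<close>

section \<open>Bounded Gateaux-holomorphic functions\<close>

text \<open>In a fixed coordinate the integrand is not smooth in the parameter: for given
  \<open>w\<close>, \<open>1 / \<bar>\<phi>\<bar>\<close> is singular at every parameter whose zero
  sits at \<open>w\<close>. The change of variables has to be holomorphic in the parameter and to
  fix the circle, so it cannot be holomorphic in \<open>w\<close>; it is chosen so that its Jacobian
  splits into holomorphic and antiholomorphic terms. The Levi form concerns one parameter value
  only, and there a Lipschitz bound against the base point suffices in the fixed coordinate.
  Parameter dependence is measured by a bound on a ball and holomorphy along complex lines: Cauchy
  estimates turn a majorant of a family into majorants of its derivatives with the same singularity.
  Strata are parametrised by balls of the whole \<open>\<complex>^n\<close>, constant in the
  directions outside \<open>K\<close>, so the analytic lemmas speak of open balls only. The 4 in the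
  pairing is what differentiating \<open>\<bar>\<phi>\<bar>\<close> twice leaves: a factor
  \<open>1/2\<close>, half of which is cancelled by the derivative of
  \<open>1 / \<bar>\<phi>\<bar>\<close>.\<close>

definition hderiv :: "complex^'n::finite \<Rightarrow> (complex^'n \<Rightarrow> complex) \<Rightarrow> complex^'n \<Rightarrow> complex" where
  "hderiv v f z = deriv (\<lambda>s. f (z + s *s v)) 0"

text \<open>Continuity in several variables is not demanded; it follows from the bound, see
  \<open>ghol_Lipschitz\<close>. The bound \<open>B\<close> is explicit because it later becomes a
  function of the point of integration.\<close>

definition ghol :: "real \<Rightarrow> complex^'n::finite \<Rightarrow> real \<Rightarrow> (complex^'n \<Rightarrow> complex) \<Rightarrow> bool" where
  "ghol B x r f \<longleftrightarrow> (\<forall>z\<in>ball x r. cmod (f z) \<le> B) \<and>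
     (\<forall>z v. (\<lambda>s. f (z + s *s v)) holomorphic_on {s. z + s *s v \<in> ball x r})"

lemma norm_vec_smult: "norm (s *s (v::complex^'n::finite)) = cmod s * norm v"
  by (simp add: norm_vec_def L2_set_right_distrib norm_mult)

lemma scaleR_eq_smult: "t *\<^sub>R (v::complex^'n::finite) = complex_of_real t *s v"
  by (simp add: vec_eq_iff) (simp add: scaleR_conv_of_real)

lemma continuous_smult: "continuous_on UNIV (\<lambda>s. (z::complex^'n::finite) + s *s v)"
  unfolding vector_scalar_mult_def by (intro continuous_intros)

lemma open_slice: "open {s. (z::complex^'n::finite) + s *s v \<in> ball x r}"
proof -
  have "open ((\<lambda>s. z + s *s v) -` ball x r)" by (intro open_vimage open_ball continuous_smult)
  then show ?thesis by (simp add: vimage_def)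
qed

lemma gholI:
  assumes "\<And>z. z \<in> ball x r \<Longrightarrow> cmod (f z) \<le> B"
    and "\<And>z v. (\<lambda>s. f (z + s *s v)) holomorphic_on {s. z + s *s v \<in> ball x r}"
  shows "ghol B x r f"
  using assms by (auto simp: ghol_def)

lemma ghol_bound: "ghol B x r f \<Longrightarrow> z \<in> ball x r \<Longrightarrow> cmod (f z) \<le> B"
  by (auto simp: ghol_def)

lemma ghol_holomorphic: "ghol B x r f \<Longrightarrow> (\<lambda>s. f (z + s *s v)) holomorphic_on {s. z + s *s v \<in> ball x r}"
  by (auto simp: ghol_def)

lemma ghol_mono:
  assumes "ghol B x r f" "r' \<le> r" "B \<le> B'" shows "ghol B' x r' f"
  unfolding ghol_def
proof (intro conjI ballI allI)
  fix z assume "z \<in> ball x r'"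
  then show "cmod (f z) \<le> B'" using assms ghol_bound[OF assms(1), of z] by auto
next
  fix z v show "(\<lambda>s. f (z + s *s v)) holomorphic_on {s. z + s *s v \<in> ball x r'}"
    by (rule holomorphic_on_subset[OF ghol_holomorphic[OF assms(1)]]) (use assms in auto)
qed

lemma ghol_nonneg: "ghol B x r f \<Longrightarrow> 0 < r \<Longrightarrow> 0 \<le> B"
  using ghol_bound[of B x r f x] by (meson centre_in_ball norm_ge_zero order_trans)

lemma ghol_DERIV:
  assumes "ghol B x r f" "z + s *s v \<in> ball x r"
  shows "((\<lambda>s. f (z + s *s v)) has_field_derivative hderiv v f (z + s *s v)) (at s)"
proof -
  have "(\<lambda>s. f (z + s *s v)) field_differentiable (at s)"
    using ghol_holomorphic[OF assms(1), of z v] assms(2) open_slice[of z v x r]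
      holomorphic_on_imp_differentiable_at by blast
  then obtain d where d: "((\<lambda>s. f (z + s *s v)) has_field_derivative d) (at s)"
    by (auto simp: field_differentiable_def)
  then have "((\<lambda>t. f (z + (t + s) *s v)) has_field_derivative d) (at 0)"
    using DERIV_shift[of "\<lambda>s. f (z + s *s v)" d 0 s] by simp
  moreover have "(\<lambda>t. f (z + (t + s) *s v)) = (\<lambda>t. f ((z + s *s v) + t *s v))"
    by (intro ext arg_cong[of _ _ f]) (simp add: vec_eq_iff algebra_simps)
  ultimately have "hderiv v f (z + s *s v) = d"
    unfolding hderiv_def by (simp add: DERIV_imp_deriv)
  then show ?thesis using d by simp
qed

lemma ghol_DERIV0:
  assumes "ghol B x r f" "z \<in> ball x r"
  shows "((\<lambda>s. f (z + s *s v)) has_field_derivative hderiv v f z) (at 0)"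
  using ghol_DERIV[OF assms(1), of z 0 v] assms(2) by simp

lemma hderiv_zero [simp]: "hderiv 0 f z = 0"
  unfolding hderiv_def by simp

lemma ghol_real_derivative:
  assumes "ghol B x r f" "z \<in> ball x r"
  shows "((\<lambda>t. f (z + t *\<^sub>R v)) has_vector_derivative hderiv v f z) (at 0)"
  using has_vector_derivative_real_field[of "\<lambda>s. f (z + s *s v)" "hderiv v f z" 0 UNIV]
    ghol_DERIV0[OF assms, of v] by (simp add: scaleR_eq_smult)

lemma hderiv_smult:
  assumes "ghol B x r f" "z \<in> ball x r"
  shows "hderiv (a *s v) f z = a * hderiv v f z"
proof -
  have "((\<lambda>s. f (z + (a * s) *s v)) has_field_derivative hderiv v f z * a) (at 0)"
    using DERIV_chain2[of "\<lambda>s. f (z + s *s v)" _ "\<lambda>s. a * s" 0 a] ghol_DERIV0[OF assms, of v]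
    by (auto intro!: derivative_eq_intros)
  moreover have "(\<lambda>s. f (z + (a * s) *s v)) = (\<lambda>s. f (z + s *s (a *s v)))"
    by (simp add: vector_smult_assoc mult.commute)
  ultimately show ?thesis unfolding hderiv_def by (simp add: DERIV_imp_deriv mult.commute)
qed

lemma slice_in_ball:
  fixes z v :: "complex^'n::finite" and s :: complex
  assumes "z \<in> ball x r'" "cmod s * norm v \<le> r - r'"
  shows "z + s *s v \<in> ball x r"
proof -
  have "dist x (z + s *s v) \<le> dist x z + norm (s *s v)"
    using dist_triangle[of x "z + s *s v" z] by (simp add: dist_norm)
  then show ?thesis using assms by (auto simp: norm_vec_smult)
qed

text \<open>Cauchy's inequality on the slice through \<open>z\<close> in direction \<open>v\<close>:
  the disc of radius \<open>(r - r') / norm v\<close> in the slice parameter stays in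
  \<open>ball x r\<close>. The result is linear in \<open>B\<close>, so majorants survive
  differentiation.\<close>

lemma hderiv_bound:
  assumes f: "ghol B x r f" and r: "r' < r" and z: "z \<in> ball x r'"
  shows "cmod (hderiv v f z) \<le> B / (r - r') * norm v"
proof (cases "v = 0")
  case True then show ?thesis by simp
next
  case False
  define \<rho> where "\<rho> = (r - r') / norm v"
  have \<rho>: "\<rho> > 0" using r False by (simp add: \<rho>_def)
  have sub: "cball 0 \<rho> \<subseteq> {s. z + s *s v \<in> ball x r}"
  proof
    fix s :: complex assume "s \<in> cball 0 \<rho>"
    then have "cmod s * norm v \<le> r - r'" using False by (simp add: \<rho>_def pos_le_divide_eq)
    then show "s \<in> {s. z + s *s v \<in> ball x r}" using slice_in_ball[OF z] by simp
  qed
  have hol: "(\<lambda>s. f (z + s *s v)) holomorphic_on cball 0 \<rho>"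
    using ghol_holomorphic[OF f] sub by (rule holomorphic_on_subset)
  have "cmod ((deriv ^^ 1) (\<lambda>s. f (z + s *s v)) 0) \<le> fact 1 * B / \<rho> ^ 1"
  proof (rule Cauchy_inequality[OF _ _ \<rho>])
    show "(\<lambda>s. f (z + s *s v)) holomorphic_on ball 0 \<rho>"
      using hol by (rule holomorphic_on_subset) auto
    show "continuous_on (cball 0 \<rho>) (\<lambda>s. f (z + s *s v))"
      using hol by (rule holomorphic_on_imp_continuous_on)
    show "cmod (f (z + s *s v)) \<le> B" if "cmod (0 - s) = \<rho>" for s
      using ghol_bound[OF f] sub that by auto
  qed
  then show ?thesis by (simp add: hderiv_def \<rho>_def)
qed

text \<open>Mean value inequality along the complex slice from \<open>z\<close> to \<open>y\<close>;
  the segment stays in \<open>ball x r'\<close> by convexity, where \<open>hderiv_bound\<close>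
  applies.\<close>

lemma ghol_Lipschitz:
  assumes f: "ghol B x r f" and r: "r' < r" and z: "z \<in> ball x r'" and y: "y \<in> ball x r'"
  shows "cmod (f y - f z) \<le> B / (r - r') * norm (y - z)"
proof -
  have in': "z + s *s (y - z) \<in> ball x r'" if s: "s \<in> closed_segment 0 1" for s :: complex
  proof -
    obtain u where u: "s = of_real u" "0 \<le> u" "u \<le> 1"
      using s by (auto simp: in_segment scaleR_conv_of_real)
    have "z + s *s (y - z) = (1 - u) *\<^sub>R z + u *\<^sub>R y"
      unfolding u scaleR_eq_smult by (simp add: vec_eq_iff algebra_simps)
    then show ?thesis using u z y convexD_alt[OF convex_ball, of z x r' y u] by simp
  qed
  have "cmod (f (z + 1 *s (y - z)) - f (z + 0 *s (y - z))) \<le> B / (r - r') * norm (y - z) * cmod (1 - 0)"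
  proof (rule field_differentiable_bound[of "closed_segment 0 1" "\<lambda>s. f (z + s *s (y - z))" "\<lambda>s. hderiv (y - z) f (z + s *s (y - z))"])
    fix s :: complex assume s: "s \<in> closed_segment 0 1"
    show "cmod (hderiv (y - z) f (z + s *s (y - z))) \<le> B / (r - r') * norm (y - z)"
      by (rule hderiv_bound[OF f r in'[OF s]])
    show "((\<lambda>s. f (z + s *s (y - z))) has_field_derivative hderiv (y - z) f (z + s *s (y - z))) (at s within closed_segment 0 1)"
      by (rule has_field_derivative_at_within, rule ghol_DERIV[OF f]) (use in'[OF s] r in auto)
  qed auto
  then show ?thesis by simp
qed

text \<open>Second-order Taylor estimate on a slice. The \<open>+ 1\<close> in \<rho> keeps it
  positive when \<open>v = 0\<close>; half of it leaves room for Cauchy discs of radius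
  \<open>\<rho>/2\<close>, which bound the second derivative by \<open>2 * B / (\<rho>/2)^2\<close>.
  The constant is linear in \<open>B\<close> and the same for all \<open>z\<close>, as
  \<open>ghol_integral\<close> and \<open>ghol_hderiv\<close> require.\<close>

lemma ghol_Taylor_bound:
  fixes s :: complex and v z :: "complex^'n::finite"
  assumes f: "ghol B x r f" and r: "r' < r" and z: "z \<in> ball x r'"
  defines "\<rho> \<equiv> (r - r') / (norm v + 1)"
  assumes s: "cmod s \<le> \<rho> / 2"
  shows "z + s *s v \<in> ball x r \<and> cmod (f (z + s *s v) - f z - s * hderiv v f z) \<le> (2 * B / (\<rho>/2)^2) * (cmod s)\<^sup>2"
proof -
  have nv: "norm v + 1 > 0" by (smt (verit) norm_ge_zero)
  have \<rho>: "\<rho> > 0" using r nv by (simp add: \<rho>_def)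
  have sub: "cball 0 \<rho> \<subseteq> {s. z + s *s v \<in> ball x r}"
  proof
    fix s :: complex assume "s \<in> cball 0 \<rho>"
    then have "cmod s * norm v \<le> \<rho> * (norm v + 1)" by (intro mult_mono) (use \<rho> in auto)
    also have "\<dots> = r - r'" using nv by (simp add: \<rho>_def)
    finally show "s \<in> {s. z + s *s v \<in> ball x r}" using slice_in_ball[OF z] by simp
  qed
  define g where "g = (\<lambda>s. f (z + s *s v))"
  have hol: "g holomorphic_on {s. z + s *s v \<in> ball x r}"
    unfolding g_def using ghol_holomorphic[OF f] .
  have "cmod ((deriv ^^ 0) g s - (\<Sum>i\<le>1. (deriv ^^ i) g 0 * (s - 0) ^ i / fact i)) \<le> 2 * B / (\<rho>/2)^2 * cmod (s - 0) ^ Suc 1 / fact 1"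
  proof (rule complex_Taylor[of "cball 0 (\<rho>/2)" 1 "\<lambda>i. (deriv ^^ i) g"])
    fix i and t :: complex assume t: "t \<in> cball 0 (\<rho>/2)" and "i \<le> (1::nat)"
    have "t \<in> ball 0 \<rho>" using t \<rho> by auto
    have holg: "g holomorphic_on ball 0 \<rho>"
      by (rule holomorphic_on_subset[OF hol]) (use sub ball_subset_cball in blast)
    have "(deriv ^^ i) g holomorphic_on ball 0 \<rho>"
      by (rule holomorphic_higher_deriv[OF holg open_ball])
    from holomorphic_derivI[OF this open_ball \<open>t \<in> ball 0 \<rho>\<close>]
    show "((deriv ^^ i) g has_field_derivative (deriv ^^ Suc i) g t) (at t within cball 0 (\<rho>/2))"
      by (simp add: has_field_derivative_at_within)
  next
    fix t :: complex assume t: "t \<in> cball 0 (\<rho>/2)"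
    have sb: "cball t (\<rho>/2) \<subseteq> cball 0 \<rho>"
    proof
      fix y assume "y \<in> cball t (\<rho>/2)"
      then show "y \<in> cball 0 \<rho>" using t dist_triangle[of 0 y t] by simp
    qed
    have "cmod ((deriv ^^ 2) g t) \<le> fact 2 * B / (\<rho>/2)^2"
    proof (rule Cauchy_inequality)
      show "continuous_on (cball t (\<rho>/2)) g"
        using sb sub by (intro holomorphic_on_imp_continuous_on holomorphic_on_subset[OF hol]) auto
      show "g holomorphic_on ball t (\<rho>/2)"
        using sb sub by (intro holomorphic_on_subset[OF hol]) (use ball_subset_cball in blast)
      show "cmod (g y) \<le> B" if "cmod (t - y) = \<rho>/2" for y
        using that sb sub ghol_bound[OF f] by (force simp: g_def dist_norm)
    qed (use \<rho> in auto)
    then show "cmod ((deriv ^^ Suc 1) g t) \<le> 2 * B / (\<rho>/2)^2" by (simp add: fact_2 numeral_2_eq_2)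
  qed (use s \<rho> in auto)
  then have "cmod (g s - (g 0 + deriv g 0 * s)) \<le> 2 * B / (\<rho>/2)^2 * (cmod s)^2" by (simp add: power2_eq_square)
  moreover have "s \<in> cball 0 \<rho>" using s \<rho> by auto
  ultimately show ?thesis using sub by (auto simp: g_def hderiv_def algebra_simps)
qed

lemma ghol_Taylor:
  assumes f: "ghol B x r f" and r: "r' < r"
  obtains K d where "K \<ge> 0" "d > 0" "\<And>z (s::complex). z \<in> ball x r' \<Longrightarrow> cmod s \<le> d \<Longrightarrow>
     z + s *s v \<in> ball x r \<and> cmod (f (z + s *s v) - f z - s * hderiv v f z) \<le> K * (cmod s)\<^sup>2"
proof (cases "0 < r'")
  case False
  then have e: "z \<notin> ball x r'" for z by (metis ball_empty empty_iff not_less)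
  show ?thesis by (rule that[of 1 1]) (simp_all only: e zero_le_one zero_less_one)
next
  case True
  define \<rho> where "\<rho> = (r - r') / (norm v + 1)"
  have "norm v + 1 > 0" by (smt (verit) norm_ge_zero)
  then have "\<rho> > 0" using r by (simp add: \<rho>_def)
  moreover have "B \<ge> 0" using ghol_nonneg[OF f] r True by simp
  ultimately show ?thesis
    by (intro that[of "2 * B / (\<rho>/2)^2" "\<rho>/2", OF _ _ ghol_Taylor_bound[OF f r, of _ _ v, folded \<rho>_def]]) auto
qed

text \<open>For holomorphy along another direction \<open>u\<close>: by the Taylor estimate the
  difference quotients in direction \<open>v\<close> converge uniformly on the slice, and each of
  them is holomorphic along \<open>u\<close>.\<close>

lemma ghol_hderiv:
  assumes f: "ghol B x r f" and r: "r' < r"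
  shows "ghol (B / (r - r') * norm v) x r' (hderiv v f)"
proof (rule gholI)
  show "cmod (hderiv v f z) \<le> B / (r - r') * norm v" if "z \<in> ball x r'" for z
    by (rule hderiv_bound[OF f r that])
next
  fix z u
  obtain K d where K: "K \<ge> 0" and d: "d > 0" and Kd: "\<And>z (s::complex). z \<in> ball x r' \<Longrightarrow> cmod s \<le> d \<Longrightarrow>
     z + s *s v \<in> ball x r \<and> cmod (f (z + s *s v) - f z - s * hderiv v f z) \<le> K * (cmod s)\<^sup>2"
    using ghol_Taylor[OF f r] by metis
  \<comment> \<open>Steps of modulus at most \<open>d\<close>, nonzero and tending to 0, so that the
    Taylor estimate holds for every \<open>n\<close>.\<close>
  define h where "h = (\<lambda>n. complex_of_real (d / (real n + 1)))"
  have h: "cmod (h n) \<le> d" "h n \<noteq> 0" for n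
  proof -
    have "cmod (h n) = d / (real n + 1)" using d by (simp add: h_def norm_divide del: of_real_divide)
    also have "\<dots> \<le> d" using d by (simp add: divide_le_eq mult_le_cancel_left1)
    finally show "cmod (h n) \<le> d" .
    have "d / (real n + 1) \<noteq> 0" using d by (simp add: add_eq_0_iff)
    then show "h n \<noteq> 0" unfolding h_def by (simp only: of_real_eq_0_iff not_False_eq_True)
  qed
  have h0: "(\<lambda>n. cmod (h n)) \<longlonglongrightarrow> 0"
  proof -
    have "(\<lambda>n. d * inverse (real (Suc n))) \<longlonglongrightarrow> d * 0"
      by (intro tendsto_mult tendsto_const LIMSEQ_inverse_real_of_nat)
    moreover have "cmod (h n) = d * inverse (real (Suc n))" for n
      unfolding h_def norm_of_real using d by (simp add: divide_inverse add.commute)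
    ultimately show ?thesis by simp
  qed
  let ?S = "{s. z + s *s u \<in> ball x r'}"
  have ul: "uniform_limit ?S (\<lambda>n s. (f ((z + s *s u) + h n *s v) - f (z + s *s u)) / h n) (\<lambda>s. hderiv v f (z + s *s u)) sequentially"
    unfolding uniform_limit_iff
  proof (intro allI impI)
    fix e :: real assume e: "e > 0"
    have "(\<lambda>n. K * cmod (h n)) \<longlonglongrightarrow> K * 0" by (intro tendsto_mult tendsto_const h0)
    then have "\<forall>\<^sub>F n in sequentially. K * cmod (h n) < e" using e order_tendstoD(2) by fastforce
    then show "\<forall>\<^sub>F n in sequentially. \<forall>s\<in>?S. dist ((f ((z + s *s u) + h n *s v) - f (z + s *s u)) / h n) (hderiv v f (z + s *s u)) < e"
    proof eventually_elim
      case (elim n)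
      show ?case
      proof
        fix s assume s: "s \<in> ?S"
        have "cmod (f ((z + s *s u) + h n *s v) - f (z + s *s u) - h n * hderiv v f (z + s *s u)) \<le> K * (cmod (h n))\<^sup>2"
          using Kd[of "z + s *s u" "h n"] s h by auto
        moreover have "((f ((z + s *s u) + h n *s v) - f (z + s *s u)) / h n - hderiv v f (z + s *s u)) * h n = f ((z + s *s u) + h n *s v) - f (z + s *s u) - h n * hderiv v f (z + s *s u)"
          using h(2)[of n] by (subst left_diff_distrib) (simp add: mult.commute)
        ultimately have "cmod (((f ((z + s *s u) + h n *s v) - f (z + s *s u)) / h n - hderiv v f (z + s *s u)) * h n) \<le> (K * cmod (h n)) * cmod (h n)"
          by (simp add: power2_eq_square)
        then have "cmod ((f ((z + s *s u) + h n *s v) - f (z + s *s u)) / h n - hderiv v f (z + s *s u)) \<le> K * cmod (h n)"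
          using h by (simp add: norm_mult)
        then show "dist ((f ((z + s *s u) + h n *s v) - f (z + s *s u)) / h n) (hderiv v f (z + s *s u)) < e"
          using elim by (simp add: dist_norm)
      qed
    qed
  qed
  show "(\<lambda>s. hderiv v f (z + s *s u)) holomorphic_on ?S"
  proof (rule holomorphic_uniform_sequence[OF open_slice])
    fix n
    have eq: "f ((z + s *s u) + h n *s v) = f ((z + h n *s v) + s *s u)" for s
      by (simp add: algebra_simps)
    have "?S \<subseteq> {s. (z + h n *s v) + s *s u \<in> ball x r}"
    proof
      fix s assume "s \<in> ?S"
      then have "(z + s *s u) + h n *s v \<in> ball x r" using Kd[of "z + s *s u" "h n"] h by auto
      then show "s \<in> {s. (z + h n *s v) + s *s u \<in> ball x r}" by (simp add: algebra_simps)
    qed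
    then have a: "(\<lambda>s. f ((z + h n *s v) + s *s u)) holomorphic_on ?S"
      using ghol_holomorphic[OF f] holomorphic_on_subset by blast
    have b: "(\<lambda>s. f (z + s *s u)) holomorphic_on ?S"
      by (rule holomorphic_on_subset[OF ghol_holomorphic[OF f]]) (use r in auto)
    show "(\<lambda>s. (f ((z + s *s u) + h n *s v) - f (z + s *s u)) / h n) holomorphic_on ?S"
      unfolding eq using a b h by (intro holomorphic_intros)
  next
    fix s assume "s \<in> ?S"
    then obtain e where "e > 0" "cball s e \<subseteq> ?S" using open_contains_cball[of ?S] open_slice by blast
    then show "\<exists>d>0. cball s d \<subseteq> ?S \<and> uniform_limit (cball s d) (\<lambda>n s. (f ((z + s *s u) + h n *s v) - f (z + s *s u)) / h n) (\<lambda>s. hderiv v f (z + s *s u)) sequentially"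
      using uniform_limit_on_subset[OF ul] by blast
  qed
qed

lemma ghol_const: "ghol (cmod c) x r (\<lambda>_. c)"
  by (rule gholI) (auto intro: holomorphic_intros)

lemma ghol_mult:
  assumes "ghol B x r f" "ghol C x r g"
  shows "ghol (B * C) x r (\<lambda>z. f z * g z)"
proof (rule gholI)
  show "cmod (f z * g z) \<le> B * C" if "z \<in> ball x r" for z
  proof -
    have "cmod (f z) \<le> B" "cmod (g z) \<le> C" using assms that ghol_bound by blast+
    then show ?thesis unfolding norm_mult by (meson mult_mono norm_ge_zero order_trans)
  qed
qed (intro holomorphic_intros ghol_holomorphic[OF assms(1)] ghol_holomorphic[OF assms(2)])

section \<open>Differentiation under the integral sign\<close>

lemma has_vector_derivative_iff_quotient:
  fixes f :: "real \<Rightarrow> 'b::real_normed_vector"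
  shows "(f has_vector_derivative D) (at a) \<longleftrightarrow> ((\<lambda>h. (f (a + h) - f a) /\<^sub>R h) \<longlongrightarrow> D) (at 0)"
proof -
  have "(f has_vector_derivative D) (at a) \<longleftrightarrow> ((\<lambda>h. norm (f (a + h) - f a - h *\<^sub>R D) / norm h) \<longlongrightarrow> 0) (at 0)"
    unfolding has_vector_derivative_def has_derivative_at by (simp add: bounded_linear_scaleR_left)
  also have "\<dots> \<longleftrightarrow> ((\<lambda>h. norm ((f (a + h) - f a) /\<^sub>R h - D)) \<longlongrightarrow> 0) (at 0)"
  proof (rule filterlim_cong[OF refl refl])
    have "norm (f (a + h) - f a - h *\<^sub>R D) / norm h = norm ((f (a + h) - f a) /\<^sub>R h - D)" if "h \<noteq> 0" for h
    proof -
      have "(f (a + h) - f a) /\<^sub>R h - D = (f (a + h) - f a - h *\<^sub>R D) /\<^sub>R h"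
        using that by (simp add: scaleR_right_diff_distrib)
      then show ?thesis by (simp add: divide_inverse)
    qed
    then show "\<forall>\<^sub>F h in at 0. norm (f (a + h) - f a - h *\<^sub>R D) / norm h = norm ((f (a + h) - f a) /\<^sub>R h - D)"
      by (auto simp: eventually_at_filter)
  qed
  also have "\<dots> \<longleftrightarrow> ((\<lambda>h. (f (a + h) - f a) /\<^sub>R h) \<longlongrightarrow> D) (at 0)"
    using tendsto_norm_zero_iff[of "\<lambda>h. (f (a + h) - f a) /\<^sub>R h - D" "at 0"]
      Lim_null[of "\<lambda>h. (f (a + h) - f a) /\<^sub>R h" D "at 0"] by blast
  finally show ?thesis .
qed

text \<open>The derivative is required at \<open>t = 0\<close> only and almost everywhere, and the
  Lipschitz bound only against \<open>F 0\<close>. This matters for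
  \<open>\<bar>\<phi>\<bar>\<close>: a given point \<open>w\<close> may be a zero for some small
  \<open>t\<close>, where differentiability fails.\<close>

lemma has_vector_derivative_integral:
  fixes F :: "real \<Rightarrow> 'w \<Rightarrow> 'b::{banach, second_countable_topology}"
  assumes \<delta>: "\<delta> > 0" and meas: "\<And>t. \<bar>t\<bar> < \<delta> \<Longrightarrow> F t \<in> borel_measurable M"
    and F0: "integrable M (F 0)" and G: "integrable M G"
    and F': "F' \<in> borel_measurable M"
    and bound: "AE w in M. \<forall>t. \<bar>t\<bar> < \<delta> \<longrightarrow> norm (F t w - F 0 w) \<le> \<bar>t\<bar> * G w"
    and der: "AE w in M. ((\<lambda>t. F t w) has_vector_derivative F' w) (at 0)"
  shows "integrable M F'"
    and "((\<lambda>t. integral\<^sup>L M (F t)) has_vector_derivative integral\<^sup>L M F') (at 0)"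
proof -
  have int: "integrable M (F t)" if t: "\<bar>t\<bar> < \<delta>" for t
  proof -
    have "integrable M (\<lambda>w. F t w - F 0 w)"
    proof (rule Bochner_Integration.integrable_bound)
      show "integrable M (\<lambda>w. \<bar>t\<bar> * G w)" using G by simp
      show "(\<lambda>w. F t w - F 0 w) \<in> borel_measurable M" using meas t \<delta> by (intro borel_measurable_diff) auto
      show "AE w in M. norm (F t w - F 0 w) \<le> norm (\<bar>t\<bar> * G w)"
        using bound by eventually_elim (use t in fastforce)
    qed
    from Bochner_Integration.integrable_add[OF this F0] show ?thesis by simp
  qed
  \<comment> \<open>The derivative inherits the majorant as a limit of difference quotients.\<close>
  have GG: "AE w in M. norm (F' w) \<le> norm (G w)"
    using bound der
  proof eventually_elim
    case (elim w)
    have "((\<lambda>h. (F (0 + h) w - F 0 w) /\<^sub>R h) \<longlongrightarrow> F' w) (at 0)"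
      using elim(2) unfolding has_vector_derivative_iff_quotient by simp
    moreover have "\<forall>\<^sub>F h in at 0. norm ((F (0 + h) w - F 0 w) /\<^sub>R h) \<le> norm (G w)"
      unfolding eventually_at
    proof (intro exI conjI ballI impI)
      fix h :: real assume h: "h \<noteq> 0 \<and> dist h 0 < \<delta>"
      then have "norm (F h w - F 0 w) \<le> \<bar>h\<bar> * norm (G w)"
        using elim(1)[rule_format, of h]
        by (simp) (metis abs_ge_self abs_ge_zero mult_left_mono order_trans)
      then show "norm ((F (0 + h) w - F 0 w) /\<^sub>R h) \<le> norm (G w)"
        using h by (simp add: divide_inverse_commute[symmetric] divide_le_eq mult.commute)
    qed (use \<delta> in auto)
    ultimately show ?case using tendsto_upperbound[OF tendsto_norm _ at_neq_bot] by blast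
  qed
  show i': "integrable M F'"
    by (rule Bochner_Integration.integrable_bound[OF G F' GG])
  \<comment> \<open>Dominated convergence is applied along sequences; the tail from
    \<open>n0\<close> on keeps \<open>h n\<close> in the range where the Lipschitz bound
    holds.\<close>
  have lim: "(\<lambda>n. (integral\<^sup>L M (F (0 + h n)) - integral\<^sup>L M (F 0)) /\<^sub>R h n) \<longlonglongrightarrow> integral\<^sup>L M F'"
    if h0: "\<And>n. h n \<noteq> 0" and hl: "h \<longlonglongrightarrow> (0::real)" for h
  proof -
    obtain n0 where n0: "\<And>n. n \<ge> n0 \<Longrightarrow> \<bar>h n\<bar> < \<delta>"
      using LIMSEQ_D[OF hl \<delta>] by auto
    have "(\<lambda>n. integral\<^sup>L M (\<lambda>w. (F (h (n + n0)) w - F 0 w) /\<^sub>R h (n + n0))) \<longlonglongrightarrow> integral\<^sup>L M F'"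
    proof (rule integral_dominated_convergence[where w = "\<lambda>w. norm (G w)"])
      show "AE w in M. (\<lambda>n. (F (h (n + n0)) w - F 0 w) /\<^sub>R h (n + n0)) \<longlonglongrightarrow> F' w"
        using der
      proof eventually_elim
        case (elim w)
        have "((\<lambda>h. (F (0 + h) w - F 0 w) /\<^sub>R h) \<longlongrightarrow> F' w) (at 0)"
          using elim unfolding has_vector_derivative_iff_quotient by simp
        moreover have "filterlim (\<lambda>n. h (n + n0)) (at 0) sequentially"
          using LIMSEQ_ignore_initial_segment[OF hl, of n0] h0 by (intro filterlim_atI) auto
        ultimately show ?case using filterlim_compose[of "\<lambda>h. (F (0 + h) w - F 0 w) /\<^sub>R h"] by fastforce
      qed
      show "AE w in M. norm ((F (h (n + n0)) w - F 0 w) /\<^sub>R h (n + n0)) \<le> norm (G w)" for n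
        using bound
      proof eventually_elim
        case (elim w)
        then have "norm (F (h (n + n0)) w - F 0 w) \<le> \<bar>h (n + n0)\<bar> * norm (G w)"
          using n0[of "n + n0"]
          by (simp) (metis abs_ge_self abs_ge_zero mult_left_mono order_trans)
        then show ?case using h0[of "n + n0"]
          by (simp add: divide_inverse_commute[symmetric] divide_le_eq mult.commute)
      qed
      show "(\<lambda>w. (F (h (n + n0)) w - F 0 w) /\<^sub>R h (n + n0)) \<in> borel_measurable M" for n
        using meas[of 0] meas[OF n0[of "n + n0"]] \<delta> by simp
    qed (use F' G in auto)
    also have "(\<lambda>n. integral\<^sup>L M (\<lambda>w. (F (h (n + n0)) w - F 0 w) /\<^sub>R h (n + n0))) =
       (\<lambda>n. (integral\<^sup>L M (F (0 + h (n + n0))) - integral\<^sup>L M (F 0)) /\<^sub>R h (n + n0))"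
      using int n0 F0 by (simp add: Bochner_Integration.integral_diff)
    finally show ?thesis by (rule LIMSEQ_offset)
  qed
  show "((\<lambda>t. integral\<^sup>L M (F t)) has_vector_derivative integral\<^sup>L M F') (at 0)"
    unfolding has_vector_derivative_iff_quotient
    by (subst tendsto_at_iff_sequentially) (use lim in \<open>auto simp: o_def\<close>)
qed

section \<open>Differentiability classes\<close>

text \<open>Openness in the directions of \<open>coord_subspace K\<close> alone. It covers both open
  subsets of \<open>\<complex>^n\<close> and the image of a stratum under an adapted chart, which is
  open only inside the coordinate subspace.\<close>

definition coord_open :: "'n set \<Rightarrow> (complex^'n::finite) set \<Rightarrow> bool" where
  "coord_open K D \<longleftrightarrow> (\<forall>x\<in>D. \<exists>e>0. \<forall>w\<in>coord_subspace K. norm w < e \<longrightarrow> x + w \<in> D)"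

lemma coord_open_open: "open D \<Longrightarrow> coord_open K D"
  unfolding coord_open_def
proof
  fix x assume "open D" "x \<in> D"
  then obtain e where "e > 0" "ball x e \<subseteq> D" using openE by blast
  then show "\<exists>e>0. \<forall>w\<in>coord_subspace K. norm w < e \<longrightarrow> x + w \<in> D"
    by (intro exI[of _ e]) (auto simp: subset_iff dist_norm)
qed

lemma coord_open_Int_subspace:
  assumes "open U" shows "coord_open K (U \<inter> coord_subspace K)"
  unfolding coord_open_def
proof
  fix x assume x: "x \<in> U \<inter> coord_subspace K"
  then obtain e where "e > 0" "ball x e \<subseteq> U" using openE assms by blast
  then show "\<exists>e>0. \<forall>w\<in>coord_subspace K. norm w < e \<longrightarrow> x + w \<in> U \<inter> coord_subspace K"
    using x by (intro exI[of _ e]) (auto simp: subset_iff dist_norm coord_subspace_def)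
qed

lemma coord_open_Int:
  assumes "coord_open K D" "open V" shows "coord_open K (D \<inter> V)"
  unfolding coord_open_def
proof
  fix x assume x: "x \<in> D \<inter> V"
  obtain e where "e > 0" "ball x e \<subseteq> V" using openE assms x by blast
  moreover obtain d where "d > 0" "\<forall>w\<in>coord_subspace K. norm w < d \<longrightarrow> x + w \<in> D"
    using x assms by (auto simp: coord_open_def)
  ultimately show "\<exists>e>0. \<forall>w\<in>coord_subspace K. norm w < e \<longrightarrow> x + w \<in> D \<inter> V"
    by (intro exI[of _ "min d e"]) (auto simp: subset_iff dist_norm)
qed

lemma coord_subspace_scaleR: "v \<in> coord_subspace K \<Longrightarrow> t *\<^sub>R v \<in> coord_subspace K"
  by (auto simp: coord_subspace_def)

lemma coord_subspace_smult: "v \<in> coord_subspace K \<Longrightarrow> a *s v \<in> coord_subspace K"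
  by (auto simp: coord_subspace_def)

lemma coord_subspace_add: "v \<in> coord_subspace K \<Longrightarrow> w \<in> coord_subspace K \<Longrightarrow> v + w \<in> coord_subspace K"
  by (auto simp: coord_subspace_def)

lemma coord_open_eventually:
  assumes "coord_open K D" "x \<in> D" "v \<in> coord_subspace K"
  shows "\<forall>\<^sub>F t in nhds (0::real). x + t *\<^sub>R v \<in> D"
proof -
  obtain d where d: "d > 0" "\<forall>w\<in>coord_subspace K. norm w < d \<longrightarrow> x + w \<in> D"
    using assms by (auto simp: coord_open_def)
  have "((\<lambda>t. norm (t *\<^sub>R v)) \<longlongrightarrow> 0) (nhds 0)" by (auto intro!: tendsto_eq_intros filterlim_ident)
  then have "\<forall>\<^sub>F t in nhds 0. norm (t *\<^sub>R v) < d" using d(1) order_tendstoD(2) by blast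
  then show ?thesis by eventually_elim (use d coord_subspace_scaleR[OF assms(3)] in blast)
qed

lemma has_vector_derivative_cong_nhds:
  assumes "\<forall>\<^sub>F t in nhds a. f t = g t"
  shows "(f has_vector_derivative D) (at (a::real)) \<longleftrightarrow> (g has_vector_derivative D) (at a)"
proof -
  have fg: "f a = g a" using assms by (rule eventually_nhds_x_imp_x)
  have e1: "\<forall>\<^sub>F t in at a. f t = g t" using assms by (auto simp: eventually_at_filter elim!: eventually_mono)
  then have e2: "\<forall>\<^sub>F t in at a. g t = f t" by (simp add: eq_commute)
  show ?thesis unfolding has_vector_derivative_def
    using has_derivative_transform_eventually[OF _ e1 fg] has_derivative_transform_eventually[OF _ e2 fg[symmetric]]
    by blast
qed

lemma vector_derivative_works_iff:
  fixes f :: "real \<Rightarrow> 'b::real_normed_vector"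
  shows "f differentiable (at a) \<longleftrightarrow> (\<exists>D. (f has_vector_derivative D) (at a))"
  using vector_derivative_works differentiableI_vector by blast

lemma dir_deriv_eqI:
  "((\<lambda>t. f (x + t *\<^sub>R v)) has_vector_derivative D) (at 0) \<Longrightarrow> dir_deriv f v x = D"
  unfolding dir_deriv_def by (rule vector_derivative_at)

lemma differentiable_dir_deriv:
  "(\<lambda>t::real. f (x + t *\<^sub>R v)) differentiable (at 0) \<Longrightarrow>
   ((\<lambda>t. f (x + t *\<^sub>R v)) has_vector_derivative dir_deriv f v x) (at 0)"
  unfolding dir_deriv_def by (simp add: vector_derivative_works)

text \<open>Derivatives along \<open>coord_subspace K\<close> see only the values on
  \<open>D\<close>, so the behaviour of chart inverses off the stratum does no harm.\<close>

lemma dir_deriv_cong: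
  assumes D: "coord_open K D" and eq: "\<And>x. x \<in> D \<Longrightarrow> f x = g x" and x: "x \<in> D" and v: "v \<in> coord_subspace K"
  shows "((\<lambda>t. f (x + t *\<^sub>R v)) has_vector_derivative d) (at 0) \<longleftrightarrow> ((\<lambda>t. g (x + t *\<^sub>R v)) has_vector_derivative d) (at 0)"
    and "dir_deriv f v x = dir_deriv g v x"
proof -
  have "\<forall>\<^sub>F t in nhds (0::real). f (x + t *\<^sub>R v) = g (x + t *\<^sub>R v)"
    using coord_open_eventually[OF D x v] by eventually_elim (rule eq)
  from has_vector_derivative_cong_nhds[OF this]
  show *: "((\<lambda>t. f (x + t *\<^sub>R v)) has_vector_derivative d) (at 0) \<longleftrightarrow> ((\<lambda>t. g (x + t *\<^sub>R v)) has_vector_derivative d) (at 0)" for d .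
  show "dir_deriv f v x = dir_deriv g v x"
    unfolding dir_deriv_def vector_derivative_def * ..
qed

lemma C_upto_cong:
  assumes "coord_open K D" "\<And>x. x \<in> D \<Longrightarrow> f x = g x" "C_upto m K D f"
  shows "C_upto m K D g"
  using assms
proof (induction m arbitrary: f g)
  case 0
  then show ?case using continuous_on_cong[of D D f g] by simp
next
  case (Suc m)
  have "continuous_on D g" using Suc.prems continuous_on_cong[of D D f g] by simp
  moreover have "(\<lambda>t::real. g (x + t *\<^sub>R v)) differentiable (at 0)" if "v \<in> coord_subspace K" "x \<in> D" for x v
  proof -
    have "\<exists>d. ((\<lambda>t. f (x + t *\<^sub>R v)) has_vector_derivative d) (at 0)"
      using Suc.prems(3) that by (simp add: vector_derivative_works_iff)
    then show ?thesis
      using dir_deriv_cong(1)[where f=f and g=g, OF Suc.prems(1,2) that(2,1)] by (simp add: vector_derivative_works_iff)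
  qed
  moreover have "C_upto m K D (dir_deriv g v)" if "v \<in> coord_subspace K" for v
    by (rule Suc.IH[OF Suc.prems(1), of "dir_deriv f v"])
       (use Suc.prems(3) that dir_deriv_cong(2)[where f=f and g=g, OF Suc.prems(1,2) _ that] in auto)
  ultimately show ?case by simp
qed

text \<open>Used to pass from smoothness on a ball of the whole space (\<open>UNIV\<close>) to
  smoothness in the coordinates of a stratum (\<open>K\<close>).\<close>

lemma C_upto_mono:
  assumes "C_upto m K D f" "D' \<subseteq> D" "K' \<subseteq> K"
  shows "C_upto m K' D' f"
  using assms
proof (induction m arbitrary: f)
  case 0 then show ?case using continuous_on_subset by auto
next
  case (Suc m)
  have "coord_subspace K' \<subseteq> coord_subspace K" using Suc.prems(3) by (auto simp: coord_subspace_def)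
  then show ?case using Suc continuous_on_subset by (auto simp: subset_iff)
qed

lemma C_upto_local:
  assumes "\<And>x. x \<in> D \<Longrightarrow> \<exists>V. open V \<and> x \<in> V \<and> C_upto m K (D \<inter> V) f"
  shows "C_upto m K D f"
  using assms
proof (induction m arbitrary: f)
  case 0
  show ?case unfolding C_upto.simps continuous_on_eq_continuous_within
  proof
    fix x assume x: "x \<in> D"
    then obtain V where V: "open V" "x \<in> V" "continuous_on (D \<inter> V) f" using 0 by auto
    then have "continuous (at x within (D \<inter> V)) f" using x by (auto simp: continuous_on_eq_continuous_within)
    moreover have "at x within (D \<inter> V) = at x within D" using V by (intro at_within_nhd[of x V]) auto
    ultimately show "continuous (at x within D) f" by simp
  qed
next
  case (Suc m)
  show ?case unfolding C_upto.simps
  proof (intro conjI ballI)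
    show "continuous_on D f"
    proof -
      have "continuous (at x within D) f" if x: "x \<in> D" for x
      proof -
        obtain V where V: "open V" "x \<in> V" "continuous_on (D \<inter> V) f" using Suc.prems[OF x] by auto
        then have "continuous (at x within (D \<inter> V)) f" using x by (auto simp: continuous_on_eq_continuous_within)
        moreover have "at x within (D \<inter> V) = at x within D" using V by (intro at_within_nhd[of x V]) auto
        ultimately show ?thesis by simp
      qed
      then show ?thesis by (simp add: continuous_on_eq_continuous_within)
    qed
    fix v assume v: "v \<in> coord_subspace K"
    show "C_upto m K D (dir_deriv f v)"
      by (rule Suc.IH) (use Suc.prems v in force)
    show "(\<lambda>t::real. f (x + t *\<^sub>R v)) differentiable (at 0)" if "x \<in> D" for x
      using Suc.prems[OF that] v that by auto
  qed
qed

lemma C_upto_bounded_linear: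
  assumes L: "bounded_linear L" and D: "coord_open K D" and f: "C_upto m K D f"
  shows "C_upto m K D (\<lambda>x. L (f x))"
  using f
proof (induction m arbitrary: f)
  case 0 then show ?case using bounded_linear.continuous_on[OF L] by auto
next
  case (Suc m)
  have hv: "((\<lambda>t. L (f (x + t *\<^sub>R v))) has_vector_derivative L (dir_deriv f v x)) (at 0)"
    if "v \<in> coord_subspace K" "x \<in> D" for x v
    by (rule bounded_linear.has_vector_derivative[OF L differentiable_dir_deriv]) (use Suc.prems that in auto)
  show ?case unfolding C_upto.simps
  proof (intro conjI ballI)
    show "continuous_on D (\<lambda>x. L (f x))" using Suc.prems bounded_linear.continuous_on[OF L] by auto
    fix v assume v: "v \<in> coord_subspace K"
    show "(\<lambda>t::real. L (f (x + t *\<^sub>R v))) differentiable (at 0)" if "x \<in> D" for x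
      using hv[OF v that] by (auto simp: vector_derivative_works_iff)
    have "C_upto m K D (\<lambda>x. L (dir_deriv f v x))" using Suc v by auto
    then show "C_upto m K D (dir_deriv (\<lambda>x. L (f x)) v)"
      by (rule C_upto_cong[OF D, rotated]) (simp add: dir_deriv_eqI[OF hv[OF v]])
  qed
qed

lemma C_upto_add:
  assumes D: "coord_open K D" and f: "C_upto m K D f" and g: "C_upto m K D g"
  shows "C_upto m K D (\<lambda>x. f x + g x)"
  using f g
proof (induction m arbitrary: f g)
  case 0 then show ?case by (auto intro: continuous_intros)
next
  case (Suc m)
  have hv: "((\<lambda>t. f (x + t *\<^sub>R v) + g (x + t *\<^sub>R v)) has_vector_derivative dir_deriv f v x + dir_deriv g v x) (at 0)"
    if "v \<in> coord_subspace K" "x \<in> D" for x v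
    using Suc.prems that by (auto intro!: has_vector_derivative_add differentiable_dir_deriv)
  show ?case unfolding C_upto.simps
  proof (intro conjI ballI)
    show "continuous_on D (\<lambda>x. f x + g x)" using Suc.prems by (auto intro: continuous_intros)
    fix v assume v: "v \<in> coord_subspace K"
    show "(\<lambda>t::real. f (x + t *\<^sub>R v) + g (x + t *\<^sub>R v)) differentiable (at 0)" if "x \<in> D" for x
      using hv[OF v that] by (auto simp: vector_derivative_works_iff)
    have "C_upto m K D (\<lambda>x. dir_deriv f v x + dir_deriv g v x)" using Suc v by auto
    then show "C_upto m K D (dir_deriv (\<lambda>x. f x + g x) v)"
      by (rule C_upto_cong[OF D, rotated]) (simp add: dir_deriv_eqI[OF hv[OF v]])
  qed
qed

lemma C_upto_zero: "C_upto m K (D::(complex^'n::finite) set) (\<lambda>x. 0::'b::real_normed_vector)"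
proof (induction m)
  case (Suc m)
  have "dir_deriv (\<lambda>x. 0::'b) v = (\<lambda>x. 0)" for v :: "complex^'n"
    by (rule ext) (simp add: dir_deriv_def)
  then show ?case using Suc by simp
qed auto

lemma C_upto_sum:
  assumes D: "coord_open K D" and "finite I" and f: "\<And>i. i \<in> I \<Longrightarrow> C_upto m K D (f i)"
  shows "C_upto m K D (\<lambda>x. \<Sum>i\<in>I. f i x)"
  using assms(2) f
proof (induction rule: finite_induct)
  case empty then show ?case by (simp add: C_upto_zero)
next
  case (insert i I) then show ?case using C_upto_add[OF D, of m "f i" "\<lambda>x. \<Sum>i\<in>I. f i x"] by simp
qed

lemma has_vector_derivative_dir_deriv:
  assumes "(\<lambda>t::real. f ((x + s *\<^sub>R v) + t *\<^sub>R v)) differentiable (at 0)"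
  shows "((\<lambda>t. f (x + t *\<^sub>R v)) has_vector_derivative dir_deriv f v (x + s *\<^sub>R v)) (at s)"
proof -
  have "((\<lambda>t. f ((x + s *\<^sub>R v) + t *\<^sub>R v)) has_vector_derivative dir_deriv f v (x + s *\<^sub>R v)) (at 0)"
    by (rule differentiable_dir_deriv[OF assms])
  then show ?thesis
    unfolding has_vector_derivative_iff_quotient by (simp add: algebra_simps)
qed

text \<open>The mean value theorem is applied first in \<open>u\<close>, to the difference of two
  parallel segments, and then in \<open>v\<close>, to the derivative in direction
  \<open>u\<close>.\<close>

lemma mixed_difference_mean_value:
  fixes f :: "complex^'n::finite \<Rightarrow> real"
  assumes C: "C_upto 2 K D f" and u: "u \<in> coord_subspace K" and v: "v \<in> coord_subspace K" and h: "h > 0"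
    and sq: "\<And>s t. 0 \<le> s \<Longrightarrow> s \<le> h \<Longrightarrow> 0 \<le> t \<Longrightarrow> t \<le> h \<Longrightarrow> x + s *\<^sub>R u + t *\<^sub>R v \<in> D"
  shows "\<exists>s t. 0 \<le> s \<and> s \<le> h \<and> 0 \<le> t \<and> t \<le> h \<and>
     f (x + h *\<^sub>R u + h *\<^sub>R v) - f (x + h *\<^sub>R u) - f (x + h *\<^sub>R v) + f x = h * h * dir_deriv (dir_deriv f u) v (x + s *\<^sub>R u + t *\<^sub>R v)"
proof -
  have C1: "(\<lambda>t::real. f (y + t *\<^sub>R u)) differentiable (at 0)" if "y \<in> D" for y
    using C u that by (simp add: numeral_2_eq_2)
  have C2: "(\<lambda>t::real. dir_deriv f u (y + t *\<^sub>R v)) differentiable (at 0)" if "y \<in> D" for y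
    using C u v that by (simp add: numeral_2_eq_2)
  have a: "((\<lambda>s. f (x + t *\<^sub>R v + s *\<^sub>R u)) has_real_derivative dir_deriv f u (x + t *\<^sub>R v + s *\<^sub>R u)) (at s)"
    if "0 \<le> s" "s \<le> h" "0 \<le> t" "t \<le> h" for s t
    using has_vector_derivative_dir_deriv[OF C1, of "x + t *\<^sub>R v" s] sq[OF that]
    by (simp add: algebra_simps has_real_derivative_iff_has_vector_derivative)
  have b: "((\<lambda>t. dir_deriv f u (x + s *\<^sub>R u + t *\<^sub>R v)) has_real_derivative dir_deriv (dir_deriv f u) v (x + s *\<^sub>R u + t *\<^sub>R v)) (at t)"
    if "0 \<le> s" "s \<le> h" "0 \<le> t" "t \<le> h" for s t
    using has_vector_derivative_dir_deriv[OF C2, of "x + s *\<^sub>R u" t] sq[OF that]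
    by (simp add: algebra_simps has_real_derivative_iff_has_vector_derivative)
  define \<phi> where "\<phi> = (\<lambda>s. f (x + h *\<^sub>R v + s *\<^sub>R u) - f (x + 0 *\<^sub>R v + s *\<^sub>R u))"
  have "\<exists>s>0. s < h \<and> \<phi> h - \<phi> 0 = (h - 0) * (dir_deriv f u (x + h *\<^sub>R v + s *\<^sub>R u) - dir_deriv f u (x + 0 *\<^sub>R v + s *\<^sub>R u))"
    unfolding \<phi>_def by (rule MVT2[OF h]) (intro DERIV_diff a, use h in auto)
  then obtain s where s: "0 < s" "s < h" "\<phi> h - \<phi> 0 = h * (dir_deriv f u (x + h *\<^sub>R v + s *\<^sub>R u) - dir_deriv f u (x + 0 *\<^sub>R v + s *\<^sub>R u))"
    by auto
  have "\<exists>t>0. t < h \<and> dir_deriv f u (x + s *\<^sub>R u + h *\<^sub>R v) - dir_deriv f u (x + s *\<^sub>R u + 0 *\<^sub>R v) = (h - 0) * dir_deriv (dir_deriv f u) v (x + s *\<^sub>R u + t *\<^sub>R v)"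
    by (rule MVT2[OF h]) (intro b, use s in auto)
  then obtain t where t: "0 < t" "t < h" "dir_deriv f u (x + s *\<^sub>R u + h *\<^sub>R v) - dir_deriv f u (x + s *\<^sub>R u) = h * dir_deriv (dir_deriv f u) v (x + s *\<^sub>R u + t *\<^sub>R v)"
    by auto
  have "f (x + h *\<^sub>R u + h *\<^sub>R v) - f (x + h *\<^sub>R u) - f (x + h *\<^sub>R v) + f x = \<phi> h - \<phi> 0"
    by (simp add: \<phi>_def algebra_simps)
  also have "\<dots> = h * (dir_deriv f u (x + s *\<^sub>R u + h *\<^sub>R v) - dir_deriv f u (x + s *\<^sub>R u))"
    unfolding s(3) by (simp add: algebra_simps)
  also have "\<dots> = h * h * dir_deriv (dir_deriv f u) v (x + s *\<^sub>R u + t *\<^sub>R v)"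
    unfolding t(3) by simp
  finally show ?thesis using s t by (intro exI[of _ s] exI[of _ t]) auto
qed

text \<open>Both mixed derivatives occur, at points near \<open>x\<close>, as the same second
  difference divided by \<open>h * h\<close>; continuity then forces equality at
  \<open>x\<close>.\<close>

lemma dir_deriv_commute:
  fixes f :: "complex^'n::finite \<Rightarrow> real"
  assumes C: "C_upto 2 K D f" and D: "coord_open K D" and x: "x \<in> D"
    and u: "u \<in> coord_subspace K" and v: "v \<in> coord_subspace K"
  shows "dir_deriv (dir_deriv f u) v x = dir_deriv (dir_deriv f v) u x"
proof (rule ccontr)
  let ?a = "dir_deriv (dir_deriv f u) v" and ?b = "dir_deriv (dir_deriv f v) u"
  assume ne: "?a x \<noteq> ?b x"
  define \<epsilon> where "\<epsilon> = \<bar>?a x - ?b x\<bar> / 2"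
  have \<epsilon>: "\<epsilon> > 0" using ne by (simp add: \<epsilon>_def)
  have "continuous_on D ?a" "continuous_on D ?b" using C u v by (simp_all add: numeral_2_eq_2)
  then obtain d1 d2 where d1: "d1 > 0" "\<And>y. y \<in> D \<Longrightarrow> dist y x < d1 \<Longrightarrow> \<bar>?a y - ?a x\<bar> < \<epsilon>"
    and d2: "d2 > 0" "\<And>y. y \<in> D \<Longrightarrow> dist y x < d2 \<Longrightarrow> \<bar>?b y - ?b x\<bar> < \<epsilon>"
    using x \<epsilon> unfolding continuous_on_iff dist_real_def by metis
  obtain e where e: "e > 0" "\<forall>w\<in>coord_subspace K. norm w < e \<longrightarrow> x + w \<in> D"
    using x D by (auto simp: coord_open_def)
  define \<delta> where "\<delta> = min e (min d1 d2)"
  have \<delta>: "\<delta> > 0" using d1 d2 e by (simp add: \<delta>_def)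
  \<comment> \<open>The parallelogram with sides \<open>h *\<^sub>R u\<close> and
    \<open>h *\<^sub>R v\<close> has to stay within \<delta> of \<open>x\<close>; the
    \<open>1\<close> covers the case \<open>u = v = 0\<close>.\<close>
  define h where "h = \<delta> / (2 * (norm u + norm v + 1))"
  have nn: "norm u + norm v + 1 > 0" by (smt (verit) norm_ge_zero)
  have h: "h > 0" using \<delta> nn by (simp add: h_def)
  have small: "norm (s *\<^sub>R u + t *\<^sub>R v) < \<delta>" if "0 \<le> s" "s \<le> h" "0 \<le> t" "t \<le> h" for s t
  proof -
    have "norm (s *\<^sub>R u + t *\<^sub>R v) \<le> s * norm u + t * norm v"
      using that norm_triangle_ineq[of "s *\<^sub>R u" "t *\<^sub>R v"] by simp
    also have "\<dots> \<le> h * norm u + h * norm v" using that by (intro add_mono mult_right_mono) auto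
    also have "\<dots> \<le> h * (norm u + norm v + 1)" using h by (simp add: algebra_simps)
    also have "\<dots> = \<delta> / 2"
    proof -
      have "\<delta> / (2 * c) * c = \<delta> / 2" if "c > 0" for c using that by (simp add: field_simps)
      from this[OF nn] show ?thesis by (simp only: h_def)
    qed
    finally show ?thesis using \<delta> by simp
  qed
  have inD: "x + s *\<^sub>R u + t *\<^sub>R v \<in> D" if "0 \<le> s" "s \<le> h" "0 \<le> t" "t \<le> h" for s t
    using e(2)[rule_format, of "s *\<^sub>R u + t *\<^sub>R v"] small[OF that] u v
    by (simp add: coord_subspace_add coord_subspace_scaleR \<delta>_def add.assoc)
  have dst: "dist (x + s *\<^sub>R u + t *\<^sub>R v) x < \<delta>" if "0 \<le> s" "s \<le> h" "0 \<le> t" "t \<le> h" for s t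
    using small[OF that] by (simp add: dist_norm add.assoc)
  obtain s t where st: "0 \<le> s" "s \<le> h" "0 \<le> t" "t \<le> h"
     "f (x + h *\<^sub>R u + h *\<^sub>R v) - f (x + h *\<^sub>R u) - f (x + h *\<^sub>R v) + f x = h * h * ?a (x + s *\<^sub>R u + t *\<^sub>R v)"
    using mixed_difference_mean_value[OF C u v h inD] by blast
  have inD': "x + s *\<^sub>R v + t *\<^sub>R u \<in> D" if "0 \<le> s" "s \<le> h" "0 \<le> t" "t \<le> h" for s t
    using inD[OF that(3,4,1,2)] by (simp add: algebra_simps)
  obtain s' t' where st': "0 \<le> s'" "s' \<le> h" "0 \<le> t'" "t' \<le> h"
     "f (x + h *\<^sub>R v + h *\<^sub>R u) - f (x + h *\<^sub>R v) - f (x + h *\<^sub>R u) + f x = h * h * ?b (x + s' *\<^sub>R v + t' *\<^sub>R u)"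
    using mixed_difference_mean_value[OF C v u h inD'] by blast
  have "h * h * ?a (x + s *\<^sub>R u + t *\<^sub>R v) = h * h * ?b (x + s' *\<^sub>R v + t' *\<^sub>R u)"
    unfolding st(5)[symmetric] st'(5)[symmetric] by (simp add: algebra_simps)
  then have "?a (x + s *\<^sub>R u + t *\<^sub>R v) = ?b (x + t' *\<^sub>R u + s' *\<^sub>R v)"
    using h by (simp add: algebra_simps)
  moreover have "\<bar>?a (x + s *\<^sub>R u + t *\<^sub>R v) - ?a x\<bar> < \<epsilon>"
    using d1(2) inD[OF st(1-4)] dst[OF st(1-4)] by (simp add: \<delta>_def)
  moreover have "\<bar>?b (x + t' *\<^sub>R u + s' *\<^sub>R v) - ?b x\<bar> < \<epsilon>"
    using d2(2) inD[OF st'(3,4,1,2)] dst[OF st'(3,4,1,2)] by (simp add: \<delta>_def)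
  moreover have "\<bar>?a x - ?b x\<bar> \<le> \<bar>y - ?a x\<bar> + \<bar>y - ?b x\<bar>" for y by linarith
  ultimately show False unfolding \<epsilon>_def by (smt (verit) field_sum_of_halves)
qed


section \<open>Integrals of products of holomorphic and antiholomorphic families\<close>

text \<open>The pointwise majorant \<open>b\<close> serves the whole ball of parameters. Derivatives
  in the parameter are bounded by multiples of the same \<open>b\<close>, so integrability of
  \<open>b\<close>, or of its square, is never lost.\<close>

definition hol_fam :: "'w measure \<Rightarrow> ('w \<Rightarrow> real) \<Rightarrow> complex^'n::finite \<Rightarrow> real \<Rightarrow> (complex^'n \<Rightarrow> 'w \<Rightarrow> complex) \<Rightarrow> bool" where
  "hol_fam M b x r p \<longleftrightarrow> (\<forall>z\<in>ball x r. p z \<in> borel_measurable M) \<and> (\<forall>w\<in>space M. ghol (b w) x r (\<lambda>z. p z w))"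

lemma hol_fam_mono:
  assumes "hol_fam M b x r p" "r' \<le> r" "\<And>w. w \<in> space M \<Longrightarrow> b w \<le> b' w"
  shows "hol_fam M b' x r' p"
  unfolding hol_fam_def
proof (intro conjI ballI)
  show "p z \<in> borel_measurable M" if "z \<in> ball x r'" for z
    using assms(1,2) that by (auto simp: hol_fam_def)
  show "ghol (b' w) x r' (\<lambda>z. p z w)" if "w \<in> space M" for w
    by (rule ghol_mono[OF _ assms(2) assms(3)[OF that]]) (use assms(1) that in \<open>auto simp: hol_fam_def\<close>)
qed

lemma hol_fam_bound: "hol_fam M b x r p \<Longrightarrow> z \<in> ball x r \<Longrightarrow> w \<in> space M \<Longrightarrow> cmod (p z w) \<le> b w"
  using ghol_bound[of "b w" x r "\<lambda>z. p z w" z] by (simp add: hol_fam_def)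

lemma hol_fam_measurable: "hol_fam M b x r p \<Longrightarrow> z \<in> ball x r \<Longrightarrow> p z \<in> borel_measurable M"
  by (simp add: hol_fam_def)

lemma shift_in_open:
  fixes z v :: "complex^'n::finite"
  assumes "open D" "z \<in> D"
  obtains \<delta> :: real where "\<delta> > 0" "\<And>t. \<bar>t\<bar> < \<delta> \<Longrightarrow> z + t *\<^sub>R v \<in> D"
proof -
  have "\<forall>\<^sub>F t in nhds (0::real). z + t *\<^sub>R v \<in> D"
    by (rule coord_open_eventually[OF coord_open_open[of D UNIV]]) (use assms in \<open>auto simp: coord_subspace_def\<close>)
  then show ?thesis using that unfolding eventually_nhds_metric by (auto simp: dist_real_def)
qed

lemma hol_fam_hderiv:
  assumes p: "hol_fam M b x r p" and r: "r' < r"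
  shows "hol_fam M (\<lambda>w. b w / (r - r') * norm v) x r' (\<lambda>z w. hderiv v (\<lambda>z. p z w) z)"
  unfolding hol_fam_def
proof (intro conjI ballI)
  fix w assume "w \<in> space M"
  then show "ghol (b w / (r - r') * norm v) x r' (\<lambda>z. hderiv v (\<lambda>z. p z w) z)"
    by (intro ghol_hderiv r) (use p in \<open>auto simp: hol_fam_def\<close>)
next
  fix z assume "z \<in> ball x r'"
  then have z: "z \<in> ball x r" using r by auto
  obtain \<delta> where \<delta>: "\<delta> > 0" "\<And>t. \<bar>t\<bar> < \<delta> \<Longrightarrow> z + t *\<^sub>R v \<in> ball x r"
    using shift_in_open[OF open_ball z] by metis
  \<comment> \<open>Measurability of the derivative is obtained from difference quotients along
    these steps, of which it is the pointwise limit.\<close>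
  define h where "h = (\<lambda>n. \<delta> / 2 * inverse (real (Suc n)))"
  have h0: "h n \<noteq> 0" for n using \<delta> by (simp add: h_def del: of_nat_Suc)
  have hd: "\<bar>h n\<bar> < \<delta>" for n
  proof -
    have "inverse (real (Suc n)) \<le> 1" by (simp add: field_simps)
    then have "h n \<le> \<delta> / 2 * 1" unfolding h_def using \<delta> by (intro mult_left_mono) auto
    moreover have "h n \<ge> 0" using \<delta> by (simp add: h_def)
    ultimately show ?thesis using \<delta> by simp
  qed
  have "(\<lambda>n. \<delta> / 2 * inverse (real (Suc n))) \<longlonglongrightarrow> \<delta> / 2 * 0"
    by (intro tendsto_mult tendsto_const LIMSEQ_inverse_real_of_nat)
  then have hl: "filterlim h (at 0) sequentially" using h0 by (intro filterlim_atI) (auto simp: h_def)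
  show "(\<lambda>w. hderiv v (\<lambda>z. p z w) z) \<in> borel_measurable M"
  proof (rule borel_measurable_LIMSEQ_metric)
    show "(\<lambda>w. (p (z + h n *\<^sub>R v) w - p z w) /\<^sub>R h n) \<in> borel_measurable M" for n
      using hol_fam_measurable[OF p z] hol_fam_measurable[OF p \<delta>(2)[OF hd[of n]]] by simp
    fix w assume w: "w \<in> space M"
    have "((\<lambda>t. p (z + t *\<^sub>R v) w) has_vector_derivative hderiv v (\<lambda>z. p z w) z) (at 0)"
      using ghol_real_derivative[of "b w" x r "\<lambda>z. p z w" z v] p z w by (simp add: hol_fam_def)
    then have "((\<lambda>t. (p (z + t *\<^sub>R v) w - p z w) /\<^sub>R t) \<longlongrightarrow> hderiv v (\<lambda>z. p z w) z) (at 0)"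
      unfolding has_vector_derivative_iff_quotient by simp
    from filterlim_compose[OF this hl]
    show "(\<lambda>n. (p (z + h n *\<^sub>R v) w - p z w) /\<^sub>R h n) \<longlonglongrightarrow> hderiv v (\<lambda>z. p z w) z" .
  qed
qed

text \<open>The Taylor estimate is integrated over \<open>w\<close>: its constant is linear in
  \<open>b w\<close>, so the remainder of the integral is quadratic in the step, with the finite
  constant \<open>K\<close>.\<close>

lemma ghol_integral:
  assumes p: "hol_fam M b x r p" and b: "integrable M b" and r: "0 < r'" "r' < r"
  shows "ghol (integral\<^sup>L M b) x r' (\<lambda>z. \<integral>w. p z w \<partial>M)"
proof -
  have int: "integrable M (p z)" if z: "z \<in> ball x r" for z
  proof (rule Bochner_Integration.integrable_bound[OF b hol_fam_measurable[OF p z]])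
    show "AE w in M. norm (p z w) \<le> norm (b w)"
      by (rule AE_I2) (use hol_fam_bound[OF p z] in \<open>simp add: order_trans[OF _ abs_ge_self]\<close>)
  qed
  show ?thesis
  proof (rule gholI)
    fix z assume "z \<in> ball x r'"
    then have z: "z \<in> ball x r" using r by auto
    have "cmod (\<integral>w. p z w \<partial>M) \<le> (\<integral>w. cmod (p z w) \<partial>M)" by (rule integral_norm_bound)
    also have "\<dots> \<le> integral\<^sup>L M b" by (rule integral_mono) (use int[OF z] b hol_fam_bound[OF p z] in auto)
    finally show "cmod (\<integral>w. p z w \<partial>M) \<le> integral\<^sup>L M b" .
  next
    fix z v
    let ?S = "{s. z + s *s v \<in> ball x r'}"
    show "(\<lambda>s. \<integral>w. p (z + s *s v) w \<partial>M) holomorphic_on ?S"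
    proof (rule holomorphic_onI)
      fix s0 assume "s0 \<in> ?S"
      define y where "y = z + s0 *s v"
      have y: "y \<in> ball x r'" using \<open>s0 \<in> ?S\<close> by (simp add: y_def)
      have yr: "y \<in> ball x r" using y r by auto
      define \<rho> where "\<rho> = (r - r') / (norm v + 1)"
      have "norm v + 1 > 0" by (smt (verit) norm_ge_zero)
      then have \<rho>: "\<rho> > 0" using r by (simp add: \<rho>_def)
      define D where "D = (\<integral>w. hderiv v (\<lambda>z. p z w) y \<partial>M)"
      have iD: "integrable M (\<lambda>w. hderiv v (\<lambda>z. p z w) y)"
      proof (rule Bochner_Integration.integrable_bound)
        show "integrable M (\<lambda>w. b w / (r - r') * norm v)" using b by simp
        show "(\<lambda>w. hderiv v (\<lambda>z. p z w) y) \<in> borel_measurable M"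
          by (rule hol_fam_measurable[OF hol_fam_hderiv[OF p r(2)] y])
        show "AE w in M. norm (hderiv v (\<lambda>z. p z w) y) \<le> norm (b w / (r - r') * norm v)"
        proof (rule AE_I2)
          fix w assume "w \<in> space M"
          from hol_fam_bound[OF hol_fam_hderiv[OF p r(2)] y this]
          show "norm (hderiv v (\<lambda>z. p z w) y) \<le> norm (b w / (r - r') * norm v)"
            unfolding real_norm_def[of "b w / (r - r') * norm v"] by (rule order_trans[OF _ abs_ge_self])
        qed
      qed
      define K where "K = (\<integral>w. 2 * b w / (\<rho>/2)^2 \<partial>M)"
      have bd: "cmod ((\<integral>w. p (y + h *s v) w \<partial>M) - (\<integral>w. p y w \<partial>M) - h * D) \<le> K * (cmod h)\<^sup>2" if h: "cmod h \<le> \<rho> / 2" for h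
      proof -
        have g: "y + h *s v \<in> ball x r \<and> cmod (p (y + h *s v) w - p y w - h * hderiv v (\<lambda>z. p z w) y) \<le> (2 * b w / (\<rho>/2)^2) * (cmod h)\<^sup>2" if "w \<in> space M" for w
          using ghol_Taylor_bound[of "b w" x r "\<lambda>z. p z w" r' y h v, folded \<rho>_def] p that r(2) y h by (simp add: hol_fam_def)
        have in_r: "y + h *s v \<in> ball x r"
          using slice_in_ball[OF y, of h v r] h r \<open>norm v + 1 > 0\<close> \<rho>
        proof -
          have "cmod h * norm v \<le> \<rho> * (norm v + 1)" by (intro mult_mono) (use h \<rho> in auto)
          also have "\<dots> = r - r'" using \<open>norm v + 1 > 0\<close> by (simp add: \<rho>_def)
          finally show ?thesis by (rule slice_in_ball[OF y])
        qed
        have "(\<integral>w. p (y + h *s v) w \<partial>M) - (\<integral>w. p y w \<partial>M) - h * D = (\<integral>w. p (y + h *s v) w - p y w - h * hderiv v (\<lambda>z. p z w) y \<partial>M)"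
          unfolding D_def using int[OF in_r] int[OF yr] iD by simp
        also have "cmod \<dots> \<le> (\<integral>w. cmod (p (y + h *s v) w - p y w - h * hderiv v (\<lambda>z. p z w) y) \<partial>M)" by (rule integral_norm_bound)
        also have "\<dots> \<le> (\<integral>w. (2 * b w / (\<rho>/2)^2) * (cmod h)\<^sup>2 \<partial>M)"
          by (rule integral_mono) (use int[OF in_r] int[OF yr] iD b g in auto)
        also have "\<dots> = K * (cmod h)\<^sup>2" by (simp add: K_def)
        finally show ?thesis .
      qed
      have "((\<lambda>h. \<integral>w. p (y + h *s v) w \<partial>M) has_field_derivative D) (at 0)"
        unfolding has_field_derivative_iff
      proof (rule Lim_transform_bound[THEN Lim_null[THEN iffD2]])
        show "((\<lambda>h. K * cmod h) \<longlongrightarrow> 0) (at (0::complex))" by (auto intro!: tendsto_eq_intros)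
        show "\<forall>\<^sub>F h in at (0::complex). norm (((\<integral>w. p (y + h *s v) w \<partial>M) - (\<integral>w. p (y + 0 *s v) w \<partial>M)) / (h - 0) - D) \<le> norm (K * cmod h)"
          unfolding eventually_at
        proof (intro exI[of _ "\<rho>/2"] conjI ballI impI)
          fix h :: complex assume h: "h \<noteq> 0 \<and> dist h 0 < \<rho> / 2"
          have "((\<integral>w. p (y + h *s v) w \<partial>M) - (\<integral>w. p y w \<partial>M)) / h - D = ((\<integral>w. p (y + h *s v) w \<partial>M) - (\<integral>w. p y w \<partial>M) - h * D) / h"
            using h by (simp add: diff_divide_distrib)
          also have "cmod \<dots> \<le> K * (cmod h)\<^sup>2 / cmod h"
            unfolding norm_divide using bd[of h] h by (intro divide_right_mono) auto
          also have "\<dots> = K * cmod h" using h by (simp add: power2_eq_square)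
          finally show "norm (((\<integral>w. p (y + h *s v) w \<partial>M) - (\<integral>w. p (y + 0 *s v) w \<partial>M)) / (h - 0) - D) \<le> norm (K * cmod h)"
            by (simp add: order_trans[OF _ abs_ge_self])
        qed (use \<rho> in auto)
      qed
      then have "((\<lambda>h. \<integral>w. p (z + (h + s0) *s v) w \<partial>M) has_field_derivative D) (at 0)"
        by (simp add: y_def algebra_simps)
      then have "((\<lambda>s. \<integral>w. p (z + s *s v) w \<partial>M) has_field_derivative D) (at s0)"
        using DERIV_shift[of "\<lambda>s. \<integral>w. p (z + s *s v) w \<partial>M" D 0 s0] by simp
      then show "(\<lambda>s. \<integral>w. p (z + s *s v) w \<partial>M) field_differentiable (at s0 within ?S)"
        using field_differentiable_at_within field_differentiable_def by blast
    qed
  qed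
qed

lemma hol_fam_product_integrable:
  assumes p: "hol_fam M b x r p" and q: "hol_fam M b x r q" and b: "integrable M (\<lambda>w. (b w)\<^sup>2)"
    and z: "z \<in> ball x r"
  shows "integrable M (\<lambda>w. p z w * cnj (q z w))"
proof (rule Bochner_Integration.integrable_bound[OF b])
  have "p z \<in> borel_measurable M" and m: "q z \<in> borel_measurable M" using p q z by (auto simp: hol_fam_def)
  moreover have "(\<lambda>w. cnj (q z w)) \<in> borel_measurable M"
    using borel_measurable_continuous_onI[of cnj] measurable_compose[OF m] by (auto intro: continuous_intros)
  ultimately show "(\<lambda>w. p z w * cnj (q z w)) \<in> borel_measurable M" by (intro borel_measurable_times)
  show "AE w in M. norm (p z w * cnj (q z w)) \<le> norm ((b w)\<^sup>2)"
  proof (rule AE_I2)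
    fix w assume w: "w \<in> space M"
    then have "cmod (p z w) \<le> b w" "cmod (q z w) \<le> b w" by (rule hol_fam_bound[OF p z], rule hol_fam_bound[OF q z])
    then show "norm (p z w * cnj (q z w)) \<le> norm ((b w)\<^sup>2)"
      by (simp add: norm_mult power2_eq_square) (meson abs_ge_self abs_ge_zero mult_mono norm_ge_zero order_trans)
  qed
qed

lemma hol_fam_product_Lipschitz:
  assumes p: "hol_fam M b x r p" and q: "hol_fam M b x r q" and r: "r' < r"
    and z: "z \<in> ball x r'" and y: "y \<in> ball x r'" and w: "w \<in> space M"
  shows "cmod (p y w * cnj (q y w) - p z w * cnj (q z w)) \<le> norm (y - z) * (2 / (r - r') * (b w)\<^sup>2)"
proof -
  have gp: "ghol (b w) x r (\<lambda>z. p z w)" and gq: "ghol (b w) x r (\<lambda>z. q z w)" using p q w by (auto simp: hol_fam_def)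
  have b0: "b w \<ge> 0" using ghol_bound[OF gp, of z] z r by (meson mem_ball norm_ge_zero order_trans less_trans)
  have "p y w * cnj (q y w) - p z w * cnj (q z w) = (p y w - p z w) * cnj (q y w) + p z w * cnj (q y w - q z w)"
    by (simp add: algebra_simps)
  also have "cmod \<dots> \<le> cmod (p y w - p z w) * cmod (q y w) + cmod (p z w) * cmod (q y w - q z w)"
    by (rule order_trans[OF norm_triangle_ineq]) (simp only: norm_mult complex_mod_cnj)
  also have "\<dots> \<le> (b w / (r - r') * norm (y - z)) * b w + b w * (b w / (r - r') * norm (y - z))"
    by (intro add_mono mult_mono ghol_Lipschitz[OF gp r z y] ghol_Lipschitz[OF gq r z y] ghol_bound[OF gp] ghol_bound[OF gq])
       (use b0 r z y in auto)
  also have "\<dots> = norm (y - z) * (2 / (r - r') * (b w)\<^sup>2)" by (simp add: power2_eq_square algebra_simps)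
  finally show ?thesis .
qed

text \<open>A real derivative of \<open>p * cnj q\<close> has a part coming from \<open>p\<close>
  and one coming from \<open>q\<close>; each is again a holomorphic family times the conjugate of
  one, so the differentiation can be repeated.\<close>

lemma hol_fam_integral_derivative:
  assumes p: "hol_fam M b x r p" and q: "hol_fam M b x r q" and b: "integrable M (\<lambda>w. (b w)\<^sup>2)"
    and r: "r' < r" and z: "z \<in> ball x r'"
  shows "((\<lambda>t. \<integral>w. p (z + t *\<^sub>R v) w * cnj (q (z + t *\<^sub>R v) w) \<partial>M) has_vector_derivative
     (\<integral>w. hderiv v (\<lambda>z. p z w) z * cnj (q z w) \<partial>M) + (\<integral>w. p z w * cnj (hderiv v (\<lambda>z. q z w) z) \<partial>M)) (at 0)"
proof -
  obtain \<delta> where \<delta>: "\<delta> > 0" "\<And>t. \<bar>t\<bar> < \<delta> \<Longrightarrow> z + t *\<^sub>R v \<in> ball x r'"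
    using shift_in_open[OF open_ball z] by metis
  have inr: "y \<in> ball x r" if "y \<in> ball x r'" for y using that r by auto
  define F where "F = (\<lambda>t w. p (z + t *\<^sub>R v) w * cnj (q (z + t *\<^sub>R v) w))"
  \<comment> \<open>One majorant for \<open>p\<close>, \<open>q\<close> and their derivatives, still
    a constant multiple of \<open>b\<close>.\<close>
  define B where "B = (\<lambda>w. max 1 (norm v / (r - r')) * b w)"
  have b0: "b w \<ge> 0" if "w \<in> space M" for w
    using p that inr[OF z] ghol_bound[of "b w" x r "\<lambda>z. p z w" z] order_trans[OF norm_ge_zero] unfolding hol_fam_def by blast
  have B1: "b w \<le> B w" "b w / (r - r') * norm v \<le> B w" if "w \<in> space M" for w
    using b0[OF that] mult_right_mono[of 1 "max 1 (norm v / (r - r'))" "b w"] mult_right_mono[of "norm v / (r - r')" "max 1 (norm v / (r - r'))" "b w"]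
    by (auto simp: B_def mult.commute)
  have iB: "integrable M (\<lambda>w. (B w)\<^sup>2)" using b by (simp add: B_def power_mult_distrib)
  have p': "hol_fam M B x r' p" and q': "hol_fam M B x r' q"
    by (rule hol_fam_mono[OF p] hol_fam_mono[OF q]; use r B1 in auto)+
  have pv: "hol_fam M B x r' (\<lambda>z w. hderiv v (\<lambda>z. p z w) z)"
    by (rule hol_fam_mono[OF hol_fam_hderiv[OF p r]]) (use B1 in auto)
  have qv: "hol_fam M B x r' (\<lambda>z w. hderiv v (\<lambda>z. q z w) z)"
    by (rule hol_fam_mono[OF hol_fam_hderiv[OF q r]]) (use B1 in auto)
  have i1: "integrable M (\<lambda>w. hderiv v (\<lambda>z. p z w) z * cnj (q z w))"
    by (rule hol_fam_product_integrable[OF pv q' iB z])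
  have i2: "integrable M (\<lambda>w. p z w * cnj (hderiv v (\<lambda>z. q z w) z))"
    by (rule hol_fam_product_integrable[OF p' qv iB z])
  have "((\<lambda>t. integral\<^sup>L M (F t)) has_vector_derivative integral\<^sup>L M (\<lambda>w. hderiv v (\<lambda>z. p z w) z * cnj (q z w) + p z w * cnj (hderiv v (\<lambda>z. q z w) z))) (at 0)"
  proof (rule has_vector_derivative_integral(2)[OF \<delta>(1)])
    show "F t \<in> borel_measurable M" if "\<bar>t\<bar> < \<delta>" for t
      unfolding F_def using hol_fam_product_integrable[OF p q b inr[OF \<delta>(2)[OF that]]] by (rule borel_measurable_integrable)
    show "integrable M (F 0)" using hol_fam_product_integrable[OF p q b inr[OF z]] by (simp add: F_def)
    show "integrable M (\<lambda>w. norm v * (2 / (r - r') * (b w)\<^sup>2))" using b by simp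
    show "(\<lambda>w. hderiv v (\<lambda>z. p z w) z * cnj (q z w) + p z w * cnj (hderiv v (\<lambda>z. q z w) z)) \<in> borel_measurable M"
      using i1 i2 by (intro borel_measurable_integrable Bochner_Integration.integrable_add)
    show "AE w in M. \<forall>t. \<bar>t\<bar> < \<delta> \<longrightarrow> norm (F t w - F 0 w) \<le> \<bar>t\<bar> * (norm v * (2 / (r - r') * (b w)\<^sup>2))"
    proof (intro AE_I2 allI impI)
      fix w t assume "w \<in> space M" "\<bar>t\<bar> < \<delta>"
      from hol_fam_product_Lipschitz[OF p q r z \<delta>(2)[OF this(2)] this(1)]
      show "norm (F t w - F 0 w) \<le> \<bar>t\<bar> * (norm v * (2 / (r - r') * (b w)\<^sup>2))" by (simp add: F_def mult.assoc)
    qed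
    show "AE w in M. ((\<lambda>t. F t w) has_vector_derivative hderiv v (\<lambda>z. p z w) z * cnj (q z w) + p z w * cnj (hderiv v (\<lambda>z. q z w) z)) (at 0)"
    proof (rule AE_I2)
      fix w assume w: "w \<in> space M"
      then have gp: "ghol (b w) x r (\<lambda>z. p z w)" and gq: "ghol (b w) x r (\<lambda>z. q z w)" using p q by (auto simp: hol_fam_def)
      have "((\<lambda>t. cnj (q (z + t *\<^sub>R v) w)) has_vector_derivative cnj (hderiv v (\<lambda>z. q z w) z)) (at 0)"
        by (rule bounded_linear.has_vector_derivative[OF bounded_linear_cnj ghol_real_derivative[OF gq inr[OF z]]])
      from has_vector_derivative_mult[OF ghol_real_derivative[OF gp inr[OF z]] this]
      show "((\<lambda>t. F t w) has_vector_derivative hderiv v (\<lambda>z. p z w) z * cnj (q z w) + p z w * cnj (hderiv v (\<lambda>z. q z w) z)) (at 0)"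
        by (simp add: F_def add.commute)
    qed
  qed
  then show ?thesis unfolding F_def using i1 i2 by (simp add: Bochner_Integration.integral_add)
qed

text \<open>The class of such integrals is closed under differentiation up to shrinking the ball,
  hence the induction with \<open>p\<close>, \<open>q\<close>, \<open>b\<close> and \<open>r\<close>
  arbitrary.\<close>

lemma C_upto_hol_integral:
  assumes "hol_fam M b x r p" "hol_fam M b x r q" "integrable M (\<lambda>w. (b w)\<^sup>2)" "0 < r'" "r' < r"
  shows "C_upto m UNIV (ball x r') (\<lambda>z. \<integral>w. p z w * cnj (q z w) \<partial>M)"
  using assms
proof (induction m arbitrary: p q b r)
  case 0
  define L where "L = (\<integral>w. 2 / (r - r') * (b w)\<^sup>2 \<partial>M)"
  have "L-lipschitz_on (ball x r') (\<lambda>z. \<integral>w. p z w * cnj (q z w) \<partial>M)"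
  proof (rule lipschitz_onI)
    fix y z assume yz: "y \<in> ball x r'" "z \<in> ball x r'"
    have i: "integrable M (\<lambda>w. p z w * cnj (q z w))" "integrable M (\<lambda>w. p y w * cnj (q y w))"
      using hol_fam_product_integrable[OF 0(1,2,3)] yz 0 by auto
    have "dist (\<integral>w. p y w * cnj (q y w) \<partial>M) (\<integral>w. p z w * cnj (q z w) \<partial>M) = norm (\<integral>w. p y w * cnj (q y w) - p z w * cnj (q z w) \<partial>M)"
      using i by (simp add: dist_norm)
    also have "\<dots> \<le> (\<integral>w. norm (p y w * cnj (q y w) - p z w * cnj (q z w)) \<partial>M)" by (rule integral_norm_bound)
    also have "\<dots> \<le> (\<integral>w. norm (y - z) * (2 / (r - r') * (b w)\<^sup>2) \<partial>M)"
      by (rule integral_mono) (use i 0 yz hol_fam_product_Lipschitz[OF 0(1,2) 0(5) yz(2,1)] in auto)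
    also have "\<dots> = L * dist y z" by (simp add: L_def dist_norm mult.commute)
    finally show "dist (\<integral>w. p y w * cnj (q y w) \<partial>M) (\<integral>w. p z w * cnj (q z w) \<partial>M) \<le> L * dist y z" .
  next
    show "0 \<le> L" unfolding L_def using 0 by (intro integral_nonneg_AE) auto
  qed
  then show ?case by (simp add: lipschitz_on_continuous_on)
next
  case (Suc m)
  have c0: "continuous_on (ball x r') (\<lambda>z. \<integral>w. p z w * cnj (q z w) \<partial>M)"
  proof -
    have "C_upto 0 UNIV (ball x r') (\<lambda>z. \<integral>w. p z w * cnj (q z w) \<partial>M)"
    proof (cases m)
      case 0 then show ?thesis using Suc.IH[OF Suc.prems] by simp
    next
      case (Suc k) then show ?thesis using Suc.IH[OF Suc.prems] by simp
    qed
    then show ?thesis by simp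
  qed
  \<comment> \<open>Each derivative costs some radius; the midpoint leaves room above
    \<open>r'\<close> for all the later ones.\<close>
  define r2 where "r2 = (r + r') / 2"
  have r2: "0 < r2" "r' < r2" "r2 < r" using Suc.prems by (auto simp: r2_def)
  show ?case unfolding C_upto.simps
  proof (intro conjI ballI)
    show "continuous_on (ball x r') (\<lambda>z. \<integral>w. p z w * cnj (q z w) \<partial>M)" by (rule c0)
    fix v assume "v \<in> coord_subspace (UNIV :: 'b set)"
    have der: "((\<lambda>t. \<integral>w. p (z + t *\<^sub>R v) w * cnj (q (z + t *\<^sub>R v) w) \<partial>M) has_vector_derivative
     (\<integral>w. hderiv v (\<lambda>z. p z w) z * cnj (q z w) \<partial>M) + (\<integral>w. p z w * cnj (hderiv v (\<lambda>z. q z w) z) \<partial>M)) (at 0)"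
      if "z \<in> ball x r'" for z
      by (rule hol_fam_integral_derivative[OF Suc.prems(1,2,3,5) that])
    show "(\<lambda>t::real. \<integral>w. p (z + t *\<^sub>R v) w * cnj (q (z + t *\<^sub>R v) w) \<partial>M) differentiable (at 0)" if "z \<in> ball x r'" for z
      using der[OF that] vector_derivative_works_iff by blast
    define B where "B = (\<lambda>w. max 1 (norm v / (r - r2)) * b w)"
    have b0: "b w \<ge> 0" if "w \<in> space M" for w
      using Suc.prems(1) that r2 ghol_nonneg[of "b w" x r "\<lambda>z. p z w"] unfolding hol_fam_def by auto
    have B1: "b w \<le> B w" "b w / (r - r2) * norm v \<le> B w" if "w \<in> space M" for w
      using b0[OF that] mult_right_mono[of 1 "max 1 (norm v / (r - r2))" "b w"] mult_right_mono[of "norm v / (r - r2)" "max 1 (norm v / (r - r2))" "b w"]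
      by (auto simp: B_def mult.commute)
    have iB: "integrable M (\<lambda>w. (B w)\<^sup>2)" using Suc.prems(3) by (simp add: B_def power_mult_distrib)
    have p': "hol_fam M B x r2 p" and q': "hol_fam M B x r2 q"
      by (rule hol_fam_mono[OF Suc.prems(1)] hol_fam_mono[OF Suc.prems(2)]; use r2 B1 in auto)+
    have pv: "hol_fam M B x r2 (\<lambda>z w. hderiv v (\<lambda>z. p z w) z)"
      by (rule hol_fam_mono[OF hol_fam_hderiv[OF Suc.prems(1) r2(3)]]) (use B1 in auto)
    have qv: "hol_fam M B x r2 (\<lambda>z w. hderiv v (\<lambda>z. q z w) z)"
      by (rule hol_fam_mono[OF hol_fam_hderiv[OF Suc.prems(2) r2(3)]]) (use B1 in auto)
    have "C_upto m UNIV (ball x r') (\<lambda>z. (\<integral>w. hderiv v (\<lambda>z. p z w) z * cnj (q z w) \<partial>M) + (\<integral>w. p z w * cnj (hderiv v (\<lambda>z. q z w) z) \<partial>M))"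
      by (intro C_upto_add coord_open_open open_ball Suc.IH[OF pv q' iB] Suc.IH[OF p' qv iB] Suc.prems(4) r2(2))
    then show "C_upto m UNIV (ball x r') (dir_deriv (\<lambda>z. \<integral>w. p z w * cnj (q z w) \<partial>M) v)"
      by (rule C_upto_cong[OF coord_open_open[OF open_ball], rotated]) (rule dir_deriv_eqI[OF der, symmetric])
  qed
qed

section \<open>Change of variables in the complex plane\<close>

text \<open>Identification of \<open>\<complex>\<close> with \<open>real^2\<close>, the setting of
  the determinant form of the change of variables theorem.\<close>

definition plane_of :: "complex \<Rightarrow> real^2" where "plane_of z = vector [Re z, Im z]"
definition of_plane :: "real^2 \<Rightarrow> complex" where "of_plane v = Complex (v $ 1) (v $ 2)"

lemma plane_of_of_plane [simp]: "plane_of (of_plane v) = v"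
  by (simp add: plane_of_def of_plane_def vec_eq_iff forall_2)

lemma of_plane_plane_of [simp]: "of_plane (plane_of z) = z"
  by (simp add: plane_of_def of_plane_def)

lemma bounded_linear_of_plane: "bounded_linear of_plane"
proof -
  have "linear of_plane" by (rule linearI) (auto simp: of_plane_def complex_eq_iff)
  then show ?thesis by (simp add: linear_conv_bounded_linear)
qed

lemma bounded_linear_plane_of: "bounded_linear plane_of"
proof -
  have "linear plane_of" by (rule linearI) (auto simp: plane_of_def vec_eq_iff forall_2)
  then show ?thesis by (simp add: linear_conv_bounded_linear)
qed

lemma plane_of_scaleR: "plane_of (r *\<^sub>R z) = r *\<^sub>R plane_of z"
  by (rule linear_cmul[OF bounded_linear.linear[OF bounded_linear_plane_of]])

lemma of_plane_measurable [measurable]: "of_plane \<in> borel_measurable borel"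
  by (intro borel_measurable_continuous_onI linear_continuous_on bounded_linear_of_plane)

lemma plane_of_measurable [measurable]: "plane_of \<in> borel_measurable borel"
  by (intro borel_measurable_continuous_onI linear_continuous_on bounded_linear_plane_of)

text \<open>Lebesgue measure is determined by its values on boxes, and \<open>of_plane\<close> maps
  boxes to boxes of the same area.\<close>

lemma lborel_of_plane: "lborel = distr lborel borel of_plane"
proof (rule lborel_eqI)
  fix l u :: complex assume lu: "\<And>b. b \<in> Basis \<Longrightarrow> l \<bullet> b \<le> u \<bullet> b"
  have le: "Re l \<le> Re u" "Im l \<le> Im u" using lu[of 1] lu[of \<i>] by (auto simp: Basis_complex_def)
  have eq: "of_plane -` box l u = box (plane_of l) (plane_of u)"
    by (auto simp: mem_box_cart plane_of_def forall_2 in_box_complex_iff of_plane_def)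
  have "emeasure (distr lborel borel of_plane) (box l u) = emeasure lborel (box (plane_of l) (plane_of u))"
    by (subst emeasure_distr) (auto simp: eq)
  also have "\<dots> = ennreal (\<Prod>b\<in>Basis. (plane_of u - plane_of l) \<bullet> b)"
  proof (rule emeasure_lborel_box)
    have "\<forall>i. plane_of l $ i \<le> plane_of u $ i" using le by (simp add: forall_2 plane_of_def)
    then show "plane_of l \<bullet> b \<le> plane_of u \<bullet> b" if "b \<in> Basis" for b
      using that by (auto simp: Basis_vec_def inner_axis)
  qed
  also have "(\<Prod>b\<in>Basis. (plane_of u - plane_of l) \<bullet> b) = (\<Prod>i\<in>UNIV. (plane_of u - plane_of l) $ i)"
  proof -
    have B: "(Basis :: (real^2) set) = (\<lambda>i. axis i 1) ` UNIV" by (auto simp: Basis_vec_def)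
    show ?thesis unfolding B by (subst prod.reindex) (auto simp: inj_on_def axis_eq_axis inner_axis)
  qed
  also have "\<dots> = prod ((\<bullet>) (u - l)) Basis"
    by (simp add: UNIV_2 plane_of_def Basis_complex_def inner_complex_def)
  finally show "emeasure (distr lborel borel of_plane) (box l u) = ennreal (prod ((\<bullet>) (u - l)) Basis)" .
qed simp

text \<open>The completed measure appears on the side of \<open>real^2\<close> because the change of
  variables theorem is about \<open>lebesgue\<close>.\<close>

lemma lborel_plane_transfer:
  fixes F :: "complex \<Rightarrow> complex"
  assumes F: "F \<in> borel_measurable borel"
  shows "integrable lborel F \<longleftrightarrow> integrable lebesgue (\<lambda>v. plane_of (F (of_plane v)))"
    and "integrable lborel F \<Longrightarrow> integral\<^sup>L lborel F = of_plane (integral\<^sup>L lebesgue (\<lambda>v. plane_of (F (of_plane v))))"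
proof -
  have m: "(\<lambda>v. plane_of (F (of_plane v))) \<in> borel_measurable lborel" using F by simp
  have 1: "integrable lborel F \<longleftrightarrow> integrable lborel (\<lambda>v. F (of_plane v))"
    by (subst lborel_of_plane, subst integrable_distr_eq) (use F in auto)
  have 2: "integrable lborel (\<lambda>v. F (of_plane v)) \<longleftrightarrow> integrable lborel (\<lambda>v. plane_of (F (of_plane v)))"
    using integrable_bounded_linear[OF bounded_linear_plane_of, of lborel "\<lambda>v. F (of_plane v)"]
      integrable_bounded_linear[OF bounded_linear_of_plane, of lborel "\<lambda>v. plane_of (F (of_plane v))"] by auto
  show iff: "integrable lborel F \<longleftrightarrow> integrable lebesgue (\<lambda>v. plane_of (F (of_plane v)))"
    using 1 2 integrable_completion[OF m] by simp
  assume i: "integrable lborel F"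
  have "integral\<^sup>L lborel F = integral\<^sup>L lborel (\<lambda>v. F (of_plane v))"
    by (subst (1) lborel_of_plane, subst integral_distr) (use F in auto)
  also have "\<dots> = of_plane (integral\<^sup>L lborel (\<lambda>v. plane_of (F (of_plane v))))"
    using integral_bounded_linear[OF bounded_linear_of_plane, of lborel "\<lambda>v. plane_of (F (of_plane v))"] i 1 2 by simp
  also have "\<dots> = of_plane (integral\<^sup>L lebesgue (\<lambda>v. plane_of (F (of_plane v))))"
    using integral_completion[OF m] by simp
  finally show "integral\<^sup>L lborel F = of_plane (integral\<^sup>L lebesgue (\<lambda>v. plane_of (F (of_plane v))))" .
qed

text \<open>A real-differentiable map with Wirtinger derivatives \<alpha> and \<beta> has this
  Jacobian determinant. The case \<beta> = 0 serves the transition maps; the general one is needed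
  for the discs about moving zeros.\<close>

lemma change_of_variables_complex:
  fixes f g :: "complex \<Rightarrow> complex" and S :: "complex set"
  assumes S: "S \<in> sets borel" and gS: "g ` S \<in> sets borel" and inj: "inj_on g S"
    and der: "\<And>z. z \<in> S \<Longrightarrow> (g has_derivative (\<lambda>h. \<alpha> z * h + \<beta> z * cnj h)) (at z)"
    and mf: "(\<lambda>z. indicator (g ` S) z *\<^sub>R f z) \<in> borel_measurable borel"
    and mg: "(\<lambda>z. indicator S z *\<^sub>R (\<bar>(cmod (\<alpha> z))\<^sup>2 - (cmod (\<beta> z))\<^sup>2\<bar> *\<^sub>R f (g z))) \<in> borel_measurable borel"
  shows "set_integrable lborel (g ` S) f \<longleftrightarrow>
           set_integrable lborel S (\<lambda>z. \<bar>(cmod (\<alpha> z))\<^sup>2 - (cmod (\<beta> z))\<^sup>2\<bar> *\<^sub>R f (g z))" (is "?A \<longleftrightarrow> ?B")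
    and "set_integrable lborel (g ` S) f \<Longrightarrow> set_lebesgue_integral lborel (g ` S) f =
           set_lebesgue_integral lborel S (\<lambda>z. \<bar>(cmod (\<alpha> z))\<^sup>2 - (cmod (\<beta> z))\<^sup>2\<bar> *\<^sub>R f (g z))"
proof -
  define J where "J = (\<lambda>z. \<bar>(cmod (\<alpha> z))\<^sup>2 - (cmod (\<beta> z))\<^sup>2\<bar>)"
  define S' where "S' = of_plane -` S"
  define g' where "g' = (\<lambda>v. plane_of (g (of_plane v)))"
  define f' where "f' = (\<lambda>v. plane_of (f (of_plane v)))"
  define D where "D = (\<lambda>v h. plane_of (\<alpha> (of_plane v) * of_plane h + \<beta> (of_plane v) * cnj (of_plane h)))"
  have S': "S' \<in> sets lebesgue"
    unfolding S'_def using measurable_sets[OF of_plane_measurable S] by simp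
  have inj': "inj_on g' S'"
  proof (rule inj_onI)
    fix u v assume "u \<in> S'" "v \<in> S'" "g' u = g' v"
    then have "of_plane u = of_plane v" using inj_onD[OF inj, of "of_plane u" "of_plane v"]
      by (metis S'_def g'_def of_plane_plane_of vimageE)
    then show "u = v" by (metis plane_of_of_plane)
  qed
  have im: "g' ` S' = of_plane -` (g ` S)"
  proof (rule subset_antisym; rule subsetI)
    fix v assume "v \<in> g' ` S'" then show "v \<in> of_plane -` (g ` S)" by (auto simp: g'_def S'_def)
  next
    fix v assume "v \<in> of_plane -` (g ` S)"
    then obtain z where "z \<in> S" "of_plane v = g z" by auto
    then have "plane_of z \<in> S'" "g' (plane_of z) = v" by (auto simp: S'_def g'_def) (metis plane_of_of_plane)
    then show "v \<in> g' ` S'" by blast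
  qed
  have der': "(g' has_derivative D v) (at v within S')" if "v \<in> S'" for v
  proof -
    have "(of_plane has_derivative of_plane) (at v)" by (rule bounded_linear_imp_has_derivative[OF bounded_linear_of_plane])
    from has_derivative_compose[OF this der[of "of_plane v"]] that
    have "((\<lambda>v. g (of_plane v)) has_derivative (\<lambda>h. \<alpha> (of_plane v) * of_plane h + \<beta> (of_plane v) * cnj (of_plane h))) (at v)"
      by (simp add: S'_def)
    from bounded_linear.has_derivative[OF bounded_linear_plane_of this]
    show ?thesis unfolding g'_def D_def by (rule has_derivative_at_withinI)
  qed
  \<comment> \<open>The columns of the matrix are the images of \<open>1\<close> and
    \<open>\<i>\<close>, that is \<open>\<alpha> + \<beta>\<close> and
    \<open>\<i> * (\<alpha> - \<beta>)\<close>.\<close>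
  have det: "\<bar>det (matrix (D v))\<bar> = J (of_plane v)" for v
  proof -
    have "matrix (D v) $ i $ j = D v (axis j 1) $ i" for i j by (simp add: matrix_def)
    then have "det (matrix (D v)) = D v (axis 1 1) $ 1 * D v (axis 2 1) $ 2 - D v (axis 2 1) $ 1 * D v (axis 1 1) $ 2"
      by (simp add: det_2)
    also have "\<dots> = (cmod (\<alpha> (of_plane v)))\<^sup>2 - (cmod (\<beta> (of_plane v)))\<^sup>2"
      by (simp add: D_def plane_of_def of_plane_def axis_def cmod_power2) (simp add: power2_eq_square algebra_simps)
    finally show ?thesis by (simp add: J_def)
  qed
  have A: "set_integrable lborel (g ` S) f \<longleftrightarrow> f' absolutely_integrable_on (g' ` S')"
  proof -
    have "plane_of (indicator (g ` S) (of_plane v) *\<^sub>R f (of_plane v)) = indicator (g' ` S') v *\<^sub>R f' v" for v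
      unfolding im f'_def by (simp add: plane_of_scaleR indicator_def)
    then show ?thesis unfolding set_integrable_def lborel_plane_transfer(1)[OF mf] by simp
  qed
  have A': "set_lebesgue_integral lborel (g ` S) f = of_plane (integral (g' ` S') f')" if "?A"
  proof -
    have "plane_of (indicator (g ` S) (of_plane v) *\<^sub>R f (of_plane v)) = indicator (g' ` S') v *\<^sub>R f' v" for v
      unfolding im f'_def by (simp add: plane_of_scaleR indicator_def)
    then have "set_lebesgue_integral lborel (g ` S) f = of_plane (set_lebesgue_integral lebesgue (g' ` S') f')"
      using that lborel_plane_transfer(2)[OF mf] unfolding set_integrable_def set_lebesgue_integral_def by simp
    then show ?thesis using A that by (simp add: set_lebesgue_integral_eq_integral(2))
  qed
  have e: "plane_of (indicator S (of_plane v) *\<^sub>R (J (of_plane v) *\<^sub>R f (g (of_plane v)))) = indicator S' v *\<^sub>R (\<bar>det (matrix (D v))\<bar> *\<^sub>R f' (g' v))" for v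
    unfolding det f'_def S'_def g'_def by (simp add: plane_of_scaleR indicator_def)
  have B: "?B \<longleftrightarrow> (\<lambda>v. \<bar>det (matrix (D v))\<bar> *\<^sub>R f' (g' v)) absolutely_integrable_on S'"
    unfolding set_integrable_def lborel_plane_transfer(1)[OF mg] e[unfolded J_def] ..
  have B': "set_lebesgue_integral lborel S (\<lambda>z. J z *\<^sub>R f (g z)) = of_plane (integral S' (\<lambda>v. \<bar>det (matrix (D v))\<bar> *\<^sub>R f' (g' v)))" if ?B
  proof -
    have "set_lebesgue_integral lborel S (\<lambda>z. J z *\<^sub>R f (g z)) = of_plane (set_lebesgue_integral lebesgue S' (\<lambda>v. \<bar>det (matrix (D v))\<bar> *\<^sub>R f' (g' v)))"
      using that lborel_plane_transfer(2)[OF mg] unfolding set_integrable_def set_lebesgue_integral_def e[unfolded J_def] J_def by simp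
    then show ?thesis using B that by (simp add: set_lebesgue_integral_eq_integral(2))
  qed
  note cov = has_absolute_integral_change_of_variables[OF S' der' inj', of f']
  show AB: "?A \<longleftrightarrow> ?B" unfolding A B using cov by blast
  assume a: ?A
  then have "integral S' (\<lambda>v. \<bar>det (matrix (D v))\<bar> *\<^sub>R f' (g' v)) = integral (g' ` S') f'"
    using cov A by blast
  then show "set_lebesgue_integral lborel (g ` S) f =
           set_lebesgue_integral lborel S (\<lambda>z. \<bar>(cmod (\<alpha> z))\<^sup>2 - (cmod (\<beta> z))\<^sup>2\<bar> *\<^sub>R f (g z))"
    using A'[OF a] B' a AB by (simp add: J_def)
qed

lemma null_sets_real_axis: "{z. Im z = 0} \<in> null_sets lborel"
proof -
  have "negligible {z::complex. \<i> \<bullet> z = 0}" by (rule negligible_hyperplane) simp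
  then have "{z::complex. Im z = 0} \<in> null_sets lebesgue" by (simp add: negligible_iff_null_sets inner_complex_def)
  moreover have "{z::complex. Im z = 0} \<in> sets lborel"
    by (simp add: closed_Collect_eq continuous_on_Im borel_closed)
  ultimately show ?thesis by (simp add: null_sets_completion_iff)
qed

text \<open>The squaring map on the right half disc has Jacobian \<open>4 * (cmod z)^2\<close>,
  which cancels the singularity: the pulled back integrand is the constant 4. The image covers the
  disc up to a part of the real axis, a null set.\<close>

lemma integrable_inverse_norm_unit: "set_integrable lborel (ball 0 1) (\<lambda>z. complex_of_real (1 / cmod z))"
proof -
  define S where "S = {z::complex. 0 < Re z} \<inter> ball 0 1"
  define g where "g = (\<lambda>z::complex. z\<^sup>2)"
  let ?f = "\<lambda>z. complex_of_real (1 / cmod z)"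
  have opS: "open S" unfolding S_def by (intro open_Int open_halfspace_Re_gt open_ball)
  then have S: "S \<in> sets borel" by simp
  have inj: "inj_on g S"
    by (rule inj_onI) (auto simp: g_def S_def power2_eq_iff)
  have "open (g ` S)"
  proof (rule open_mapping_thm3[OF _ opS inj])
    show "g holomorphic_on S" unfolding g_def by (intro holomorphic_intros)
  qed
  then have gS: "g ` S \<in> sets borel" by simp
  have fm: "?f \<in> borel_measurable borel" by measurable
  have "set_integrable lborel (g ` S) ?f \<longleftrightarrow> set_integrable lborel S (\<lambda>z. \<bar>(cmod (2 * z))\<^sup>2 - (cmod 0)\<^sup>2\<bar> *\<^sub>R ?f (g z))"
  proof (rule change_of_variables_complex(1)[OF S gS inj])
    show "(g has_derivative (\<lambda>h. 2 * z * h + 0 * cnj h)) (at z)" for z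
      unfolding g_def by (auto intro!: derivative_eq_intros simp: algebra_simps)
    show "(\<lambda>z. indicator (g ` S) z *\<^sub>R ?f z) \<in> borel_measurable borel" using gS fm by measurable
    show "(\<lambda>z. indicator S z *\<^sub>R (\<bar>(cmod (2 * z))\<^sup>2 - (cmod 0)\<^sup>2\<bar> *\<^sub>R ?f (g z))) \<in> borel_measurable borel"
      using S unfolding g_def by measurable
  qed
  moreover have "set_integrable lborel S (\<lambda>z. \<bar>(cmod (2 * z))\<^sup>2 - (cmod 0)\<^sup>2\<bar> *\<^sub>R ?f (g z))"
  proof -
    have "emeasure lborel S < \<infinity>" unfolding S_def using emeasure_bounded_finite[of "{z::complex. 0 < Re z} \<inter> ball 0 1"]
      by (auto intro: bounded_Int)
    then have "set_integrable lborel S (\<lambda>z. 4 :: complex)" using S by (simp add: set_integrable_def)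
    moreover have "(\<lambda>z. indicator S z *\<^sub>R (4::complex)) = (\<lambda>z. indicator S z *\<^sub>R (\<bar>(cmod (2 * z))\<^sup>2 - (cmod 0)\<^sup>2\<bar> *\<^sub>R ?f (g z)))"
    proof
      fix z show "indicator S z *\<^sub>R (4::complex) = indicator S z *\<^sub>R (\<bar>(cmod (2 * z))\<^sup>2 - (cmod 0)\<^sup>2\<bar> *\<^sub>R ?f (g z))"
      proof (cases "z \<in> S")
        case True
        then have "cmod z \<noteq> 0" by (auto simp: S_def)
        then show ?thesis using True by (simp add: g_def norm_mult norm_power power_mult_distrib scaleR_conv_of_real)
      qed simp
    qed
    ultimately show ?thesis unfolding set_integrable_def by simp
  qed
  ultimately have i: "set_integrable lborel (g ` S) ?f" by simp
  have sub: "g ` S \<subseteq> ball 0 1"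
    by (auto simp: g_def S_def norm_power power_less_one_iff abs_square_less_1)
  have cover: "z \<in> g ` S" if "z \<in> ball 0 1" "Im z \<noteq> 0" for z
  proof
    show "z = g (csqrt z)" by (simp add: g_def)
    have "Re (csqrt z) \<noteq> 0"
    proof
      assume "Re (csqrt z) = 0"
      then have "Im ((csqrt z)\<^sup>2) = 0" by (simp add: power2_eq_square)
      then show False using that by simp
    qed
    then have "Re (csqrt z) > 0" using csqrt_principal[of z] by auto
    moreover have "cmod (csqrt z) < 1" using that by simp
    ultimately show "csqrt z \<in> S" by (simp add: S_def)
  qed
  have "integrable lborel (\<lambda>z. indicator (g ` S) z *\<^sub>R ?f z) \<longleftrightarrow> integrable lborel (\<lambda>z. indicator (ball 0 1) z *\<^sub>R ?f z)"
  proof (rule integrable_cong_AE)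
    show "(\<lambda>z. indicator (g ` S) z *\<^sub>R ?f z) \<in> borel_measurable lborel" using gS fm by measurable
    show "(\<lambda>z. indicator (ball 0 1) z *\<^sub>R ?f z) \<in> borel_measurable lborel"
      using fm by (intro borel_measurable_scaleR borel_measurable_indicator) auto
    have "AE z in lborel. z \<notin> {z. Im z = 0}" by (rule AE_not_in[OF null_sets_real_axis])
    then show "AE z in lborel. indicator (g ` S) z *\<^sub>R ?f z = indicator (ball 0 1) z *\<^sub>R ?f z"
      by eventually_elim (use sub cover in \<open>auto simp: indicator_def\<close>)
  qed
  then show ?thesis using i by (simp add: set_integrable_def)
qed

lemma integrable_inverse_norm:
  fixes c :: complex and \<rho> :: real
  assumes "\<rho> > 0"
  shows "set_integrable lborel (ball c \<rho>) (\<lambda>z. 1 / cmod (z - c))"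
proof -
  define g where "g = (\<lambda>z. c + of_real \<rho> * z)"
  let ?f = "\<lambda>z. complex_of_real (1 / cmod (z - c))"
  have im: "g ` ball 0 1 = ball c \<rho>"
  proof (rule subset_antisym; rule subsetI)
    fix z assume "z \<in> g ` ball 0 1" then show "z \<in> ball c \<rho>" using assms by (auto simp: g_def dist_norm norm_mult)
  next
    fix z assume "z \<in> ball c \<rho>"
    then have "(z - c) / of_real \<rho> \<in> ball 0 1" using assms by (simp add: norm_divide dist_norm norm_minus_commute)
    moreover have "z = g ((z - c) / of_real \<rho>)" using assms by (simp add: g_def)
    ultimately show "z \<in> g ` ball 0 1" by blast
  qed
  have fm: "?f \<in> borel_measurable borel" by measurable
  have "set_integrable lborel (g ` ball 0 1) ?f \<longleftrightarrow> set_integrable lborel (ball 0 1) (\<lambda>z. \<bar>(cmod (of_real \<rho>))\<^sup>2 - (cmod 0)\<^sup>2\<bar> *\<^sub>R ?f (g z))"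
  proof (rule change_of_variables_complex(1))
    show "inj_on g (ball 0 1)" using assms by (auto simp: g_def inj_on_def)
    show "(g has_derivative (\<lambda>h. of_real \<rho> * h + 0 * cnj h)) (at z)" for z
      unfolding g_def by (auto intro!: derivative_eq_intros simp: algebra_simps)
    show "(\<lambda>z. indicator (g ` ball 0 1) z *\<^sub>R ?f z) \<in> borel_measurable borel" unfolding im
      using fm by (intro borel_measurable_scaleR borel_measurable_indicator) auto
    show "(\<lambda>z. indicator (ball 0 1) z *\<^sub>R (\<bar>(cmod (of_real \<rho>))\<^sup>2 - (cmod 0)\<^sup>2\<bar> *\<^sub>R ?f (g z))) \<in> borel_measurable borel"
      unfolding g_def by (intro borel_measurable_scaleR borel_measurable_indicator) auto
  qed (simp_all add: im)
  also have "(\<lambda>z. \<bar>(cmod (of_real \<rho>))\<^sup>2 - (cmod 0)\<^sup>2\<bar> *\<^sub>R ?f (g z)) = (\<lambda>z. \<rho> *\<^sub>R complex_of_real (1 / cmod z))"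
    using assms by (auto simp: g_def norm_mult power2_eq_square scaleR_conv_of_real fun_eq_iff divide_simps)
  finally have "set_integrable lborel (ball c \<rho>) ?f"
    using integrable_inverse_norm_unit unfolding im by simp
  then have "integrable lborel (\<lambda>z. complex_of_real (indicator (ball c \<rho>) z *\<^sub>R (1 / cmod (z - c))))"
    unfolding set_integrable_def by (simp add: scaleR_conv_of_real)
  then show ?thesis unfolding set_integrable_def complex_of_real_integrable_eq .
qed

section \<open>Charts, densities and integrals on a compact Riemann surface\<close>

lemma borel_preimage_on:
  assumes "continuous_on D g" "open D" "V \<in> sets borel"
  shows "{z \<in> D. g z \<in> V} \<in> sets borel"
proof -
  have "g \<in> borel_measurable (restrict_space borel D)"
    by (rule borel_measurable_continuous_on_restrict[OF assms(1)])
  from measurable_sets[OF this assms(3)] have "g -` V \<inter> D \<in> sets (restrict_space borel D)"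
    by (simp add: space_restrict_space)
  then have "g -` V \<inter> D \<in> sets borel" using assms(2) by (simp add: sets_restrict_space_iff)
  moreover have "g -` V \<inter> D = {z \<in> D. g z \<in> V}" by auto
  ultimately show ?thesis by simp
qed

text \<open>Each set is reduced by those already placed. The members of \<open>Z\<close> come first
  and are disjoint, so they lose nothing; later this keeps the discs about zeros whole.\<close>

lemma disjointify:
  fixes D :: "'i \<Rightarrow> 'a set"
  assumes "finite R" "finite Z" "disjoint_family_on D Z"
  shows "\<exists>Q. (\<forall>p\<in>Z. Q p = {}) \<and> (\<forall>p\<in>Z \<union> R. Q p \<subseteq> Z \<union> R) \<and> disjoint_family_on (\<lambda>p. D p - \<Union>(D ` Q p)) (Z \<union> R) \<and>
     (\<Union>p\<in>Z \<union> R. D p - \<Union>(D ` Q p)) = \<Union>(D ` (Z \<union> R))"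
  using assms(1)
proof (induction rule: finite_induct)
  case empty
  show ?case using assms(3) by (intro exI[of _ "\<lambda>_. {}"]) auto
next
  case (insert r R)
  then obtain Q where Q0: "(\<forall>p\<in>Z. Q p = {}) \<and> (\<forall>p\<in>Z \<union> R. Q p \<subseteq> Z \<union> R) \<and> disjoint_family_on (\<lambda>p. D p - \<Union>(D ` Q p)) (Z \<union> R) \<and>
     (\<Union>p\<in>Z \<union> R. D p - \<Union>(D ` Q p)) = \<Union>(D ` (Z \<union> R))" by (elim exE)
  note Q = Q0[THEN conjunct1] Q0[THEN conjunct2, THEN conjunct1]
    Q0[THEN conjunct2, THEN conjunct2, THEN conjunct1] Q0[THEN conjunct2, THEN conjunct2, THEN conjunct2]
  show ?case
  proof (cases "r \<in> Z")
    case True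
    then have e: "Z \<union> insert r R = Z \<union> R" by auto
    show ?thesis unfolding e by (rule exI[of _ Q], rule Q0)
  next
    case False
    define Q' where "Q' = Q(r := Z \<union> R)"
    have old: "Q' p = Q p" if "p \<in> Z \<union> R" for p using that False insert.hyps by (auto simp: Q'_def)
    have new: "Q' r = Z \<union> R" by (simp add: Q'_def)
    have uni: "(\<Union>p\<in>Z \<union> R. D p - \<Union>(D ` Q' p)) = \<Union>(D ` (Z \<union> R))"
      unfolding Q(4)[symmetric] using old by (intro SUP_cong) auto
    have ins: "Z \<union> insert r R = insert r (Z \<union> R)" by auto
    show ?thesis
    proof (intro exI[of _ Q'] conjI)
      show "\<forall>p\<in>Z. Q' p = {}" using Q(1) old by auto
      show "\<forall>p\<in>Z \<union> insert r R. Q' p \<subseteq> Z \<union> insert r R" using Q(2) old new by auto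
      show "(\<Union>p\<in>Z \<union> insert r R. D p - \<Union>(D ` Q' p)) = \<Union>(D ` (Z \<union> insert r R))"
        unfolding ins UN_insert uni using new by auto
      show "disjoint_family_on (\<lambda>p. D p - \<Union>(D ` Q' p)) (Z \<union> insert r R)"
        unfolding ins disjoint_family_on_def
      proof (intro ballI impI)
        fix p q assume pq: "p \<in> insert r (Z \<union> R)" "q \<in> insert r (Z \<union> R)" "p \<noteq> q"
        consider "p \<in> Z \<union> R" "q \<in> Z \<union> R" | "p = r" "q \<in> Z \<union> R" | "p \<in> Z \<union> R" "q = r" using pq by auto
        then show "(D p - \<Union>(D ` Q' p)) \<inter> (D q - \<Union>(D ` Q' q)) = {}"
        proof cases
          case 1 then show ?thesis using Q(3) pq old unfolding disjoint_family_on_def by auto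
        next
          case 2 then show ?thesis using new by auto
        next
          case 3 then show ?thesis using new by auto
        qed
      qed
    qed
  qed
qed

locale riemann_surface =
  fixes X :: "'a topology" and A :: "'a chart set"
  assumes surface: "compact_riemann_surface X A"
begin

lemma atlas: "complex_atlas X A" and hausdorff: "Hausdorff_space X" and compact_X: "compact_space X"
  and connected_X: "connected_space X"
  using surface by (auto simp: compact_riemann_surface_def)

abbreviation dom :: "'a chart \<Rightarrow> 'a set" where "dom c \<equiv> fst c"
abbreviation im :: "'a chart \<Rightarrow> complex set" where "im c \<equiv> snd c ` fst c"

lemma openin_dom: "c \<in> A \<Longrightarrow> openin X (dom c)"
  and open_im: "c \<in> A \<Longrightarrow> open (im c)"
  and homeo: "c \<in> A \<Longrightarrow> homeomorphic_map (subtopology X (dom c)) (top_of_set (im c)) (snd c)"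
  using atlas by (auto simp: complex_atlas_def)

lemma dom_subset: "c \<in> A \<Longrightarrow> dom c \<subseteq> topspace X"
  using openin_dom openin_subset by blast

lemma chart_at: "p \<in> topspace X \<Longrightarrow> \<exists>c\<in>A. p \<in> dom c"
  using atlas by (auto simp: complex_atlas_def)

lemma chart_inj:
  assumes "c \<in> A" shows "inj_on (snd c) (dom c)"
proof -
  have "topspace X \<inter> dom c = dom c" using dom_subset[OF assms] by auto
  then show ?thesis using homeomorphic_imp_injective_map[OF homeo[OF assms]] by simp
qed

lemma param_coord [simp]: "c \<in> A \<Longrightarrow> p \<in> dom c \<Longrightarrow> chart_param c (snd c p) = p"
  unfolding chart_param_def using chart_inj by (simp add: inv_into_f_f)

lemma param_in [simp]: "z \<in> im c \<Longrightarrow> chart_param c z \<in> dom c"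
  unfolding chart_param_def by (rule inv_into_into)

lemma coord_param [simp]: "z \<in> im c \<Longrightarrow> snd c (chart_param c z) = z"
  unfolding chart_param_def by (rule f_inv_into_f)

lemma open_coord:
  assumes c: "c \<in> A" and U: "openin X U"
  shows "open (snd c ` (U \<inter> dom c))"
proof -
  have "openin (subtopology X (dom c)) (U \<inter> dom c)" using U by (auto simp: openin_subtopology)
  then have "openin (top_of_set (im c)) (snd c ` (U \<inter> dom c))"
    using homeomorphic_imp_open_map[OF homeo[OF c]] by (auto simp: open_map_def)
  then show ?thesis using open_im[OF c] openin_open_trans by blast
qed

lemma openin_param:
  assumes c: "c \<in> A" and V: "open V" "V \<subseteq> im c"
  shows "openin X (chart_param c ` V)"
proof -
  have "continuous_map (subtopology X (dom c)) (top_of_set (im c)) (snd c)"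
    by (rule homeomorphic_imp_continuous_map[OF homeo[OF c]])
  moreover have "openin (top_of_set (im c)) V" using V by (simp add: open_subset)
  ultimately have "openin (subtopology X (dom c)) {p \<in> topspace (subtopology X (dom c)). snd c p \<in> V}"
    by (rule openin_continuous_map_preimage)
  then have "openin X {p \<in> topspace (subtopology X (dom c)). snd c p \<in> V}"
    using openin_dom[OF c] openin_trans_full by blast
  moreover have "{p \<in> topspace (subtopology X (dom c)). snd c p \<in> V} = chart_param c ` V"
  proof (rule subset_antisym; rule subsetI)
    fix p assume "p \<in> {p \<in> topspace (subtopology X (dom c)). snd c p \<in> V}"
    then show "p \<in> chart_param c ` V" using c by (intro image_eqI[of _ _ "snd c p"]) auto
  next
    fix p assume "p \<in> chart_param c ` V"
    then obtain z where z: "z \<in> V" "p = chart_param c z" by auto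
    then have "z \<in> im c" using V by blast
    then have "p \<in> dom c" "snd c p = z" using param_in[of z c] coord_param[of z c] z by simp_all
    then show "p \<in> {p \<in> topspace (subtopology X (dom c)). snd c p \<in> V}"
      using dom_subset[OF c] z by auto
  qed
  ultimately show ?thesis by simp
qed

section \<open>Transition maps and the transformation of densities\<close>

definition tr :: "'a chart \<Rightarrow> 'a chart \<Rightarrow> complex \<Rightarrow> complex" where "tr c d = snd d \<circ> chart_param c"

definition overlap :: "'a chart \<Rightarrow> 'a chart \<Rightarrow> complex set" where "overlap c d = snd c ` (dom c \<inter> dom d)"

lemma overlap_iff: "c \<in> A \<Longrightarrow> z \<in> overlap c d \<longleftrightarrow> z \<in> im c \<and> chart_param c z \<in> dom d"
  unfolding overlap_def by (auto intro!: image_eqI[of _ "snd c" "chart_param c z"])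

lemma open_overlap: "c \<in> A \<Longrightarrow> d \<in> A \<Longrightarrow> open (overlap c d)"
  using open_coord[OF _ openin_dom, of c d] by (simp add: overlap_def Int_commute)

lemma tr_holomorphic: "c \<in> A \<Longrightarrow> d \<in> A \<Longrightarrow> tr c d holomorphic_on overlap c d"
  using atlas by (auto simp: complex_atlas_def tr_def overlap_def)

lemma tr_in: "c \<in> A \<Longrightarrow> d \<in> A \<Longrightarrow> z \<in> overlap c d \<Longrightarrow> tr c d z \<in> im d \<and> chart_param d (tr c d z) = chart_param c z"
  by (auto simp: overlap_iff tr_def)

lemma tr_inj: "c \<in> A \<Longrightarrow> d \<in> A \<Longrightarrow> inj_on (tr c d) (overlap c d)"
proof (rule inj_onI)
  fix y z assume "c \<in> A" "d \<in> A" "y \<in> overlap c d" "z \<in> overlap c d" "tr c d y = tr c d z"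
  then have "chart_param c y = chart_param c z" using tr_in by metis
  then show "y = z" using \<open>y \<in> overlap c d\<close> \<open>z \<in> overlap c d\<close> \<open>c \<in> A\<close> by (metis coord_param overlap_iff)
qed

definition density :: "('a chart \<Rightarrow> 'a \<Rightarrow> complex) \<Rightarrow> bool" where
  "density f \<longleftrightarrow> (\<forall>c\<in>A. \<forall>d\<in>A. \<forall>p\<in>dom c \<inter> dom d. f c p = of_real ((cmod (deriv (tr c d) (snd c p)))\<^sup>2) * f d p) \<and>
     (\<forall>c\<in>A. (\<lambda>z. indicator (im c) z *\<^sub>R f c (chart_param c z)) \<in> borel_measurable borel)"

lemma density_eq:
  "density f \<Longrightarrow> c \<in> A \<Longrightarrow> d \<in> A \<Longrightarrow> p \<in> dom c \<inter> dom d \<Longrightarrow> f c p = of_real ((cmod (deriv (tr c d) (snd c p)))\<^sup>2) * f d p"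
  unfolding density_def by blast

lemma density_measurable_on:
  assumes "density f" "c \<in> A" "W \<in> sets borel" "W \<subseteq> im c"
  shows "(\<lambda>z. indicator W z *\<^sub>R f c (chart_param c z)) \<in> borel_measurable borel"
proof -
  have "(\<lambda>z. indicator W z *\<^sub>R (indicator (im c) z *\<^sub>R f c (chart_param c z))) \<in> borel_measurable borel"
    by (rule borel_measurable_scaleR) (use assms in \<open>auto simp: density_def\<close>)
  also have "(\<lambda>z. indicator W z *\<^sub>R (indicator (im c) z *\<^sub>R f c (chart_param c z))) = (\<lambda>z. indicator W z *\<^sub>R f c (chart_param c z))"
    using assms(4) by (auto simp: indicator_def fun_eq_iff)
  finally show ?thesis .
qed

text \<open>A transition map is holomorphic, so \<beta> = 0 in the change of variables and the
  Jacobian is exactly the factor in the transformation law of densities.\<close>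

lemma density_transfer:
  assumes f: "density f" and c: "c \<in> A" and d: "d \<in> A" and V: "V \<in> sets borel" "V \<subseteq> overlap c d"
    and V': "tr c d ` V \<in> sets borel"
  shows "set_integrable lborel V (\<lambda>z. f c (chart_param c z)) \<longleftrightarrow> set_integrable lborel (tr c d ` V) (\<lambda>z. f d (chart_param d z))"
    and "set_integrable lborel V (\<lambda>z. f c (chart_param c z)) \<Longrightarrow>
      set_lebesgue_integral lborel V (\<lambda>z. f c (chart_param c z)) = set_lebesgue_integral lborel (tr c d ` V) (\<lambda>z. f d (chart_param d z))"
proof -
  let ?\<tau> = "tr c d"
  have sub: "?\<tau> ` V \<subseteq> im d" using tr_in[OF c d] V(2) by auto
  have subc: "V \<subseteq> im c" using V(2) c by (auto simp: overlap_iff)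
  have eq: "indicator V z *\<^sub>R (\<bar>(cmod (deriv ?\<tau> z))\<^sup>2 - (cmod 0)\<^sup>2\<bar> *\<^sub>R f d (chart_param d (?\<tau> z))) = indicator V z *\<^sub>R f c (chart_param c z)" for z
  proof (cases "z \<in> V")
    case True
    then have z: "z \<in> overlap c d" using V by auto
    then have "chart_param c z \<in> dom d" "z \<in> im c" using overlap_iff[OF c, of z d] by blast+
    then have "chart_param c z \<in> dom c \<inter> dom d" using param_in[of z c] by blast
    then have "f c (chart_param c z) = of_real ((cmod (deriv ?\<tau> (snd c (chart_param c z))))\<^sup>2) * f d (chart_param c z)"
      using density_eq[OF f c d] by blast
    then show ?thesis using True tr_in[OF c d z] \<open>z \<in> im c\<close> by (simp add: scaleR_conv_of_real)
  qed simp
  have der: "(?\<tau> has_derivative (\<lambda>h. deriv ?\<tau> z * h + 0 * cnj h)) (at z)" if "z \<in> V" for z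
  proof -
    have "z \<in> overlap c d" using that V(2) by blast
    from holomorphic_derivI[OF tr_holomorphic[OF c d] open_overlap[OF c d] this]
    show ?thesis by (simp add: has_field_derivative_def)
  qed
  have inj: "inj_on ?\<tau> V" using tr_inj[OF c d] V(2) inj_on_subset by blast
  have m1: "(\<lambda>z. indicator (?\<tau> ` V) z *\<^sub>R f d (chart_param d z)) \<in> borel_measurable borel"
    by (rule density_measurable_on[OF f d V' sub])
  have m2: "(\<lambda>z. indicator V z *\<^sub>R (\<bar>(cmod (deriv ?\<tau> z))\<^sup>2 - (cmod 0)\<^sup>2\<bar> *\<^sub>R f d (chart_param d (?\<tau> z)))) \<in> borel_measurable borel"
    unfolding eq by (rule density_measurable_on[OF f c V(1) subc])
  note cov = change_of_variables_complex[OF V(1) V' inj der m1 m2]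
  show iff: "set_integrable lborel V (\<lambda>z. f c (chart_param c z)) \<longleftrightarrow> set_integrable lborel (tr c d ` V) (\<lambda>z. f d (chart_param d z))"
    using cov(1) unfolding set_integrable_def eq by simp
  assume "set_integrable lborel V (\<lambda>z. f c (chart_param c z))"
  then show "set_lebesgue_integral lborel V (\<lambda>z. f c (chart_param c z)) = set_lebesgue_integral lborel (tr c d ` V) (\<lambda>z. f d (chart_param d z))"
    using cov(2) iff unfolding set_lebesgue_integral_def eq by simp
qed

text \<open>Like \<open>chart_partition\<close>, but with an arbitrary index set, so that one chart
  may carry several pieces, and with the pieces given in coordinates.\<close>

definition pieces :: "'i set \<Rightarrow> ('i \<Rightarrow> 'a chart) \<Rightarrow> ('i \<Rightarrow> complex set) \<Rightarrow> bool" where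
  "pieces I \<gamma> W \<longleftrightarrow> finite I \<and> (\<forall>i\<in>I. \<gamma> i \<in> A \<and> W i \<in> sets borel \<and> W i \<subseteq> im (\<gamma> i)) \<and>
     disjoint_family_on (\<lambda>i. chart_param (\<gamma> i) ` W i) I \<and> (\<Union>i\<in>I. chart_param (\<gamma> i) ` W i) = topspace X"

text \<open>\<open>W\<close> is cut along the pieces of \<open>J\<close> and each part is moved to
  the chart of its piece. Integrability over \<open>W\<close> thus follows from integrability over
  the pieces.\<close>

lemma pieces_split:
  assumes J: "pieces J \<delta> V" and f: "density f" and c: "c \<in> A" and W: "W \<in> sets borel" "W \<subseteq> im c"
    and int: "\<And>j. j \<in> J \<Longrightarrow> set_integrable lborel (V j) (\<lambda>z. f (\<delta> j) (chart_param (\<delta> j) z))"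
  shows "set_integrable lborel W (\<lambda>z. f c (chart_param c z))"
    and "set_lebesgue_integral lborel W (\<lambda>z. f c (chart_param c z)) =
       (\<Sum>j\<in>J. set_lebesgue_integral lborel {w \<in> V j. chart_param (\<delta> j) w \<in> chart_param c ` W} (\<lambda>z. f (\<delta> j) (chart_param (\<delta> j) z)))"
    and "\<And>j. j \<in> J \<Longrightarrow> {w \<in> V j. chart_param (\<delta> j) w \<in> chart_param c ` W} \<in> sets borel"
proof -
  define Wj where "Wj j = {z \<in> W. chart_param c z \<in> chart_param (\<delta> j) ` V j}" for j
  define Vj where "Vj j = {w \<in> V j. chart_param (\<delta> j) w \<in> chart_param c ` W}" for j
  have fin: "finite J" and J': "\<And>j. j \<in> J \<Longrightarrow> \<delta> j \<in> A \<and> V j \<in> sets borel \<and> V j \<subseteq> im (\<delta> j)"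
    and disj: "disjoint_family_on (\<lambda>i. chart_param (\<delta> i) ` V i) J" and cov: "(\<Union>i\<in>J. chart_param (\<delta> i) ` V i) = topspace X"
    using J by (auto simp: pieces_def)
  have Wj_sub: "Wj j \<subseteq> overlap c (\<delta> j)" if "j \<in> J" for j
    using J'[OF that] W c by (auto simp: Wj_def overlap_iff subset_iff)
  \<comment> \<open>This form exhibits the part as a preimage under a transition map, hence as a
    Borel set.\<close>
  have Wj_eq: "Wj j = W \<inter> {z \<in> overlap c (\<delta> j). tr c (\<delta> j) z \<in> V j}" if "j \<in> J" for j
  proof (rule subset_antisym; rule subsetI)
    fix z assume z: "z \<in> Wj j"
    then obtain v where v: "v \<in> V j" "chart_param c z = chart_param (\<delta> j) v" "z \<in> W" by (auto simp: Wj_def)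
    then have "tr c (\<delta> j) z = v" using J'[OF that] by (auto simp: tr_def)
    then show "z \<in> W \<inter> {z \<in> overlap c (\<delta> j). tr c (\<delta> j) z \<in> V j}" using v Wj_sub[OF that] z by auto
  next
    fix z assume z: "z \<in> W \<inter> {z \<in> overlap c (\<delta> j). tr c (\<delta> j) z \<in> V j}"
    then have e: "chart_param c z = chart_param (\<delta> j) (tr c (\<delta> j) z)" using tr_in[OF c, of "\<delta> j" z] J'[OF that] by simp
    show "z \<in> Wj j" unfolding Wj_def using z image_eqI[where f="chart_param (\<delta> j)", OF e] by blast
  qed
  have Wj_sets: "Wj j \<in> sets borel" if "j \<in> J" for j
    unfolding Wj_eq[OF that]
    by (intro sets.Int W(1) borel_preimage_on holomorphic_on_imp_continuous_on tr_holomorphic open_overlap c) (use J'[OF that] in auto)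
  have Vj_sub: "Vj j \<subseteq> overlap (\<delta> j) c" if "j \<in> J" for j
    using J'[OF that] W c by (auto simp: Vj_def overlap_iff subset_iff)
  have Vj_eq: "Vj j = V j \<inter> {z \<in> overlap (\<delta> j) c. tr (\<delta> j) c z \<in> W}" if "j \<in> J" for j
  proof (rule subset_antisym; rule subsetI)
    fix z assume z: "z \<in> Vj j"
    then obtain v where v: "v \<in> W" "chart_param (\<delta> j) z = chart_param c v" "z \<in> V j" by (auto simp: Vj_def)
    then have "tr (\<delta> j) c z = v" using W by (auto simp: tr_def)
    then show "z \<in> V j \<inter> {z \<in> overlap (\<delta> j) c. tr (\<delta> j) c z \<in> W}" using v Vj_sub[OF that] z by auto
  next
    fix z assume z: "z \<in> V j \<inter> {z \<in> overlap (\<delta> j) c. tr (\<delta> j) c z \<in> W}"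
    then have e: "chart_param (\<delta> j) z = chart_param c (tr (\<delta> j) c z)" using tr_in[of "\<delta> j" c z] J'[OF that] c by simp
    show "z \<in> Vj j" unfolding Vj_def using z image_eqI[where f="chart_param c", OF e] by blast
  qed
  have Vj_sets: "Vj j \<in> sets borel" if "j \<in> J" for j
    unfolding Vj_eq[OF that]
    by (intro sets.Int borel_preimage_on holomorphic_on_imp_continuous_on tr_holomorphic open_overlap c W(1)) (use J'[OF that] in auto)
  then show "\<And>j. j \<in> J \<Longrightarrow> {w \<in> V j. chart_param (\<delta> j) w \<in> chart_param c ` W} \<in> sets borel" by (simp add: Vj_def)
  have img: "tr c (\<delta> j) ` Wj j = Vj j" if j: "j \<in> J" for j
  proof (rule subset_antisym; rule subsetI)
    fix v assume "v \<in> tr c (\<delta> j) ` Wj j"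
    then obtain z where z: "z \<in> Wj j" "v = tr c (\<delta> j) z" by auto
    then have "v \<in> V j" using Wj_eq[OF j] by auto
    moreover have "chart_param (\<delta> j) v = chart_param c z" using z Wj_sub[OF j] tr_in[OF c, of "\<delta> j" z] J'[OF j] by auto
    ultimately show "v \<in> Vj j" using z by (auto simp: Vj_def Wj_def)
  next
    fix v assume "v \<in> Vj j"
    then obtain z where z: "z \<in> W" "chart_param (\<delta> j) v = chart_param c z" "v \<in> V j" by (auto simp: Vj_def)
    then have "z \<in> Wj j" by (auto simp: Wj_def) (metis image_eqI)
    moreover have "tr c (\<delta> j) z = v" unfolding tr_def comp_def z(2)[symmetric] using z(3) J'[OF j] by auto
    ultimately show "v \<in> tr c (\<delta> j) ` Wj j" by auto
  qed
  have intV: "set_integrable lborel (Vj j) (\<lambda>z. f (\<delta> j) (chart_param (\<delta> j) z))" if "j \<in> J" for j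
    by (rule set_integrable_subset[OF int[OF that]]) (use Vj_sets[OF that] in \<open>auto simp: Vj_def\<close>)
  have tr1: "set_integrable lborel (Wj j) (\<lambda>z. f c (chart_param c z))" if "j \<in> J" for j
    using density_transfer(1)[OF f c _ Wj_sets[OF that] Wj_sub[OF that]] J'[OF that] Vj_sets[OF that] img[OF that] intV[OF that] by simp
  have tr2: "set_lebesgue_integral lborel (Wj j) (\<lambda>z. f c (chart_param c z)) = set_lebesgue_integral lborel (Vj j) (\<lambda>z. f (\<delta> j) (chart_param (\<delta> j) z))" if "j \<in> J" for j
    using density_transfer(2)[OF f c _ Wj_sets[OF that] Wj_sub[OF that] _ tr1[OF that]] J'[OF that] Vj_sets[OF that] img[OF that] by simp
  have WU: "W = (\<Union>j\<in>J. Wj j)"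
  proof (rule subset_antisym; rule subsetI)
    fix z assume z: "z \<in> W"
    then have "chart_param c z \<in> topspace X" using W dom_subset[OF c] param_in by blast
    then have "chart_param c z \<in> (\<Union>i\<in>J. chart_param (\<delta> i) ` V i)" by (simp only: cov)
    then show "z \<in> (\<Union>j\<in>J. Wj j)" using z unfolding Wj_def by blast
  qed (auto simp: Wj_def)
  have dW: "disjoint_family_on Wj J"
    using disj unfolding disjoint_family_on_def Wj_def by blast
  show "set_integrable lborel W (\<lambda>z. f c (chart_param c z))"
    unfolding WU by (rule set_integrable_UN[OF fin tr1]) (use Wj_sets in auto)
  have "set_lebesgue_integral lborel W (\<lambda>z. f c (chart_param c z)) = (\<Sum>j\<in>J. set_lebesgue_integral lborel (Wj j) (\<lambda>z. f c (chart_param c z)))"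
    unfolding WU by (rule set_integral_finite_Union[OF fin dW tr1]) (use Wj_sets in auto)
  then show "set_lebesgue_integral lborel W (\<lambda>z. f c (chart_param c z)) =
       (\<Sum>j\<in>J. set_lebesgue_integral lborel {w \<in> V j. chart_param (\<delta> j) w \<in> chart_param c ` W} (\<lambda>z. f (\<delta> j) (chart_param (\<delta> j) z)))"
    using tr2 by (simp add: Vj_def)
qed

text \<open>Both sums equal the double sum over the common refinement \<open>Vi\<close>.\<close>

lemma pieces_integral_eq:
  assumes I: "pieces I \<gamma> W" and J: "pieces J \<delta> V" and f: "density f"
    and int: "\<And>j. j \<in> J \<Longrightarrow> set_integrable lborel (V j) (\<lambda>z. f (\<delta> j) (chart_param (\<delta> j) z))"
  shows "(\<Sum>i\<in>I. set_lebesgue_integral lborel (W i) (\<lambda>z. f (\<gamma> i) (chart_param (\<gamma> i) z))) =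
    (\<Sum>j\<in>J. set_lebesgue_integral lborel (V j) (\<lambda>z. f (\<delta> j) (chart_param (\<delta> j) z)))"
proof -
  define Vi where "Vi i j = {w \<in> V j. chart_param (\<delta> j) w \<in> chart_param (\<gamma> i) ` W i}" for i j
  have finI: "finite I" and I': "\<And>i. i \<in> I \<Longrightarrow> \<gamma> i \<in> A \<and> W i \<in> sets borel \<and> W i \<subseteq> im (\<gamma> i)"
    and disj: "disjoint_family_on (\<lambda>i. chart_param (\<gamma> i) ` W i) I" and cov: "(\<Union>i\<in>I. chart_param (\<gamma> i) ` W i) = topspace X"
    using I by (auto simp: pieces_def)
  have J': "\<And>j. j \<in> J \<Longrightarrow> \<delta> j \<in> A \<and> V j \<in> sets borel \<and> V j \<subseteq> im (\<delta> j)" using J by (auto simp: pieces_def)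
  have sets: "Vi i j \<in> sets borel" if "i \<in> I" "j \<in> J" for i j
    unfolding Vi_def by (rule pieces_split(3)[OF J f _ _ _ int that(2)]) (use I'[OF that(1)] in auto)
  have "(\<Sum>i\<in>I. set_lebesgue_integral lborel (W i) (\<lambda>z. f (\<gamma> i) (chart_param (\<gamma> i) z))) =
     (\<Sum>i\<in>I. \<Sum>j\<in>J. set_lebesgue_integral lborel (Vi i j) (\<lambda>z. f (\<delta> j) (chart_param (\<delta> j) z)))"
    unfolding Vi_def by (intro sum.cong refl pieces_split(2)[OF J f _ _ _ int]) (use I' in auto)
  also have "\<dots> = (\<Sum>j\<in>J. \<Sum>i\<in>I. set_lebesgue_integral lborel (Vi i j) (\<lambda>z. f (\<delta> j) (chart_param (\<delta> j) z)))"
    by (rule sum.swap)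
  also have "\<dots> = (\<Sum>j\<in>J. set_lebesgue_integral lborel (V j) (\<lambda>z. f (\<delta> j) (chart_param (\<delta> j) z)))"
  proof (rule sum.cong[OF refl])
    fix j assume j: "j \<in> J"
    have U: "V j = (\<Union>i\<in>I. Vi i j)"
    proof (rule subset_antisym; rule subsetI)
      fix z assume z: "z \<in> V j"
      then have "chart_param (\<delta> j) z \<in> topspace X" using J'[OF j] dom_subset[of "\<delta> j"] param_in by blast
      then have "chart_param (\<delta> j) z \<in> (\<Union>i\<in>I. chart_param (\<gamma> i) ` W i)" by (simp only: cov)
      then show "z \<in> (\<Union>i\<in>I. Vi i j)" using z unfolding Vi_def by blast
    qed (auto simp: Vi_def)
    have "set_lebesgue_integral lborel (\<Union>i\<in>I. Vi i j) (\<lambda>z. f (\<delta> j) (chart_param (\<delta> j) z)) = (\<Sum>i\<in>I. set_lebesgue_integral lborel (Vi i j) (\<lambda>z. f (\<delta> j) (chart_param (\<delta> j) z)))"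
    proof (rule set_integral_finite_Union[OF finI])
      show "disjoint_family_on (\<lambda>i. Vi i j) I" using disj unfolding disjoint_family_on_def Vi_def by blast
      show "set_integrable lborel (Vi i j) (\<lambda>z. f (\<delta> j) (chart_param (\<delta> j) z))" if "i \<in> I" for i
        by (rule set_integrable_subset[OF int[OF j]]) (use sets[OF that j] in \<open>auto simp: Vi_def\<close>)
      show "Vi i j \<in> sets lborel" if "i \<in> I" for i using sets[OF that j] by simp
    qed
    then show "(\<Sum>i\<in>I. set_lebesgue_integral lborel (Vi i j) (\<lambda>z. f (\<delta> j) (chart_param (\<delta> j) z))) = set_lebesgue_integral lborel (V j) (\<lambda>z. f (\<delta> j) (chart_param (\<delta> j) z))"
      using U by simp
  qed
  finally show ?thesis .
qed

section \<open>Construction of pieces from coordinate discs\<close>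

lemma small_disc:
  assumes c: "c \<in> A" and p: "p \<in> dom c" and N: "openin X N" "p \<in> N"
  shows "\<exists>\<rho>>0. cball (snd c p) \<rho> \<subseteq> im c \<and> chart_param c ` cball (snd c p) \<rho> \<subseteq> N"
proof -
  have "open (snd c ` (N \<inter> dom c))" by (rule open_coord[OF c N(1)])
  moreover have "snd c p \<in> snd c ` (N \<inter> dom c)" using p N by blast
  ultimately obtain \<rho> where \<rho>: "\<rho> > 0" "cball (snd c p) \<rho> \<subseteq> snd c ` (N \<inter> dom c)"
    using open_contains_cball by blast
  have "chart_param c z \<in> N" if "z \<in> cball (snd c p) \<rho>" for z
  proof -
    obtain q where "q \<in> N" "q \<in> dom c" "z = snd c q" using \<rho>(2) \<open>z \<in> cball (snd c p) \<rho>\<close> by blast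
    then show ?thesis using c by simp
  qed
  then show ?thesis using \<rho> by blast
qed

lemma pieces_of_cover:
  assumes P: "finite R" "finite Z" and cov: "(\<Union>p\<in>Z \<union> R. chart_param (\<gamma> p) ` D p) = topspace X"
    and D: "\<And>p. p \<in> Z \<union> R \<Longrightarrow> \<gamma> p \<in> A \<and> open (D p) \<and> D p \<subseteq> im (\<gamma> p)"
    and disj: "disjoint_family_on (\<lambda>p. chart_param (\<gamma> p) ` D p) Z"
  shows "\<exists>W. pieces (Z \<union> R) \<gamma> W \<and> (\<forall>p\<in>Z. W p = D p) \<and> (\<forall>p\<in>Z \<union> R. W p \<subseteq> D p)"
proof -
  define B where "B p = chart_param (\<gamma> p) ` D p" for p
  obtain Q where Q0: "(\<forall>p\<in>Z. Q p = {}) \<and> (\<forall>p\<in>Z \<union> R. Q p \<subseteq> Z \<union> R) \<and> disjoint_family_on (\<lambda>p. B p - \<Union>(B ` Q p)) (Z \<union> R) \<and>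
     (\<Union>p\<in>Z \<union> R. B p - \<Union>(B ` Q p)) = \<Union>(B ` (Z \<union> R))"
  proof -
    have "disjoint_family_on B Z" using disj by (simp add: B_def[abs_def])
    from disjointify[OF P this] show ?thesis using that by (elim exE)
  qed
  note Q = Q0[THEN conjunct1] Q0[THEN conjunct2, THEN conjunct1]
    Q0[THEN conjunct2, THEN conjunct2, THEN conjunct1] Q0[THEN conjunct2, THEN conjunct2, THEN conjunct2]
  \<comment> \<open>The sets to be removed are carried into the coordinate of \<open>p\<close>;
    outside the domain of \<open>\<gamma> p\<close> there is nothing to remove.\<close>
  define W where "W p = D p - (\<Union>q\<in>Q p. snd (\<gamma> p) ` (B q \<inter> dom (\<gamma> p)))" for p
  have opB: "openin X (B p)" if "p \<in> Z \<union> R" for p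
    unfolding B_def using D[OF that] by (intro openin_param) auto
  have img: "chart_param (\<gamma> p) ` W p = B p - \<Union>(B ` Q p)" if p: "p \<in> Z \<union> R" for p
  proof -
    have g: "\<gamma> p \<in> A" and Dp: "D p \<subseteq> im (\<gamma> p)" using D[OF p] by auto
    have key: "z \<in> snd (\<gamma> p) ` (B q \<inter> dom (\<gamma> p)) \<longleftrightarrow> chart_param (\<gamma> p) z \<in> B q" if z: "z \<in> D p" for z q
    proof
      assume "z \<in> snd (\<gamma> p) ` (B q \<inter> dom (\<gamma> p))"
      then obtain y where "y \<in> B q" "y \<in> dom (\<gamma> p)" "z = snd (\<gamma> p) y" by blast
      then show "chart_param (\<gamma> p) z \<in> B q" using g by simp
    next
      assume a: "chart_param (\<gamma> p) z \<in> B q"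
      have "z \<in> im (\<gamma> p)" using z Dp by blast
      then have "z = snd (\<gamma> p) (chart_param (\<gamma> p) z)" "chart_param (\<gamma> p) z \<in> dom (\<gamma> p)"
        using param_in coord_param by metis+
      then show "z \<in> snd (\<gamma> p) ` (B q \<inter> dom (\<gamma> p))" using a by blast
    qed
    have Weq: "W p = {z \<in> D p. \<forall>q\<in>Q p. chart_param (\<gamma> p) z \<notin> B q}"
      unfolding W_def using key by auto
    show ?thesis unfolding Weq B_def[of p] by auto
  qed
  have "pieces (Z \<union> R) \<gamma> W" unfolding pieces_def
  proof (intro conjI ballI)
    show "finite (Z \<union> R)" using P by simp
    fix p assume p: "p \<in> Z \<union> R"
    show "\<gamma> p \<in> A" using D[OF p] by simp
    show "W p \<subseteq> im (\<gamma> p)" using D[OF p] unfolding W_def by blast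
    have "finite (Q p)" using Q(2) p P finite_subset by blast
    moreover have "open (snd (\<gamma> p) ` (B q \<inter> dom (\<gamma> p)))" if "q \<in> Q p" for q
      by (rule open_coord[OF _ opB]) (use Q(2) p that D[OF p] in blast)+
    ultimately show "W p \<in> sets borel" unfolding W_def using D[OF p] by (intro sets.Diff sets.finite_UN) auto
  next
    show "disjoint_family_on (\<lambda>i. chart_param (\<gamma> i) ` W i) (Z \<union> R)"
      using Q(3) unfolding disjoint_family_on_def by (simp add: img)
    have "(\<Union>i\<in>Z \<union> R. chart_param (\<gamma> i) ` W i) = (\<Union>p\<in>Z \<union> R. B p - \<Union>(B ` Q p))"
      by (rule SUP_cong) (use img in auto)
    then show "(\<Union>i\<in>Z \<union> R. chart_param (\<gamma> i) ` W i) = topspace X"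
      using Q(4) cov by (simp add: B_def)
  qed
  moreover have "\<forall>p\<in>Z. W p = D p" using Q(1) by (simp add: W_def)
  moreover have "\<forall>p\<in>Z \<union> R. W p \<subseteq> D p" by (auto simp: W_def)
  ultimately show ?thesis by blast
qed

lemma finite_subcover_discs:
  assumes "\<And>p. p \<in> topspace X \<Longrightarrow> openin X (U p) \<and> p \<in> U p"
  shows "\<exists>P. finite P \<and> P \<subseteq> topspace X \<and> (\<Union>p\<in>P. U p) = topspace X"
proof -
  have "\<forall>\<U>. Ball \<U> (openin X) \<and> topspace X \<subseteq> \<Union>\<U> \<longrightarrow> (\<exists>\<F>. finite \<F> \<and> \<F> \<subseteq> \<U> \<and> topspace X \<subseteq> \<Union>\<F>)"
    using compact_X unfolding compact_space_alt by blast
  moreover have "Ball (U ` topspace X) (openin X) \<and> topspace X \<subseteq> \<Union>(U ` topspace X)" using assms by blast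
  ultimately have "\<exists>\<F>. finite \<F> \<and> \<F> \<subseteq> U ` topspace X \<and> topspace X \<subseteq> \<Union>\<F>"
    by (drule_tac x="U ` topspace X" in spec) (erule (1) mp)
  then obtain \<F> where F: "finite \<F>" "\<F> \<subseteq> U ` topspace X" "topspace X \<subseteq> \<Union>\<F>" by (elim exE conjE)
  then obtain P where P: "finite P" "P \<subseteq> topspace X" "\<F> = U ` P" using finite_subset_image by metis
  moreover have "(\<Union>p\<in>P. U p) \<subseteq> topspace X" using assms P(2) openin_subset by blast
  ultimately show ?thesis using F(3) by blast
qed

text \<open>In the application \<open>Z\<close> is the zero set of a differential: its points are
  centres of pieces that are full discs, and no closed disc contains a point of \<open>Z\<close>
  other than its centre.\<close>

lemma adapted_pieces:
  assumes Z: "finite Z" "Z \<subseteq> topspace X"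
  shows "\<exists>P \<gamma> \<rho> W. pieces P \<gamma> W \<and> Z \<subseteq> P \<and> P \<subseteq> topspace X \<and>
     (\<forall>p\<in>P. \<gamma> p \<in> A \<and> p \<in> dom (\<gamma> p) \<and> \<rho> p > 0 \<and> cball (snd (\<gamma> p) p) (\<rho> p) \<subseteq> im (\<gamma> p) \<and> W p \<subseteq> ball (snd (\<gamma> p) p) (\<rho> p) \<and>
        (\<forall>z\<in>cball (snd (\<gamma> p) p) (\<rho> p). chart_param (\<gamma> p) z \<in> Z \<longrightarrow> chart_param (\<gamma> p) z = p)) \<and>
     (\<forall>p\<in>Z. W p = ball (snd (\<gamma> p) p) (\<rho> p))"
proof -
  have "\<exists>U V. openin X U \<and> openin X V \<and> x \<in> U \<and> y \<in> V \<and> U \<inter> V = {}" if "x \<in> topspace X" "y \<in> topspace X" "x \<noteq> y" for x y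
    using hausdorff that unfolding Hausdorff_space_def disjnt_def by blast
  then obtain U V where UV: "\<And>x y. x \<in> topspace X \<Longrightarrow> y \<in> topspace X \<Longrightarrow> x \<noteq> y \<Longrightarrow> openin X (U x y) \<and> openin X (V x y) \<and> x \<in> U x y \<and> y \<in> V x y \<and> U x y \<inter> V x y = {}"
    by metis
  \<comment> \<open>The separating sets are used in both roles: for two points of \<open>Z\<close>
    the sets \<open>N\<close> are disjoint, and for any \<open>p\<close> the set \<open>N p\<close>
    meets \<open>Z\<close> at most in \<open>p\<close>.\<close>
  define N where "N p = topspace X \<inter> (\<Inter>q\<in>Z - {p}. U p q \<inter> V q p)" for p
  have opN: "openin X (N p)" and inN: "p \<in> N p" if p: "p \<in> topspace X" for p
  proof -
    have "openin X (topspace X \<inter> \<Inter>((\<lambda>q. U p q \<inter> V q p) ` (Z - {p})))"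
    proof (cases "Z - {p} = {}")
      case True then show ?thesis by (simp only: True image_empty Inter_empty Int_UNIV_right openin_topspace)
    next
      case False
      show ?thesis
      proof (intro openin_Int openin_Inter openin_topspace)
        show "openin X T" if "T \<in> (\<lambda>q. U p q \<inter> V q p) ` (Z - {p})" for T using that UV Z p by (auto intro!: openin_Int)
      qed (use Z False in auto)
    qed
    then show "openin X (N p)" by (simp add: N_def)
    show "p \<in> N p" using UV Z p by (auto simp: N_def)
  qed
  have disjN: "N p \<inter> N q = {}" if "p \<in> Z" "q \<in> Z" "p \<noteq> q" for p q
  proof -
    have "N p \<subseteq> U p q" "N q \<subseteq> V p q" using that by (auto simp: N_def)
    then show ?thesis using UV[of p q] that Z by blast
  qed
  have NZ: "q = p" if "q \<in> N p" "q \<in> Z" "p \<in> topspace X" for p q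
  proof (rule ccontr)
    assume "q \<noteq> p"
    then have "q \<in> U p q" "q \<in> V q p" using that by (auto simp: N_def)
    moreover have "q \<in> V p q" "U p q \<inter> V p q = {}" using UV[of p q] that \<open>q \<noteq> p\<close> Z by blast+
    ultimately show False by blast
  qed
  obtain \<gamma> where \<gamma>: "\<And>p. p \<in> topspace X \<Longrightarrow> \<gamma> p \<in> A \<and> p \<in> dom (\<gamma> p)" using chart_at by metis
  have "\<exists>\<rho>>0. cball (snd (\<gamma> p) p) \<rho> \<subseteq> im (\<gamma> p) \<and> chart_param (\<gamma> p) ` cball (snd (\<gamma> p) p) \<rho> \<subseteq> N p" if "p \<in> topspace X" for p
    using small_disc[of "\<gamma> p" p "N p"] \<gamma>[OF that] opN[OF that] inN[OF that] by blast
  then obtain \<rho> where \<rho>: "\<And>p. p \<in> topspace X \<Longrightarrow> \<rho> p > 0 \<and> cball (snd (\<gamma> p) p) (\<rho> p) \<subseteq> im (\<gamma> p) \<and> chart_param (\<gamma> p) ` cball (snd (\<gamma> p) p) (\<rho> p) \<subseteq> N p"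
    by metis
  define D where "D p = ball (snd (\<gamma> p) p) (\<rho> p)" for p
  have D: "\<gamma> p \<in> A \<and> open (D p) \<and> D p \<subseteq> im (\<gamma> p)" if "p \<in> topspace X" for p
    unfolding D_def using \<gamma>[OF that] \<rho>[OF that] by (auto intro: subset_trans[OF ball_subset_cball])
  have opD: "openin X (chart_param (\<gamma> p) ` D p) \<and> p \<in> chart_param (\<gamma> p) ` D p" if "p \<in> topspace X" for p
  proof
    show "openin X (chart_param (\<gamma> p) ` D p)" using D[OF that] by (intro openin_param) auto
    have "snd (\<gamma> p) p \<in> D p" using \<rho>[OF that] by (simp add: D_def)
    then have "chart_param (\<gamma> p) (snd (\<gamma> p) p) \<in> chart_param (\<gamma> p) ` D p" by (rule imageI)
    then show "p \<in> chart_param (\<gamma> p) ` D p" using \<gamma>[OF that] by simp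
  qed
  have "\<exists>P. finite P \<and> P \<subseteq> topspace X \<and> (\<Union>p\<in>P. chart_param (\<gamma> p) ` D p) = topspace X"
    by (rule finite_subcover_discs) (rule opD)
  then obtain R where R: "finite R" "R \<subseteq> topspace X" "(\<Union>p\<in>R. chart_param (\<gamma> p) ` D p) = topspace X"
    by (elim exE conjE)
  have ZR: "Z \<union> R \<subseteq> topspace X" using Z R by blast
  have "\<exists>W. pieces (Z \<union> R) \<gamma> W \<and> (\<forall>p\<in>Z. W p = D p) \<and> (\<forall>p\<in>Z \<union> R. W p \<subseteq> D p)"
  proof (rule pieces_of_cover[OF R(1) Z(1)])
    have "(\<Union>p\<in>Z. chart_param (\<gamma> p) ` D p) \<subseteq> topspace X"
    proof (rule UN_least)
      show "chart_param (\<gamma> p) ` D p \<subseteq> topspace X" if "p \<in> Z" for p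
        by (rule openin_subset[OF conjunct1[OF opD]]) (use that Z in blast)
    qed
    then show "(\<Union>p\<in>Z \<union> R. chart_param (\<gamma> p) ` D p) = topspace X" unfolding UN_Un R(3) by (rule Un_absorb1)
    show "\<gamma> p \<in> A \<and> open (D p) \<and> D p \<subseteq> im (\<gamma> p)" if "p \<in> Z \<union> R" for p using D ZR that by blast
    have "chart_param (\<gamma> p) ` D p \<subseteq> N p" if "p \<in> Z" for p
      using \<rho>[of p] Z that ball_subset_cball unfolding D_def by blast
    then show "disjoint_family_on (\<lambda>p. chart_param (\<gamma> p) ` D p) Z"
      unfolding disjoint_family_on_def using disjN by blast
  qed
  then obtain W where W: "pieces (Z \<union> R) \<gamma> W" "\<forall>p\<in>Z. W p = D p" "\<forall>p\<in>Z \<union> R. W p \<subseteq> D p" by blast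
  show ?thesis
  proof (intro exI[of _ "Z \<union> R"] exI[of _ \<gamma>] exI[of _ \<rho>] exI[of _ W] conjI ballI impI)
    fix p assume "p \<in> Z \<union> R"
    then have p: "p \<in> topspace X" using ZR by blast
    show "\<gamma> p \<in> A" "p \<in> dom (\<gamma> p)" using \<gamma>[OF p] by auto
    show "\<rho> p > 0" "cball (snd (\<gamma> p) p) (\<rho> p) \<subseteq> im (\<gamma> p)" using \<rho>[OF p] by auto
    show "W p \<subseteq> ball (snd (\<gamma> p) p) (\<rho> p)" using W(3) \<open>p \<in> Z \<union> R\<close> by (simp add: D_def)
    fix z assume "z \<in> cball (snd (\<gamma> p) p) (\<rho> p)" "chart_param (\<gamma> p) z \<in> Z"
    then show "chart_param (\<gamma> p) z = p" using NZ[of "chart_param (\<gamma> p) z" p] p \<rho>[OF p] by blast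
  qed (use W ZR in \<open>auto simp: D_def\<close>)
qed

text \<open>Gives meaning to the choice of a partition in \<open>surface_integral\<close>.\<close>

lemma chart_partition_exists: "\<exists>C E. chart_partition X A C E"
proof -
  obtain \<gamma> where \<gamma>: "\<And>p. p \<in> topspace X \<Longrightarrow> \<gamma> p \<in> A \<and> p \<in> dom (\<gamma> p)" using chart_at by metis
  obtain P where P: "finite P" "P \<subseteq> topspace X" "(\<Union>p\<in>P. dom (\<gamma> p)) = topspace X"
    using finite_subcover_discs[of "\<lambda>p. dom (\<gamma> p)"] \<gamma> openin_dom by metis
  define C where "C = \<gamma> ` P"
  have C: "finite C" "C \<subseteq> A" using P \<gamma> by (auto simp: C_def)
  have pd: "chart_param c ` im c = dom c" if "c \<in> A" for c
    using that param_in[of _ c] param_coord[OF that] by (force intro: image_eqI)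
  have "\<exists>W. pieces ({} \<union> C) (\<lambda>c. c) W \<and> (\<forall>p\<in>{}. W p = im p) \<and> (\<forall>p\<in>{} \<union> C. W p \<subseteq> im p)"
  proof (rule pieces_of_cover)
    show "(\<Union>c\<in>{} \<union> C. chart_param c ` im c) = topspace X"
    proof -
      have "(\<Union>c\<in>C. chart_param c ` im c) = (\<Union>c\<in>C. dom c)" by (rule SUP_cong[OF refl pd]) (use C in blast)
      then show ?thesis unfolding P(3)[symmetric] by (simp add: C_def)
    qed
    show "c \<in> A \<and> open (im c) \<and> im c \<subseteq> im c" if "c \<in> {} \<union> C" for c using that C open_im by auto
  qed (use C in \<open>auto simp: disjoint_family_on_def\<close>)
  then obtain W where W: "pieces C (\<lambda>c. c) W" by auto
  have "chart_partition X A C (\<lambda>c. chart_param c ` W c)" unfolding chart_partition_def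
  proof (intro conjI ballI)
    show "finite C" "C \<subseteq> A" by (rule C)+
    show "disjoint_family_on (\<lambda>c. chart_param c ` W c) C" "(\<Union>c\<in>C. chart_param c ` W c) = topspace X"
      using W by (auto simp: pieces_def)
    fix c assume c: "c \<in> C"
    then have Wc: "W c \<subseteq> im c" "W c \<in> sets borel" using W by (auto simp: pieces_def)
    then show "chart_param c ` W c \<subseteq> dom c" using param_in by blast
    have "snd c ` chart_param c ` W c = (\<lambda>z. z) ` W c" unfolding image_image
      by (rule image_cong[OF refl]) (use Wc coord_param in blast)
    then show "snd c ` chart_param c ` W c \<in> sets borel" using Wc by simp
  qed
  then show ?thesis by blast
qed

text \<open>The chosen partition is one more system of pieces, so every convenient system computes
  the same integral.\<close>

lemma surface_integral_pieces:
  assumes J: "pieces J \<delta> V" and f: "density f"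
    and int: "\<And>j. j \<in> J \<Longrightarrow> set_integrable lborel (V j) (\<lambda>z. f (\<delta> j) (chart_param (\<delta> j) z))"
  shows "surface_integral X A f = (\<Sum>j\<in>J. set_lebesgue_integral lborel (V j) (\<lambda>z. f (\<delta> j) (chart_param (\<delta> j) z)))"
proof -
  define P where "P = (SOME P. chart_partition X A (fst P) (snd P))"
  have "\<exists>P. chart_partition X A (fst P) (snd P)" using chart_partition_exists by auto
  then have P: "chart_partition X A (fst P) (snd P)" unfolding P_def by (rule someI_ex)
  have pe: "chart_param c ` snd c ` snd P c = snd P c" if "c \<in> fst P" for c
  proof -
    have "c \<in> A" "snd P c \<subseteq> dom c" using P that by (auto simp: chart_partition_def)
    then have "(\<lambda>p. chart_param c (snd c p)) ` snd P c = (\<lambda>p. p) ` snd P c"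
      by (intro image_cong[OF refl]) (use param_coord in blast)
    then show ?thesis by (simp add: image_image)
  qed
  have "pieces (fst P) (\<lambda>c. c) (\<lambda>c. snd c ` snd P c)"
    unfolding pieces_def
  proof (intro conjI ballI)
    show "finite (fst P)" using P by (simp add: chart_partition_def)
    show "c \<in> A" "snd c ` snd P c \<in> sets borel" "snd c ` snd P c \<subseteq> im c" if "c \<in> fst P" for c
      using P that unfolding chart_partition_def by (blast intro: image_mono)+
    have "disjoint_family_on (\<lambda>c. snd P c) (fst P)" using P by (simp add: chart_partition_def)
    then show "disjoint_family_on (\<lambda>i. chart_param i ` snd i ` snd P i) (fst P)"
      unfolding disjoint_family_on_def using pe by simp
    have "(\<Union>i\<in>fst P. chart_param i ` snd i ` snd P i) = (\<Union>i\<in>fst P. snd P i)" by (rule SUP_cong[OF refl pe])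
    then show "(\<Union>i\<in>fst P. chart_param i ` snd i ` snd P i) = topspace X" using P by (simp add: chart_partition_def)
  qed
  from pieces_integral_eq[OF this J f int]
  show ?thesis unfolding surface_integral_def P_def[symmetric] Let_def by simp
qed

lemma surface_integrable_pieces:
  assumes J: "pieces J \<delta> V" and f: "density f"
    and int: "\<And>j. j \<in> J \<Longrightarrow> set_integrable lborel (V j) (\<lambda>z. f (\<delta> j) (chart_param (\<delta> j) z))"
  shows "surface_integrable A f"
  unfolding surface_integrable_def
  by (intro ballI pieces_split(1)[OF J f _ _ _ int]) (use open_im in auto)

end

section \<open>Holomorphic quadratic differentials\<close>

lemma borel_measurable_cnj [measurable]: "cnj \<in> borel_measurable borel"
  by (intro borel_measurable_continuous_onI continuous_intros)

context riemann_surface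
begin

abbreviation qd :: "'a differential set" where "qd \<equiv> holomorphic_differentials 2 A"

lemma qd_holomorphic: "\<phi> \<in> qd \<Longrightarrow> c \<in> A \<Longrightarrow> (\<lambda>z. \<phi> c (chart_param c z)) holomorphic_on im c"
  by (auto simp: holomorphic_differentials_def comp_def)

lemma qd_transform: "\<phi> \<in> qd \<Longrightarrow> c \<in> A \<Longrightarrow> d \<in> A \<Longrightarrow> p \<in> dom c \<Longrightarrow> p \<in> dom d \<Longrightarrow> \<phi> c p = \<phi> d p * deriv (tr c d) (snd c p) ^ 2"
  unfolding holomorphic_differentials_def tr_def by blast

lemma qd_outside: "\<phi> \<in> qd \<Longrightarrow> \<not> (c \<in> A \<and> p \<in> dom c) \<Longrightarrow> \<phi> c p = 0"
  unfolding holomorphic_differentials_def by blast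

lemma qd_measurable: "\<phi> \<in> qd \<Longrightarrow> c \<in> A \<Longrightarrow> (\<lambda>z. indicator (im c) z *\<^sub>R \<phi> c (chart_param c z)) \<in> borel_measurable borel"
  by (rule borel_measurable_continuous_on_indicator)
     (use open_im holomorphic_on_imp_continuous_on[OF qd_holomorphic] in auto)

text \<open>With \<open>t\<close> the derivative of the coordinate change, the numerator scales by
  \<open>(cmod t)^4\<close> and the denominator by \<open>(cmod t)^2\<close>.\<close>

lemma density_pairing:
  assumes "\<phi> \<in> qd" "\<psi>1 \<in> qd" "\<psi>2 \<in> qd"
  shows "density (pairing_density \<phi> \<psi>1 \<psi>2)"
  unfolding density_def
proof (intro conjI ballI)
  fix c d p assume c: "c \<in> A" and d: "d \<in> A" and p: "p \<in> dom c \<inter> dom d"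
  define t where "t = deriv (tr c d) (snd c p)"
  have e: "\<phi> c p = \<phi> d p * t ^ 2" "\<psi>1 c p = \<psi>1 d p * t ^ 2" "\<psi>2 c p = \<psi>2 d p * t ^ 2"
    unfolding t_def using p by (auto intro!: qd_transform assms c d)
  have t4: "t ^ 2 * cnj (t ^ 2) = of_real ((cmod t) ^ 2) * of_real ((cmod t)^2)"
    by (metis complex_norm_square norm_power of_real_mult power2_eq_square)
  have "pairing_density \<phi> \<psi>1 \<psi>2 c p = (\<psi>1 d p * cnj (\<psi>2 d p)) * (t ^ 2 * cnj (t ^ 2)) / (4 * complex_of_real (cmod (\<phi> d p)) * of_real ((cmod t)^2))"
    unfolding pairing_density_def e by (simp add: norm_mult norm_power mult_ac)
  also have "\<dots> = of_real ((cmod t) ^ 2) * pairing_density \<phi> \<psi>1 \<psi>2 d p"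
  proof (cases "t = 0")
    case True then show ?thesis by simp
  next
    case False
    \<comment> \<open>The case \<open>b = 0\<close> occurs at the zeros of \<phi>, where both sides
      are 0 by the convention on division.\<close>
    have gen: "a * (x * x) / (b * x) = x * (a / b)" if "x \<noteq> 0" for a b x :: complex
      using that by (cases "b = 0") (auto simp: field_simps)
    have "complex_of_real ((cmod t) ^ 2) \<noteq> 0" using False by simp
    from gen[OF this] show ?thesis unfolding t4 pairing_density_def by simp
  qed
  finally show "pairing_density \<phi> \<psi>1 \<psi>2 c p = of_real ((cmod (deriv (tr c d) (snd c p)))\<^sup>2) * pairing_density \<phi> \<psi>1 \<psi>2 d p"
    unfolding t_def .
next
  fix c assume c: "c \<in> A"
  let ?i = "\<lambda>\<psi> z. indicator (im c) z *\<^sub>R \<psi> c (chart_param c z)"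
  have [measurable]: "?i \<phi> \<in> borel_measurable borel" "?i \<psi>1 \<in> borel_measurable borel" "?i \<psi>2 \<in> borel_measurable borel"
    using assms c qd_measurable by auto
  have "(\<lambda>z. indicator (im c) z *\<^sub>R pairing_density \<phi> \<psi>1 \<psi>2 c (chart_param c z)) =
     (\<lambda>z. ?i \<psi>1 z * cnj (?i \<psi>2 z) / (4 * complex_of_real (cmod (?i \<phi> z))))"
    by (auto simp: pairing_density_def indicator_def fun_eq_iff)
  also have "\<dots> \<in> borel_measurable borel" by measurable
  finally show "(\<lambda>z. indicator (im c) z *\<^sub>R pairing_density \<phi> \<psi>1 \<psi>2 c (chart_param c z)) \<in> borel_measurable borel" .
qed

section \<open>Zeros of quadratic differentials and poles of their quotients\<close>

definition zeros :: "'a differential \<Rightarrow> 'a set" where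
  "zeros \<phi> = {p \<in> topspace X. \<exists>c\<in>A. p \<in> dom c \<and> \<phi> c p = 0}"

lemma zeros_iff:
  assumes "\<phi> \<in> qd" "c \<in> A" "p \<in> dom c" shows "p \<in> zeros \<phi> \<longleftrightarrow> \<phi> c p = 0"
proof
  assume "p \<in> zeros \<phi>"
  then obtain d where "d \<in> A" "p \<in> dom d" "\<phi> d p = 0" by (auto simp: zeros_def)
  then show "\<phi> c p = 0" using qd_transform[OF assms(1,2), of d p] assms by simp
next
  assume "\<phi> c p = 0"
  then show "p \<in> zeros \<phi>" using assms dom_subset unfolding zeros_def by blast
qed

text \<open>On each coordinate disc the identity theorem gives either identical vanishing or
  finitely many zeros in the half disc. The two kinds of points have disjoint open neighbourhoods,
  so connectedness leaves one kind: the first contradicts \<open>nz\<close>, and compactness settles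
  the second.\<close>

lemma finite_zeros:
  assumes \<phi>: "\<phi> \<in> qd" and nz: "\<phi> \<noteq> (\<lambda>c p. 0)"
  shows "finite (zeros \<phi>)"
proof -
  obtain \<gamma> where \<gamma>: "\<And>p. p \<in> topspace X \<Longrightarrow> \<gamma> p \<in> A \<and> p \<in> dom (\<gamma> p)" using chart_at by metis
  have "\<exists>\<rho>>0. cball (snd (\<gamma> p) p) \<rho> \<subseteq> im (\<gamma> p)" if "p \<in> topspace X" for p
    using small_disc[of "\<gamma> p" p "topspace X"] \<gamma>[OF that] that by blast
  then obtain \<rho> where \<rho>: "\<And>p. p \<in> topspace X \<Longrightarrow> \<rho> p > 0 \<and> cball (snd (\<gamma> p) p) (\<rho> p) \<subseteq> im (\<gamma> p)" by metis
  define B where "B p = ball (snd (\<gamma> p) p) (\<rho> p)" for p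
  have B: "B p \<subseteq> im (\<gamma> p)" "open (B p)" "connected (B p)" "snd (\<gamma> p) p \<in> B p" if "p \<in> topspace X" for p
    using \<rho>[OF that] by (auto simp: B_def intro: subset_trans[OF ball_subset_cball])
  define f where "f p z = \<phi> (\<gamma> p) (chart_param (\<gamma> p) z)" for p z
  have hol: "f p holomorphic_on B p" if "p \<in> topspace X" for p
    unfolding f_def by (rule holomorphic_on_subset[OF qd_holomorphic[OF \<phi>] B(1)[OF that]]) (use \<gamma>[OF that] in blast)
  define flat where "flat p \<longleftrightarrow> (\<forall>z\<in>B p. f p z = 0)" for p
  have disc: "finite {z \<in> cball (snd (\<gamma> p) p) (\<rho> p / 2). f p z = 0}" if p: "p \<in> topspace X" and "\<not> flat p" for p
  proof (cases "f p constant_on B p")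
    case True
    then obtain k where k: "\<And>z. z \<in> B p \<Longrightarrow> f p z = k" by (auto simp: constant_on_def)
    then have "k \<noteq> 0" using \<open>\<not> flat p\<close> by (auto simp: flat_def)
    moreover have "cball (snd (\<gamma> p) p) (\<rho> p / 2) \<subseteq> B p" using \<rho>[OF p] by (auto simp: B_def)
    ultimately have "{z \<in> cball (snd (\<gamma> p) p) (\<rho> p / 2). f p z = 0} = {}" using k by blast
    then show ?thesis by (simp only: finite.emptyI)
  next
    case False
    show ?thesis by (rule holomorphic_compact_finite_zeros[OF hol[OF p] B(2,3)[OF p] _ _ False])
       (use \<rho>[OF p] in \<open>auto simp: B_def\<close>)
  qed
  define H where "H p = chart_param (\<gamma> p) ` ball (snd (\<gamma> p) p) (\<rho> p / 2)" for p
  have Hop: "openin X (H p) \<and> p \<in> H p" if p: "p \<in> topspace X" for p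
  proof
    have "ball (snd (\<gamma> p) p) (\<rho> p / 2) \<subseteq> B p" using \<rho>[OF p] by (auto simp: B_def)
    then show "openin X (H p)" unfolding H_def using B[OF p] \<gamma>[OF p] by (intro openin_param) auto
    have "snd (\<gamma> p) p \<in> ball (snd (\<gamma> p) p) (\<rho> p / 2)" using \<rho>[OF p] by simp
    then have "chart_param (\<gamma> p) (snd (\<gamma> p) p) \<in> H p" unfolding H_def by (rule imageI)
    then show "p \<in> H p" using \<gamma>[OF p] by simp
  qed
  have Hsub: "z \<in> B p" if "z \<in> ball (snd (\<gamma> p) p) (\<rho> p / 2)" "p \<in> topspace X" for z p using that \<rho>[of p] by (auto simp: B_def)
  have zH: "zeros \<phi> \<inter> H p \<subseteq> chart_param (\<gamma> p) ` {z \<in> cball (snd (\<gamma> p) p) (\<rho> p / 2). f p z = 0}" if p: "p \<in> topspace X" for p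
  proof
    fix q assume q: "q \<in> zeros \<phi> \<inter> H p"
    then obtain z where z: "z \<in> ball (snd (\<gamma> p) p) (\<rho> p / 2)" "q = chart_param (\<gamma> p) z" by (auto simp: H_def)
    have "z \<in> im (\<gamma> p)" using Hsub[OF z(1) p] B(1)[OF p] by blast
    then have "f p z = 0" using q zeros_iff[OF \<phi>, of "\<gamma> p" q] \<gamma>[OF p] z(2) param_in[of z "\<gamma> p"] by (simp add: f_def)
    then show "q \<in> chart_param (\<gamma> p) ` {z \<in> cball (snd (\<gamma> p) p) (\<rho> p / 2). f p z = 0}" using z by auto
  qed
  have fin: "finite (zeros \<phi> \<inter> H p)" if "p \<in> topspace X" "\<not> flat p" for p
    using finite_subset[OF zH[OF that(1)] finite_imageI[OF disc[OF that]]] .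
  have flatz: "H p \<subseteq> zeros \<phi>" if p: "p \<in> topspace X" and "flat p" for p
  proof
    fix q assume "q \<in> H p"
    then obtain z where z: "z \<in> ball (snd (\<gamma> p) p) (\<rho> p / 2)" "q = chart_param (\<gamma> p) z" by (auto simp: H_def)
    have zB: "z \<in> B p" by (rule Hsub[OF z(1) p])
    then have "z \<in> im (\<gamma> p)" using B(1)[OF p] by blast
    then show "q \<in> zeros \<phi>" using zeros_iff[OF \<phi>, of "\<gamma> p" q] \<gamma>[OF p] z(2) param_in[of z "\<gamma> p"] zB \<open>flat p\<close> by (simp add: f_def flat_def)
  qed
  \<comment> \<open>Keeps a flat and a non-flat disc apart: their intersection would be an infinite
    set of zeros inside the non-flat one.\<close>
  have inf_open: "infinite U" if U: "openin X U" "q \<in> U" for U q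
  proof
    assume "finite U"
    have q: "q \<in> topspace X" using U openin_subset by blast
    have "open (snd (\<gamma> q) ` (U \<inter> dom (\<gamma> q)))" using open_coord[OF _ U(1)] \<gamma>[OF q] by blast
    moreover have "snd (\<gamma> q) q \<in> snd (\<gamma> q) ` (U \<inter> dom (\<gamma> q))" using U(2) \<gamma>[OF q] by blast
    moreover have "finite (snd (\<gamma> q) ` (U \<inter> dom (\<gamma> q)))" using \<open>finite U\<close> by simp
    ultimately show False using finite_imp_not_open by blast
  qed
  define V1 where "V1 = (\<Union>p\<in>{p \<in> topspace X. flat p}. H p)"
  define V2 where "V2 = (\<Union>p\<in>{p \<in> topspace X. \<not> flat p}. H p)"
  have o: "openin X V1" "openin X V2" unfolding V1_def V2_def using Hop by (auto intro!: openin_clauses(3))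
  have cov: "topspace X \<subseteq> V1 \<union> V2" unfolding V1_def V2_def using Hop by blast
  have dj: "V1 \<inter> V2 = {}"
  proof (rule ccontr)
    assume "V1 \<inter> V2 \<noteq> {}"
    then obtain q p1 p2 where "q \<in> H p1" "q \<in> H p2" "p1 \<in> topspace X" "p2 \<in> topspace X" "flat p1" "\<not> flat p2"
      unfolding V1_def V2_def by blast
    moreover from this have "infinite (H p1 \<inter> H p2)" using inf_open[of "H p1 \<inter> H p2" q] Hop by blast
    moreover have "H p1 \<inter> H p2 \<subseteq> zeros \<phi> \<inter> H p2" using calculation flatz by blast
    ultimately show False using fin finite_subset by blast
  qed
  show ?thesis
  proof (cases "V1 = {}")
    case True
    obtain P where P: "finite P" "P \<subseteq> topspace X" "(\<Union>p\<in>P. H p) = topspace X"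
      using finite_subcover_discs[of H] Hop by metis
    have nf: "\<not> flat p" if "p \<in> P" for p using True P(2) that Hop unfolding V1_def by blast
    have "zeros \<phi> = (\<Union>p\<in>P. zeros \<phi> \<inter> H p)" using P(3) by (auto simp: zeros_def)
    also have "finite \<dots>" using P(1,2) fin nf by blast
    finally show ?thesis .
  next
    case False
    then have "V2 = {}" using connected_X o cov dj unfolding connected_space_def by blast
    then have all: "topspace X \<subseteq> zeros \<phi>" using cov flatz unfolding V1_def by blast
    have "\<phi> c p = 0" for c p
    proof (cases "c \<in> A \<and> p \<in> dom c")
      case True
      then show ?thesis using all zeros_iff[OF \<phi>, of c p] dom_subset[of c] by blast
    qed (rule qd_outside[OF \<phi>])
    then show ?thesis using nz by blast
  qed
qed

lemma finite_zeros_chart: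
  assumes "\<phi> \<in> qd" "\<phi> \<noteq> (\<lambda>c p. 0)" "c \<in> A"
  shows "finite {z \<in> im c. \<phi> c (chart_param c z) = 0}"
proof (rule finite_subset)
  show "{z \<in> im c. \<phi> c (chart_param c z) = 0} \<subseteq> snd c ` zeros \<phi>"
  proof
    fix z assume "z \<in> {z \<in> im c. \<phi> c (chart_param c z) = 0}"
    then have z: "z \<in> im c" "\<phi> c (chart_param c z) = 0" by blast+
    then have "chart_param c z \<in> zeros \<phi>" using zeros_iff[OF assms(1,3) param_in[OF z(1)]] by simp
    then show "z \<in> snd c ` zeros \<phi>" using coord_param[OF z(1)] by (metis image_eqI)
  qed
  show "finite (snd c ` zeros \<phi>)" using finite_zeros[OF assms(1,2)] by simp
qed

lemma eventually_nonzero: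
  assumes "\<phi> \<in> qd" "\<phi> \<noteq> (\<lambda>c p. 0)" "c \<in> A" "z \<in> im c"
  shows "\<forall>\<^sub>F w in at z. \<phi> c (chart_param c w) \<noteq> 0"
proof -
  let ?F = "{z \<in> im c. \<phi> c (chart_param c z) = 0} - {z}"
  have "open (im c - ?F)" using finite_zeros_chart[OF assms(1-3)] open_im[OF assms(3)] by (intro open_Diff finite_imp_closed) auto
  then show ?thesis unfolding eventually_at_topological using assms(4) by (intro exI[of _ "im c - ?F"]) auto
qed

lemma zero_order_pos_iff:
  assumes "\<phi> \<in> qd" "\<phi> \<noteq> (\<lambda>c p. 0)" "p \<in> topspace X"
  shows "zero_order A \<phi> p > 0 \<longleftrightarrow> p \<in> zeros \<phi>"
proof -
  define c where "c = (SOME c. c \<in> A \<and> p \<in> dom c)"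
  have "\<exists>c. c \<in> A \<and> p \<in> dom c" using chart_at[OF assms(3)] by blast
  then have c: "c \<in> A" "p \<in> dom c" unfolding c_def by (metis (mono_tags, lifting) someI_ex)+
  have z: "snd c p \<in> im c" using c by blast
  have "zorder (\<lambda>z. \<phi> c (chart_param c z)) (snd c p) > 0 \<longleftrightarrow> \<phi> c (chart_param c (snd c p)) = 0"
    by (rule zorder_pos_iff[OF qd_holomorphic[OF assms(1) c(1)] open_im[OF c(1)] z])
       (rule eventually_frequently[OF at_neq_bot eventually_nonzero[OF assms(1,2) c(1) z]])
  then show ?thesis using c zeros_iff[OF assms(1) c] unfolding zero_order_def c_def[symmetric] Let_def by simp
qed

text \<open>The size of the multiset of multiplicities is the number of distinct zeros. Constancy of
  this number along a stratum is what makes the zeros move without splitting or merging.\<close>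

lemma card_zeros_symbol:
  assumes "\<phi> \<in> qd" "\<phi> \<noteq> (\<lambda>c p. 0)" "\<phi>' \<in> qd" "\<phi>' \<noteq> (\<lambda>c p. 0)" "symbol X A \<phi> = symbol X A \<phi>'"
  shows "card (zeros \<phi>) = card (zeros \<phi>')"
proof -
  have eq: "{p \<in> topspace X. zero_order A \<phi> p > 0} = zeros \<phi>" if "\<phi> \<in> qd" "\<phi> \<noteq> (\<lambda>c p. 0)" for \<phi>
    using zero_order_pos_iff[OF that] by (auto simp: zeros_def)
  have "size (fst (symbol X A \<phi>)) = card (zeros \<phi>)" if "\<phi> \<in> qd" "\<phi> \<noteq> (\<lambda>c p. 0)" for \<phi>
    unfolding symbol_def eq[OF that] by simp
  then show ?thesis using assms by metis
qed

text \<open>\<open>(w - a) * \<psi> / \<phi>\<close> has order at least 0 at its only possible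
  singularity \<open>a\<close>, hence is bounded there and extends holomorphically. The conclusion
  is written without a quotient so that it holds at \<open>a\<close> as well.\<close>

lemma simple_pole_quotient:
  assumes \<phi>: "\<phi> \<in> qd" "\<phi> \<noteq> (\<lambda>c p. 0)" and \<psi>: "\<psi> \<in> qd" and q: "quotient_at_most_simple_poles A \<psi> \<phi>"
    and c: "c \<in> A" and D: "open D" "D \<subseteq> im c" and a: "a \<in> D" "\<phi> c (chart_param c a) = 0"
    and uniq: "\<And>w. w \<in> D \<Longrightarrow> \<phi> c (chart_param c w) = 0 \<Longrightarrow> w = a"
  shows "\<exists>s. s holomorphic_on D \<and> (\<forall>w\<in>D. (w - a) * \<psi> c (chart_param c w) = s w * \<phi> c (chart_param c w))"
\<comment> \<open>For \<psi> = 0 the order of the quotient carries no information, which is why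
  \<open>quotient_at_most_simple_poles\<close> lists this case separately.\<close>
proof (cases "\<psi> = (\<lambda>c p. 0)")
  case True
  then show ?thesis by (intro exI[of _ "\<lambda>_. 0"]) (auto intro: holomorphic_intros)
next
  case False
  define f where "f = (\<lambda>w. \<phi> c (chart_param c w))"
  define g where "g = (\<lambda>w. \<psi> c (chart_param c w))"
  have fh: "f holomorphic_on D" and gh: "g holomorphic_on D"
    unfolding f_def g_def using holomorphic_on_subset[OF qd_holomorphic D(2)] \<phi> \<psi> c by blast+
  have aim: "a \<in> im c" using a D by blast
  have "chart_param c a \<in> dom c" "snd c (chart_param c a) = a" using param_in[OF aim] coord_param[OF aim] by blast+
  then have zo: "zorder (\<lambda>w. g w / f w) a \<ge> -1"
    using q False c unfolding quotient_at_most_simple_poles_def f_def g_def by metis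
  have fnz: "\<forall>\<^sub>F w in at a. f w \<noteq> 0" unfolding f_def by (rule eventually_nonzero[OF \<phi> c aim])
  have gnz: "\<forall>\<^sub>F w in at a. g w \<noteq> 0" unfolding g_def by (rule eventually_nonzero[OF \<psi> False c aim])
  have hol_q: "(\<lambda>w. g w / f w) holomorphic_on D - {a}"
    using uniq by (intro holomorphic_intros holomorphic_on_subset[OF fh] holomorphic_on_subset[OF gh]) (auto simp: f_def)
  have iso: "isolated_singularity_at (\<lambda>w. g w / f w) a"
    by (rule isolated_singularity_at_holomorphic[OF hol_q D(1) a(1)])
  have iso': "isolated_singularity_at g a" "isolated_singularity_at f a"
    by (rule isolated_singularity_at_holomorphic[OF holomorphic_on_subset[OF gh] D(1) a(1)], blast)
       (rule isolated_singularity_at_holomorphic[OF holomorphic_on_subset[OF fh] D(1) a(1)], blast)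
  have ness: "not_essential (\<lambda>w. g w / f w) a"
    by (rule not_essential_divide[OF not_essential_holomorphic[OF gh a(1) D(1)] not_essential_holomorphic[OF fh a(1) D(1)] iso'])
  have "\<forall>\<^sub>F w in at a. g w / f w \<noteq> 0" using fnz gnz by eventually_elim simp
  then have freq: "\<exists>\<^sub>F w in at a. g w / f w \<noteq> 0" by (rule eventually_frequently[OF at_neq_bot])
  define n where "n = zorder (\<lambda>w. g w / f w) a"
  obtain k r where r: "r > 0" "k holomorphic_on cball a r"
    and kr: "\<And>w. w \<in> cball a r - {a} \<Longrightarrow> g w / f w = k w * (w - a) powi n"
    using zorder_exist[OF iso ness freq] unfolding n_def by blast
  have n: "n \<ge> -1" using zo by (simp add: n_def)
  have "continuous_on (cball a r) (\<lambda>w. k w * (w - a) ^ nat (n + 1))"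
    by (intro continuous_intros holomorphic_on_imp_continuous_on r)
  then have "bounded ((\<lambda>w. k w * (w - a) ^ nat (n + 1)) ` cball a r)"
    by (intro compact_imp_bounded compact_continuous_image) auto
  then obtain B where "\<forall>y\<in>(\<lambda>w. k w * (w - a) ^ nat (n + 1)) ` cball a r. cmod y \<le> B" unfolding bounded_iff by blast
  then have B: "cmod (k w * (w - a) ^ nat (n + 1)) \<le> B" if "w \<in> cball a r" for w using that by blast
  \<comment> \<open>The exponent \<open>n + 1\<close> is nonnegative, so the integer power becomes
    an ordinary one and stays bounded at \<open>a\<close>.\<close>
  have eqk: "(w - a) * (g w / f w) = k w * (w - a) ^ nat (n + 1)" if "w \<in> cball a r - {a}" for w
  proof -
    have "(w - a) * ((w - a) powi n) = (w - a) powi (n + 1)" using that by (simp add: power_int_add)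
    also have "\<dots> = (w - a) ^ nat (n + 1)" using n by (simp add: power_int_def)
    finally have "(w - a) * ((w - a) powi n) = (w - a) ^ nat (n + 1)" .
    then show ?thesis unfolding kr[OF that] by (simp add: mult.left_commute)
  qed
  have "\<forall>\<^sub>F w in at a. cmod ((w - a) * (g w / f w)) \<le> B"
    unfolding eventually_at
  proof (intro exI[of _ r] conjI ballI impI r(1))
    fix w assume "w \<noteq> a \<and> dist w a < r"
    then have "w \<in> cball a r - {a}" by (auto simp: dist_commute)
    then show "cmod ((w - a) * (g w / f w)) \<le> B" using eqk B by auto
  qed
  moreover have "(\<lambda>w. (w - a) * (g w / f w)) holomorphic_on D - {a}" by (intro holomorphic_intros hol_q)
  moreover have "a \<in> interior D" using D a by (simp add: interior_open)
  ultimately obtain s where s: "s holomorphic_on D" "\<And>w. w \<in> D - {a} \<Longrightarrow> s w = (w - a) * (g w / f w)"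
    using holomorphic_on_extend_bounded[of "\<lambda>w. (w - a) * (g w / f w)" D a] by blast
  have "(w - a) * g w = s w * f w" if "w \<in> D" for w
  proof (cases "w = a")
    case True then show ?thesis using a(2) by (simp add: f_def)
  next
    case False
    then have "f w \<noteq> 0" using uniq that by (auto simp: f_def)
    then show ?thesis using s(2)[of w] False that by simp
  qed
  then show ?thesis using s(1) unfolding f_def g_def by blast
qed

text \<open>The partition behind \<open>surface_integral\<close> is chosen independently of the
  density, so additivity can be checked piece by piece.\<close>

lemma the_partition:
  fixes f :: "'a chart \<Rightarrow> 'a \<Rightarrow> 'b::{banach, second_countable_topology}"
  shows "\<exists>C E. chart_partition X A C E \<and> (\<forall>f :: 'a chart \<Rightarrow> 'a \<Rightarrow> 'b. surface_integral X A f = (\<Sum>c\<in>C. set_lebesgue_integral lborel (snd c ` E c) (\<lambda>z. f c (chart_param c z)))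
     \<and> (surface_integrable A f \<longrightarrow> (\<forall>c\<in>C. set_integrable lborel (snd c ` E c) (\<lambda>z. f c (chart_param c z)))))"
proof -
  define P where "P = (SOME P. chart_partition X A (fst P) (snd P))"
  have "\<exists>P. chart_partition X A (fst P) (snd P)" using chart_partition_exists by auto
  then have P: "chart_partition X A (fst P) (snd P)" unfolding P_def by (rule someI_ex)
  have "set_integrable lborel (snd c ` snd P c) (\<lambda>z. f c (chart_param c z))"
    if "surface_integrable A f" "c \<in> fst P" for f :: "'a chart \<Rightarrow> 'a \<Rightarrow> 'b" and c
  proof (rule set_integrable_subset)
    show "set_integrable lborel (im c) (\<lambda>z. f c (chart_param c z))"
      using that P unfolding surface_integrable_def chart_partition_def by blast
    show "snd c ` snd P c \<in> sets lborel" "snd c ` snd P c \<subseteq> im c"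
      using that P unfolding chart_partition_def by (auto intro: image_mono)
  qed
  then show ?thesis using P unfolding surface_integral_def P_def[symmetric] Let_def by blast
qed

lemma surface_integral_add:
  assumes "surface_integrable A f" "surface_integrable A g"
  shows "surface_integral X A (\<lambda>c p. f c p + g c p) = surface_integral X A f + surface_integral X A (g :: 'a chart \<Rightarrow> 'a \<Rightarrow> complex)"
proof -
  obtain C E where CE: "chart_partition X A C E" and eq: "\<And>f :: 'a chart \<Rightarrow> 'a \<Rightarrow> complex. surface_integral X A f = (\<Sum>c\<in>C. set_lebesgue_integral lborel (snd c ` E c) (\<lambda>z. f c (chart_param c z)))"
    and int: "\<And>f :: 'a chart \<Rightarrow> 'a \<Rightarrow> complex. surface_integrable A f \<Longrightarrow> (\<forall>c\<in>C. set_integrable lborel (snd c ` E c) (\<lambda>z. f c (chart_param c z)))"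
    using the_partition[where ?'b=complex] by blast
  show ?thesis unfolding eq using int[OF assms(1)] int[OF assms(2)] by (simp add: sum.distrib[symmetric])
qed

lemma surface_integral_mult:
  shows "surface_integral X A (\<lambda>c p. a * f c p) = a * surface_integral X A (f :: 'a chart \<Rightarrow> 'a \<Rightarrow> complex)"
  unfolding surface_integral_def Let_def by (simp add: sum_distrib_left)

lemma surface_integral_cnj:
  shows "surface_integral X A (\<lambda>c p. cnj (f c p)) = cnj (surface_integral X A (f :: 'a chart \<Rightarrow> 'a \<Rightarrow> complex))"
proof -
  have "set_lebesgue_integral lborel S (\<lambda>z. cnj (f z)) = cnj (set_lebesgue_integral lborel S f)" for S :: "complex set" and f
  proof -
    have "(\<lambda>z. indicat_real S z *\<^sub>R cnj (f z)) = (\<lambda>z. cnj (indicat_real S z *\<^sub>R f z))" by auto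
    then show ?thesis unfolding set_lebesgue_integral_def by (simp only: Bochner_Integration.integral_cnj)
  qed
  then show ?thesis unfolding surface_integral_def Let_def by simp
qed

lemma surface_integral_of_real:
  "surface_integral X A (\<lambda>c p. complex_of_real (f c p)) = complex_of_real (surface_integral X A f)"
proof -
  have "set_lebesgue_integral lborel S (\<lambda>z. complex_of_real (f z)) = complex_of_real (set_lebesgue_integral lborel S f)" for S :: "complex set" and f
  proof -
    have "(\<lambda>z. indicat_real S z *\<^sub>R complex_of_real (f z)) = (\<lambda>z. complex_of_real (indicat_real S z *\<^sub>R f z))"
      by (auto simp: scaleR_conv_of_real)
    then show ?thesis unfolding set_lebesgue_integral_def by (simp only: integral_complex_of_real)
  qed
  then show ?thesis unfolding surface_integral_def Let_def by simp
qed

lemma surface_integrable_zero: "surface_integrable A (\<lambda>c p. 0)"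
  by (simp add: surface_integrable_def set_integrable_def)

text \<open>If the integral over one full disc vanished, the nonnegative integrand would vanish
  almost everywhere on it; as \<phi> and \<psi> have finitely many zeros, the open disc would be a
  null set.\<close>

lemma pairing_positive:
  assumes \<phi>: "\<phi> \<in> qd" "\<phi> \<noteq> (\<lambda>c p. 0)" and \<psi>: "\<psi> \<in> qd" "\<psi> \<noteq> (\<lambda>c p. 0)"
    and int: "surface_integrable A (pairing_density \<phi> \<psi> \<psi>)"
  shows "Im (pairing X A \<phi> \<psi> \<psi>) = 0 \<and> Re (pairing X A \<phi> \<psi> \<psi>) > 0"
proof -
  obtain c p where "\<psi> c p \<noteq> 0" using \<psi>(2) by blast
  then have "c \<in> A" "p \<in> dom c" using qd_outside[OF \<psi>(1)] by blast+
  then have p: "p \<in> topspace X" using dom_subset by blast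
  obtain P \<gamma> \<rho> W where pc: "pieces P \<gamma> W" and pP: "p \<in> P"
    and pr: "\<gamma> p \<in> A" "cball (snd (\<gamma> p) p) (\<rho> p) \<subseteq> im (\<gamma> p)" "\<rho> p > 0" and Wp: "W p = ball (snd (\<gamma> p) p) (\<rho> p)"
    using adapted_pieces[of "{p}"] p by auto
  define F where "F q z = (cmod (\<psi> (\<gamma> q) (chart_param (\<gamma> q) z)))\<^sup>2 / (4 * cmod (\<phi> (\<gamma> q) (chart_param (\<gamma> q) z)))" for q z
  have Feq: "pairing_density \<phi> \<psi> \<psi> (\<gamma> q) (chart_param (\<gamma> q) z) = complex_of_real (F q z)" for q z
    unfolding pairing_density_def F_def by (simp add: complex_norm_square[symmetric] flip: of_real_power)
  have Wsub: "W q \<in> sets borel" "W q \<subseteq> im (\<gamma> q)" "\<gamma> q \<in> A" if "q \<in> P" for q using pc that by (auto simp: pieces_def)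
  have intF: "set_integrable lborel (W q) (\<lambda>z. pairing_density \<phi> \<psi> \<psi> (\<gamma> q) (chart_param (\<gamma> q) z))" if "q \<in> P" for q
    by (rule set_integrable_subset[of _ "im (\<gamma> q)"]) (use int Wsub[OF that] in \<open>auto simp: surface_integrable_def\<close>)
  have "integrable lborel (\<lambda>z. complex_of_real (indicator (W q) z *\<^sub>R F q z))" if "q \<in> P" for q
    using intF[OF that] unfolding set_integrable_def Feq by (simp add: scaleR_conv_of_real)
  then have iF: "integrable lborel (\<lambda>z. indicator (W q) z *\<^sub>R F q z)" if "q \<in> P" for q
    unfolding complex_of_real_integrable_eq using that by blast
  have F0: "F q z \<ge> 0" for q z by (simp add: F_def)
  have "pairing X A \<phi> \<psi> \<psi> = (\<Sum>q\<in>P. set_lebesgue_integral lborel (W q) (\<lambda>z. complex_of_real (F q z)))"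
    using surface_integral_pieces[OF pc density_pairing[OF \<phi>(1) \<psi>(1) \<psi>(1)] intF] by (simp add: pairing_def Feq)
  also have "\<dots> = (\<Sum>q\<in>P. complex_of_real (integral\<^sup>L lborel (\<lambda>z. indicator (W q) z *\<^sub>R F q z)))"
  proof (rule sum.cong[OF refl])
    fix q
    have "(\<lambda>z. indicat_real (W q) z *\<^sub>R complex_of_real (F q z)) = (\<lambda>z. complex_of_real (indicator (W q) z *\<^sub>R F q z))"
      by (auto simp: scaleR_conv_of_real)
    then show "set_lebesgue_integral lborel (W q) (\<lambda>z. complex_of_real (F q z)) = complex_of_real (integral\<^sup>L lborel (\<lambda>z. indicator (W q) z *\<^sub>R F q z))"
      unfolding set_lebesgue_integral_def by (simp only: integral_complex_of_real)
  qed
  finally have eq: "pairing X A \<phi> \<psi> \<psi> = complex_of_real (\<Sum>q\<in>P. integral\<^sup>L lborel (\<lambda>z. indicator (W q) z *\<^sub>R F q z))" by simp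
  have nn: "integral\<^sup>L lborel (\<lambda>z. indicator (W q) z *\<^sub>R F q z) \<ge> 0" for q
    by (intro integral_nonneg_AE) (use F0 in auto)
  have pos: "integral\<^sup>L lborel (\<lambda>z. indicator (W p) z *\<^sub>R F p z) > 0"
  proof (rule ccontr)
    assume "\<not> ?thesis"
    then have "integral\<^sup>L lborel (\<lambda>z. indicator (W p) z *\<^sub>R F p z) = 0" using nn[of p] by simp
    then have ae: "AE z in lborel. indicator (W p) z *\<^sub>R F p z = 0"
      using integral_nonneg_eq_0_iff_AE[OF iF[OF pP]] F0 by simp
    let ?Z = "{z \<in> im (\<gamma> p). \<phi> (\<gamma> p) (chart_param (\<gamma> p) z) = 0} \<union> {z \<in> im (\<gamma> p). \<psi> (\<gamma> p) (chart_param (\<gamma> p) z) = 0}"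
    have "finite ?Z" using finite_zeros_chart[OF \<phi> pr(1)] finite_zeros_chart[OF \<psi> pr(1)] by simp
    then have "?Z \<in> null_sets lborel" by (rule finite_imp_null_set_lborel)
    then have "AE z in lborel. z \<notin> ?Z" by (rule AE_not_in)
    with ae have "AE z in lborel. z \<notin> W p"
    proof eventually_elim
      case (elim z)
      then show ?case using Wsub(2)[OF pP] by (auto simp: F_def)
    qed
    then have "W p \<in> null_sets lborel" using Wsub(1)[OF pP] by (subst (asm) AE_iff_null) auto
    then have "negligible (W p)" using null_sets_completionI negligible_iff_null_sets by blast
    moreover have "W p \<noteq> {}" "open (W p)" using Wp pr by auto
    ultimately show False using open_not_negligible by blast
  qed
  have "finite P" using pc by (simp add: pieces_def)
  then have "(\<Sum>q\<in>P. integral\<^sup>L lborel (\<lambda>z. indicator (W q) z *\<^sub>R F q z)) > 0"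
    using nn pos pP by (intro sum_pos2[of P p]) auto
  then show ?thesis unfolding eq by simp
qed

end

lemma borel_measurable_csqrt [measurable]: "csqrt \<in> borel_measurable borel"
  unfolding borel_measurable_complex_iff by (simp add: sgn_if)

section \<open>Smooth dependence of the pairing on parameters\<close>

text \<open>The half plane \<open>Re R > 0\<close> avoids the cut of \<open>csqrt\<close>.\<close>

lemma csqrt_near_one:
  assumes "cmod (R - 1) \<le> 1/2"
  shows "R \<notin> \<real>\<^sub>\<le>\<^sub>0" "R \<noteq> 0" "(cmod (csqrt R))\<^sup>2 = cmod R" "csqrt R \<noteq> 0"
proof -
  have "\<bar>Re R - 1\<bar> \<le> 1/2" using abs_Re_le_cmod[of "R - 1"] assms by simp
  then have "Re R > 0" by arith
  then show "R \<notin> \<real>\<^sub>\<le>\<^sub>0" "R \<noteq> 0" by (auto simp: complex_nonpos_Reals_iff)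
  then show "csqrt R \<noteq> 0" by simp
  show "(cmod (csqrt R))\<^sup>2 = cmod R" by (metis norm_power power2_csqrt)
qed

text \<open>The modulus in the denominator is a product of a holomorphic and an antiholomorphic square
  root, whose branch is fixed by comparison with a reference function.\<close>

lemma pairing_family_smooth:
  fixes \<phi> \<psi>\<^sub>1 \<psi>\<^sub>2 :: "complex^'n::finite \<Rightarrow> 'w \<Rightarrow> complex"
  assumes m: "\<And>z. z \<in> ball x r \<Longrightarrow> \<phi> z \<in> borel_measurable M" "\<And>z. z \<in> ball x r \<Longrightarrow> \<psi>\<^sub>1 z \<in> borel_measurable M"
      "\<And>z. z \<in> ball x r \<Longrightarrow> \<psi>\<^sub>2 z \<in> borel_measurable M" "\<phi>\<^sub>0 \<in> borel_measurable M"
    and nz: "\<And>w. w \<in> space M \<Longrightarrow> \<phi>\<^sub>0 w \<noteq> 0"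
    and hol: "\<And>w z v. w \<in> space M \<Longrightarrow> (\<lambda>s. \<phi> (z + s *s v) w) holomorphic_on {s. z + s *s v \<in> ball x r}"
       "\<And>w z v. w \<in> space M \<Longrightarrow> (\<lambda>s. \<psi>\<^sub>1 (z + s *s v) w) holomorphic_on {s. z + s *s v \<in> ball x r}"
       "\<And>w z v. w \<in> space M \<Longrightarrow> (\<lambda>s. \<psi>\<^sub>2 (z + s *s v) w) holomorphic_on {s. z + s *s v \<in> ball x r}"
    and near: "\<And>w z. w \<in> space M \<Longrightarrow> z \<in> ball x r \<Longrightarrow> cmod (\<phi> z w / \<phi>\<^sub>0 w - 1) \<le> 1/2"
    and bnd: "\<And>w z. w \<in> space M \<Longrightarrow> z \<in> ball x r \<Longrightarrow> (cmod (\<psi>\<^sub>1 z w))\<^sup>2 \<le> B w * cmod (\<phi> z w)"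
       "\<And>w z. w \<in> space M \<Longrightarrow> z \<in> ball x r \<Longrightarrow> (cmod (\<psi>\<^sub>2 z w))\<^sup>2 \<le> B w * cmod (\<phi> z w)"
    and B: "integrable M B" "\<And>w. w \<in> space M \<Longrightarrow> B w \<ge> 0"
  shows "z \<in> ball x r \<Longrightarrow> integrable M (\<lambda>w. \<psi>\<^sub>1 z w * cnj (\<psi>\<^sub>2 z w) / (4 * complex_of_real (cmod (\<phi> z w))))"
    and "0 < r' \<Longrightarrow> r' < r \<Longrightarrow> C_upto m UNIV (ball x r') (\<lambda>z. \<integral>w. \<psi>\<^sub>1 z w * cnj (\<psi>\<^sub>2 z w) / (4 * complex_of_real (cmod (\<phi> z w))) \<partial>M)"
proof -
  \<comment> \<open>Normalised so that the squared modulus of the denominator of \<open>p\<close> is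
    \<open>4 * cmod (\<phi> z w)\<close>; \<kappa> does not depend on the parameter, so holomorphy
    is not affected.\<close>
  define \<kappa> where "\<kappa> w = complex_of_real (2 * sqrt (cmod (\<phi>\<^sub>0 w)))" for w
  define p where "p \<psi> z w = \<psi> z w / (\<kappa> w * csqrt (\<phi> z w / \<phi>\<^sub>0 w))" for \<psi> :: "complex^'n \<Rightarrow> 'w \<Rightarrow> complex" and z w
  have den: "(cmod (\<kappa> w * csqrt (\<phi> z w / \<phi>\<^sub>0 w)))\<^sup>2 = 4 * cmod (\<phi> z w)" "\<kappa> w * csqrt (\<phi> z w / \<phi>\<^sub>0 w) \<noteq> 0" "cmod (\<phi> z w) > 0"
    if "w \<in> space M" "z \<in> ball x r" for w z
  proof -
    note c = csqrt_near_one[OF near[OF that]]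
    show "(cmod (\<kappa> w * csqrt (\<phi> z w / \<phi>\<^sub>0 w)))\<^sup>2 = 4 * cmod (\<phi> z w)"
      unfolding norm_mult power_mult_distrib c(3) using nz[OF that(1)] by (simp add: \<kappa>_def norm_divide power_mult_distrib)
    show "\<kappa> w * csqrt (\<phi> z w / \<phi>\<^sub>0 w) \<noteq> 0" using c(2,4) nz[OF that(1)] by (auto simp: \<kappa>_def)
    show "cmod (\<phi> z w) > 0" using c(2) by auto
  qed
  \<comment> \<open>The majorant is \<open>sqrt (B w)\<close>: its square is integrable, as
    \<open>C_upto_hol_integral\<close> requires.\<close>
  have fam: "hol_fam M (\<lambda>w. sqrt (B w)) x r (p \<psi>)"
    if mp: "\<And>z. z \<in> ball x r \<Longrightarrow> \<psi> z \<in> borel_measurable M"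
      and hp: "\<And>w z v. w \<in> space M \<Longrightarrow> (\<lambda>s. \<psi> (z + s *s v) w) holomorphic_on {s. z + s *s v \<in> ball x r}"
      and bp: "\<And>w z. w \<in> space M \<Longrightarrow> z \<in> ball x r \<Longrightarrow> (cmod (\<psi> z w))\<^sup>2 \<le> B w * cmod (\<phi> z w)" for \<psi>
    unfolding hol_fam_def
  proof (intro conjI ballI gholI)
    fix z assume z: "z \<in> ball x r"
    have [measurable]: "\<phi> z \<in> borel_measurable M" "\<psi> z \<in> borel_measurable M" "\<phi>\<^sub>0 \<in> borel_measurable M" using m mp z by auto
    show "p \<psi> z \<in> borel_measurable M" unfolding p_def[abs_def] \<kappa>_def[abs_def] by measurable
  next
    fix w z assume w: "w \<in> space M" and z: "z \<in> ball x r"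
    have "(cmod (p \<psi> z w))\<^sup>2 = (cmod (\<psi> z w))\<^sup>2 / (4 * cmod (\<phi> z w))"
      unfolding p_def norm_divide power_divide den[OF w z] ..
    also have "\<dots> \<le> B w * cmod (\<phi> z w) / (4 * cmod (\<phi> z w))" by (intro divide_right_mono bp w z) simp
    also have "\<dots> \<le> B w" using den(3)[OF w z] B(2)[OF w] by simp
    finally show "cmod (p \<psi> z w) \<le> sqrt (B w)" by (rule real_le_rsqrt)
  next
    fix w z v assume w: "w \<in> space M"
    show "(\<lambda>s. p \<psi> (z + s *s v) w) holomorphic_on {s. z + s *s v \<in> ball x r}"
      unfolding p_def
    proof (intro holomorphic_on_divide hp w holomorphic_on_mult holomorphic_on_const holomorphic_on_csqrt')
      show "\<And>s. s \<in> {s. z + s *s v \<in> ball x r} \<Longrightarrow> \<kappa> w * csqrt (\<phi> (z + s *s v) w / \<phi>\<^sub>0 w) \<noteq> 0" using den(2)[OF w] by blast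
      show "\<And>s. s \<in> {s. z + s *s v \<in> ball x r} \<Longrightarrow> \<phi> (z + s *s v) w / \<phi>\<^sub>0 w \<notin> \<real>\<^sub>\<le>\<^sub>0" using csqrt_near_one(1)[OF near[OF w]] by blast
    qed (use hol(1)[OF w] nz[OF w] in auto)
  qed
  have f1: "hol_fam M (\<lambda>w. sqrt (B w)) x r (p \<psi>\<^sub>1)" by (rule fam[OF m(2) hol(2) bnd(1)])
  have f2: "hol_fam M (\<lambda>w. sqrt (B w)) x r (p \<psi>\<^sub>2)" by (rule fam[OF m(3) hol(3) bnd(2)])
  have eq: "p \<psi>\<^sub>1 z w * cnj (p \<psi>\<^sub>2 z w) = \<psi>\<^sub>1 z w * cnj (\<psi>\<^sub>2 z w) / (4 * complex_of_real (cmod (\<phi> z w)))" if "w \<in> space M" "z \<in> ball x r" for w z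
  proof -
    have "p \<psi>\<^sub>1 z w * cnj (p \<psi>\<^sub>2 z w) = \<psi>\<^sub>1 z w * cnj (\<psi>\<^sub>2 z w) / ((\<kappa> w * csqrt (\<phi> z w / \<phi>\<^sub>0 w)) * cnj (\<kappa> w * csqrt (\<phi> z w / \<phi>\<^sub>0 w)))"
      by (simp add: p_def)
    then show ?thesis unfolding complex_norm_square[symmetric] den(1)[OF that] by simp
  qed
  have iB: "integrable M (\<lambda>w. (sqrt (B w))\<^sup>2)"
    using B by (subst Bochner_Integration.integrable_cong[OF refl, of _ _ B]) auto
  show "integrable M (\<lambda>w. \<psi>\<^sub>1 z w * cnj (\<psi>\<^sub>2 z w) / (4 * complex_of_real (cmod (\<phi> z w))))" if z: "z \<in> ball x r"
  proof -
    have "integrable M (\<lambda>w. p \<psi>\<^sub>1 z w * cnj (p \<psi>\<^sub>2 z w))" by (rule hol_fam_product_integrable[OF f1 f2 iB z])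
    then show ?thesis using eq[OF _ z] by (subst Bochner_Integration.integrable_cong[OF refl, of _ _ "\<lambda>w. p \<psi>\<^sub>1 z w * cnj (p \<psi>\<^sub>2 z w)"]) auto
  qed
  assume r: "0 < r'" "r' < r"
  have "C_upto m UNIV (ball x r') (\<lambda>z. \<integral>w. p \<psi>\<^sub>1 z w * cnj (p \<psi>\<^sub>2 z w) \<partial>M)"
    by (rule C_upto_hol_integral[OF f1 f2 iB r])
  then show "C_upto m UNIV (ball x r') (\<lambda>z. \<integral>w. \<psi>\<^sub>1 z w * cnj (\<psi>\<^sub>2 z w) / (4 * complex_of_real (cmod (\<phi> z w))) \<partial>M)"
  proof (rule C_upto_cong[OF coord_open_open[OF open_ball], rotated])
    fix z assume "z \<in> ball x r'"
    then have "z \<in> ball x r" using r by auto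
    then show "(\<integral>w. p \<psi>\<^sub>1 z w * cnj (p \<psi>\<^sub>2 z w) \<partial>M) = (\<integral>w. \<psi>\<^sub>1 z w * cnj (\<psi>\<^sub>2 z w) / (4 * complex_of_real (cmod (\<phi> z w))) \<partial>M)"
      by (intro Bochner_Integration.integral_cong refl eq)
  qed
qed

section \<open>Families of linear combinations of fixed functions\<close>

lemma ghol_cong:
  assumes "ghol B x r f" "\<And>z. z \<in> ball x r \<Longrightarrow> f z = g z" shows "ghol B x r g"
proof (rule gholI)
  show "cmod (g z) \<le> B" if "z \<in> ball x r" for z using ghol_bound[OF assms(1) that] assms(2)[OF that] by simp
  show "(\<lambda>s. g (z + s *s v)) holomorphic_on {s. z + s *s v \<in> ball x r}" for z v
    by (rule holomorphic_transform[OF ghol_holomorphic[OF assms(1)]]) (use assms(2) in blast)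
qed

text \<open>The local coefficient of the differential with coordinates \<open>y\<close>, where
  \<open>\<epsilon> j\<close> is the coefficient of the \<open>j\<close>-th basis element in a
  chart. A family arises by letting \<open>y\<close> depend on a parameter.\<close>

definition lin_comb :: "('n::finite \<Rightarrow> complex \<Rightarrow> complex) \<Rightarrow> complex^'n \<Rightarrow> complex \<Rightarrow> complex" where
  "lin_comb \<epsilon> y z = (\<Sum>j\<in>UNIV. y $ j * \<epsilon> j z)"

definition vghol :: "real \<Rightarrow> complex^'n::finite \<Rightarrow> real \<Rightarrow> (complex^'n \<Rightarrow> complex^'m::finite) \<Rightarrow> bool" where
  "vghol B x r Y \<longleftrightarrow> (\<forall>j. ghol B x r (\<lambda>z. Y z $ j))"

lemma vghol_ghol: "vghol B x r Y \<Longrightarrow> ghol B x r (\<lambda>z. Y z $ j)"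
  by (simp add: vghol_def)

lemma vghol_mono: "vghol B x r Y \<Longrightarrow> r' \<le> r \<Longrightarrow> B \<le> B' \<Longrightarrow> vghol B' x r' Y"
  unfolding vghol_def using ghol_mono by blast

lemma lin_comb_holomorphic: "(\<And>j. \<epsilon> j holomorphic_on S) \<Longrightarrow> lin_comb \<epsilon> y holomorphic_on S"
  unfolding lin_comb_def[abs_def] by (intro holomorphic_intros)

lemma lin_comb_continuous: "(\<And>j. continuous_on S (\<epsilon> j)) \<Longrightarrow> continuous_on S (lin_comb \<epsilon> y)"
  unfolding lin_comb_def[abs_def] by (intro continuous_intros)

lemma lin_comb_diff: "lin_comb \<epsilon> y z - lin_comb \<epsilon> y' z = lin_comb \<epsilon> (y - y') z"
  by (simp add: lin_comb_def sum_subtractf[symmetric] algebra_simps)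

lemma lin_comb_bound:
  fixes y :: "complex^'n::finite"
  assumes "\<And>j. cmod (y $ j) \<le> B" "\<And>j. cmod (\<epsilon> j z) \<le> E" "E \<ge> 0"
  shows "cmod (lin_comb \<epsilon> y z) \<le> of_nat (CARD('n)) * (B * E)"
proof -
  have "cmod (lin_comb \<epsilon> y z) \<le> (\<Sum>j\<in>(UNIV::'n set). B * E)"
    unfolding lin_comb_def
  proof (rule sum_norm_le)
    fix j
    have "0 \<le> B" using assms(1)[of j] norm_ge_zero order_trans by blast
    then show "cmod (y $ j * \<epsilon> j z) \<le> B * E" unfolding norm_mult using assms by (intro mult_mono) auto
  qed
  then show ?thesis by simp
qed

lemma vghol_Lipschitz:
  fixes Y :: "complex^'n::finite \<Rightarrow> complex^'m::finite"
  assumes "vghol B x r Y" "r' < r" "z \<in> ball x r'" "y \<in> ball x r'"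
  shows "cmod ((Y y - Y z) $ j) \<le> B / (r - r') * norm (y - z)"
  using ghol_Lipschitz[of B x r "\<lambda>z. Y z $ j" r' z y] assms by (simp add: vghol_def)

lemma ghol_lin_comb:
  fixes Y :: "complex^'n::finite \<Rightarrow> complex^'m::finite"
  assumes Y: "vghol B x r Y" and E: "\<And>j. cmod (\<epsilon> j w) \<le> E" "E \<ge> 0"
  shows "ghol (of_nat (CARD('m)) * (B * E)) x r (\<lambda>z. lin_comb \<epsilon> (Y z) w)"
proof (rule gholI)
  show "cmod (lin_comb \<epsilon> (Y z) w) \<le> of_nat (CARD('m)) * (B * E)" if "z \<in> ball x r" for z
  proof (rule lin_comb_bound)
    show "cmod (Y z $ j) \<le> B" for j using ghol_bound[of B x r "\<lambda>z. Y z $ j" z] Y that by (simp add: vghol_def)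
  qed (use E in auto)
  show "(\<lambda>s. lin_comb \<epsilon> (Y (z + s *s v)) w) holomorphic_on {s. z + s *s v \<in> ball x r}" for z v
    unfolding lin_comb_def by (intro holomorphic_intros ghol_holomorphic[OF vghol_ghol[OF Y]])
qed

lemma lin_comb_bounded_on_compact:
  fixes \<epsilon> :: "'m::finite \<Rightarrow> complex \<Rightarrow> complex"
  assumes "compact S" "\<And>j. continuous_on S (\<epsilon> j)"
  obtains E where "E > 0" "\<And>j z. z \<in> S \<Longrightarrow> cmod (\<epsilon> j z) \<le> E"
proof -
  have "\<exists>E. \<forall>z\<in>S. cmod (\<epsilon> j z) \<le> E" for j
  proof -
    have "bounded (\<epsilon> j ` S)" by (intro compact_imp_bounded compact_continuous_image assms)
    then show ?thesis by (auto simp: bounded_iff)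
  qed
  then obtain E where E: "\<And>j z. z \<in> S \<Longrightarrow> cmod (\<epsilon> j z) \<le> E j" by metis
  have "cmod (\<epsilon> j z) \<le> Max (range E)" if "z \<in> S" for j z
  proof -
    have "E j \<le> Max (range E)" by (rule Max_ge) auto
    then show ?thesis using E[OF that, of j] by linarith
  qed
  then show ?thesis by (intro that[of "max 1 (Max (range E))"]) (auto simp: le_max_iff_disj)
qed

lemma lin_comb_variation:
  fixes \<epsilon> :: "'m::finite \<Rightarrow> complex \<Rightarrow> complex" and Y :: "complex^'n::finite \<Rightarrow> complex^'m"
  assumes S: "compact S" "\<And>j. continuous_on S (\<epsilon> j)" and Y: "vghol B x r Y" and r: "r > 0" and \<eta>: "\<eta> > 0"
  obtains r' where "0 < r'" "r' < r" "\<And>z w. z \<in> ball x r' \<Longrightarrow> w \<in> S \<Longrightarrow> cmod (lin_comb \<epsilon> (Y z) w - lin_comb \<epsilon> (Y x) w) \<le> \<eta>"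
proof -
  obtain E where E: "E > 0" "\<And>j z. z \<in> S \<Longrightarrow> cmod (\<epsilon> j z) \<le> E" using lin_comb_bounded_on_compact[where \<epsilon> = \<epsilon>, OF S] by metis
  have B: "B \<ge> 0" using ghol_nonneg[OF vghol_ghol[OF Y] r] .
  define C where "C = of_nat (CARD('m)) * (B / (r / 2) * E)"
  have C: "C \<ge> 0" using B E r by (simp add: C_def)
  \<comment> \<open>At most \<open>r / 2\<close>, for the Lipschitz estimate, and so small that
    \<open>C * r' \<le> \<eta>\<close>; the \<open>+ 1\<close> avoids a zero denominator.\<close>
  define r' where "r' = min (r / 2) (\<eta> / (C + 1))"
  have r': "0 < r'" "r' \<le> r/2" "r' < r" "C * r' \<le> \<eta>"
  proof -
    show "0 < r'" using r \<eta> C by (simp add: r'_def)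
    show "r' \<le> r/2" unfolding r'_def by (rule min.cobounded1)
    then show "r' < r" using r by simp
    have "C * r' \<le> C * (\<eta> / (C + 1))" using C by (intro mult_left_mono) (auto simp: r'_def)
    also have "\<dots> \<le> \<eta>" using C \<eta> by (simp add: field_simps)
    finally show "C * r' \<le> \<eta>" .
  qed
  have "cmod (lin_comb \<epsilon> (Y z) w - lin_comb \<epsilon> (Y x) w) \<le> \<eta>" if z: "z \<in> ball x r'" and w: "w \<in> S" for z w
  proof -
    have zr: "z \<in> ball x (r/2)" "x \<in> ball x (r/2)" using z r' r by auto
    have "cmod ((Y z - Y x) $ j) \<le> B / (r / 2) * r'" for j
    proof -
      have "cmod ((Y z - Y x) $ j) \<le> B / (r - r/2) * norm (z - x)" by (rule vghol_Lipschitz[OF Y _ zr(2,1)]) (use r in simp)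
      also have "\<dots> \<le> B / (r / 2) * r'" using z B r by (intro mult_mono) (auto simp: dist_norm norm_minus_commute)
      finally show ?thesis .
    qed
    then have "cmod (lin_comb \<epsilon> (Y z - Y x) w) \<le> of_nat (CARD('m)) * ((B / (r / 2) * r') * E)"
      by (rule lin_comb_bound) (use E w in auto)
    also have "\<dots> = C * r'" by (simp add: C_def)
    finally show ?thesis unfolding lin_comb_diff using r'(4) by simp
  qed
  then show ?thesis using that[OF r'(1,3)] by blast
qed

lemma compact_nonzero_lower_bound:
  fixes f :: "complex \<Rightarrow> complex"
  assumes "compact S" "continuous_on S f" "\<And>z. z \<in> S \<Longrightarrow> f z \<noteq> 0"
  obtains \<delta> where "\<delta> > 0" "\<And>z. z \<in> S \<Longrightarrow> \<delta> \<le> cmod (f z)"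
proof (cases "S = {}")
  case True then show ?thesis using that[of 1] by auto
next
  case False
  obtain z where "z \<in> S" "\<And>w. w \<in> S \<Longrightarrow> cmod (f z) \<le> cmod (f w)"
    using continuous_attains_inf[OF assms(1) False, of "\<lambda>z. cmod (f z)"] assms(2) by (auto intro: continuous_intros)
  then show ?thesis using that[of "cmod (f z)"] assms(3) by auto
qed

text \<open>The case away from the zeros: \<open>\<bar>\<phi>\<bar>\<close> has a positive lower
  bound on the compact set, so a constant majorant will do in \<open>pairing_family_smooth\<close>,
  with the differential at the centre of the ball as reference function.\<close>

lemma pairing_piece_smooth:
  fixes \<epsilon> :: "'m::finite \<Rightarrow> complex \<Rightarrow> complex" and P Y\<^sub>1 Y\<^sub>2 :: "complex^'n::finite \<Rightarrow> complex^'m"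
  assumes S: "compact S" "\<And>j. continuous_on S (\<epsilon> j)" and W: "W \<in> sets borel" "W \<subseteq> S"
    and r: "r > 0" and P: "vghol B x r P" and Y1: "vghol B x r Y\<^sub>1" and Y2: "vghol B x r Y\<^sub>2"
    and nz: "\<And>w. w \<in> S \<Longrightarrow> lin_comb \<epsilon> (P x) w \<noteq> 0"
  shows "\<exists>r'>0. (\<forall>z\<in>ball x r'. set_integrable lborel W (\<lambda>w. lin_comb \<epsilon> (Y\<^sub>1 z) w * cnj (lin_comb \<epsilon> (Y\<^sub>2 z) w) / (4 * complex_of_real (cmod (lin_comb \<epsilon> (P z) w))))) \<and>
     (\<forall>m. C_upto m UNIV (ball x r') (\<lambda>z. set_lebesgue_integral lborel W (\<lambda>w. lin_comb \<epsilon> (Y\<^sub>1 z) w * cnj (lin_comb \<epsilon> (Y\<^sub>2 z) w) / (4 * complex_of_real (cmod (lin_comb \<epsilon> (P z) w))))))"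
proof -
  let ?M = "restrict_space lborel W"
  have WM: "W \<inter> space lborel \<in> sets lborel" using W by simp
  have sp: "space ?M = W" by (simp add: space_restrict_space)
  obtain \<delta> where \<delta>: "\<delta> > 0" "\<And>z. z \<in> S \<Longrightarrow> \<delta> \<le> cmod (lin_comb \<epsilon> (P x) z)"
    using compact_nonzero_lower_bound[OF S(1) lin_comb_continuous[where \<epsilon> = \<epsilon>, OF S(2)] nz] by metis
  obtain r1 where r1: "0 < r1" "r1 < r" "\<And>z w. z \<in> ball x r1 \<Longrightarrow> w \<in> S \<Longrightarrow> cmod (lin_comb \<epsilon> (P z) w - lin_comb \<epsilon> (P x) w) \<le> \<delta> / 2"
    using lin_comb_variation[where \<epsilon> = \<epsilon>, OF S P r, of "\<delta>/2"] \<delta>(1) by (metis half_gt_zero)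
  obtain E where E: "E > 0" "\<And>j z. z \<in> S \<Longrightarrow> cmod (\<epsilon> j z) \<le> E" using lin_comb_bounded_on_compact[where \<epsilon> = \<epsilon>, OF S] by metis
  define C where "C = of_nat (CARD('m)) * (B * E)"
  have g: "ghol C x r1 (\<lambda>z. lin_comb \<epsilon> (Y z) w)" if "vghol B x r Y" "w \<in> S" for Y w
    unfolding C_def by (rule ghol_mono[OF ghol_lin_comb[OF that(1)]]) (use E that r1 in auto)
  have half: "\<delta> / 2 \<le> cmod (lin_comb \<epsilon> (P z) w)" if "z \<in> ball x r1" "w \<in> S" for z w
    using norm_triangle_ineq3[of "lin_comb \<epsilon> (P z) w" "lin_comb \<epsilon> (P x) w"] r1(3)[OF that] \<delta>(2)[OF that(2)] by linarith
  have meas: "lin_comb \<epsilon> y \<in> borel_measurable ?M" for y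
  proof -
    have "borel_measurable ?M = borel_measurable (restrict_space borel W)"
      by (rule measurable_cong_sets) (simp_all add: sets_restrict_space)
    then show ?thesis
      using borel_measurable_continuous_on_restrict[OF continuous_on_subset[OF lin_comb_continuous[where \<epsilon> = \<epsilon>, OF S(2)] W(2)]] by simp
  qed
  have fin: "emeasure lborel W < \<infinity>"
    using emeasure_bounded_finite[OF bounded_subset[OF compact_imp_bounded[OF S(1)] W(2)]] .
  note L = pairing_family_smooth[where M = ?M and x = x and r = r1 and \<phi> = "\<lambda>z. lin_comb \<epsilon> (P z)" and \<psi>\<^sub>1 = "\<lambda>z. lin_comb \<epsilon> (Y\<^sub>1 z)" and \<psi>\<^sub>2 = "\<lambda>z. lin_comb \<epsilon> (Y\<^sub>2 z)" and \<phi>\<^sub>0 = "lin_comb \<epsilon> (P x)"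
      and B = "\<lambda>w. C\<^sup>2 / (\<delta> / 2)"]
  have sq: "(cmod (lin_comb \<epsilon> (Y z) w))\<^sup>2 \<le> C\<^sup>2 / (\<delta> / 2) * cmod (lin_comb \<epsilon> (P z) w)" if "vghol B x r Y" "w \<in> S" "z \<in> ball x r1" for Y z w
  proof -
    have "(cmod (lin_comb \<epsilon> (Y z) w))\<^sup>2 \<le> C\<^sup>2" using ghol_bound[OF g[OF that(1,2)] that(3)] by (rule power_mono) simp
    also have "\<dots> = C\<^sup>2 / (\<delta> / 2) * (\<delta> / 2)" using \<delta> by simp
    also have "\<dots> \<le> C\<^sup>2 / (\<delta> / 2) * cmod (lin_comb \<epsilon> (P z) w)" using half[OF that(3,2)] \<delta> by (intro mult_left_mono) auto
    finally show ?thesis .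
  qed
  have near: "cmod (lin_comb \<epsilon> (P z) w / lin_comb \<epsilon> (P x) w - 1) \<le> 1 / 2" if "w \<in> S" "z \<in> ball x r1" for z w
  proof -
    have "lin_comb \<epsilon> (P z) w / lin_comb \<epsilon> (P x) w - 1 = (lin_comb \<epsilon> (P z) w - lin_comb \<epsilon> (P x) w) / lin_comb \<epsilon> (P x) w"
      using nz[OF that(1)] by (simp add: diff_divide_distrib)
    also have "cmod \<dots> \<le> (\<delta> / 2) / \<delta>" unfolding norm_divide using r1(3)[OF that(2,1)] \<delta>(2)[OF that(1)] \<delta>(1) by (intro frac_le) auto
    finally show ?thesis using \<delta> by simp
  qed
  have bint: "integrable ?M (\<lambda>w. C\<^sup>2 / (\<delta> / 2))"
  proof -
    have "finite_measure ?M" by (rule finite_measureI) (use fin W in \<open>simp add: emeasure_restrict_space space_restrict_space\<close>)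
    then show ?thesis by (rule finite_measure.integrable_const)
  qed
  have 1: "integrable ?M (\<lambda>w. lin_comb \<epsilon> (Y\<^sub>1 z) w * cnj (lin_comb \<epsilon> (Y\<^sub>2 z) w) / (4 * complex_of_real (cmod (lin_comb \<epsilon> (P z) w))))" if "z \<in> ball x r1" for z
    by (rule L(1)) (use that W(2) sp meas nz near sq[OF Y1] sq[OF Y2] g[OF P] g[OF Y1] g[OF Y2] bint \<delta> in \<open>auto simp: ghol_def subset_iff\<close>)
  have 2: "C_upto m UNIV (ball x (r1/2)) (\<lambda>z. \<integral>w. lin_comb \<epsilon> (Y\<^sub>1 z) w * cnj (lin_comb \<epsilon> (Y\<^sub>2 z) w) / (4 * complex_of_real (cmod (lin_comb \<epsilon> (P z) w))) \<partial>?M)" for m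
    by (rule L(2)) (use r1 W(2) sp meas nz near sq[OF Y1] sq[OF Y2] g[OF P] g[OF Y1] g[OF Y2] bint \<delta> in \<open>auto simp: ghol_def subset_iff\<close>)
  have e1: "integrable ?M f \<longleftrightarrow> set_integrable lborel W f" for f :: "complex \<Rightarrow> complex"
    unfolding set_integrable_def by (rule integrable_restrict_space[OF WM])
  have e2: "integral\<^sup>L ?M f = set_lebesgue_integral lborel W f" for f :: "complex \<Rightarrow> complex"
    unfolding set_lebesgue_integral_def by (rule integral_restrict_space[OF WM])
  show ?thesis
    using 1 2 r1 unfolding e1 e2 by (intro exI[of _ "r1/2"]) auto
qed


section \<open>The zero of a family as a holomorphic function of the parameter\<close>

lemma ghol_tendsto:
  assumes "ghol B x r f" "r > 0" shows "(f \<longlongrightarrow> f x) (nhds x)"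
proof -
  have "((\<lambda>z. f z - f x) \<longlongrightarrow> 0) (nhds x)"
  proof (rule Lim_null_comparison)
    have "\<forall>\<^sub>F z in nhds x. z \<in> ball x (r/2)" using assms(2) by (intro eventually_nhds_in_open) auto
    then show "\<forall>\<^sub>F z in nhds x. norm (f z - f x) \<le> B / (r - r/2) * norm (z - x)"
    proof eventually_elim
      case (elim z)
      have "r / 2 < r" "x \<in> ball x (r / 2)" using assms(2) by simp_all
      then show ?case using ghol_Lipschitz[OF assms(1) _ _ elim] by simp
    qed
    show "((\<lambda>z. B / (r - r/2) * norm (z - x)) \<longlongrightarrow> 0) (nhds x)"
      using assms(2) by (auto intro!: tendsto_eq_intros filterlim_ident)
  qed
  then show ?thesis using Lim_null by blast
qed

lemma vghol_tendsto:
  assumes "vghol B x r Y" "r > 0" shows "(Y \<longlongrightarrow> Y x) (nhds x)"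
  by (rule vec_tendstoI, rule ghol_tendsto[OF vghol_ghol[OF assms(1)] assms(2)])

text \<open>Uniform continuity on the compact product gives closeness in the parameter uniformly in
  \<open>w\<close>.\<close>

lemma compact_param_near:
  fixes g :: "'p::metric_space \<Rightarrow> 'q::metric_space \<Rightarrow> complex"
  assumes "compact K" "compact S" "p0 \<in> K" "continuous_on (K \<times> S) (\<lambda>q. g (fst q) (snd q))" "\<eta> > 0"
  obtains \<delta> where "\<delta> > 0" "\<And>p w. p \<in> K \<Longrightarrow> w \<in> S \<Longrightarrow> dist p p0 < \<delta> \<Longrightarrow> dist (g p w) (g p0 w) < \<eta>"
proof -
  have "uniformly_continuous_on (K \<times> S) (\<lambda>q. g (fst q) (snd q))"
    by (intro compact_uniformly_continuous compact_Times assms)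
  then obtain \<delta> where \<delta>: "\<delta> > 0" "\<And>q q'. q \<in> K \<times> S \<Longrightarrow> q' \<in> K \<times> S \<Longrightarrow> dist q' q < \<delta> \<Longrightarrow> dist (g (fst q') (snd q')) (g (fst q) (snd q)) < \<eta>"
    using assms(5) unfolding uniformly_continuous_on_def by metis
  show ?thesis
  proof (rule that[OF \<delta>(1)])
    fix p w assume "p \<in> K" "w \<in> S" "dist p p0 < \<delta>"
    then show "dist (g p w) (g p0 w) < \<eta>" using \<delta>(2)[of "(p0, w)" "(p, w)"] assms(3) by (simp add: dist_Pair_Pair)
  qed
qed

text \<open>\<open>f\<close> is divided by the exact power of \<open>w - a\<close>, and the quotient
  extends over \<open>a\<close> as a removable singularity. As \<open>a\<close> is the only zero in
  the closed disc, the cofactor has none there.\<close>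

lemma zero_factorization:
  fixes f :: "complex \<Rightarrow> complex"
  assumes f: "f holomorphic_on D" and D: "open D" "cball z0 \<rho> \<subseteq> D" and a: "a \<in> ball z0 \<rho>" "f a = 0"
    and uniq: "\<And>w. w \<in> cball z0 \<rho> \<Longrightarrow> f w = 0 \<Longrightarrow> w = a"
  shows "\<exists>n u. n \<ge> 1 \<and> u holomorphic_on D \<and> (\<forall>w\<in>D. f w = (w - a) ^ n * u w) \<and> (\<forall>w\<in>cball z0 \<rho>. u w \<noteq> 0)"
proof -
  obtain e where e: "e > 0" "ball a e \<subseteq> ball z0 \<rho>" using a(1) openE by blast
  have sub: "ball a e \<subseteq> D" "ball a e \<subseteq> cball z0 \<rho>" using e D ball_subset_cball by blast+
  define n where "n = nat (zorder f a)"
  have "a + of_real (e/2) \<in> ball a e" "a + of_real (e/2) \<noteq> a" using e by (auto simp: dist_norm)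
  then have ex: "\<exists>w\<in>ball a e. f w \<noteq> 0" using uniq sub(2) by blast
  obtain r where r: "zorder f a > 0" "r > 0" "zor_poly f a holomorphic_on cball a r"
     "\<And>w. w \<in> cball a r \<Longrightarrow> f w = zor_poly f a w * (w - a) ^ n \<and> zor_poly f a w \<noteq> 0"
  proof -
    have "a \<in> ball a e" using e(1) by simp
    from zorder_exist_zero[OF holomorphic_on_subset[OF f sub(1)] open_ball connected_ball this ex]
    show ?thesis using that a(2) unfolding n_def by auto
  qed
  have n: "n \<ge> 1" using r(1) by (simp add: n_def)
  have aD: "a \<in> interior D" using D a ball_subset_cball by (auto simp: interior_open)
  define g where "g = zor_poly f a"
  have gc: "continuous_on (cball a r) g" using r(3) holomorphic_on_imp_continuous_on by (simp add: g_def)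
  have "bounded (g ` cball a r)" by (intro compact_imp_bounded compact_continuous_image gc) auto
  then obtain B where B: "\<forall>y\<in>g ` cball a r. cmod y \<le> B" unfolding bounded_iff by blast
  have eqg: "f w / (w - a) ^ n = g w" if "w \<in> cball a r" "w \<noteq> a" for w using r(4)[OF that(1)] that by (simp add: g_def)
  have near: "\<forall>\<^sub>F w in at a. w \<in> cball a r \<and> w \<noteq> a"
    unfolding eventually_at by (intro exI[of _ r]) (use r(2) in \<open>auto simp: dist_commute\<close>)
  have "\<forall>\<^sub>F w in at a. cmod (f w / (w - a) ^ n) \<le> B"
    using near by eventually_elim (use B eqg in auto)
  moreover have "(\<lambda>w. f w / (w - a) ^ n) holomorphic_on D - {a}"
    by (intro holomorphic_intros holomorphic_on_subset[OF f]) auto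
  ultimately obtain u where u: "u holomorphic_on D" "\<And>w. w \<in> D - {a} \<Longrightarrow> u w = f w / (w - a) ^ n"
    using holomorphic_on_extend_bounded[OF _ aD, of "\<lambda>w. f w / (w - a) ^ n"] by blast
  have aD': "a \<in> D" using aD interior_subset by blast
  \<comment> \<open>The extension agrees near \<open>a\<close> with the nonvanishing factor from the
    local order of the zero, hence by continuity also at \<open>a\<close>.\<close>
  have "u a = g a"
  proof (rule tendsto_unique[OF at_neq_bot])
    show "(u \<longlongrightarrow> u a) (at a)"
      using holomorphic_on_imp_continuous_on[OF u(1)] D(1) aD' by (simp add: continuous_on_eq_continuous_at isCont_def)
    have "isCont g a" using continuous_on_interior[OF gc, of a] r(2) by simp
    then have "(g \<longlongrightarrow> g a) (at a)" by (simp add: isCont_def)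
    moreover have "\<forall>\<^sub>F w in at a. w \<in> D" using eventually_at_in_open'[OF D(1) aD'] .
    then have "\<forall>\<^sub>F w in at a. g w = u w" using near by eventually_elim (use u(2) eqg in auto)
    ultimately show "(u \<longlongrightarrow> g a) (at a)" using Lim_transform_eventually by blast
  qed
  moreover have "g a \<noteq> 0" using r(2,4) by (simp add: g_def)
  ultimately have ua: "u a \<noteq> 0" by simp
  have fac: "f w = (w - a) ^ n * u w" if "w \<in> D" for w
  proof (cases "w = a")
    case True then show ?thesis using a(2) n by simp
  next
    case False then show ?thesis using u(2)[of w] that by simp
  qed
  have "u w \<noteq> 0" if "w \<in> cball z0 \<rho>" for w
  proof (cases "w = a")
    case False
    then have "f w \<noteq> 0" using uniq that by blast
    then show ?thesis using fac that D by auto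
  qed (use ua in auto)
  then show ?thesis using n u(1) fac by blast
qed

text \<open>Zeroth and first moment of the logarithmic derivative
  \<open>n / (w - a) + u' / u\<close>; the second summand is holomorphic on the closed disc and
  contributes nothing by Cauchy's theorem.\<close>

lemma log_deriv_integrals:
  assumes D: "open D" "cball z0 \<rho> \<subseteq> D" and u: "u holomorphic_on D" "\<And>w. w \<in> cball z0 \<rho> \<Longrightarrow> u w \<noteq> 0" and a: "a \<in> ball z0 \<rho>"
    and f: "\<And>w. w \<in> D \<Longrightarrow> f w = (w - a) ^ n * u w"
  shows "((\<lambda>w. deriv f w / f w) has_contour_integral 2 * complex_of_real pi * \<i> * of_nat n) (circlepath z0 \<rho>)"
    and "((\<lambda>w. w * (deriv f w / f w)) has_contour_integral 2 * complex_of_real pi * \<i> * (of_nat n * a)) (circlepath z0 \<rho>)"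
proof -
  have \<rho>: "\<rho> > 0" using a by (metis ball_eq_empty empty_iff not_less)
  have q: "(\<lambda>w. deriv u w / u w) holomorphic_on cball z0 \<rho>"
    by (intro holomorphic_on_divide holomorphic_on_subset[OF holomorphic_deriv[OF u(1) D(1)] D(2)] holomorphic_on_subset[OF u(1) D(2)] u(2))
  have path: "path_image (circlepath z0 \<rho>) \<subseteq> cball z0 \<rho>" using \<rho> by auto
  have eq: "of_nat n / (w - a) + deriv u w / u w = deriv f w / f w" if "w \<in> path_image (circlepath z0 \<rho>)" for w
  proof -
    have w: "w \<in> D" "w \<noteq> a" "u w \<noteq> 0" using that path D(2) u(2) a \<rho> by (auto simp: dist_norm)
    have "((\<lambda>w. (w - a) ^ n * u w) has_field_derivative (w - a) ^ n * deriv u w + of_nat n * (w - a) ^ (n - 1) * u w) (at w)"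
      by (rule derivative_eq_intros holomorphic_derivI[OF u(1) D(1) w(1)] refl | simp)+
    then have "(f has_field_derivative (w - a) ^ n * deriv u w + of_nat n * (w - a) ^ (n - 1) * u w) (at w)"
      using f has_field_derivative_transform_within_open[OF _ D(1) w(1), of "\<lambda>w. (w - a) ^ n * u w" _ f] by simp
    then have df: "deriv f w = (w - a) ^ n * deriv u w + of_nat n * (w - a) ^ (n - 1) * u w" by (rule DERIV_imp_deriv)
    have e1: "(w - a) ^ n * deriv u w / ((w - a) ^ n * u w) = deriv u w / u w" using w by simp
    have e2: "of_nat n * (w - a) ^ (n - 1) * u w / ((w - a) ^ n * u w) = of_nat n / (w - a)"
      by (cases n) (use w in \<open>auto simp: field_simps\<close>)
    show ?thesis unfolding df f[OF w(1)] add_divide_distrib e1 e2 by (rule add.commute)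
  qed
  have c1: "((\<lambda>w. deriv u w / u w) has_contour_integral 0) (circlepath z0 \<rho>)"
    by (rule Cauchy_theorem_convex_simple[OF q convex_cball]) (use path in auto)
  have c2: "((\<lambda>w. w * (deriv u w / u w)) has_contour_integral 0) (circlepath z0 \<rho>)"
    by (rule Cauchy_theorem_convex_simple[OF holomorphic_on_mult[OF holomorphic_on_ident q] convex_cball]) (use path in auto)
  have d1: "((\<lambda>w. of_nat n / (w - a)) has_contour_integral 2 * complex_of_real pi * \<i> * of_nat n) (circlepath z0 \<rho>)"
    by (rule Cauchy_integral_circlepath) (use a in \<open>auto simp: dist_norm norm_minus_commute intro: holomorphic_intros\<close>)
  have d2: "((\<lambda>w. (of_nat n * w) / (w - a)) has_contour_integral 2 * complex_of_real pi * \<i> * (of_nat n * a)) (circlepath z0 \<rho>)"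
    by (rule Cauchy_integral_circlepath) (use a in \<open>auto simp: dist_norm norm_minus_commute intro!: holomorphic_intros continuous_intros\<close>)
  show "((\<lambda>w. deriv f w / f w) has_contour_integral 2 * complex_of_real pi * \<i> * of_nat n) (circlepath z0 \<rho>)"
    using has_contour_integral_eq[OF has_contour_integral_add[OF d1 c1] eq] by simp
  have eq2: "(of_nat n * w) / (w - a) + w * (deriv u w / u w) = w * (deriv f w / f w)" if "w \<in> path_image (circlepath z0 \<rho>)" for w
    unfolding eq[OF that, symmetric] by (simp add: algebra_simps)
  show "((\<lambda>w. w * (deriv f w / f w)) has_contour_integral 2 * complex_of_real pi * \<i> * (of_nat n * a)) (circlepath z0 \<rho>)"
    using has_contour_integral_eq[OF has_contour_integral_add[OF d2 c2] eq2] by simp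
qed

text \<open>The contour integral is an integral over \<open>{0..1}\<close> of a family that is
  holomorphic in the parameter, and bounded because the denominator stays away from 0 on the circle;
  so \<open>ghol_integral\<close> applies.\<close>

lemma contour_integral_lin_comb_ghol:
  fixes \<epsilon> \<epsilon>' :: "'m::finite \<Rightarrow> complex \<Rightarrow> complex" and P :: "complex^'n::finite \<Rightarrow> complex^'m"
  assumes \<rho>: "\<rho> > 0" and c: "\<And>j. continuous_on (sphere z0 \<rho>) (\<epsilon> j)" "\<And>j. continuous_on (sphere z0 \<rho>) (\<epsilon>' j)" "continuous_on (sphere z0 \<rho>) k"
    and r: "0 < r'" "r' < r" and P: "vghol B x r P" and \<delta>: "\<delta> > 0" "\<And>z w. z \<in> ball x r \<Longrightarrow> w \<in> sphere z0 \<rho> \<Longrightarrow> \<delta> \<le> cmod (lin_comb \<epsilon> (P z) w)"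
  shows "\<exists>C. ghol C x r' (\<lambda>z. contour_integral (circlepath z0 \<rho>) (\<lambda>w. k w * (lin_comb \<epsilon>' (P z) w / lin_comb \<epsilon> (P z) w)))"
proof -
  let ?\<gamma> = "circlepath z0 \<rho>"
  define \<gamma>' where "\<gamma>' t = vector_derivative ?\<gamma> (at t)" for t
  have g': "\<gamma>' = (\<lambda>t. 2 * pi * \<i> * \<rho> * exp (2 * of_real pi * \<i> * t))" unfolding \<gamma>'_def[abs_def] by (simp add: vector_derivative_circlepath)
  have gs: "?\<gamma> t \<in> sphere z0 \<rho>" for t
    using \<rho> by (simp add: circlepath dist_norm norm_mult)
  have gc: "continuous_on {0..1} ?\<gamma>" by (simp add: circlepath) (intro continuous_intros)
  have gc': "continuous_on {0..1} \<gamma>'" unfolding g' by (intro continuous_intros)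
  define h where "h z t = k (?\<gamma> t) * (lin_comb \<epsilon>' (P z) (?\<gamma> t) / lin_comb \<epsilon> (P z) (?\<gamma> t)) * \<gamma>' t" for z t
  have nzc: "lin_comb \<epsilon> (P z) (?\<gamma> t) \<noteq> 0" if "z \<in> ball x r" for z t using \<delta>(2)[OF that gs[of t]] \<delta>(1) by auto
  have hc: "continuous_on {0..1} (h z)" if "z \<in> ball x r" for z
    unfolding h_def
    by (intro continuous_intros gc' continuous_on_compose2[OF c(3) gc] continuous_on_compose2[OF lin_comb_continuous[where \<epsilon> = \<epsilon>', OF c(2)] gc] continuous_on_compose2[OF lin_comb_continuous[where \<epsilon> = \<epsilon>, OF c(1)] gc])
       (use gs nzc[OF that] in auto)
  let ?M = "restrict_space lborel {0..1::real}"
  obtain E where E: "E > 0" "\<And>j z. z \<in> sphere z0 \<rho> \<Longrightarrow> cmod (\<epsilon> j z) \<le> E" using lin_comb_bounded_on_compact[where \<epsilon> = \<epsilon>, OF compact_sphere c(1)] by metis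
  obtain E' where E': "E' > 0" "\<And>j z. z \<in> sphere z0 \<rho> \<Longrightarrow> cmod (\<epsilon>' j z) \<le> E'" using lin_comb_bounded_on_compact[where \<epsilon> = \<epsilon>', OF compact_sphere c(2)] by metis
  have "bounded (k ` sphere z0 \<rho>)" by (intro compact_imp_bounded compact_continuous_image c) auto
  then obtain k0 where "\<forall>y\<in>k ` sphere z0 \<rho>. cmod y \<le> k0" unfolding bounded_iff by blast
  then have k0: "cmod (k z) \<le> k0" if "z \<in> sphere z0 \<rho>" for z using that by blast
  define C where "C = k0 * (of_nat (CARD('m)) * (B * E') / \<delta>) * (2 * pi * \<rho>)"
  have fam: "hol_fam ?M (\<lambda>_. C) x r h"
    unfolding hol_fam_def
  proof (intro conjI ballI gholI)
    fix z assume "z \<in> ball x r"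
    then show "h z \<in> borel_measurable ?M"
      using borel_measurable_continuous_on_restrict[OF hc] measurable_cong_sets[of ?M "restrict_space borel {0..1}" borel borel]
      by (simp add: sets_restrict_space)
  next
    fix t z assume z: "z \<in> ball x r"
    have "cmod (lin_comb \<epsilon>' (P z) (?\<gamma> t)) \<le> of_nat (CARD('m)) * (B * E')"
      using ghol_bound[OF ghol_lin_comb[OF P, of \<epsilon>' "?\<gamma> t" E'] z] E' gs by auto
    then have "cmod (lin_comb \<epsilon>' (P z) (?\<gamma> t) / lin_comb \<epsilon> (P z) (?\<gamma> t)) \<le> of_nat (CARD('m)) * (B * E') / \<delta>"
      unfolding norm_divide using \<delta>(2)[OF z gs] \<delta>(1) by (intro frac_le) (auto intro: order_trans[OF norm_ge_zero])
    moreover have "cmod (\<gamma>' t) = 2 * pi * \<rho>" unfolding g' using \<rho> by (simp add: norm_mult)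
    moreover have "0 \<le> k0" using order_trans[OF norm_ge_zero k0[OF gs]] .
    moreover have "0 \<le> of_nat (CARD('m)) * (B * E') / \<delta>" using order_trans[OF norm_ge_zero calculation(1)] .
    ultimately show "cmod (h z t) \<le> C"
      unfolding h_def C_def norm_mult[of _ "\<gamma>' t"] norm_mult[of "k _"]
      using k0[OF gs] \<rho> by (intro mult_mono mult_nonneg_nonneg) auto
  next
    fix t z v
    show "(\<lambda>s. h (z + s *s v) t) holomorphic_on {s. z + s *s v \<in> ball x r}"
      unfolding h_def
    proof (intro holomorphic_intros)
      show "(\<lambda>s. lin_comb \<epsilon>' (P (z + s *s v)) (?\<gamma> t)) holomorphic_on {s. z + s *s v \<in> ball x r}"
        by (rule ghol_holomorphic[OF ghol_lin_comb[OF P, of \<epsilon>' "?\<gamma> t" E']]) (use E' gs in auto)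
      show "(\<lambda>s. lin_comb \<epsilon> (P (z + s *s v)) (?\<gamma> t)) holomorphic_on {s. z + s *s v \<in> ball x r}"
        by (rule ghol_holomorphic[OF ghol_lin_comb[OF P, of \<epsilon> "?\<gamma> t" E]]) (use E gs in auto)
      show "\<And>s. s \<in> {s. z + s *s v \<in> ball x r} \<Longrightarrow> lin_comb \<epsilon> (P (z + s *s v)) (?\<gamma> t) \<noteq> 0"
        using nzc by blast
    qed
  qed
  have "finite_measure ?M" by (rule finite_measureI) (simp add: emeasure_restrict_space space_restrict_space)
  then have ic: "integrable ?M (\<lambda>_. C)" by (rule finite_measure.integrable_const)
  have G: "ghol (integral\<^sup>L ?M (\<lambda>_. C)) x r' (\<lambda>z. \<integral>t. h z t \<partial>?M)" by (rule ghol_integral[OF fam ic r])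
  have eq: "(\<integral>t. h z t \<partial>?M) = contour_integral ?\<gamma> (\<lambda>w. k w * (lin_comb \<epsilon>' (P z) w / lin_comb \<epsilon> (P z) w))" if "z \<in> ball x r'" for z
  proof -
    have z: "z \<in> ball x r" using that r by auto
    have "(\<integral>t. h z t \<partial>?M) = set_lebesgue_integral lborel {0..1} (h z)"
      unfolding set_lebesgue_integral_def by (rule integral_restrict_space) simp
    also have "\<dots> = integral {0..1} (h z)"
      by (rule set_borel_integral_eq_integral(2)) (rule borel_integrable_atLeastAtMost'[OF hc[OF z]])
    finally show ?thesis unfolding contour_integral_integral h_def \<gamma>'_def .
  qed
  show ?thesis by (rule exI, rule ghol_cong[OF G eq])
qed

text \<open>The order of the zero is an integer depending continuously on the parameter, hence
  locally constant. Dividing the first moment of the logarithmic derivative by it shows that the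
  zero is holomorphic.\<close>

lemma moving_zero:
  fixes \<epsilon> :: "'m::finite \<Rightarrow> complex \<Rightarrow> complex" and P :: "complex^'n::finite \<Rightarrow> complex^'m"
  assumes D: "open D" "cball z0 \<rho> \<subseteq> D" and hol: "\<And>j. \<epsilon> j holomorphic_on D" and r: "r > 0" and P: "vghol B x r P"
    and a: "\<And>z. z \<in> ball x r \<Longrightarrow> a z \<in> ball z0 \<rho>" "\<And>z. z \<in> ball x r \<Longrightarrow> lin_comb \<epsilon> (P z) (a z) = 0"
    and uniq: "\<And>z w. z \<in> ball x r \<Longrightarrow> w \<in> cball z0 \<rho> \<Longrightarrow> lin_comb \<epsilon> (P z) w = 0 \<Longrightarrow> w = a z"
  shows "\<exists>m r' C u. m \<ge> 1 \<and> 0 < r' \<and> r' < r \<and> ghol C x r' a \<and> (\<forall>z\<in>ball x r'. u z holomorphic_on D \<and>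
     (\<forall>w\<in>D. lin_comb \<epsilon> (P z) w = (w - a z) ^ m * u z w) \<and> (\<forall>w\<in>cball z0 \<rho>. u z w \<noteq> 0))"
proof -
  have "x \<in> ball x r" using r by simp
  then have "a x \<in> ball z0 \<rho>" by (rule a(1))
  then have \<rho>: "\<rho> > 0" by (metis ball_eq_empty empty_iff not_less)
  have holf: "lin_comb \<epsilon> y holomorphic_on D" for y by (rule lin_comb_holomorphic[OF hol])
  have "\<exists>n u. n \<ge> 1 \<and> u holomorphic_on D \<and> (\<forall>w\<in>D. lin_comb \<epsilon> (P z) w = (w - a z) ^ n * u w) \<and> (\<forall>w\<in>cball z0 \<rho>. u w \<noteq> 0)" if z: "z \<in> ball x r" for z
    by (rule zero_factorization[OF holf D a(1)[OF z] a(2)[OF z] uniq[OF z]])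
  \<comment> \<open>Order and cofactor are packed into one pair so that both are chosen at
    once.\<close>
  then have "\<forall>z. \<exists>q. z \<in> ball x r \<longrightarrow> fst q \<ge> 1 \<and> snd q holomorphic_on D \<and> (\<forall>w\<in>D. lin_comb \<epsilon> (P z) w = (w - a z) ^ fst q * snd q w) \<and> (\<forall>w\<in>cball z0 \<rho>. snd q w \<noteq> 0)"
    by simp
  from choice[OF this] obtain q where q: "\<forall>z. z \<in> ball x r \<longrightarrow> fst (q z) \<ge> 1 \<and> snd (q z) holomorphic_on D \<and> (\<forall>w\<in>D. lin_comb \<epsilon> (P z) w = (w - a z) ^ fst (q z) * snd (q z) w) \<and> (\<forall>w\<in>cball z0 \<rho>. snd (q z) w \<noteq> 0)"
    by (elim exE)
  define n u where "n z = fst (q z)" and "u z = snd (q z)" for z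
  have nu: "n z \<ge> 1 \<and> u z holomorphic_on D \<and> (\<forall>w\<in>D. lin_comb \<epsilon> (P z) w = (w - a z) ^ n z * u z w) \<and> (\<forall>w\<in>cball z0 \<rho>. u z w \<noteq> 0)" if "z \<in> ball x r" for z
    using q that unfolding n_def u_def by blast
  have sD: "sphere z0 \<rho> \<subseteq> D" using D(2) by auto
  have ec: "continuous_on (sphere z0 \<rho>) (\<epsilon> j)" for j
    using holomorphic_on_imp_continuous_on[OF hol] continuous_on_subset[OF _ sD] by blast
  define \<epsilon>' where "\<epsilon>' j = deriv (\<epsilon> j)" for j
  have ec': "continuous_on (sphere z0 \<rho>) (\<epsilon>' j)" for j unfolding \<epsilon>'_def
    using holomorphic_on_imp_continuous_on[OF holomorphic_deriv[OF hol D(1)]] continuous_on_subset[OF _ sD] by blast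
  have dl: "deriv (lin_comb \<epsilon> y) w = lin_comb \<epsilon>' y w" if "w \<in> D" for y w
  proof (rule DERIV_imp_deriv)
    show "(lin_comb \<epsilon> y has_field_derivative lin_comb \<epsilon>' y w) (at w)"
      unfolding lin_comb_def[abs_def] \<epsilon>'_def
      by (intro DERIV_sum DERIV_cmult holomorphic_derivI[OF hol D(1) that])
  qed
  have nzs: "lin_comb \<epsilon> (P x) w \<noteq> 0" if "w \<in> sphere z0 \<rho>" for w
    using uniq[OF \<open>x \<in> ball x r\<close>, of w] that a(1)[OF \<open>x \<in> ball x r\<close>] by (auto simp: dist_norm)
  obtain \<delta> where \<delta>: "\<delta> > 0" "\<And>w. w \<in> sphere z0 \<rho> \<Longrightarrow> \<delta> \<le> cmod (lin_comb \<epsilon> (P x) w)"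
    using compact_nonzero_lower_bound[OF compact_sphere lin_comb_continuous[where \<epsilon> = \<epsilon>, OF ec] nzs] by metis
  obtain r1 where r1: "0 < r1" "r1 < r" "\<And>z w. z \<in> ball x r1 \<Longrightarrow> w \<in> sphere z0 \<rho> \<Longrightarrow> cmod (lin_comb \<epsilon> (P z) w - lin_comb \<epsilon> (P x) w) \<le> \<delta> / 2"
    using lin_comb_variation[where \<epsilon> = \<epsilon>, OF compact_sphere ec P r, of "\<delta>/2"] \<delta>(1) by (metis half_gt_zero)
  have half: "\<delta> / 2 \<le> cmod (lin_comb \<epsilon> (P z) w)" if "z \<in> ball x r1" "w \<in> sphere z0 \<rho>" for z w
    using norm_triangle_ineq3[of "lin_comb \<epsilon> (P z) w" "lin_comb \<epsilon> (P x) w"] r1(3)[OF that] \<delta>(2)[OF that(2)] by linarith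
  have P1: "vghol B x r1 P" using vghol_mono[OF P] r1 by simp
  define I where "I k z = contour_integral (circlepath z0 \<rho>) (\<lambda>w. k w * (lin_comb \<epsilon>' (P z) w / lin_comb \<epsilon> (P z) w))" for k z
  have gI: "\<exists>C. ghol C x (r1/2) (I k)" if "continuous_on (sphere z0 \<rho>) k" for k
    unfolding I_def using contour_integral_lin_comb_ghol[OF \<rho> ec ec' that _ _ P1, of "r1/2" "\<delta>/2"] half \<delta>(1) r1 by simp
  obtain C0 where C0: "ghol C0 x (r1/2) (I (\<lambda>_. 1))" using gI[of "\<lambda>_. 1"] by (auto intro: continuous_intros)
  obtain C1 where C1: "ghol C1 x (r1/2) (I (\<lambda>w. w))" using gI[of "\<lambda>w. w"] by (auto intro: continuous_intros)
  have pim: "path_image (circlepath z0 \<rho>) \<subseteq> D" using \<rho> sD by simp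
  have I0: "I (\<lambda>_. 1) z = 2 * complex_of_real pi * \<i> * of_nat (n z)" and I1: "I (\<lambda>w. w) z = 2 * complex_of_real pi * \<i> * (of_nat (n z) * a z)" if "z \<in> ball x r" for z
  proof -
    have "((\<lambda>w. deriv (lin_comb \<epsilon> (P z)) w / lin_comb \<epsilon> (P z) w) has_contour_integral 2 * complex_of_real pi * \<i> * of_nat (n z)) (circlepath z0 \<rho>)"
         "((\<lambda>w. w * (deriv (lin_comb \<epsilon> (P z)) w / lin_comb \<epsilon> (P z) w)) has_contour_integral 2 * complex_of_real pi * \<i> * (of_nat (n z) * a z)) (circlepath z0 \<rho>)"
      using log_deriv_integrals[OF D, of "u z" "a z" "lin_comb \<epsilon> (P z)" "n z"] nu[OF that] a(1)[OF that] by auto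
    then have "((\<lambda>w. 1 * (lin_comb \<epsilon>' (P z) w / lin_comb \<epsilon> (P z) w)) has_contour_integral 2 * complex_of_real pi * \<i> * of_nat (n z)) (circlepath z0 \<rho>)"
      and "((\<lambda>w. w * (lin_comb \<epsilon>' (P z) w / lin_comb \<epsilon> (P z) w)) has_contour_integral 2 * complex_of_real pi * \<i> * (of_nat (n z) * a z)) (circlepath z0 \<rho>)"
      using pim dl by (auto elim!: has_contour_integral_eq simp: subset_iff)
    then show "I (\<lambda>_. 1) z = 2 * complex_of_real pi * \<i> * of_nat (n z)" "I (\<lambda>w. w) z = 2 * complex_of_real pi * \<i> * (of_nat (n z) * a z)"
      unfolding I_def by (auto dest: contour_integral_unique)
  qed
  have "(I (\<lambda>_. 1) \<longlongrightarrow> I (\<lambda>_. 1) x) (nhds x)" by (rule ghol_tendsto[OF C0]) (use r1 in simp)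
  \<comment> \<open>The values of this integral are integer multiples of
    \<open>2 * pi * \<i>\<close>, so a distance below \<open>2 * pi\<close> means equality of the
    orders.\<close>
  then have "\<forall>\<^sub>F z in nhds x. dist (I (\<lambda>_. 1) z) (I (\<lambda>_. 1) x) < 2 * pi" by (rule tendstoD) simp
  then obtain r2 where r2: "r2 > 0" "\<And>z. dist z x < r2 \<Longrightarrow> dist (I (\<lambda>_. 1) z) (I (\<lambda>_. 1) x) < 2 * pi"
    unfolding eventually_nhds_metric by auto
  define r' where "r' = min (r1/2) r2"
  have r': "0 < r'" "r' < r" "r' \<le> r1/2" "r' \<le> r2" using r1 r2 by (auto simp: r'_def)
  have n_const: "n z = n x" if z: "z \<in> ball x r'" for z
  proof -
    have zr: "z \<in> ball x r" using z r' by auto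
    have "dist z x < r2" using z r'(4) by (auto simp: dist_commute)
    from r2(2)[OF this] have "cmod (2 * complex_of_real pi * \<i> * (of_nat (n z) - of_nat (n x))) < 2 * pi"
      unfolding I0[OF zr] I0[OF \<open>x \<in> ball x r\<close>] dist_norm right_diff_distrib .
    then have "cmod (of_nat (n z) - of_nat (n x)) < 1" unfolding norm_mult by (simp add: mult_less_cancel_left2)
    then have "\<bar>real (n z) - real (n x)\<bar> < 1" by (metis norm_of_real of_real_diff of_real_of_nat_eq)
    then show ?thesis by linarith
  qed
  have "ghol (C1 * cmod (1 / (2 * complex_of_real pi * \<i> * of_nat (n x)))) x (r1/2) (\<lambda>z. I (\<lambda>w. w) z * (1 / (2 * complex_of_real pi * \<i> * of_nat (n x))))"
    by (intro ghol_mult C1 ghol_const)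
  then have g: "ghol (C1 * cmod (1 / (2 * complex_of_real pi * \<i> * of_nat (n x)))) x r' (\<lambda>z. I (\<lambda>w. w) z * (1 / (2 * complex_of_real pi * \<i> * of_nat (n x))))"
    by (rule ghol_mono) (use r' in auto)
  have ae: "I (\<lambda>w. w) z * (1 / (2 * complex_of_real pi * \<i> * of_nat (n x))) = a z" if z: "z \<in> ball x r'" for z
  proof -
    have zr: "z \<in> ball x r" using z r' by auto
    have "of_nat (n x) \<noteq> (0::complex)" using nu[OF \<open>x \<in> ball x r\<close>] by auto
    then show ?thesis unfolding I1[OF zr] n_const[OF z] by (simp add: field_simps)
  qed
  have ga: "ghol (C1 * cmod (1 / (2 * complex_of_real pi * \<i> * of_nat (n x)))) x r' a"
    by (rule ghol_cong[OF g ae])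
  have "u z holomorphic_on D \<and> (\<forall>w\<in>D. lin_comb \<epsilon> (P z) w = (w - a z) ^ n x * u z w) \<and> (\<forall>w\<in>cball z0 \<rho>. u z w \<noteq> 0)" if z: "z \<in> ball x r'" for z
  proof -
    have "z \<in> ball x r" using z r' by auto
    from nu[OF this] show ?thesis unfolding n_const[OF z] by blast
  qed
  moreover have "n x \<ge> 1" using nu[OF \<open>x \<in> ball x r\<close>] by blast
  ultimately show ?thesis using ga r'(1,2) by blast
qed

section \<open>Discs around a moving zero\<close>

text \<open>The map \<open>disc_map z0 \<rho> \<alpha>\<close> sends the unit disc onto the disc of radius \<open>\<rho>\<close> about \<open>z0\<close> and \<open>0\<close> to
  \<open>z0 + \<rho>\<alpha>\<close>. It depends holomorphically on \<open>\<alpha>\<close>, and its Jacobian is a sum of a holomorphic and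
  an antiholomorphic function of \<open>\<alpha>\<close>.\<close>

definition disc_map :: "complex \<Rightarrow> real \<Rightarrow> complex \<Rightarrow> complex \<Rightarrow> complex" where
  "disc_map z0 \<rho> \<alpha> w = z0 + of_real \<rho> * (w + \<alpha> * (1 - w * cnj w))"

text \<open>The difference to the moving zero carries the factor \<open>w\<close>; the cofactor
  \<open>1 - \<alpha> * cnj w\<close> has no zero in the unit disc when
  \<open>cmod \<alpha> \<le> 1/4\<close>.\<close>

lemma disc_map_minus: "disc_map z0 \<rho> \<alpha> w - (z0 + of_real \<rho> * \<alpha>) = of_real \<rho> * w * (1 - \<alpha> * cnj w)"
  by (simp add: disc_map_def algebra_simps)

lemma one_minus_norm_sq: "1 - w * cnj w = of_real (1 - (cmod w)\<^sup>2)"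
  by (simp add: complex_norm_square[symmetric])

text \<open>Since \<open>1 - (cmod w)\<^sup>2 \<le> 2 * (1 - cmod w)\<close>, the bound
  \<open>1/4\<close> makes the displacement, before scaling by \<rho>, at most half the distance
  from \<open>w\<close> to the unit circle.\<close>

lemma disc_map_le:
  assumes "cmod w \<le> 1" "cmod \<alpha> \<le> 1/4" "\<rho> > 0"
  shows "dist z0 (disc_map z0 \<rho> \<alpha> w) \<le> \<rho> * (cmod w + (1 - cmod w) / 2)"
proof -
  have sq: "(cmod w)\<^sup>2 \<le> 1" using assms(1) by (simp add: power_le_one)
  have "cmod (w + \<alpha> * (1 - w * cnj w)) \<le> cmod w + cmod \<alpha> * (1 - (cmod w)\<^sup>2)"
    unfolding one_minus_norm_sq using sq
    by (intro order_trans[OF norm_triangle_ineq]) (simp add: norm_mult del: of_real_diff)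
  also have "\<dots> \<le> cmod w + 1/4 * (1 - (cmod w)\<^sup>2)" using assms(2) sq by (intro add_left_mono mult_right_mono) auto
  also have "1 - (cmod w)\<^sup>2 = (1 - cmod w) * (1 + cmod w)" by (simp add: power2_eq_square algebra_simps)
  also have "cmod w + 1/4 * ((1 - cmod w) * (1 + cmod w)) \<le> cmod w + 1/4 * ((1 - cmod w) * 2)"
    using assms(1) by (intro add_left_mono mult_left_mono) auto
  finally have "cmod (w + \<alpha> * (1 - w * cnj w)) \<le> cmod w + (1 - cmod w) / 2" by (simp add: field_simps)
  then show ?thesis using assms(3) by (simp add: disc_map_def dist_norm norm_mult)
qed

lemma disc_map_cball: "cmod w \<le> 1 \<Longrightarrow> cmod \<alpha> \<le> 1/4 \<Longrightarrow> \<rho> > 0 \<Longrightarrow> disc_map z0 \<rho> \<alpha> w \<in> cball z0 \<rho>"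
proof -
  assume a: "cmod w \<le> 1" "cmod \<alpha> \<le> 1/4" "\<rho> > 0"
  have "\<rho> * (cmod w + (1 - cmod w) / 2) \<le> \<rho> * 1" using a by (intro mult_left_mono) (auto simp: field_simps)
  then show ?thesis using disc_map_le[OF a, of z0] by simp
qed

lemma disc_map_ball: "cmod w < 1 \<Longrightarrow> cmod \<alpha> \<le> 1/4 \<Longrightarrow> \<rho> > 0 \<Longrightarrow> disc_map z0 \<rho> \<alpha> w \<in> ball z0 \<rho>"
proof -
  assume a: "cmod w < 1" "cmod \<alpha> \<le> 1/4" "\<rho> > 0"
  have "\<rho> * (cmod w + (1 - cmod w) / 2) < \<rho> * 1" using a by (intro mult_strict_left_mono) (auto simp: field_simps)
  moreover have "dist z0 (disc_map z0 \<rho> \<alpha> w) \<le> \<rho> * (cmod w + (1 - cmod w) / 2)"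
    by (rule disc_map_le) (use a in auto)
  ultimately have "dist z0 (disc_map z0 \<rho> \<alpha> w) < \<rho>" by linarith
  then show ?thesis by (simp only: mem_ball)
qed

text \<open>The perturbation \<open>\<alpha> * (1 - w * cnj w)\<close> is a contraction of the disc
  with factor \<open>1/2\<close>, so it cannot compensate for \<open>v - w\<close>.\<close>

lemma disc_map_inj:
  assumes "cmod \<alpha> \<le> 1/4" "\<rho> > 0" shows "inj_on (disc_map z0 \<rho> \<alpha>) (ball 0 1)"
proof (rule inj_onI)
  fix v w assume vw: "v \<in> ball 0 1" "w \<in> ball 0 1" "disc_map z0 \<rho> \<alpha> v = disc_map z0 \<rho> \<alpha> w"
  then have "v + \<alpha> * (1 - v * cnj v) = w + \<alpha> * (1 - w * cnj w)" using assms(2) by (simp add: disc_map_def)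
  then have "v - w = \<alpha> * of_real ((cmod v)\<^sup>2 - (cmod w)\<^sup>2)"
    unfolding one_minus_norm_sq by (simp add: algebra_simps)
  then have "cmod (v - w) = cmod \<alpha> * \<bar>(cmod v)\<^sup>2 - (cmod w)\<^sup>2\<bar>" by (metis norm_mult norm_of_real)
  also have "(cmod v)\<^sup>2 - (cmod w)\<^sup>2 = (cmod v - cmod w) * (cmod v + cmod w)" by (simp add: power2_eq_square algebra_simps)
  also have "cmod \<alpha> * \<bar>(cmod v - cmod w) * (cmod v + cmod w)\<bar> \<le> 1/4 * (cmod (v - w) * 2)"
    unfolding abs_mult using vw(1,2) assms(1) norm_triangle_ineq3[of v w] by (intro mult_mono) auto
  finally show "v = w" by simp
qed

text \<open>In the normalised coordinate \<open>y\<close> a preimage has the form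
  \<open>y - s * \<alpha>\<close> with \<open>s = 1 - (cmod w)\<^sup>2\<close>; this is one real
  equation for \<open>s\<close>, solved by the intermediate value theorem.\<close>

lemma disc_map_image:
  assumes "cmod \<alpha> \<le> 1/4" "\<rho> > 0" shows "disc_map z0 \<rho> \<alpha> ` ball 0 1 = ball z0 \<rho>"
proof (rule subset_antisym; rule subsetI)
  fix z assume "z \<in> disc_map z0 \<rho> \<alpha> ` ball 0 1"
  then show "z \<in> ball z0 \<rho>" using disc_map_ball[OF _ assms] by auto
next
  fix z assume z: "z \<in> ball z0 \<rho>"
  define y where "y = (z - z0) / of_real \<rho>"
  have y: "cmod y < 1" using z assms(2) by (simp add: y_def norm_divide dist_norm norm_minus_commute)
  define g where "g s = s - 1 + (cmod (y - of_real s * \<alpha>))\<^sup>2" for s :: real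
  have "\<exists>s. 0 \<le> s \<and> s \<le> 1 \<and> g s = 0"
  proof (rule IVT')
    show "g 0 \<le> 0" using y by (simp add: g_def power_le_one)
    show "0 \<le> g 1" by (simp add: g_def)
    show "continuous_on {0..1} g" unfolding g_def[abs_def] by (intro continuous_intros)
  qed simp
  then obtain s where s: "0 \<le> s" "s \<le> 1" "g s = 0" by blast
  define w where "w = y - of_real s * \<alpha>"
  have w2: "(cmod w)\<^sup>2 = 1 - s" using s(3) by (simp add: g_def w_def)
  have "s \<noteq> 0"
  proof
    assume "s = 0"
    then have "(cmod y)\<^sup>2 = 1" using w2 by (simp add: w_def)
    then have "cmod y = 1" using norm_ge_zero[of y] by (simp add: power2_eq_1_iff)
    then show False using y by simp
  qed
  then have "(cmod w)\<^sup>2 < 1" using w2 s by simp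
  then have "w \<in> ball 0 1" by (simp add: power_less_one_iff abs_square_less_1)
  moreover have "disc_map z0 \<rho> \<alpha> w = z"
    unfolding disc_map_def one_minus_norm_sq w2 using assms(2) by (simp add: w_def y_def mult.commute)
  ultimately show "z \<in> disc_map z0 \<rho> \<alpha> ` ball 0 1" by blast
qed

lemma disc_map_derivative:
  "(disc_map z0 \<rho> \<alpha> has_derivative (\<lambda>h. (of_real \<rho> * (1 - \<alpha> * cnj w)) * h + (- of_real \<rho> * \<alpha> * w) * cnj h)) (at w)"
  unfolding disc_map_def[abs_def]
  by (auto intro!: derivative_eq_intros bounded_linear.has_derivative[OF bounded_linear_cnj] simp: algebra_simps)

text \<open>The two terms of second order in \<alpha>, both equal to
  \<open>(cmod (\<alpha> * w))\<^sup>2\<close>, cancel. What remains is linear in \<alpha> plus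
  linear in its conjugate, so each summand can be absorbed into one factor of the integrand.\<close>

lemma disc_map_jacobian:
  assumes "cmod \<alpha> \<le> 1/4" "cmod w \<le> 1"
  shows "complex_of_real \<bar>(cmod (of_real \<rho> * (1 - \<alpha> * cnj w)))\<^sup>2 - (cmod (- of_real \<rho> * \<alpha> * w))\<^sup>2\<bar> =
     of_real (\<rho>\<^sup>2) * (1 - \<alpha> * cnj w - cnj (\<alpha> * cnj w))"
proof -
  have "complex_of_real ((cmod (of_real \<rho> * (1 - \<alpha> * cnj w)))\<^sup>2 - (cmod (- of_real \<rho> * \<alpha> * w))\<^sup>2) =
     of_real (\<rho>\<^sup>2) * (1 - \<alpha> * cnj w - cnj (\<alpha> * cnj w))"
    unfolding of_real_diff complex_norm_square by (simp add: algebra_simps power2_eq_square)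
  moreover have "(cmod (of_real \<rho> * (1 - \<alpha> * cnj w)))\<^sup>2 - (cmod (- of_real \<rho> * \<alpha> * w))\<^sup>2 \<ge> 0"
  proof -
    have "cmod (\<alpha> * w) \<le> 1/4 * 1" unfolding norm_mult using assms by (intro mult_mono) auto
    moreover have "cmod (\<alpha> * cnj w) = cmod (\<alpha> * w)" by (simp add: norm_mult)
    moreover have "1 - cmod (\<alpha> * cnj w) \<le> cmod (1 - \<alpha> * cnj w)" using norm_triangle_ineq2[of 1 "\<alpha> * cnj w"] by simp
    ultimately have "cmod (\<alpha> * w) \<le> cmod (1 - \<alpha> * cnj w)" by linarith
    then have "\<bar>\<rho>\<bar> * cmod (\<alpha> * w) \<le> \<bar>\<rho>\<bar> * cmod (1 - \<alpha> * cnj w)" by (intro mult_left_mono) auto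
    then have "cmod (- of_real \<rho> * \<alpha> * w) \<le> cmod (of_real \<rho> * (1 - \<alpha> * cnj w))" by (simp add: norm_mult mult.assoc)
    then show ?thesis by (simp add: power_mono)
  qed
  ultimately show ?thesis by simp
qed

section \<open>The pairing on a disc about a moving zero\<close>

lemma maximum_modulus_cball:
  assumes "continuous_on (cball z0 \<rho>) f" "f holomorphic_on ball z0 \<rho>" "\<rho> > 0" "\<And>z. z \<in> sphere z0 \<rho> \<Longrightarrow> cmod (f z) \<le> B" "z \<in> cball z0 \<rho>"
  shows "cmod (f z) \<le> B"
proof (rule maximum_modulus_frontier[of f "cball z0 \<rho>"])
  show "f holomorphic_on interior (cball z0 \<rho>)" using assms by simp
  show "continuous_on (closure (cball z0 \<rho>)) f" using assms by simp
  show "\<And>z. z \<in> frontier (cball z0 \<rho>) \<Longrightarrow> cmod (f z) \<le> B" using assms by simp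
qed (use assms in auto)

lemma lin_comb_continuous_joint:
  fixes \<epsilon> :: "'m::finite \<Rightarrow> complex \<Rightarrow> complex"
  assumes "\<And>j. continuous_on S (\<epsilon> j)" "continuous_on T f" "continuous_on T g" "g ` T \<subseteq> S"
  shows "continuous_on T (\<lambda>q. lin_comb \<epsilon> (f q) (g q))"
  unfolding lin_comb_def
  by (intro continuous_intros assms(2) continuous_on_compose2[OF assms(1) assms(3,4)])

text \<open>After dividing out the zeros the ratio is \<open>u z / u x\<close> at the image point
  times a factor \<open>H\<close> that depends on the parameter through \<alpha> only; both are
  close to 1. This keeps one branch of the square root valid on the whole disc.\<close>

lemma disc_ratio_near_one:
  fixes \<epsilon> :: "'m::finite \<Rightarrow> complex \<Rightarrow> complex" and P :: "complex^'n::finite \<Rightarrow> complex^'m"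
  assumes D: "open D" "cball z0 \<rho> \<subseteq> D" and \<rho>: "\<rho> > 0" and hol: "\<And>j. \<epsilon> j holomorphic_on D" and r: "r > 0"
    and P: "vghol B x r P" and a: "ghol C x r a" "a x = z0" "\<And>z. z \<in> ball x r \<Longrightarrow> a z \<in> ball z0 \<rho>"
    and u: "\<And>z. z \<in> ball x r \<Longrightarrow> u z holomorphic_on D"
      "\<And>z w. z \<in> ball x r \<Longrightarrow> w \<in> D \<Longrightarrow> lin_comb \<epsilon> (P z) w = (w - a z) ^ m * u z w"
      "\<And>z w. z \<in> ball x r \<Longrightarrow> w \<in> cball z0 \<rho> \<Longrightarrow> u z w \<noteq> 0"
  shows "\<forall>\<^sub>F z in nhds x. z \<in> ball x r \<and> cmod ((a z - z0) / of_real \<rho>) \<le> 1/4 \<and> (\<forall>w\<in>sphere z0 \<rho>. cmod (u z w / u x w - 1) \<le> 1/5) \<and>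
     (\<forall>w\<in>ball 0 1 - {0}. cmod (lin_comb \<epsilon> (P z) (disc_map z0 \<rho> ((a z - z0) / of_real \<rho>) w) / lin_comb \<epsilon> (P x) (z0 + of_real \<rho> * w) - 1) \<le> 1/2)"
proof -
  have xr: "x \<in> ball x r" using r by simp
  have ec: "continuous_on D (\<epsilon> j)" for j by (rule holomorphic_on_imp_continuous_on[OF hol])
  have uxc: "continuous_on D (u x)" by (rule holomorphic_on_imp_continuous_on[OF u(1)[OF xr]])
  have sD: "sphere z0 \<rho> \<subseteq> D" "sphere z0 \<rho> \<subseteq> cball z0 \<rho>" using D(2) by auto
  define G where "G p w = lin_comb \<epsilon> (fst p) w * (w - z0) ^ m / ((w - snd p) ^ m * lin_comb \<epsilon> (P x) w)" for p :: "(complex^'m) \<times> complex" and w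
  have fx0: "lin_comb \<epsilon> (P x) w \<noteq> 0" if "w \<in> cball z0 \<rho>" "w \<noteq> z0" for w
    using u(2)[OF xr, of w] u(3)[OF xr that(1)] that a(2) D(2) by auto
  have Gc: "continuous_on ((cball (P x) 1 \<times> cball z0 (\<rho>/2)) \<times> sphere z0 \<rho>) (\<lambda>q. G (fst q) (snd q))"
    unfolding G_def
  proof (intro continuous_intros lin_comb_continuous_joint[OF ec])
    show "\<forall>q\<in>(cball (P x) 1 \<times> cball z0 (\<rho>/2)) \<times> sphere z0 \<rho>. (snd q - snd (fst q)) ^ m * lin_comb \<epsilon> (P x) (snd q) \<noteq> 0"
    proof
      fix q assume "q \<in> (cball (P x) 1 \<times> cball z0 (\<rho>/2)) \<times> sphere z0 \<rho>"
      then have q: "dist z0 (snd q) = \<rho>" "dist z0 (snd (fst q)) \<le> \<rho>/2" by auto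
      then have "snd q \<noteq> snd (fst q)" "snd q \<noteq> z0" using \<rho> by auto
      then show "(snd q - snd (fst q)) ^ m * lin_comb \<epsilon> (P x) (snd q) \<noteq> 0" using fx0[of "snd q"] q by simp
    qed
  qed (use sD in auto)
  have K1: "(P x, z0) \<in> cball (P x) 1 \<times> cball z0 (\<rho>/2)" using \<rho> by simp
  obtain \<delta>1 where \<delta>1: "\<delta>1 > 0" "\<And>p w. p \<in> cball (P x) 1 \<times> cball z0 (\<rho>/2) \<Longrightarrow> w \<in> sphere z0 \<rho> \<Longrightarrow> dist p (P x, z0) < \<delta>1 \<Longrightarrow> dist (G p w) (G (P x, z0) w) < 1/5"
    using compact_param_near[OF _ compact_sphere K1 Gc, of "1/5"] by (metis compact_Times compact_cball zero_less_divide_1_iff zero_less_numeral)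
  \<comment> \<open>The part of the ratio due to the change of variables; it equals 1 for \<alpha> =
    0.\<close>
  define H where "H \<alpha> w = (1 - \<alpha> * cnj w) ^ m * (u x (disc_map z0 \<rho> \<alpha> w) / u x (z0 + of_real \<rho> * w))" for \<alpha> w
  have scin: "z0 + of_real \<rho> * w \<in> cball z0 \<rho>" if "w \<in> cball 0 1" for w
    using that \<rho> mult_left_mono[of "cmod w" 1 \<rho>] by (simp add: dist_norm norm_mult)
  have Hc: "continuous_on (cball 0 (1/4) \<times> cball 0 1) (\<lambda>q. H (fst q) (snd q))"
    unfolding H_def
  proof (intro continuous_intros continuous_on_compose2[OF uxc])
    show "continuous_on (cball 0 (1/4) \<times> cball 0 1) (\<lambda>q. disc_map z0 \<rho> (fst q) (snd q))"
      unfolding disc_map_def by (intro continuous_intros)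
    show "(\<lambda>q. disc_map z0 \<rho> (fst q) (snd q)) ` (cball 0 (1/4) \<times> cball 0 1) \<subseteq> D"
      using disc_map_cball[OF _ _ \<rho>, of _ _ z0] D(2) by (auto simp: subset_iff)
    show "(\<lambda>q. z0 + of_real \<rho> * snd q) ` (cball 0 (1/4) \<times> cball 0 1) \<subseteq> D"
      using scin D(2) by (force simp: subset_iff)
    show "\<forall>q\<in>cball 0 (1/4) \<times> cball 0 1. u x (z0 + of_real \<rho> * snd q) \<noteq> 0"
      using u(3)[OF xr scin] by auto
  qed
  have K2: "(0::complex) \<in> cball 0 (1/4)" by simp
  obtain \<delta>2 where \<delta>2: "\<delta>2 > 0" "\<And>\<alpha> w. \<alpha> \<in> cball 0 (1/4) \<Longrightarrow> w \<in> cball 0 1 \<Longrightarrow> dist \<alpha> 0 < \<delta>2 \<Longrightarrow> dist (H \<alpha> w) (H 0 w) < 1/5"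
    using compact_param_near[OF compact_cball compact_cball K2 Hc, of "1/5"] by (metis zero_less_divide_1_iff zero_less_numeral)
  have tP: "(P \<longlongrightarrow> P x) (nhds x)" by (rule vghol_tendsto[OF P r])
  have ta: "(a \<longlongrightarrow> z0) (nhds x)" using ghol_tendsto[OF a(1) r] a(2) by simp
  have e1: "\<forall>\<^sub>F z in nhds x. dist (P z) (P x) < 1" by (rule tendstoD[OF tP]) simp
  have e2: "\<forall>\<^sub>F z in nhds x. dist (a z) z0 < min (\<rho>/4) (\<rho> * \<delta>2)" by (rule tendstoD[OF ta]) (use \<rho> \<delta>2 in simp)
  have e3: "\<forall>\<^sub>F z in nhds x. dist (P z, a z) (P x, z0) < \<delta>1" by (rule tendstoD[OF tendsto_Pair[OF tP ta] \<delta>1(1)])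
  have e4: "\<forall>\<^sub>F z in nhds x. z \<in> ball x r" using r by (intro eventually_nhds_in_open) auto
  show ?thesis using e1 e2 e3 e4
  proof eventually_elim
    case (elim z)
    note z = elim(4)
    define \<alpha> where "\<alpha> = (a z - z0) / of_real \<rho>"
    have \<alpha>: "cmod \<alpha> \<le> 1/4" "cmod \<alpha> < \<delta>2"
      using elim(2) \<rho> by (auto simp: \<alpha>_def norm_divide dist_norm field_simps)
    have az: "a z = z0 + of_real \<rho> * \<alpha>" using \<rho> by (simp add: \<alpha>_def)
    have azin: "a z \<in> cball z0 (\<rho>/2)" using elim(2) \<rho> by (simp add: dist_commute)
    have Q1: "cmod (u z w / u x w - 1) \<le> 1/5" if w: "w \<in> sphere z0 \<rho>" for w
    proof -
      have wD: "w \<in> D" "w \<in> cball z0 \<rho>" using w sD by auto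
      have ne: "w - a z \<noteq> 0" "w - z0 \<noteq> 0" using w azin \<rho> by (auto simp: dist_norm)
      have "G (P z, a z) w = u z w / u x w"
        unfolding G_def using u(2)[OF z wD(1)] u(2)[OF xr wD(1)] ne a(2) u(3)[OF xr wD(2)] by (simp add: field_simps)
      moreover have "G (P x, z0) w = 1" unfolding G_def using ne fx0[OF wD(2)] by auto
      moreover have "dist (G (P z, a z) w) (G (P x, z0) w) < 1/5"
        by (rule \<delta>1(2)[OF _ w elim(3)]) (use elim(1) azin in \<open>auto simp: dist_commute\<close>)
      ultimately show ?thesis by (simp add: dist_norm)
    qed
    have Q: "cmod (u z w / u x w - 1) \<le> 1/5" if w: "w \<in> cball z0 \<rho>" for w
    proof (rule maximum_modulus_cball[of z0 \<rho> "\<lambda>w. u z w / u x w - 1", OF _ _ \<rho> Q1 w])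
      have h: "(\<lambda>w. u z w / u x w - 1) holomorphic_on cball z0 \<rho>"
        using u(3)[OF xr] by (intro holomorphic_intros holomorphic_on_subset[OF u(1)[OF z] D(2)] holomorphic_on_subset[OF u(1)[OF xr] D(2)]) auto
      then show "continuous_on (cball z0 \<rho>) (\<lambda>w. u z w / u x w - 1)" by (rule holomorphic_on_imp_continuous_on)
      show "(\<lambda>w. u z w / u x w - 1) holomorphic_on ball z0 \<rho>" by (rule holomorphic_on_subset[OF h]) auto
    qed
    have R: "cmod (lin_comb \<epsilon> (P z) (disc_map z0 \<rho> \<alpha> w) / lin_comb \<epsilon> (P x) (z0 + of_real \<rho> * w) - 1) \<le> 1/2" if w: "w \<in> ball 0 1 - {0}" for w
    proof -
      let ?T = "disc_map z0 \<rho> \<alpha> w"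
      have w1: "w \<in> cball 0 1" "w \<noteq> 0" using w by auto
      have T: "?T \<in> cball z0 \<rho>" using disc_map_cball[OF _ \<alpha>(1) \<rho>, of w z0] w1 by simp
      have TD: "?T \<in> D" using T D(2) by blast
      have sc: "z0 + of_real \<rho> * w \<in> cball z0 \<rho>" by (rule scin[OF w1(1)])
      then have scD: "z0 + of_real \<rho> * w \<in> D" using D(2) by blast
      have "lin_comb \<epsilon> (P z) ?T / lin_comb \<epsilon> (P x) (z0 + of_real \<rho> * w) =
         ((of_real \<rho> * w * (1 - \<alpha> * cnj w)) ^ m * u z ?T) / ((of_real \<rho> * w) ^ m * u x (z0 + of_real \<rho> * w))"
        unfolding u(2)[OF z TD] u(2)[OF xr scD] a(2) az disc_map_minus by simp
      also have "\<dots> = (u z ?T / u x ?T) * H \<alpha> w"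
        unfolding H_def using w1(2) \<rho> u(3)[OF xr T] u(3)[OF xr sc] by (simp add: power_mult_distrib)
      finally have e: "lin_comb \<epsilon> (P z) ?T / lin_comb \<epsilon> (P x) (z0 + of_real \<rho> * w) = (u z ?T / u x ?T) * H \<alpha> w" .
      have "H 0 w = 1" unfolding H_def using u(3)[OF xr sc] by (simp add: disc_map_def)
      then have H1: "cmod (H \<alpha> w - 1) \<le> 1/5" using \<delta>2(2)[of \<alpha> w] \<alpha> w1(1) by (simp add: dist_norm)
      then have H2: "cmod (H \<alpha> w) \<le> 6/5" using norm_triangle_ineq2[of "H \<alpha> w" 1] by simp
      have "(u z ?T / u x ?T) * H \<alpha> w - 1 = (u z ?T / u x ?T - 1) * H \<alpha> w + (H \<alpha> w - 1)" by (simp add: algebra_simps)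
      also have "cmod \<dots> \<le> cmod (u z ?T / u x ?T - 1) * cmod (H \<alpha> w) + cmod (H \<alpha> w - 1)"
        by (rule order_trans[OF norm_triangle_ineq]) (simp add: norm_mult)
      \<comment> \<open>\<open>6/25 + 1/5 = 11/25\<close> is below \<open>1/2\<close>, which
        explains the tolerance \<open>1/5\<close> used above.\<close>
      also have "\<dots> \<le> 1/5 * (6/5) + 1/5" using Q[OF T] H1 H2 by (intro add_mono mult_mono) auto
      finally show ?thesis unfolding e by simp
    qed
    show ?case using z \<alpha>(1) Q1 R unfolding \<alpha>_def by blast
  qed
qed


lemma set_integrable_restrict:
  fixes f :: "complex \<Rightarrow> complex"
  assumes "W \<in> sets borel"
  shows "integrable (restrict_space lborel W) f \<longleftrightarrow> set_integrable lborel W f"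
    and "integral\<^sup>L (restrict_space lborel W) f = set_lebesgue_integral lborel W f"
  unfolding set_integrable_def set_lebesgue_integral_def using assms
  by (intro integrable_restrict_space integral_restrict_space; simp)+

lemma borel_measurable_restrict_lborel:
  assumes "continuous_on W f" shows "(f :: complex \<Rightarrow> complex) \<in> borel_measurable (restrict_space lborel W)"
proof -
  have "borel_measurable (restrict_space lborel W) = (borel_measurable (restrict_space borel W) :: (complex \<Rightarrow> complex) set)"
    by (rule measurable_cong_sets) (simp_all add: sets_restrict_space)
  then show ?thesis using borel_measurable_continuous_on_restrict[OF assms] by simp
qed

text \<open>The integral is pulled back by \<open>disc_map\<close>, whose Jacobian has three terms;
  \<open>pairing_family_smooth\<close> applies to each of them on the punctured unit disc with
  majorant \<open>K / cmod w\<close>.\<close>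

lemma pairing_disc_smooth:
  fixes \<epsilon> :: "'m::finite \<Rightarrow> complex \<Rightarrow> complex" and P Y\<^sub>1 Y\<^sub>2 :: "complex^'n::finite \<Rightarrow> complex^'m"
  assumes D: "open D" "cball z0 \<rho> \<subseteq> D" and \<rho>: "\<rho> > 0" and hol: "\<And>j. \<epsilon> j holomorphic_on D" and r: "r > 0"
    and P: "vghol B x r P" and Y1: "vghol B x r Y\<^sub>1" and Y2: "vghol B x r Y\<^sub>2"
    and a: "a x = z0" "\<And>z. z \<in> ball x r \<Longrightarrow> a z \<in> ball z0 \<rho>" "\<And>z. z \<in> ball x r \<Longrightarrow> lin_comb \<epsilon> (P z) (a z) = 0"
    and uniq: "\<And>z w. z \<in> ball x r \<Longrightarrow> w \<in> cball z0 \<rho> \<Longrightarrow> lin_comb \<epsilon> (P z) w = 0 \<Longrightarrow> w = a z"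
    and pole: "\<And>z Y. z \<in> ball x r \<Longrightarrow> Y \<in> {Y\<^sub>1, Y\<^sub>2} \<Longrightarrow> \<exists>s. continuous_on (cball z0 \<rho>) s \<and> s holomorphic_on ball z0 \<rho> \<and>
       (\<forall>w\<in>cball z0 \<rho>. (w - a z) * lin_comb \<epsilon> (Y z) w = s w * lin_comb \<epsilon> (P z) w)"
  defines "F \<equiv> \<lambda>z w. lin_comb \<epsilon> (Y\<^sub>1 z) w * cnj (lin_comb \<epsilon> (Y\<^sub>2 z) w) / (4 * complex_of_real (cmod (lin_comb \<epsilon> (P z) w)))"
  shows "\<exists>r'>0. (\<forall>z\<in>ball x r'. set_integrable lborel (ball z0 \<rho>) (F z)) \<and>
     (\<forall>m. C_upto m UNIV (ball x r') (\<lambda>z. set_lebesgue_integral lborel (ball z0 \<rho>) (F z)))"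
proof -
  obtain m r1 C u where r1: "0 < r1" "r1 < r" and m: "m \<ge> 1" and ga: "ghol C x r1 a" and u: "\<forall>z\<in>ball x r1. u z holomorphic_on D \<and>
     (\<forall>w\<in>D. lin_comb \<epsilon> (P z) w = (w - a z) ^ m * u z w) \<and> (\<forall>w\<in>cball z0 \<rho>. u z w \<noteq> 0)"
    using moving_zero[OF D hol r P a(2,3) uniq] by blast
  have r1r: "z \<in> ball x r" if "z \<in> ball x r1" for z using that r1 by auto
  have P1: "vghol B x r1 P" and Y11: "vghol B x r1 Y\<^sub>1" and Y21: "vghol B x r1 Y\<^sub>2"
    using vghol_mono[OF P] vghol_mono[OF Y1] vghol_mono[OF Y2] r1 by auto
  have u': "\<And>z. z \<in> ball x r1 \<Longrightarrow> u z holomorphic_on D" "\<And>z w. z \<in> ball x r1 \<Longrightarrow> w \<in> D \<Longrightarrow> lin_comb \<epsilon> (P z) w = (w - a z) ^ m * u z w"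
     "\<And>z w. z \<in> ball x r1 \<Longrightarrow> w \<in> cball z0 \<rho> \<Longrightarrow> u z w \<noteq> 0" using u by blast+
  have xr1: "x \<in> ball x r1" using r1 by simp
  define \<alpha> where "\<alpha> z = (a z - z0) / of_real \<rho>" for z
  have ev: "\<forall>\<^sub>F z in nhds x. z \<in> ball x r1 \<and> cmod (\<alpha> z) \<le> 1/4 \<and> (\<forall>w\<in>sphere z0 \<rho>. cmod (u z w / u x w - 1) \<le> 1/5) \<and>
     (\<forall>w\<in>ball 0 1 - {0}. cmod (lin_comb \<epsilon> (P z) (disc_map z0 \<rho> (\<alpha> z) w) / lin_comb \<epsilon> (P x) (z0 + of_real \<rho> * w) - 1) \<le> 1/2)"
    unfolding \<alpha>_def by (rule disc_ratio_near_one[OF D \<rho> hol r1(1) P1 ga a(1) a(2)[OF r1r] u'])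
  then obtain r3 where r3: "r3 > 0" and near3: "\<And>z. z \<in> ball x r3 \<Longrightarrow> z \<in> ball x r1 \<and> cmod (\<alpha> z) \<le> 1/4 \<and> (\<forall>w\<in>sphere z0 \<rho>. cmod (u z w / u x w - 1) \<le> 1/5) \<and>
     (\<forall>w\<in>ball 0 1 - {0}. cmod (lin_comb \<epsilon> (P z) (disc_map z0 \<rho> (\<alpha> z) w) / lin_comb \<epsilon> (P x) (z0 + of_real \<rho> * w) - 1) \<le> 1/2)"
    unfolding eventually_nhds_metric by (auto simp: dist_commute)
  define r2 where "r2 = min r3 r1"
  have r2: "r2 > 0" and r2r1: "r2 \<le> r1" using r3 r1 by (auto simp: r2_def)
  have near: "z \<in> ball x r1 \<and> cmod (\<alpha> z) \<le> 1/4 \<and> (\<forall>w\<in>sphere z0 \<rho>. cmod (u z w / u x w - 1) \<le> 1/5) \<and>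
     (\<forall>w\<in>ball 0 1 - {0}. cmod (lin_comb \<epsilon> (P z) (disc_map z0 \<rho> (\<alpha> z) w) / lin_comb \<epsilon> (P x) (z0 + of_real \<rho> * w) - 1) \<le> 1/2)"
    if "z \<in> ball x r2" for z
    by (rule near3) (use that in \<open>auto simp: r2_def\<close>)
  have ec: "continuous_on D (\<epsilon> j)" for j by (rule holomorphic_on_imp_continuous_on[OF hol])
  have lc: "continuous_on D (lin_comb \<epsilon> y)" for y by (rule lin_comb_continuous[OF ec])
  have az: "a z = z0 + of_real \<rho> * \<alpha> z" for z using \<rho> by (simp add: \<alpha>_def)
  let ?T = "\<lambda>z. disc_map z0 \<rho> (\<alpha> z)"
  have T: "?T z w \<in> cball z0 \<rho>" "?T z w \<in> ball z0 \<rho>" "?T z w \<in> D" if "z \<in> ball x r2" "w \<in> ball 0 1" for z w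
  proof -
    show "?T z w \<in> ball z0 \<rho>" using disc_map_ball[OF _ _ \<rho>] near[OF that(1)] that(2) by simp
    then show "?T z w \<in> cball z0 \<rho>" by auto
    then show "?T z w \<in> D" using D(2) by blast
  qed
  \<comment> \<open>The centre is removed because the reference function vanishes there.\<close>
  define V where "V = ball (0::complex) 1 - {0}"
  let ?M = "restrict_space lborel V"
  have Vs: "V \<in> sets borel" "V \<subseteq> ball 0 1" "space ?M = V" by (auto simp: V_def space_restrict_space)
  define \<phi> where "\<phi> z w = lin_comb \<epsilon> (P z) (?T z w)" for z w
  define \<phi>\<^sub>0 where "\<phi>\<^sub>0 w = lin_comb \<epsilon> (P x) (z0 + of_real \<rho> * w)" for w
  define \<psi> where "\<psi> Y z w = lin_comb \<epsilon> (Y z) (?T z w)" for Y :: "complex^'n \<Rightarrow> complex^'m" and z w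
  \<comment> \<open>Carries the Jacobian term \<open>\<alpha> * cnj w\<close>. It is still
    holomorphic in the parameter, since \<open>cnj w\<close> is a constant there.\<close>
  define \<psi>' where "\<psi>' Y z w = \<alpha> z * cnj w * lin_comb \<epsilon> (Y z) (?T z w)" for Y :: "complex^'n \<Rightarrow> complex^'m" and z w
  have sx: "z0 + of_real \<rho> * w \<in> cball z0 \<rho>" "z0 + of_real \<rho> * w \<in> D" if "w \<in> ball 0 1" for w
  proof -
    have "\<rho> * cmod w \<le> \<rho> * 1" using that \<rho> by (intro mult_left_mono) auto
    then show "z0 + of_real \<rho> * w \<in> cball z0 \<rho>" using \<rho> by (simp add: dist_norm norm_mult)
    then show "z0 + of_real \<rho> * w \<in> D" using D(2) by blast
  qed
  have \<phi>0: "\<phi>\<^sub>0 w \<noteq> 0" if "w \<in> V" for w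
  proof -
    have w: "w \<in> ball 0 1" "w \<noteq> 0" using that by (auto simp: V_def)
    show ?thesis unfolding \<phi>\<^sub>0_def u'(2)[OF xr1 sx(2)[OF w(1)]] using u'(3)[OF xr1 sx(1)[OF w(1)]] w(2) \<rho> a(1) by simp
  qed
  have Tc: "continuous_on V (?T z)" for z unfolding disc_map_def[abs_def] by (intro continuous_intros)
  have TV: "?T z ` V \<subseteq> D" if "z \<in> ball x r2" for z using T(3)[OF that] Vs(2) by blast
  have cy: "continuous_on V (\<lambda>w. lin_comb \<epsilon> y (?T z w))" if "z \<in> ball x r2" for z y
    by (rule continuous_on_compose2[OF lc Tc TV[OF that]])
  have m1: "\<phi> z \<in> borel_measurable ?M" "\<psi> Y z \<in> borel_measurable ?M" "\<psi>' Y z \<in> borel_measurable ?M" if "z \<in> ball x r2" for z Y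
    unfolding \<phi>_def[abs_def] \<psi>_def[abs_def] \<psi>'_def[abs_def] using cy[OF that]
    by (intro borel_measurable_restrict_lborel continuous_intros; assumption)+
  have m2: "\<phi>\<^sub>0 \<in> borel_measurable ?M" unfolding \<phi>\<^sub>0_def[abs_def]
  proof (rule borel_measurable_restrict_lborel, rule continuous_on_compose2[OF lc])
    show "(\<lambda>w. z0 + of_real \<rho> * w) ` V \<subseteq> D" using sx(2) Vs(2) by blast
  qed (intro continuous_intros)
  have g\<alpha>: "(\<lambda>s. \<alpha> (z + s *s v)) holomorphic_on {s. z + s *s v \<in> ball x r2}" for z v
    unfolding \<alpha>_def by (intro holomorphic_intros holomorphic_on_subset[OF ghol_holomorphic[OF ga]]) (use r2r1 \<rho> in auto)
  \<comment> \<open>For fixed \<open>w\<close> the image point is affine in \<alpha>, hence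
    holomorphic in the parameter. A holomorphic automorphism of the disc moving the centre would
    involve \<open>cnj \<alpha>\<close> instead.\<close>
  have gT: "(\<lambda>s. ?T (z + s *s v) w) holomorphic_on {s. z + s *s v \<in> ball x r2}" for z v w
    unfolding disc_map_def by (intro holomorphic_intros g\<alpha>)
  have h1: "(\<lambda>s. \<psi> Y (z + s *s v) w) holomorphic_on {s. z + s *s v \<in> ball x r2}" if "w \<in> V" "vghol B x r1 Y" for z v w Y
    unfolding \<psi>_def lin_comb_def
  proof (intro holomorphic_intros)
    fix j
    show "(\<lambda>s. Y (z + s *s v) $ j) holomorphic_on {s. z + s *s v \<in> ball x r2}"
      by (rule holomorphic_on_subset[OF ghol_holomorphic[OF vghol_ghol[OF that(2)]]]) (use r2r1 in auto)
    have "(\<epsilon> j \<circ> (\<lambda>s. ?T (z + s *s v) w)) holomorphic_on {s. z + s *s v \<in> ball x r2}"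
      by (rule holomorphic_on_compose_gen[OF gT hol]) (use T(3) that(1) Vs(2) in blast)
    then show "(\<lambda>s. \<epsilon> j (?T (z + s *s v) w)) holomorphic_on {s. z + s *s v \<in> ball x r2}" by (simp add: o_def)
  qed
  have h2: "(\<lambda>s. \<psi>' Y (z + s *s v) w) holomorphic_on {s. z + s *s v \<in> ball x r2}" if "w \<in> V" "vghol B x r1 Y" for z v w Y
    using holomorphic_on_mult[OF holomorphic_on_mult[OF g\<alpha> holomorphic_on_const] h1[OF that]] unfolding \<psi>'_def \<psi>_def .
  have h3: "(\<lambda>s. \<phi> (z + s *s v) w) holomorphic_on {s. z + s *s v \<in> ball x r2}" if "w \<in> V" for z v w
    using h1[OF that P1] unfolding \<phi>_def \<psi>_def .
  have nr: "cmod (\<phi> z w / \<phi>\<^sub>0 w - 1) \<le> 1/2" if "w \<in> V" "z \<in> ball x r2" for w z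
    using near[OF that(2)] that(1) unfolding \<phi>_def \<phi>\<^sub>0_def V_def by blast
  have sph: "sphere z0 \<rho> \<subseteq> cball z0 \<rho>" by auto
  obtain E where E: "E > 0" "\<And>j w. w \<in> cball z0 \<rho> \<Longrightarrow> cmod (\<epsilon> j w) \<le> E"
    using lin_comb_bounded_on_compact[where \<epsilon> = \<epsilon>, OF compact_cball continuous_on_subset[OF ec D(2)]] by metis
  \<comment> \<open>The bound for a single function is that of a family which is constant in its
    index.\<close>
  obtain U0 where U0: "U0 > 0" "\<And>w. w \<in> cball z0 \<rho> \<Longrightarrow> cmod (u x w) \<le> U0"
    using lin_comb_bounded_on_compact[where \<epsilon> = "\<lambda>_::'n. u x", OF compact_cball continuous_on_subset[OF holomorphic_on_imp_continuous_on[OF u'(1)[OF xr1]] D(2)]] by metis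
  obtain \<delta> where \<delta>: "\<delta> > 0" "\<And>w. w \<in> cball z0 \<rho> \<Longrightarrow> \<delta> \<le> cmod (u x w)"
    using compact_nonzero_lower_bound[OF compact_cball continuous_on_subset[OF holomorphic_on_imp_continuous_on[OF u'(1)[OF xr1]] D(2)] u'(3)[OF xr1]] by metis
  define CY where "CY = of_nat (CARD('m)) * (B * E)"
  have CY: "cmod (lin_comb \<epsilon> (Y z) w) \<le> CY" if "vghol B x r1 Y" "z \<in> ball x r2" "w \<in> cball z0 \<rho>" for Y z w
    unfolding CY_def by (rule ghol_bound[OF ghol_lin_comb[OF that(1)]]) (use E that r2r1 in auto)
  have us: "cmod (u z w) \<ge> 4/5 * \<delta>" "cmod (u z w) \<le> 6/5 * U0" if "z \<in> ball x r2" "w \<in> sphere z0 \<rho>" for z w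
  proof -
    have w: "w \<in> cball z0 \<rho>" using that(2) by auto
    have q: "cmod (u z w / u x w - 1) \<le> 1/5" using near[OF that(1)] that(2) by blast
    have e: "cmod (u z w) = cmod (u z w / u x w) * cmod (u x w)" using u'(3)[OF xr1 w] by (simp add: norm_divide)
    have "4/5 \<le> cmod (u z w / u x w)" "cmod (u z w / u x w) \<le> 6/5"
      using norm_triangle_ineq2[of 1 "1 - u z w / u x w"] norm_triangle_ineq2[of "u z w / u x w" 1] q by (auto simp: norm_minus_commute)
    then show "cmod (u z w) \<ge> 4/5 * \<delta>" "cmod (u z w) \<le> 6/5 * U0"
      unfolding e using mult_mono[OF _ \<delta>(2)[OF w], of "4/5" "cmod (u z w / u x w)"]
        mult_mono[OF _ U0(2)[OF w], of "cmod (u z w / u x w)" "6/5"] \<delta>(1) U0(1) by auto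
  qed
  have ub: "cmod (u z w) \<le> 6/5 * U0" if "z \<in> ball x r2" "w \<in> cball z0 \<rho>" for z w
  proof (rule maximum_modulus_cball[OF _ _ \<rho> us(2)[OF that(1)] that(2)])
    have h: "u z holomorphic_on cball z0 \<rho>" using u'(1) near[OF that(1)] D(2) holomorphic_on_subset by blast
    then show "continuous_on (cball z0 \<rho>) (u z)" by (rule holomorphic_on_imp_continuous_on)
    show "u z holomorphic_on ball z0 \<rho>" by (rule holomorphic_on_subset[OF h]) auto
  qed
  have azr: "cmod (a z - z0) \<le> \<rho>/4" if "z \<in> ball x r2" for z
  proof -
    have "cmod (\<alpha> z) \<le> 1/4" using near[OF that] by blast
    then show ?thesis using \<rho> by (simp add: \<alpha>_def norm_divide field_simps)
  qed
  \<comment> \<open>Bound for the pole function \<open>s\<close> on the circle: there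
    \<open>\<bar>w - a\<bar>\<close> is at most \<open>2 * \<rho>\<close>,
    \<open>\<bar>\<psi>\<bar>\<close> at most \<open>CY\<close>, and
    \<open>\<bar>\<phi>\<bar>\<close> at least \<open>(\<rho>/2) ^ m * (4/5 * \<delta>)\<close>. It
    holds inside by the maximum principle, uniformly in the parameter.\<close>
  define S0 where "S0 = 2 * \<rho> * CY / ((\<rho>/2) ^ m * (4/5 * \<delta>))"
  have CY0: "CY \<ge> 0" using ghol_nonneg[OF vghol_ghol[OF P1] r1(1)] E by (simp add: CY_def)
  \<comment> \<open>From \<open>\<psi> = s * \<phi> / (w - a)\<close> one gets
    \<open>\<bar>\<psi>\<bar>^2 / \<bar>\<phi>\<bar> = \<bar>s\<bar>^2 * \<bar>\<phi>\<bar> /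
    \<bar>w - a\<bar>^2\<close>. One factor \<open>w - a\<close> of \<phi> cancels, the other
    \<open>m - 1\<close> are bounded by \<open>2 * \<rho>\<close>, and the remaining denominator is
    at least \<open>\<rho>/2\<close> times the modulus of the disc coordinate.\<close>
  define K where "K = S0\<^sup>2 * ((2 * \<rho>) ^ (m - 1) * (6/5 * U0)) / (\<rho> / 2)"
  have K0: "K \<ge> 0" using \<rho> U0 by (simp add: K_def)
  have bnd: "(cmod (\<psi> Y z w))\<^sup>2 \<le> (K / cmod w) * cmod (\<phi> z w)" if w: "w \<in> V" and z: "z \<in> ball x r2" and Y: "Y \<in> {Y\<^sub>1, Y\<^sub>2}" for w z Y
  proof -
    have zr1: "z \<in> ball x r1" using near[OF z] by blast
    have vY: "vghol B x r1 Y" using Y Y11 Y21 by auto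
    obtain s where s: "continuous_on (cball z0 \<rho>) s" "s holomorphic_on ball z0 \<rho>"
        "\<And>w. w \<in> cball z0 \<rho> \<Longrightarrow> (w - a z) * lin_comb \<epsilon> (Y z) w = s w * lin_comb \<epsilon> (P z) w"
      using pole[OF r1r[OF zr1] Y] by blast
    have sb: "cmod (s y) \<le> S0" if "y \<in> cball z0 \<rho>" for y
    proof (rule maximum_modulus_cball[OF s(1,2) \<rho> _ that])
      fix y assume y: "y \<in> sphere z0 \<rho>"
      have y': "y \<in> cball z0 \<rho>" "y \<in> D" using y D(2) by auto
      have d: "\<rho>/2 \<le> cmod (y - a z)" "cmod (y - a z) \<le> 2 * \<rho>"
        using azr[OF z] y norm_triangle_ineq2[of "y - z0" "a z - z0"] norm_triangle_ineq4[of "y - z0" "a z - z0"] \<rho>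
        by (auto simp: dist_norm norm_minus_commute)
      have "cmod (lin_comb \<epsilon> (P z) y) = cmod (y - a z) ^ m * cmod (u z y)" unfolding u'(2)[OF zr1 y'(2)] by (simp add: norm_mult norm_power)
      also have "\<dots> \<ge> (\<rho>/2) ^ m * (4/5 * \<delta>)" using d us(1)[OF z y] \<rho> \<delta> by (intro mult_mono power_mono) auto
      finally have lo: "(\<rho>/2) ^ m * (4/5 * \<delta>) \<le> cmod (lin_comb \<epsilon> (P z) y)" .
      have pos: "0 < (\<rho>/2) ^ m * (4/5 * \<delta>)" using \<rho> \<delta> by simp
      have "cmod (s y) * ((\<rho>/2) ^ m * (4/5 * \<delta>)) \<le> cmod (s y) * cmod (lin_comb \<epsilon> (P z) y)" using lo by (intro mult_left_mono) auto
      also have "\<dots> = cmod (y - a z) * cmod (lin_comb \<epsilon> (Y z) y)" using s(3)[OF y'(1)] by (metis norm_mult)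
      also have "\<dots> \<le> 2 * \<rho> * CY" using d(2) CY[OF vY z y'(1)] \<rho> by (intro mult_mono) auto
      finally show "cmod (s y) \<le> S0" unfolding S0_def pos_le_divide_eq[OF pos] .
    qed
    have w1: "w \<in> ball 0 1" "w \<noteq> 0" "cmod w > 0" using w by (auto simp: V_def)
    let ?t = "?T z w"
    have tin: "?t \<in> cball z0 \<rho>" "?t \<in> D" using T[OF z w1(1)] by auto
    have ta: "?t - a z = of_real \<rho> * w * (1 - \<alpha> z * cnj w)" unfolding az by (rule disc_map_minus)
    have "cmod (\<alpha> z * cnj w) \<le> 1/4 * 1" unfolding norm_mult using near[OF z] w1(1) by (intro mult_mono) auto
    then have "1/2 \<le> cmod (1 - \<alpha> z * cnj w)" using norm_triangle_ineq2[of 1 "\<alpha> z * cnj w"] by simp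
    then have "\<rho> * cmod w * (1/2) \<le> \<rho> * cmod w * cmod (1 - \<alpha> z * cnj w)" using \<rho> by (intro mult_left_mono) auto
    then have talow: "\<rho> / 2 * cmod w \<le> cmod (?t - a z)" unfolding ta norm_mult using \<rho> by simp
    then have tapos: "cmod (?t - a z) > 0" using \<rho> w1(3) by (meson half_gt_zero less_le_trans mult_pos_pos)
    have tahigh: "cmod (?t - a z) \<le> 2 * \<rho>"
      using tin(1) azr[OF z] norm_triangle_ineq4[of "?t - z0" "a z - z0"] \<rho> by (simp add: dist_norm norm_minus_commute)
    have ph: "cmod (\<phi> z w) = cmod (?t - a z) ^ m * cmod (u z ?t)" unfolding \<phi>_def u'(2)[OF zr1 tin(2)] by (simp add: norm_mult norm_power)
    also have "cmod (?t - a z) ^ m = cmod (?t - a z) * cmod (?t - a z) ^ (m - 1)" using m by (cases m) auto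
    finally have ph2: "cmod (\<phi> z w) = cmod (?t - a z) * (cmod (?t - a z) ^ (m - 1) * cmod (u z ?t))" by simp
    have ph3: "cmod (?t - a z) ^ (m - 1) * cmod (u z ?t) \<le> (2 * \<rho>) ^ (m - 1) * (6/5 * U0)"
      using tahigh ub[OF z tin(1)] \<rho> U0 by (intro mult_mono power_mono) auto
    have "cmod (?t - a z) * cmod (\<psi> Y z w) = cmod (s ?t) * cmod (\<phi> z w)"
      using s(3)[OF tin(1)] unfolding \<psi>_def \<phi>_def by (metis norm_mult)
    then have "cmod (\<psi> Y z w) = cmod (s ?t) * (cmod (?t - a z) ^ (m - 1) * cmod (u z ?t))"
      unfolding ph2 using tapos by (simp add: mult.left_commute)
    then have "(cmod (\<psi> Y z w))\<^sup>2 = (cmod (s ?t))\<^sup>2 * (cmod (?t - a z) ^ (m - 1) * cmod (u z ?t)) * (cmod (\<phi> z w) / cmod (?t - a z))"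
      unfolding ph2 using tapos by (simp add: power2_eq_square)
    also have "\<dots> \<le> S0\<^sup>2 * ((2 * \<rho>) ^ (m - 1) * (6/5 * U0)) * (cmod (\<phi> z w) / (\<rho> / 2 * cmod w))"
      using sb[OF tin(1)] ph3 talow \<rho> w1(3) U0 tahigh ub[OF z tin(1)] by (intro mult_mono power_mono divide_left_mono mult_nonneg_nonneg mult_pos_pos tapos) auto
    also have "\<dots> = (K / cmod w) * cmod (\<phi> z w)" by (simp add: K_def field_simps)
    finally show ?thesis .
  qed
  have bnd': "(cmod (\<psi>' Y z w))\<^sup>2 \<le> (K / cmod w) * cmod (\<phi> z w)" if w: "w \<in> V" and z: "z \<in> ball x r2" and Y: "Y \<in> {Y\<^sub>1, Y\<^sub>2}" for w z Y
  proof -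
    have "cmod (\<alpha> z * cnj w) \<le> 1 * 1" unfolding norm_mult using near[OF z] w by (intro mult_mono) (auto simp: V_def)
    then have "cmod (\<psi>' Y z w) \<le> 1 * cmod (\<psi> Y z w)" unfolding \<psi>'_def \<psi>_def norm_mult[of "\<alpha> z * cnj w"] by (intro mult_right_mono) auto
    then have "(cmod (\<psi>' Y z w))\<^sup>2 \<le> (cmod (\<psi> Y z w))\<^sup>2" by (intro power_mono) auto
    then show ?thesis using bnd[OF that] by linarith
  qed
  have iK: "integrable ?M (\<lambda>w. K / cmod w)"
  proof -
    have "set_integrable lborel V (\<lambda>w. 1 / cmod (w - 0))"
      by (rule set_integrable_subset[OF integrable_inverse_norm[of 1 0]]) (use Vs in auto)
    then have "integrable ?M (\<lambda>w. 1 / cmod w)" unfolding set_integrable_def using Vs(1) by (subst integrable_restrict_space) auto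
    then have "integrable ?M (\<lambda>w. K * (1 / cmod w))" by (rule integrable_mult_right)
    then show ?thesis by simp
  qed
  define J where "J f g z = (\<integral>w. f z w * cnj (g z w) / (4 * complex_of_real (cmod (\<phi> z w))) \<partial>?M)" for f g :: "complex^'n \<Rightarrow> complex \<Rightarrow> complex" and z
  have key: "(\<forall>z\<in>ball x r2. integrable ?M (\<lambda>w. f z w * cnj (g z w) / (4 * complex_of_real (cmod (\<phi> z w))))) \<and> (\<forall>k. C_upto k UNIV (ball x (r2/2)) (J f g))"
    if fg: "f \<in> {\<psi> Y\<^sub>1, \<psi>' Y\<^sub>1}" "g \<in> {\<psi> Y\<^sub>2, \<psi>' Y\<^sub>2}" for f g
  proof -
    have fm: "f z \<in> borel_measurable ?M" "g z \<in> borel_measurable ?M" if "z \<in> ball x r2" for z using fg m1[OF that] by auto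
    have fh: "(\<lambda>s. f (z + s *s v) w) holomorphic_on {s. z + s *s v \<in> ball x r2}" "(\<lambda>s. g (z + s *s v) w) holomorphic_on {s. z + s *s v \<in> ball x r2}" if "w \<in> space ?M" for z v w
      using fg h1[of w] h2[of w] Y11 Y21 that Vs(3) by auto
    have fb: "(cmod (f z w))\<^sup>2 \<le> (K / cmod w) * cmod (\<phi> z w)" "(cmod (g z w))\<^sup>2 \<le> (K / cmod w) * cmod (\<phi> z w)" if "w \<in> space ?M" "z \<in> ball x r2" for z w
      using fg bnd[of w z] bnd'[of w z] that Vs(3) by auto
    note L = pairing_family_smooth[where M = ?M and x = x and r = r2 and \<phi> = \<phi> and \<psi>\<^sub>1 = f and \<psi>\<^sub>2 = g and \<phi>\<^sub>0 = \<phi>\<^sub>0 and B = "\<lambda>w. K / cmod w",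
       OF m1(1) fm m2 _ _ fh _ fb iK]
    show ?thesis unfolding J_def using L \<phi>0 h3 nr K0 Vs(3) r2 by auto
  qed
  \<comment> \<open>One integral for each term of the Jacobian
    \<open>1 - \<alpha> * cnj w - cnj (\<alpha> * cnj w)\<close>; the last term is a conjugate and
    goes into the second, conjugated factor.\<close>
  define N where "N z = of_real (\<rho>\<^sup>2) * (J (\<psi> Y\<^sub>1) (\<psi> Y\<^sub>2) z + (-1) * J (\<psi>' Y\<^sub>1) (\<psi> Y\<^sub>2) z + (-1) * J (\<psi> Y\<^sub>1) (\<psi>' Y\<^sub>2) z)" for z
  have main: "set_integrable lborel (ball z0 \<rho>) (F z) \<and> set_lebesgue_integral lborel (ball z0 \<rho>) (F z) = N z" if z: "z \<in> ball x r2" for z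
  proof -
    have zr: "z \<in> ball x r" using near[OF z] r1r by blast
    have \<alpha>4: "cmod (\<alpha> z) \<le> 1/4" using near[OF z] by blast
    define S where "S = ball z0 \<rho> - {a z}"
    have T0: "?T z 0 = a z" unfolding az by (simp add: disc_map_def)
    have img: "?T z ` V = S"
    proof -
      have "?T z ` V = ?T z ` ball 0 1 - ?T z ` {0}"
        unfolding V_def by (rule inj_on_image_set_diff[OF disc_map_inj[OF \<alpha>4 \<rho>]]) auto
      then show ?thesis unfolding S_def disc_map_image[OF \<alpha>4 \<rho>] by (simp add: T0)
    qed
    define Jac where "Jac w = \<bar>(cmod (of_real \<rho> * (1 - \<alpha> z * cnj w)))\<^sup>2 - (cmod (- of_real \<rho> * \<alpha> z * w))\<^sup>2\<bar>" for w
    \<comment> \<open>Puncturing at the zero changes nothing: there the denominator is 0 and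
      \<open>F\<close> is 0 by the convention on division.\<close>
    have indF: "indicator (ball z0 \<rho>) w *\<^sub>R F z w = indicator S w *\<^sub>R F z w" for w
      using a(3)[OF zr] by (auto simp: S_def indicator_def F_def)
    have SetsS: "S \<in> sets borel" by (auto simp: S_def)
    have SD: "S \<subseteq> D" using D(2) by (auto simp: S_def subset_iff)
    have li: "(\<lambda>w. indicator S w *\<^sub>R lin_comb \<epsilon> y w) \<in> borel_measurable borel" for y
      by (rule borel_measurable_continuous_on_indicator[OF SetsS continuous_on_subset[OF lc SD]])
    have mF: "(\<lambda>w. indicator S w *\<^sub>R F z w) \<in> borel_measurable borel"
    proof -
      note [measurable] = li
      have "(\<lambda>w. indicator S w *\<^sub>R F z w) = (\<lambda>w. (indicator S w *\<^sub>R lin_comb \<epsilon> (Y\<^sub>1 z) w) * cnj (indicator S w *\<^sub>R lin_comb \<epsilon> (Y\<^sub>2 z) w) / (4 * complex_of_real (cmod (indicator S w *\<^sub>R lin_comb \<epsilon> (P z) w))))"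
        by (auto simp: F_def indicator_def fun_eq_iff)
      also have "\<dots> \<in> borel_measurable borel" by measurable
      finally show ?thesis .
    qed
    have eqJ: "Jac w *\<^sub>R F z (?T z w) = of_real (\<rho>\<^sup>2) * (\<psi> Y\<^sub>1 z w * cnj (\<psi> Y\<^sub>2 z w) / (4 * complex_of_real (cmod (\<phi> z w)))
       - \<psi>' Y\<^sub>1 z w * cnj (\<psi> Y\<^sub>2 z w) / (4 * complex_of_real (cmod (\<phi> z w))) - \<psi> Y\<^sub>1 z w * cnj (\<psi>' Y\<^sub>2 z w) / (4 * complex_of_real (cmod (\<phi> z w))))"
      if "w \<in> V" for w
    proof -
      have "complex_of_real (Jac w) = of_real (\<rho>\<^sup>2) * (1 - \<alpha> z * cnj w - cnj (\<alpha> z * cnj w))"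
        unfolding Jac_def using that by (intro disc_map_jacobian[OF \<alpha>4]) (auto simp: V_def)
      then have "Jac w *\<^sub>R F z (?T z w) = of_real (\<rho>\<^sup>2) * (1 - \<alpha> z * cnj w - cnj (\<alpha> z * cnj w)) * F z (?T z w)"
        unfolding scaleR_conv_of_real by simp
      then show ?thesis unfolding F_def \<psi>_def \<psi>'_def \<phi>_def by (simp add: algebra_simps diff_divide_distrib add_divide_distrib)
    qed
    let ?R = "\<lambda>w. of_real (\<rho>\<^sup>2) * (\<psi> Y\<^sub>1 z w * cnj (\<psi> Y\<^sub>2 z w) / (4 * complex_of_real (cmod (\<phi> z w)))
       - \<psi>' Y\<^sub>1 z w * cnj (\<psi> Y\<^sub>2 z w) / (4 * complex_of_real (cmod (\<phi> z w))) - \<psi> Y\<^sub>1 z w * cnj (\<psi>' Y\<^sub>2 z w) / (4 * complex_of_real (cmod (\<phi> z w))))"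
    have iR: "integrable ?M ?R"
      using key[of "\<psi> Y\<^sub>1" "\<psi> Y\<^sub>2"] key[of "\<psi>' Y\<^sub>1" "\<psi> Y\<^sub>2"] key[of "\<psi> Y\<^sub>1" "\<psi>' Y\<^sub>2"] z by (intro integrable_mult_right Bochner_Integration.integrable_diff) auto
    have iJ: "integrable ?M (\<lambda>w. Jac w *\<^sub>R F z (?T z w))"
      using iR eqJ Vs(3) by (subst Bochner_Integration.integrable_cong[OF refl, of _ _ ?R]) auto
    have sJ: "set_integrable lborel V (\<lambda>w. Jac w *\<^sub>R F z (?T z w))" using iJ set_integrable_restrict(1)[OF Vs(1)] by blast
    have mJ: "(\<lambda>w. indicator V w *\<^sub>R (Jac w *\<^sub>R F z (?T z w))) \<in> borel_measurable borel"
      using borel_measurable_integrable[OF sJ[unfolded set_integrable_def]] by simp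
    have inj: "inj_on (?T z) V" by (rule inj_on_subset[OF disc_map_inj[OF \<alpha>4 \<rho>] Vs(2)])
    note cov = change_of_variables_complex[of V "?T z" "\<lambda>w. of_real \<rho> * (1 - \<alpha> z * cnj w)" "\<lambda>w. - of_real \<rho> * \<alpha> z * w" "F z", folded Jac_def, unfolded img,
       OF Vs(1) SetsS inj disc_map_derivative mF mJ]
    have s1: "set_integrable lborel S (F z)" using cov(1) sJ by blast
    have "set_lebesgue_integral lborel S (F z) = set_lebesgue_integral lborel V (\<lambda>w. Jac w *\<^sub>R F z (?T z w))" by (rule cov(2)[OF s1])
    also have "\<dots> = (\<integral>w. Jac w *\<^sub>R F z (?T z w) \<partial>?M)" by (rule set_integrable_restrict(2)[OF Vs(1), symmetric])
    also have "\<dots> = integral\<^sup>L ?M ?R" by (rule Bochner_Integration.integral_cong[OF refl eqJ]) (simp add: Vs(3))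
    also have "\<dots> = N z"
      unfolding N_def J_def using key[of "\<psi> Y\<^sub>1" "\<psi> Y\<^sub>2"] key[of "\<psi>' Y\<^sub>1" "\<psi> Y\<^sub>2"] key[of "\<psi> Y\<^sub>1" "\<psi>' Y\<^sub>2"] z by simp
    finally show ?thesis using s1 unfolding set_integrable_def set_lebesgue_integral_def indF by simp
  qed
  have NC: "C_upto k UNIV (ball x (r2/2)) N" for k
  proof -
    have o: "coord_open UNIV (ball x (r2/2))" by (rule coord_open_open[OF open_ball])
    have bl: "bounded_linear (\<lambda>y::complex. c * y)" for c by (rule bounded_linear_mult_right)
    show ?thesis unfolding N_def[abs_def]
      by (intro C_upto_bounded_linear[OF bl o] C_upto_add[OF o]) (use key in auto)
  qed
  have "C_upto k UNIV (ball x (r2/2)) (\<lambda>z. set_lebesgue_integral lborel (ball z0 \<rho>) (F z))" for k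
    by (rule C_upto_cong[OF coord_open_open[OF open_ball] _ NC]) (use main r2 in auto)
  then show ?thesis using main r2 by (intro exI[of _ "r2/2"]) auto
qed

section \<open>First and second derivatives of the norm\<close>

definition vderiv :: "complex^'n::finite \<Rightarrow> (complex^'n \<Rightarrow> complex^'m::finite) \<Rightarrow> complex^'n \<Rightarrow> complex^'m" where
  "vderiv v P z = (\<chi> j. hderiv v (\<lambda>z. P z $ j) z)"

lemma vghol_vderiv:
  assumes "vghol B x r P" "r' < r" shows "vghol (B / (r - r') * norm v) x r' (vderiv v P)"
  unfolding vghol_def vderiv_def using ghol_hderiv[OF vghol_ghol[OF assms(1)] assms(2)] by simp

lemma vderiv_smult:
  assumes "vghol B x r P" "z \<in> ball x r" shows "vderiv (a *s v) P z = a *s vderiv v P z"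
  unfolding vderiv_def using hderiv_smult[OF vghol_ghol[OF assms(1)] assms(2)] by (simp add: vec_eq_iff)

lemma lin_comb_smult: "lin_comb \<epsilon> (a *s y) w = a * lin_comb \<epsilon> y w"
  by (simp add: lin_comb_def sum_distrib_left mult.assoc)

lemma lin_comb_real_derivative:
  assumes "vghol B x r P" "z \<in> ball x r"
  shows "((\<lambda>t. lin_comb \<epsilon> (P (z + t *\<^sub>R v)) w) has_vector_derivative lin_comb \<epsilon> (vderiv v P z) w) (at 0)"
  unfolding lin_comb_def vderiv_def
  by (intro has_vector_derivative_sum) (simp, intro has_vector_derivative_mult_left ghol_real_derivative[OF vghol_ghol[OF assms(1)] assms(2)])

lemma lin_comb_Lipschitz:
  fixes P :: "complex^'n::finite \<Rightarrow> complex^'m::finite"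
  assumes P: "vghol B x r P" and r: "r' < r" and z: "z \<in> ball x r'" "y \<in> ball x r'" and E: "\<And>j. cmod (\<epsilon> j w) \<le> E" "E \<ge> 0"
  shows "cmod (lin_comb \<epsilon> (P y) w - lin_comb \<epsilon> (P z) w) \<le> of_nat (CARD('m)) * (B / (r - r') * E) * norm (y - z)"
proof -
  have "cmod (lin_comb \<epsilon> (P y - P z) w) \<le> of_nat (CARD('m)) * ((B / (r - r') * norm (y - z)) * E)"
    by (rule lin_comb_bound) (use vghol_Lipschitz[OF P r z] E in auto)
  then show ?thesis unfolding lin_comb_diff by (simp add: mult_ac)
qed

lemma norm_derivative:
  fixes f :: "real \<Rightarrow> complex"
  assumes f: "(f has_vector_derivative f') (at 0)" and nz: "f 0 \<noteq> 0"
  shows "((\<lambda>t. complex_of_real (cmod (f t))) has_vector_derivative (cnj (f 0) * f' + f 0 * cnj f') / (2 * complex_of_real (cmod (f 0)))) (at 0)"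
proof -
  have "((\<lambda>t. cmod (f t)) has_derivative (\<lambda>h. (h *\<^sub>R f') \<bullet> sgn (f 0))) (at 0)"
    using has_derivative_compose[OF f[unfolded has_vector_derivative_def] has_derivative_norm[OF nz]] .
  then have "((\<lambda>t. cmod (f t)) has_vector_derivative (f' \<bullet> sgn (f 0))) (at 0)"
    unfolding has_vector_derivative_def by simp
  then have "((\<lambda>t. cmod (f t)) has_real_derivative (f' \<bullet> sgn (f 0))) (at 0)"
    by (simp add: has_real_derivative_iff_has_vector_derivative)
  from has_vector_derivative_of_real[OF this]
  have "((\<lambda>t. complex_of_real (cmod (f t))) has_vector_derivative complex_of_real (f' \<bullet> sgn (f 0))) (at 0)" .
  moreover have "complex_of_real (f' \<bullet> sgn (f 0)) = (cnj (f 0) * f' + f 0 * cnj f') / (2 * complex_of_real (cmod (f 0)))"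
  proof -
    have "f' \<bullet> sgn (f 0) = (f' \<bullet> f 0) / cmod (f 0)" by (simp add: sgn_div_norm divide_inverse mult.commute)
    moreover have "cnj (f 0) * f' + f 0 * cnj f' = complex_of_real (2 * (f' \<bullet> f 0))"
      by (simp add: complex_eq_iff inner_complex_def)
    ultimately show ?thesis by simp
  qed
  ultimately show ?thesis by simp
qed

text \<open>Only the base value \<open>x\<close> must be nonzero: for \<open>y = 0\<close> the left
  side is 1 and the right side 2. This gives a Lipschitz bound at the base parameter even if the
  perturbed differential vanishes at the point.\<close>

lemma phase_Lipschitz:
  fixes x y :: complex
  assumes "x \<noteq> 0"
  shows "cmod (x / cmod x - y / cmod y) \<le> 2 * cmod (x - y) / cmod x"
proof (cases "y = 0")
  case True
  then show ?thesis using assms by (simp add: norm_divide)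
next
  case False
  have "x / cmod x - y / cmod y = (x - y) / cmod x + y * (cmod y - cmod x) / (cmod x * cmod y)"
    using assms False by (simp add: field_simps)
  also have "cmod \<dots> \<le> cmod ((x - y) / cmod x) + cmod (y * (cmod y - cmod x) / (cmod x * cmod y))" by (rule norm_triangle_ineq)
  also have "cmod (y * (cmod y - cmod x) / (cmod x * cmod y)) = \<bar>cmod y - cmod x\<bar> / cmod x"
  proof -
    have "cmod (y * complex_of_real (cmod y - cmod x) / (cmod x * cmod y)) = cmod y * \<bar>cmod y - cmod x\<bar> / (cmod x * cmod y)"
      unfolding norm_divide norm_mult norm_of_real by simp
    then show ?thesis using False by simp
  qed
  also have "\<dots> \<le> cmod (x - y) / cmod x" using norm_triangle_ineq3[of y x] by (intro divide_right_mono) (auto simp: norm_minus_commute)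
  finally show ?thesis by (simp add: norm_divide)
qed

lemma finite_AE_lborel: "finite N \<Longrightarrow> N \<in> null_sets (lborel :: complex measure)"
  by (rule finite_imp_null_set_lborel)

text \<open>Here the differentials may have zeros in the piece; the assumptions are continuity and
  boundedness of the basis coefficients on a compact set.\<close>

locale family_piece =
  fixes \<epsilon> :: "'m::finite \<Rightarrow> complex \<Rightarrow> complex" and S W :: "complex set" and E :: real
  assumes S: "compact S" "\<And>j. continuous_on S (\<epsilon> j)" and W: "W \<in> sets borel" "W \<subseteq> S"
    and E: "E \<ge> 0" "\<And>j w. w \<in> S \<Longrightarrow> cmod (\<epsilon> j w) \<le> E"
begin

abbreviation M :: "complex measure" where "M \<equiv> restrict_space lborel W"

lemma space_M: "space M = W" using W by (simp add: space_restrict_space)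

lemma finite_measure_M: "finite_measure M"
proof -
  have "emeasure lborel W < \<infinity>"
    by (rule emeasure_bounded_finite[OF bounded_subset[OF compact_imp_bounded[OF S(1)] W(2)]])
  then show ?thesis by (intro finite_measureI) (use W in \<open>simp add: emeasure_restrict_space space_restrict_space\<close>)
qed

lemma lin_comb_measurable [measurable]: "lin_comb \<epsilon> y \<in> borel_measurable M"
  by (rule borel_measurable_restrict_lborel[OF continuous_on_subset[OF lin_comb_continuous[where \<epsilon> = \<epsilon>, OF S(2)] W(2)]])

lemma AE_M_finite: "finite N \<Longrightarrow> (\<And>w. w \<in> W \<Longrightarrow> w \<notin> N \<Longrightarrow> Q w) \<Longrightarrow> AE w in M. Q w"
proof -
  assume N: "finite N" and Q: "\<And>w. w \<in> W \<Longrightarrow> w \<notin> N \<Longrightarrow> Q w"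
  have "AE w in lborel. w \<notin> N" by (rule AE_not_in[OF finite_AE_lborel[OF N]])
  then have "AE w in lborel. w \<in> W \<longrightarrow> Q w" by eventually_elim (use Q in blast)
  then show "AE w in M. Q w" using W by (subst AE_restrict_space_iff) auto
qed

lemma bounded_integrable:
  fixes f :: "complex \<Rightarrow> complex"
  assumes "f \<in> borel_measurable M" "\<And>w. w \<in> W \<Longrightarrow> cmod (f w) \<le> K"
  shows "integrable M f"
proof (rule finite_measure.integrable_const_bound[OF finite_measure_M _ assms(1)])
  show "AE w in M. norm (f w) \<le> K" by (rule AE_I2) (use assms(2) space_M in auto)
qed

text \<open>\<open>\<bar>\<phi>\<bar>\<close> is Lipschitz in the parameter at every point and
  differentiable at \<open>t = 0\<close> off the finitely many zeros. \<open>G\<close> is the part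
  of the derivative that is antilinear in \<open>v\<close>.\<close>

lemma norm_first_derivative:
  fixes P :: "complex^'n::finite \<Rightarrow> complex^'m" and v :: "complex^'n"
  assumes P: "vghol B x r P" and z: "z \<in> ball x r" and fin: "finite {w \<in> W. lin_comb \<epsilon> (P z) w = 0}"
  defines "G \<equiv> (\<integral>w. lin_comb \<epsilon> (P z) w * cnj (lin_comb \<epsilon> (vderiv v P z) w) / (2 * complex_of_real (cmod (lin_comb \<epsilon> (P z) w))) \<partial>M)"
  shows "((\<lambda>t. \<integral>w. complex_of_real (cmod (lin_comb \<epsilon> (P (z + t *\<^sub>R v)) w)) \<partial>M) has_vector_derivative G + cnj G) (at 0)"
proof -
  define r' where "r' = (r + dist x z) / 2"
  have r': "r' < r" "z \<in> ball x r'" using z by (auto simp: r'_def)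
  obtain \<delta> where \<delta>: "\<delta> > 0" "\<And>t. \<bar>t\<bar> < \<delta> \<Longrightarrow> z + t *\<^sub>R v \<in> ball x r'" using shift_in_open[OF open_ball r'(2)] by metis
  define L where "L = of_nat (CARD('m)) * (B / (r - r') * E) * norm v"
  define g where "g w = lin_comb \<epsilon> (P z) w * cnj (lin_comb \<epsilon> (vderiv v P z) w) / (2 * complex_of_real (cmod (lin_comb \<epsilon> (P z) w)))" for w
  have gm: "g \<in> borel_measurable M" unfolding g_def[abs_def] by measurable
  have cg: "integrable M (\<lambda>w. lin_comb \<epsilon> y w)" for y
  proof (rule bounded_integrable[OF lin_comb_measurable])
    show "cmod (lin_comb \<epsilon> y w) \<le> of_nat (CARD('m)) * (norm y * E)" if "w \<in> W" for w
      using that E W by (intro lin_comb_bound Finite_Cartesian_Product.norm_nth_le) auto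
  qed
  have ig: "integrable M g"
  proof (rule Bochner_Integration.integrable_bound[OF cg[of "vderiv v P z"] gm])
    show "AE w in M. norm (g w) \<le> norm (lin_comb \<epsilon> (vderiv v P z) w)"
      by (rule AE_I2) (auto simp: g_def norm_divide norm_mult)
  qed
  have "((\<lambda>t. \<integral>w. complex_of_real (cmod (lin_comb \<epsilon> (P (z + t *\<^sub>R v)) w)) \<partial>M) has_vector_derivative (\<integral>w. g w + cnj (g w) \<partial>M)) (at 0)"
  proof (rule has_vector_derivative_integral(2)[where M = M and F = "\<lambda>t w. complex_of_real (cmod (lin_comb \<epsilon> (P (z + t *\<^sub>R v)) w))" and G = "\<lambda>_. L", OF \<delta>(1)])
    show "(\<lambda>w. complex_of_real (cmod (lin_comb \<epsilon> (P (z + t *\<^sub>R v)) w))) \<in> borel_measurable M" for t by measurable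
    show "integrable M (\<lambda>w. complex_of_real (cmod (lin_comb \<epsilon> (P (z + 0 *\<^sub>R v)) w)))"
      using integrable_norm[OF cg[of "P z"]] by (simp add: complex_of_real_integrable_eq)
    show "integrable M (\<lambda>_. L)" by (rule finite_measure.integrable_const[OF finite_measure_M])
    show "(\<lambda>w. g w + cnj (g w)) \<in> borel_measurable M" using gm by measurable
    show "AE w in M. \<forall>t. \<bar>t\<bar> < \<delta> \<longrightarrow> norm (complex_of_real (cmod (lin_comb \<epsilon> (P (z + t *\<^sub>R v)) w)) - complex_of_real (cmod (lin_comb \<epsilon> (P (z + 0 *\<^sub>R v)) w))) \<le> \<bar>t\<bar> * L"
    proof (intro AE_I2 allI impI)
      fix w t assume w: "w \<in> space M" and t: "\<bar>t\<bar> < \<delta>"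
      have wS: "w \<in> S" using w space_M W by auto
      have "norm (complex_of_real (cmod (lin_comb \<epsilon> (P (z + t *\<^sub>R v)) w)) - complex_of_real (cmod (lin_comb \<epsilon> (P (z + 0 *\<^sub>R v)) w)))
         = \<bar>cmod (lin_comb \<epsilon> (P (z + t *\<^sub>R v)) w) - cmod (lin_comb \<epsilon> (P z) w)\<bar>"
        by (metis add.right_neutral norm_of_real of_real_diff scaleR_zero_left)
      also have "\<dots> \<le> cmod (lin_comb \<epsilon> (P (z + t *\<^sub>R v)) w - lin_comb \<epsilon> (P z) w)" by (rule norm_triangle_ineq3)
      also have "\<dots> \<le> of_nat (CARD('m)) * (B / (r - r') * E) * norm ((z + t *\<^sub>R v) - z)"
        by (rule lin_comb_Lipschitz[OF P r' \<delta>(2)[OF t]]) (use E wS in auto)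
      also have "\<dots> = \<bar>t\<bar> * L" by (simp add: L_def)
      finally show "norm (complex_of_real (cmod (lin_comb \<epsilon> (P (z + t *\<^sub>R v)) w)) - complex_of_real (cmod (lin_comb \<epsilon> (P (z + 0 *\<^sub>R v)) w))) \<le> \<bar>t\<bar> * L" .
    qed
    show "AE w in M. ((\<lambda>t. complex_of_real (cmod (lin_comb \<epsilon> (P (z + t *\<^sub>R v)) w))) has_vector_derivative g w + cnj (g w)) (at 0)"
    proof (rule AE_M_finite[OF fin])
      fix w assume "w \<in> W" "w \<notin> {w \<in> W. lin_comb \<epsilon> (P z) w = 0}"
      then have nz: "lin_comb \<epsilon> (P (z + 0 *\<^sub>R v)) w \<noteq> 0" by simp
      from norm_derivative[OF lin_comb_real_derivative[OF P z, of \<epsilon> v w] nz]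
      show "((\<lambda>t. complex_of_real (cmod (lin_comb \<epsilon> (P (z + t *\<^sub>R v)) w))) has_vector_derivative g w + cnj (g w)) (at 0)"
        by (simp add: g_def add_divide_distrib add.commute)
    qed
  qed
  moreover have "(\<integral>w. g w + cnj (g w) \<partial>M) = G + cnj G"
    using ig unfolding G_def g_def[symmetric] by simp
  ultimately show ?thesis by simp
qed

text \<open>Differentiates the antilinear part of the first derivative in the fixed coordinate.
  \<open>H\<close> is complex linear in \<open>v\<close>, whereas \<kappa> picks up
  \<open>- \<i>\<close>, so a Wirtinger derivative isolates \<open>H\<close>. The integrable
  \<open>G\<close> bounds \<open>\<bar>\<psi> / \<phi>\<bar>\<close>; in the application simple
  poles allow this.\<close>

lemma norm_second_derivative:
  fixes P Y :: "complex^'n::finite \<Rightarrow> complex^'m"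
  assumes P: "vghol B x r P" and Y: "vghol B x r Y" and r: "r > 0" and fin: "finite {w \<in> W. lin_comb \<epsilon> (P x) w = 0}"
    and G: "integrable M G" "\<And>w. w \<in> W \<Longrightarrow> lin_comb \<epsilon> (P x) w \<noteq> 0 \<Longrightarrow> cmod (lin_comb \<epsilon> (Y x) w) \<le> G w * cmod (lin_comb \<epsilon> (P x) w)"
  defines "H \<equiv> \<lambda>v. (\<integral>w. lin_comb \<epsilon> (vderiv v P x) w * cnj (lin_comb \<epsilon> (Y x) w) / (4 * complex_of_real (cmod (lin_comb \<epsilon> (P x) w))) \<partial>M)"
  shows "\<exists>\<kappa>. (\<forall>v. ((\<lambda>t. \<integral>w. lin_comb \<epsilon> (P (x + t *\<^sub>R v)) w * cnj (lin_comb \<epsilon> (Y (x + t *\<^sub>R v)) w) / (2 * complex_of_real (cmod (lin_comb \<epsilon> (P (x + t *\<^sub>R v)) w))) \<partial>M)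
       has_vector_derivative H v + \<kappa> v) (at 0)) \<and> (\<forall>v. \<kappa> (\<i> *s v) = - \<i> * \<kappa> v)"
proof -
  have xr: "x \<in> ball x r" using r by simp
  define \<phi> where "\<phi> w = lin_comb \<epsilon> (P x) w" for w
  define \<psi> where "\<psi> w = lin_comb \<epsilon> (Y x) w" for w
  define \<phi>v where "\<phi>v v w = lin_comb \<epsilon> (vderiv v P x) w" for v w
  define \<psi>v where "\<psi>v v w = lin_comb \<epsilon> (vderiv v Y x) w" for v w
  have [measurable]: "\<phi> \<in> borel_measurable M" "\<psi> \<in> borel_measurable M" "\<phi>v v \<in> borel_measurable M" "\<psi>v v \<in> borel_measurable M" for v
    unfolding \<phi>_def[abs_def] \<psi>_def[abs_def] \<phi>v_def[abs_def] \<psi>v_def[abs_def] by measurable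
  \<comment> \<open>Of the coefficient \<open>1/2\<close> of \<open>\<phi>v * cnj \<psi>\<close>,
    half is cancelled by the derivative of \<open>1 / \<bar>\<phi>\<bar>\<close>, because
    \<open>\<phi> * cnj \<phi>\<close> is the square of \<open>\<bar>\<phi>\<bar>\<close>; hence the
    4.\<close>
  define h where "h v w = \<phi>v v w * cnj (\<psi> w) / (4 * complex_of_real (cmod (\<phi> w)))" for v w
  define k where "k v w = \<phi> w * cnj (\<psi>v v w) / (2 * complex_of_real (cmod (\<phi> w))) - (\<phi> w)\<^sup>2 * cnj (\<psi> w) * cnj (\<phi>v v w) / (4 * complex_of_real (cmod (\<phi> w)) ^ 3)" for v w
  define E1 where "E1 = of_nat (CARD('m)) * (B / (r / 2) * E)"
  have B0: "B \<ge> 0" using ghol_nonneg[OF vghol_ghol[OF P] r] .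
  have E10: "E1 \<ge> 0" using B0 E r by (simp add: E1_def)
  have bv: "cmod (lin_comb \<epsilon> (vderiv v Q x) w) \<le> E1 * norm v" if "vghol B x r Q" "w \<in> W" for v w and Q :: "complex^'n \<Rightarrow> complex^'m"
  proof -
    have "vghol (B / (r - r/2) * norm v) x (r/2) (vderiv v Q)" by (rule vghol_vderiv[OF that(1)]) (use r in simp)
    then have "cmod (lin_comb \<epsilon> (vderiv v Q x) w) \<le> of_nat (CARD('m)) * ((B / (r - r/2) * norm v) * E)"
      by (rule ghol_bound[OF ghol_lin_comb]) (use E W that r in auto)
    then show ?thesis by (simp add: E1_def mult_ac)
  qed
  have ih: "integrable M (h v)" for v
  proof (rule Bochner_Integration.integrable_bound)
    show "integrable M (\<lambda>w. E1 * norm v * G w)" using G by simp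
    show "h v \<in> borel_measurable M" unfolding h_def[abs_def] by measurable
    show "AE w in M. norm (h v w) \<le> norm (E1 * norm v * G w)"
    proof (rule AE_M_finite[OF fin])
      fix w assume w: "w \<in> W" "w \<notin> {w \<in> W. lin_comb \<epsilon> (P x) w = 0}"
      then have nz: "cmod (\<phi> w) > 0" by (simp add: \<phi>_def)
      have "cmod (h v w) = cmod (\<phi>v v w) * cmod (\<psi> w) / (4 * cmod (\<phi> w))" by (simp add: h_def norm_divide norm_mult)
      also have "\<dots> \<le> (E1 * norm v) * (G w * cmod (\<phi> w)) / (4 * cmod (\<phi> w))"
        using bv[OF P w(1), of v] G(2)[OF w(1)] w E10 unfolding \<phi>v_def \<psi>_def \<phi>_def by (intro divide_right_mono mult_mono) auto
      also have "\<dots> = E1 * norm v * G w / 4" using nz by simp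
      also have "\<dots> \<le> norm (E1 * norm v * G w)" unfolding real_norm_def
        using abs_ge_self[of "E1 * norm v * G w"] abs_ge_zero[of "E1 * norm v * G w"] by linarith
      finally show "norm (h v w) \<le> norm (E1 * norm v * G w)" .
    qed
  qed
  have main: "integrable M (\<lambda>w. h v w + k v w)" "((\<lambda>t. \<integral>w. lin_comb \<epsilon> (P (x + t *\<^sub>R v)) w * cnj (lin_comb \<epsilon> (Y (x + t *\<^sub>R v)) w) / (2 * complex_of_real (cmod (lin_comb \<epsilon> (P (x + t *\<^sub>R v)) w))) \<partial>M)
       has_vector_derivative (\<integral>w. h v w + k v w \<partial>M)) (at 0)" for v
  proof -
    have xr2: "x \<in> ball x (r/2)" using r by simp
    obtain \<delta> where \<delta>: "\<delta> > 0" "\<And>t. \<bar>t\<bar> < \<delta> \<Longrightarrow> x + t *\<^sub>R v \<in> ball x (r/2)" using shift_in_open[OF open_ball xr2] by metis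
    define F where "F t w = lin_comb \<epsilon> (P (x + t *\<^sub>R v)) w * cnj (lin_comb \<epsilon> (Y (x + t *\<^sub>R v)) w) / (2 * complex_of_real (cmod (lin_comb \<epsilon> (P (x + t *\<^sub>R v)) w)))" for t w
    define K where "K w = E1 * norm v / 2 + E1 * norm v * G w" for w
    have Fm: "F t \<in> borel_measurable M" for t unfolding F_def[abs_def] by measurable
    have F0: "integrable M (F 0)"
    proof (rule bounded_integrable[OF Fm])
      fix w assume w: "w \<in> W"
      have "cmod (F 0 w) \<le> cmod (lin_comb \<epsilon> (Y x) w)" by (simp add: F_def norm_divide norm_mult)
      also have "\<dots> \<le> of_nat (CARD('m)) * (B * E)" by (rule ghol_bound[OF ghol_lin_comb[OF Y] xr]) (use E W w in auto)
      finally show "cmod (F 0 w) \<le> of_nat (CARD('m)) * (B * E)" .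
    qed
    have iK: "integrable M K" unfolding K_def[abs_def]
      by (intro Bochner_Integration.integrable_add integrable_mult_right G(1) finite_measure.integrable_const[OF finite_measure_M])
    have hkm: "(\<lambda>w. h v w + k v w) \<in> borel_measurable M" unfolding h_def[abs_def] k_def[abs_def] by measurable
    have Lip: "cmod (lin_comb \<epsilon> (Q (x + t *\<^sub>R v)) w - lin_comb \<epsilon> (Q x) w) \<le> \<bar>t\<bar> * (E1 * norm v)" if "vghol B x r Q" "w \<in> W" "\<bar>t\<bar> < \<delta>" for Q t w
    proof -
      have "cmod (lin_comb \<epsilon> (Q (x + t *\<^sub>R v)) w - lin_comb \<epsilon> (Q x) w) \<le> of_nat (CARD('m)) * (B / (r - r/2) * E) * norm ((x + t *\<^sub>R v) - x)"
        by (rule lin_comb_Lipschitz[OF that(1) _ xr2 \<delta>(2)[OF that(3)]]) (use r E W that in auto)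
      then show ?thesis by (simp add: E1_def mult_ac)
    qed
    have bd: "AE w in M. \<forall>t. \<bar>t\<bar> < \<delta> \<longrightarrow> norm (F t w - F 0 w) \<le> \<bar>t\<bar> * K w"
    proof (rule AE_M_finite[OF fin], intro allI impI)
      fix w t assume w: "w \<in> W" "w \<notin> {w \<in> W. lin_comb \<epsilon> (P x) w = 0}" and t: "\<bar>t\<bar> < \<delta>"
      then have nz: "\<phi> w \<noteq> 0" by (simp add: \<phi>_def)
      define p where "p = lin_comb \<epsilon> (P (x + t *\<^sub>R v)) w"
      define q where "q = lin_comb \<epsilon> (Y (x + t *\<^sub>R v)) w"
      \<comment> \<open>The change of \<psi> is multiplied by a number of modulus at most 1. The
        change of the phase is bounded by \<open>phase_Lipschitz\<close>, whose denominator
        \<open>\<bar>\<phi>\<bar>\<close> is compensated by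
        \<open>\<bar>\<psi>\<bar> \<le> G * \<bar>\<phi>\<bar>\<close>.\<close>
      have "F t w - F 0 w = (p / cmod p) * cnj (q - \<psi> w) / 2 + cnj (\<psi> w) * (p / cmod p - \<phi> w / cmod (\<phi> w)) / 2"
        by (simp add: F_def p_def q_def \<phi>_def \<psi>_def algebra_simps diff_divide_distrib add_divide_distrib)
      also have "cmod \<dots> \<le> cmod (p / cmod p) * cmod (q - \<psi> w) / 2 + cmod (\<psi> w) * cmod (p / cmod p - \<phi> w / cmod (\<phi> w)) / 2"
        by (rule order_trans[OF norm_triangle_ineq]) (simp only: norm_mult norm_divide complex_mod_cnj norm_numeral order_refl)
      also have "\<dots> \<le> 1 * (\<bar>t\<bar> * (E1 * norm v)) / 2 + (G w * cmod (\<phi> w)) * (2 * (\<bar>t\<bar> * (E1 * norm v)) / cmod (\<phi> w)) / 2"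
      proof (intro add_mono divide_right_mono mult_mono)
        show "cmod (p / cmod p) \<le> 1" by (simp add: norm_divide)
        show "cmod (q - \<psi> w) \<le> \<bar>t\<bar> * (E1 * norm v)" unfolding q_def \<psi>_def by (rule Lip[OF Y w(1) t])
        show "cmod (\<psi> w) \<le> G w * cmod (\<phi> w)" unfolding \<psi>_def \<phi>_def by (rule G(2)) (use w in auto)
        have "cmod (\<phi> w - p) \<le> \<bar>t\<bar> * (E1 * norm v)" using Lip[OF P w(1) t] by (simp add: p_def \<phi>_def norm_minus_commute)
        then have "2 * cmod (\<phi> w - p) / cmod (\<phi> w) \<le> 2 * (\<bar>t\<bar> * (E1 * norm v)) / cmod (\<phi> w)" by (intro divide_right_mono mult_left_mono) auto
        then show "cmod (p / cmod p - \<phi> w / cmod (\<phi> w)) \<le> 2 * (\<bar>t\<bar> * (E1 * norm v)) / cmod (\<phi> w)"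
          by (subst norm_minus_commute) (rule order_trans[OF phase_Lipschitz[OF nz]])
        show "0 \<le> G w * cmod (\<phi> w)" using \<open>cmod (\<psi> w) \<le> G w * cmod (\<phi> w)\<close> norm_ge_zero order_trans by blast
      qed auto
      also have "\<dots> = \<bar>t\<bar> * K w" using nz by (simp add: K_def field_simps)
      finally show "norm (F t w - F 0 w) \<le> \<bar>t\<bar> * K w" .
    qed
    have der: "AE w in M. ((\<lambda>t. F t w) has_vector_derivative h v w + k v w) (at 0)"
    proof (rule AE_M_finite[OF fin])
      fix w assume w: "w \<in> W" "w \<notin> {w \<in> W. lin_comb \<epsilon> (P x) w = 0}"
      then have nz: "\<phi> w \<noteq> 0" by (simp add: \<phi>_def)
      let ?p = "\<lambda>t. lin_comb \<epsilon> (P (x + t *\<^sub>R v)) w"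
      let ?q = "\<lambda>t. lin_comb \<epsilon> (Y (x + t *\<^sub>R v)) w"
      have p: "(?p has_vector_derivative \<phi>v v w) (at 0)" unfolding \<phi>v_def by (rule lin_comb_real_derivative[OF P xr])
      have q: "(?q has_vector_derivative \<psi>v v w) (at 0)" unfolding \<psi>v_def by (rule lin_comb_real_derivative[OF Y xr])
      have cq: "((\<lambda>t. cnj (?q t)) has_vector_derivative cnj (\<psi>v v w)) (at 0)"
        by (rule bounded_linear.has_vector_derivative[OF bounded_linear_cnj q])
      have p0: "?p 0 = \<phi> w" "?q 0 = \<psi> w" by (simp_all add: \<phi>_def \<psi>_def)
      define n' where "n' = (cnj (\<phi> w) * \<phi>v v w + \<phi> w * cnj (\<phi>v v w)) / (2 * complex_of_real (cmod (\<phi> w)))"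
      have n: "((\<lambda>t. complex_of_real (cmod (?p t))) has_vector_derivative n') (at 0)"
        using norm_derivative[OF p] nz unfolding p0 n'_def by simp
      define c where "c = complex_of_real (cmod (\<phi> w))"
      have c: "c \<noteq> 0" using nz by (simp add: c_def)
      have inv: "((\<lambda>t. inverse (complex_of_real (cmod (?p t)))) has_vector_derivative - (inverse c * n' * inverse c)) (at 0)"
      proof -
        have "(inverse has_derivative (\<lambda>h. - (inverse c * h * inverse c))) (at (complex_of_real (cmod (?p 0))))"
          unfolding p0 c_def[symmetric] by (rule has_derivative_inverse'[OF c])
        from has_derivative_compose[OF n[unfolded has_vector_derivative_def] this]
        show ?thesis unfolding has_vector_derivative_def by simp
      qed
      have A1: "((\<lambda>t. ?p t * cnj (?q t) * inverse (complex_of_real (cmod (?p t))) / 2) has_vector_derivative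
         ((\<phi> w * cnj (\<psi>v v w) + \<phi>v v w * cnj (\<psi> w)) * inverse c + \<phi> w * cnj (\<psi> w) * (- (inverse c * n' * inverse c))) / 2) (at 0)"
        using has_vector_derivative_divide[OF has_vector_derivative_mult[OF has_vector_derivative_mult[OF p cq] inv], of 2]
        unfolding p0 c_def[symmetric] by (simp add: add.commute)
      have A2: "(\<lambda>t. ?p t * cnj (?q t) * inverse (complex_of_real (cmod (?p t))) / 2) = (\<lambda>t. F t w)"
      proof -
        have gen: "a * b * inverse c / 2 = a * b / (2 * c)" for a b c :: complex
          by (cases "c = 0") (simp_all add: field_simps)
        show ?thesis unfolding F_def gen ..
      qed
      have A3: "((\<phi> w * cnj (\<psi>v v w) + \<phi>v v w * cnj (\<psi> w)) * inverse c + \<phi> w * cnj (\<psi> w) * (- (inverse c * n' * inverse c))) / 2 = h v w + k v w"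
      proof -
        have cc: "\<phi> w * cnj (\<phi> w) = c * c" unfolding c_def by (metis complex_norm_square of_real_mult power2_eq_square)
        have "\<phi> w * cnj (\<psi> w) * (inverse c * n' * inverse c) = cnj (\<psi> w) * ((\<phi> w * cnj (\<phi> w)) * \<phi>v v w + (\<phi> w)\<^sup>2 * cnj (\<phi>v v w)) / (2 * c ^ 3)"
          using c unfolding n'_def c_def[symmetric] by (simp add: field_simps power2_eq_square power3_eq_cube)
        also have "\<dots> = cnj (\<psi> w) * \<phi>v v w / (2 * c) + (\<phi> w)\<^sup>2 * cnj (\<psi> w) * cnj (\<phi>v v w) / (2 * c ^ 3)"
          unfolding cc using c by (simp add: field_simps power2_eq_square power3_eq_cube)
        finally have "\<phi> w * cnj (\<psi> w) * (inverse c * n' * inverse c) = cnj (\<psi> w) * \<phi>v v w / (2 * c) + (\<phi> w)\<^sup>2 * cnj (\<psi> w) * cnj (\<phi>v v w) / (2 * c ^ 3)" .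
        then have e: "\<phi> w * cnj (\<psi> w) * (- (inverse c * n' * inverse c)) = - (cnj (\<psi> w) * \<phi>v v w / (2 * c)) - (\<phi> w)\<^sup>2 * cnj (\<psi> w) * cnj (\<phi>v v w) / (2 * c ^ 3)" by simp
        show ?thesis unfolding e h_def k_def c_def[symmetric] using c by (simp add: field_simps)
      qed
      show "((\<lambda>t. F t w) has_vector_derivative h v w + k v w) (at 0)" using A1 unfolding A2 A3 .
    qed
    note R = has_vector_derivative_integral[where M = M and F = F and G = K and F' = "\<lambda>w. h v w + k v w", OF \<delta>(1) Fm F0 iK hkm bd der]
    show "integrable M (\<lambda>w. h v w + k v w)" by (rule R(1))
    show "((\<lambda>t. \<integral>w. lin_comb \<epsilon> (P (x + t *\<^sub>R v)) w * cnj (lin_comb \<epsilon> (Y (x + t *\<^sub>R v)) w) / (2 * complex_of_real (cmod (lin_comb \<epsilon> (P (x + t *\<^sub>R v)) w))) \<partial>M)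
       has_vector_derivative (\<integral>w. h v w + k v w \<partial>M)) (at 0)"
      using R(2) unfolding F_def .
  qed
  define \<kappa> where "\<kappa> v = integral\<^sup>L M (k v)" for v
  have ik: "integrable M (k v)" for v
    using Bochner_Integration.integrable_diff[OF main(1)[of v] ih[of v]] by simp
  have kk: "k (\<i> *s v) w = - \<i> * k v w" for v w
    unfolding k_def \<phi>v_def \<psi>v_def vderiv_smult[OF P xr] vderiv_smult[OF Y xr] lin_comb_smult by (simp add: algebra_simps)
  have "\<kappa> (\<i> *s v) = - \<i> * \<kappa> v" for v unfolding \<kappa>_def ext[OF kk] by (rule integral_mult_right_zero)
  moreover have "(\<integral>w. h v w + k v w \<partial>M) = H v + \<kappa> v" for v
    using ih ik unfolding H_def \<kappa>_def h_def[symmetric] \<phi>_def[symmetric] \<psi>_def[symmetric] \<phi>v_def[symmetric] by (simp add: h_def[symmetric])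
  ultimately show ?thesis using main(2) by (intro exI[of _ \<kappa>]) simp
qed

end

section \<open>The pairing along a stratum\<close>

lemma finite_common_radius:
  assumes "finite I" "\<And>i. i \<in> I \<Longrightarrow> \<exists>r>0. Q i r" "\<And>i r r'. Q i r \<Longrightarrow> 0 < r' \<Longrightarrow> r' \<le> r \<Longrightarrow> Q i r'"
  shows "\<exists>r>(0::real). \<forall>i\<in>I. Q i r"
  using assms(1,2)
proof (induction rule: finite_induct)
  case empty then show ?case by (intro exI[of _ 1]) auto
next
  case (insert i I)
  then obtain r where r: "r > 0" "\<forall>i\<in>I. Q i r" by blast
  obtain r' where r': "r' > 0" "Q i r'" using insert.prems by blast
  have "Q j (min r r')" if "j \<in> insert i I" for j
    using that r r' assms(3)[of j r "min r r'"] assms(3)[of i r' "min r r'"] by auto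
  then show ?case using r r' by (intro exI[of _ "min r r'"]) auto
qed

locale stratum = riemann_surface X A for X :: "'a topology" and A :: "'a chart set" +
  fixes e :: "'n::finite \<Rightarrow> 'a differential" and S :: "(complex^'n) set"
  assumes basis: "qd_basis A e" and nonzero: "q \<in> S \<Longrightarrow> q \<noteq> 0"
    and symbol_const: "q \<in> S \<Longrightarrow> q' \<in> S \<Longrightarrow> symbol X A (qd_of e q) = symbol X A (qd_of e q')"
    and simple_poles: "q \<in> S \<Longrightarrow> v \<in> tangent_space S q \<Longrightarrow> quotient_at_most_simple_poles A (qd_of e v) (qd_of e q)"
begin

lemma qd_of_in: "qd_of e y \<in> qd"
  using basis by (auto simp: qd_basis_def bij_betw_def)

lemma qd_of_zero: "qd_of e 0 = (\<lambda>c p. 0)"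
  by (simp add: qd_of_def)

lemma qd_of_eq_zero_iff: "qd_of e y = (\<lambda>c p. 0) \<longleftrightarrow> y = 0"
proof
  assume "qd_of e y = (\<lambda>c p. 0)"
  then have "qd_of e y = qd_of e 0" by (simp add: qd_of_zero)
  then show "y = 0" using basis by (simp add: qd_basis_def bij_betw_def inj_eq)
qed (simp add: qd_of_zero)

lemma qd_of_nonzero: "q \<in> S \<Longrightarrow> qd_of e q \<noteq> (\<lambda>c p. 0)"
  using nonzero qd_of_eq_zero_iff by blast

definition coeff :: "'a chart \<Rightarrow> 'n \<Rightarrow> complex \<Rightarrow> complex" where "coeff c j z = e j c (chart_param c z)"

lemma qd_of_coeff: "qd_of e y c (chart_param c z) = lin_comb (coeff c) y z"
  by (simp add: qd_of_def lin_comb_def coeff_def)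

lemma coeff_holomorphic:
  assumes "c \<in> A" shows "coeff c j holomorphic_on im c"
proof -
  have "qd_of e (axis j 1) = e j"
    by (auto simp: qd_of_def fun_eq_iff axis_def if_distrib[of "\<lambda>x. x * _"] cong: if_cong)
  then have "e j \<in> qd" using qd_of_in[of "axis j 1"] by simp
  then show ?thesis using qd_holomorphic[of "e j" c] assms by (simp add: coeff_def[abs_def])
qed

lemma card_zeros_const: "q \<in> S \<Longrightarrow> q' \<in> S \<Longrightarrow> card (zeros (qd_of e q)) = card (zeros (qd_of e q'))"
  by (intro card_zeros_symbol qd_of_in qd_of_nonzero symbol_const)

text \<open>Pieces centred at zeros are full discs, so that the disc map applies to them; every
  other closed disc is free of zeros of \<open>q\<close>, so that \<open>\<bar>\<phi>\<bar>\<close>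
  is bounded below on it.\<close>

definition adapted :: "(complex^'n) \<Rightarrow> 'a set \<Rightarrow> ('a \<Rightarrow> 'a chart) \<Rightarrow> ('a \<Rightarrow> real) \<Rightarrow> ('a \<Rightarrow> complex set) \<Rightarrow> bool" where
  "adapted q I \<gamma> \<rho> W \<longleftrightarrow> pieces I \<gamma> W \<and> zeros (qd_of e q) \<subseteq> I \<and>
     (\<forall>p\<in>I. \<gamma> p \<in> A \<and> p \<in> dom (\<gamma> p) \<and> \<rho> p > 0 \<and> cball (snd (\<gamma> p) p) (\<rho> p) \<subseteq> im (\<gamma> p) \<and> W p \<subseteq> ball (snd (\<gamma> p) p) (\<rho> p) \<and> W p \<in> sets borel \<and>
        (\<forall>z\<in>cball (snd (\<gamma> p) p) (\<rho> p). lin_comb (coeff (\<gamma> p)) q z = 0 \<longrightarrow> p \<in> zeros (qd_of e q) \<and> z = snd (\<gamma> p) p)) \<and>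
     (\<forall>p\<in>zeros (qd_of e q). W p = ball (snd (\<gamma> p) p) (\<rho> p) \<and> lin_comb (coeff (\<gamma> p)) q (snd (\<gamma> p) p) = 0)"

lemma zeros_lin_comb: "c \<in> A \<Longrightarrow> z \<in> im c \<Longrightarrow> chart_param c z \<in> zeros (qd_of e y) \<longleftrightarrow> lin_comb (coeff c) y z = 0"
  using zeros_iff[OF qd_of_in, of c "chart_param c z" y] param_in[of z c] by (simp add: qd_of_coeff)

lemma adapted_exists:
  assumes q: "q \<in> S" shows "\<exists>I \<gamma> \<rho> W. adapted q I \<gamma> \<rho> W"
proof -
  let ?Z = "zeros (qd_of e q)"
  have Z: "finite ?Z" "?Z \<subseteq> topspace X" using finite_zeros[OF qd_of_in qd_of_nonzero[OF q]] by (auto simp: zeros_def)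
  obtain I \<gamma> \<rho> W where I: "pieces I \<gamma> W" "?Z \<subseteq> I" "I \<subseteq> topspace X"
     and pr: "\<And>p. p \<in> I \<Longrightarrow> \<gamma> p \<in> A \<and> p \<in> dom (\<gamma> p) \<and> \<rho> p > 0 \<and> cball (snd (\<gamma> p) p) (\<rho> p) \<subseteq> im (\<gamma> p) \<and> W p \<subseteq> ball (snd (\<gamma> p) p) (\<rho> p) \<and>
        (\<forall>z\<in>cball (snd (\<gamma> p) p) (\<rho> p). chart_param (\<gamma> p) z \<in> ?Z \<longrightarrow> chart_param (\<gamma> p) z = p)"
     and WZ: "\<And>p. p \<in> ?Z \<Longrightarrow> W p = ball (snd (\<gamma> p) p) (\<rho> p)"
    using adapted_pieces[OF Z] by blast
  have "adapted q I \<gamma> \<rho> W" unfolding adapted_def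
  proof (intro conjI ballI impI)
    show "pieces I \<gamma> W" "?Z \<subseteq> I" by (rule I)+
  next
    fix p assume p: "p \<in> I"
    show "\<gamma> p \<in> A" "p \<in> dom (\<gamma> p)" "\<rho> p > 0" "cball (snd (\<gamma> p) p) (\<rho> p) \<subseteq> im (\<gamma> p)" "W p \<subseteq> ball (snd (\<gamma> p) p) (\<rho> p)" using pr[OF p] by auto
    show "W p \<in> sets borel" using I(1) p by (simp add: pieces_def)
    fix z assume z: "z \<in> cball (snd (\<gamma> p) p) (\<rho> p)" "lin_comb (coeff (\<gamma> p)) q z = 0"
    have zi: "z \<in> im (\<gamma> p)" using pr[OF p] z(1) by blast
    then have "chart_param (\<gamma> p) z \<in> ?Z" using zeros_lin_comb[of "\<gamma> p" z q] pr[OF p] z(2) by blast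
    moreover from this have "chart_param (\<gamma> p) z = p" using pr[OF p] z(1) by blast
    ultimately show "p \<in> ?Z" "z = snd (\<gamma> p) p" using coord_param[OF zi] by auto
  next
    fix p assume p: "p \<in> ?Z"
    show "W p = ball (snd (\<gamma> p) p) (\<rho> p)" by (rule WZ[OF p])
    have "\<gamma> p \<in> A" "p \<in> dom (\<gamma> p)" using pr[of p] I(2) p by auto
    moreover have "qd_of e q (\<gamma> p) p = 0" using zeros_iff[OF qd_of_in calculation] p by blast
    ultimately show "lin_comb (coeff (\<gamma> p)) q (snd (\<gamma> p) p) = 0" using qd_of_coeff[of q "\<gamma> p" "snd (\<gamma> p) p"] by simp
  qed
  then show ?thesis by blast
qed

text \<open>Existence: without a zero in a disc, \<open>1 / \<phi>\<close> would obey the maximum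
  principle, although \<phi> is small at the centre and large on the circle. Uniqueness: the
  disjoint discs already use up the constant number of zeros.\<close>

lemma moving_zeros:
  assumes ad: "adapted (P x) I \<gamma> \<rho> W" and P: "vghol B x r P" and r: "r > 0" and PS: "\<And>z. z \<in> ball x r \<Longrightarrow> P z \<in> S"
  shows "\<exists>r1 a. 0 < r1 \<and> r1 \<le> r \<and> (\<forall>p\<in>zeros (qd_of e (P x)). a p x = snd (\<gamma> p) p \<and>
     (\<forall>z\<in>ball x r1. a p z \<in> ball (snd (\<gamma> p) p) (\<rho> p) \<and> lin_comb (coeff (\<gamma> p)) (P z) (a p z) = 0 \<and>
       (\<forall>w\<in>cball (snd (\<gamma> p) p) (\<rho> p). lin_comb (coeff (\<gamma> p)) (P z) w = 0 \<longrightarrow> w = a p z)))"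
proof -
  let ?Z = "zeros (qd_of e (P x))"
  define c where "c p = snd (\<gamma> p) p" for p
  have xr: "x \<in> ball x r" using r by simp
  have I: "pieces I \<gamma> W" "?Z \<subseteq> I" and pr: "\<And>p. p \<in> I \<Longrightarrow> \<gamma> p \<in> A \<and> p \<in> dom (\<gamma> p) \<and> \<rho> p > 0 \<and> cball (c p) (\<rho> p) \<subseteq> im (\<gamma> p)"
    and zr: "\<And>p z. p \<in> I \<Longrightarrow> z \<in> cball (c p) (\<rho> p) \<Longrightarrow> lin_comb (coeff (\<gamma> p)) (P x) z = 0 \<Longrightarrow> p \<in> ?Z \<and> z = c p"
    and WZ: "\<And>p. p \<in> ?Z \<Longrightarrow> W p = ball (c p) (\<rho> p)" and z0: "\<And>p. p \<in> ?Z \<Longrightarrow> lin_comb (coeff (\<gamma> p)) (P x) (c p) = 0"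
    using ad unfolding adapted_def c_def by blast+
  have finI: "finite I" using I(1) by (simp add: pieces_def)
  have finZ: "finite ?Z" using finite_subset[OF I(2) finI] .
  have coc: "continuous_on (cball (c p) (\<rho> p)) (coeff (\<gamma> p) j)" if "p \<in> I" for p j
    using holomorphic_on_imp_continuous_on[OF coeff_holomorphic, of "\<gamma> p" j] pr[OF that] continuous_on_subset by blast
  have "\<exists>r1>0. r1 \<le> r \<and> (\<forall>z\<in>ball x r1. (\<forall>w\<in>sphere (c p) (\<rho> p). lin_comb (coeff (\<gamma> p)) (P z) w \<noteq> 0) \<and> (\<exists>w\<in>ball (c p) (\<rho> p). lin_comb (coeff (\<gamma> p)) (P z) w = 0))"
    if p: "p \<in> ?Z" for p
  proof -
    have pI: "p \<in> I" using p I by blast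
    have \<rho>: "\<rho> p > 0" using pr[OF pI] by blast
    have sub: "sphere (c p) (\<rho> p) \<subseteq> cball (c p) (\<rho> p)" by auto
    have nzs: "lin_comb (coeff (\<gamma> p)) (P x) w \<noteq> 0" if "w \<in> sphere (c p) (\<rho> p)" for w
    proof
      assume "lin_comb (coeff (\<gamma> p)) (P x) w = 0"
      then have "w = c p" using zr[OF pI, of w] that sub by blast
      then show False using that \<rho> by simp
    qed
    obtain \<delta> where \<delta>: "\<delta> > 0" "\<And>w. w \<in> sphere (c p) (\<rho> p) \<Longrightarrow> \<delta> \<le> cmod (lin_comb (coeff (\<gamma> p)) (P x) w)"
      using compact_nonzero_lower_bound[OF compact_sphere continuous_on_subset[OF lin_comb_continuous[where \<epsilon> = "coeff (\<gamma> p)", OF coc[OF pI]] sub] nzs] by metis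
    \<comment> \<open>A change of at most \<open>\<delta> / 3\<close> leaves modulus at least
      \<open>2 / 3 * \<delta>\<close> on the circle and at most \<open>\<delta> / 3\<close> at the
      centre, where the differential at \<open>x\<close> vanishes; this gap gives the
      contradiction.\<close>
    have \<delta>3: "\<delta> / 3 > 0" using \<delta> by simp
    obtain r1 where r1: "0 < r1" "r1 < r" "\<And>z w. z \<in> ball x r1 \<Longrightarrow> w \<in> cball (c p) (\<rho> p) \<Longrightarrow> cmod (lin_comb (coeff (\<gamma> p)) (P z) w - lin_comb (coeff (\<gamma> p)) (P x) w) \<le> \<delta> / 3"
      using lin_comb_variation[where \<epsilon> = "coeff (\<gamma> p)", OF compact_cball coc[OF pI] P r \<delta>3] by metis
    have lo: "2 / 3 * \<delta> \<le> cmod (lin_comb (coeff (\<gamma> p)) (P z) w)" if "z \<in> ball x r1" "w \<in> sphere (c p) (\<rho> p)" for z w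
      using r1(3)[OF that(1), of w] \<delta>(2)[OF that(2)] that(2) sub
        norm_triangle_ineq2[of "lin_comb (coeff (\<gamma> p)) (P x) w" "lin_comb (coeff (\<gamma> p)) (P x) w - lin_comb (coeff (\<gamma> p)) (P z) w"]
      by (auto simp: norm_minus_commute)
    have ex: "\<exists>w\<in>ball (c p) (\<rho> p). lin_comb (coeff (\<gamma> p)) (P z) w = 0" if z: "z \<in> ball x r1" for z
    proof (rule ccontr)
      assume no: "\<not> (\<exists>w\<in>ball (c p) (\<rho> p). lin_comb (coeff (\<gamma> p)) (P z) w = 0)"
      let ?f = "lin_comb (coeff (\<gamma> p)) (P z)"
      have nz: "?f w \<noteq> 0" if "w \<in> cball (c p) (\<rho> p)" for w
      proof (cases "w \<in> ball (c p) (\<rho> p)")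
        case False
        then have "w \<in> sphere (c p) (\<rho> p)" using that by auto
        from lo[OF z this] show ?thesis using \<delta> by auto
      qed (use no in blast)
      have h: "(\<lambda>w. 1 / ?f w) holomorphic_on cball (c p) (\<rho> p)"
        using pr[OF pI] nz
        by (intro holomorphic_intros holomorphic_on_subset[OF lin_comb_holomorphic[where \<epsilon> = "coeff (\<gamma> p)", OF coeff_holomorphic]]) auto
      have "cmod (1 / ?f (c p)) \<le> 1 / (2 / 3 * \<delta>)"
      proof (rule maximum_modulus_cball[OF holomorphic_on_imp_continuous_on[OF h] holomorphic_on_subset[OF h] \<rho>])
        show "cmod (1 / ?f w) \<le> 1 / (2 / 3 * \<delta>)" if "w \<in> sphere (c p) (\<rho> p)" for w
          unfolding norm_divide using lo[OF z that] \<delta> by (intro frac_le) auto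
      qed (use \<rho> in auto)
      moreover have "c p \<in> cball (c p) (\<rho> p)" using \<rho> by simp
      then have "cmod (?f (c p)) \<le> \<delta> / 3" "?f (c p) \<noteq> 0" using r1(3)[OF z, of "c p"] z0[OF p] nz by auto
      ultimately show False using \<delta> by (simp add: norm_divide divide_simps split: if_splits)
    qed
    have "lin_comb (coeff (\<gamma> p)) (P z) w \<noteq> 0" if "z \<in> ball x r1" "w \<in> sphere (c p) (\<rho> p)" for z w
      using lo[OF that] \<delta> by auto
    then show ?thesis using ex r1 by (intro exI[of _ r1]) auto
  qed
  then have "\<exists>r1>0. \<forall>p\<in>?Z. r1 \<le> r \<and> (\<forall>z\<in>ball x r1. (\<forall>w\<in>sphere (c p) (\<rho> p). lin_comb (coeff (\<gamma> p)) (P z) w \<noteq> 0) \<and> (\<exists>w\<in>ball (c p) (\<rho> p). lin_comb (coeff (\<gamma> p)) (P z) w = 0))"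
    by (intro finite_common_radius[OF finZ]) auto
  then obtain r0 where r0: "r0 > 0" and R0: "\<And>p z. p \<in> ?Z \<Longrightarrow> z \<in> ball x r0 \<Longrightarrow> (\<forall>w\<in>sphere (c p) (\<rho> p). lin_comb (coeff (\<gamma> p)) (P z) w \<noteq> 0) \<and> (\<exists>w\<in>ball (c p) (\<rho> p). lin_comb (coeff (\<gamma> p)) (P z) w = 0)"
    by blast
  define r1 where "r1 = min r0 r"
  have r1: "r1 > 0" "r1 \<le> r" using r0 r by (auto simp: r1_def)
  define a where "a p z = (SOME w. w \<in> ball (c p) (\<rho> p) \<and> lin_comb (coeff (\<gamma> p)) (P z) w = 0)" for p z
  have a: "a p z \<in> ball (c p) (\<rho> p)" "lin_comb (coeff (\<gamma> p)) (P z) (a p z) = 0" if "p \<in> ?Z" "z \<in> ball x r1" for p z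
  proof -
    have "\<exists>w. w \<in> ball (c p) (\<rho> p) \<and> lin_comb (coeff (\<gamma> p)) (P z) w = 0" using R0[OF that(1), of z] that(2) by (auto simp: r1_def)
    from someI_ex[OF this] show "a p z \<in> ball (c p) (\<rho> p)" "lin_comb (coeff (\<gamma> p)) (P z) (a p z) = 0" unfolding a_def by auto
  qed
  have uniq: "w = a p z" if p: "p \<in> ?Z" and z: "z \<in> ball x r1" and w: "w \<in> cball (c p) (\<rho> p)" "lin_comb (coeff (\<gamma> p)) (P z) w = 0" for p z w
  proof -
    have zr': "z \<in> ball x r" using z r1 by auto
    have img: "y \<in> im (\<gamma> p)" if "p \<in> ?Z" "y \<in> ball (c p) (\<rho> p)" for p y
      using pr[of p] I(2) that by (auto simp: subset_iff)
    define q where "q p = chart_param (\<gamma> p) (a p z)" for p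
    have qW: "q p \<in> chart_param (\<gamma> p) ` W p" if "p \<in> ?Z" for p
      unfolding q_def WZ[OF that] using a(1)[OF that z] by (rule imageI)
    have disj: "p = p'" if "p \<in> ?Z" "p' \<in> ?Z" "y \<in> chart_param (\<gamma> p) ` W p" "y \<in> chart_param (\<gamma> p') ` W p'" for p p' y
      using I that unfolding pieces_def disjoint_family_on_def by blast
    have inj: "inj_on q ?Z" by (rule inj_onI) (metis disj qW)
    have qz: "q p \<in> zeros (qd_of e (P z))" if "p \<in> ?Z" for p
      unfolding q_def using zeros_lin_comb[of "\<gamma> p" "a p z" "P z"] img[OF that a(1)[OF that z]] a(2)[OF that z] pr[of p] I(2) that by blast
    \<comment> \<open>Pigeonhole: one zero per disc gives an injection between finite sets of equal
      cardinality, so there are no further zeros.\<close>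
    have "q ` ?Z = zeros (qd_of e (P z))"
    proof (rule card_subset_eq)
      show "finite (zeros (qd_of e (P z)))" by (rule finite_zeros[OF qd_of_in qd_of_nonzero[OF PS[OF zr']]])
      show "q ` ?Z \<subseteq> zeros (qd_of e (P z))" using qz by blast
      show "card (q ` ?Z) = card (zeros (qd_of e (P z)))"
        unfolding card_image[OF inj] by (rule card_zeros_const[OF PS[OF xr] PS[OF zr']])
    qed
    \<comment> \<open>The circle is free of zeros, so the zero lies in the open disc; disjointness
      is available for the open discs only.\<close>
    moreover have wb: "w \<in> ball (c p) (\<rho> p)"
    proof (rule ccontr)
      assume "w \<notin> ball (c p) (\<rho> p)"
      then have "w \<in> sphere (c p) (\<rho> p)" using w(1) by auto
      then show False using R0[OF p, of z] z w(2) by (auto simp: r1_def)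
    qed
    moreover have "chart_param (\<gamma> p) w \<in> zeros (qd_of e (P z))"
      using zeros_lin_comb[of "\<gamma> p" w "P z"] img[OF p wb] w(2) pr[of p] I(2) p by blast
    ultimately obtain p' where p': "p' \<in> ?Z" "chart_param (\<gamma> p) w = q p'" by (metis imageE)
    have "p = p'" by (rule disj[OF p p'(1) _ qW[OF p'(1), folded p'(2)]]) (use wb WZ[OF p] in blast)
    then have "chart_param (\<gamma> p) w = chart_param (\<gamma> p) (a p z)" using p'(2) by (simp add: q_def)
    then show "w = a p z" using coord_param[OF img[OF p wb]] coord_param[OF img[OF p a(1)[OF p z]]] by metis
  qed
  have x1: "x \<in> ball x r1" using r1 by simp
  have "a p x = c p" if "p \<in> ?Z" for p
    using uniq[OF that x1 _ z0[OF that]] pr[of p] I(2) that by (metis centre_in_cball less_imp_le subsetD)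
  then show ?thesis using r1 a uniq unfolding c_def by blast
qed

lemma pole_function:
  assumes c: "c \<in> A" "cball z0 \<rho> \<subseteq> im c" and q: "q \<in> S" and v: "quotient_at_most_simple_poles A (qd_of e v) (qd_of e q)"
    and a: "a \<in> ball z0 \<rho>" "lin_comb (coeff c) q a = 0" and uniq: "\<And>w. w \<in> cball z0 \<rho> \<Longrightarrow> lin_comb (coeff c) q w = 0 \<Longrightarrow> w = a"
  shows "\<exists>s. continuous_on (cball z0 \<rho>) s \<and> s holomorphic_on ball z0 \<rho> \<and>
       (\<forall>w\<in>cball z0 \<rho>. (w - a) * lin_comb (coeff c) v w = s w * lin_comb (coeff c) q w)"
proof -
  have cont: "continuous_on (im c) (lin_comb (coeff c) q)"
    by (rule holomorphic_on_imp_continuous_on[OF lin_comb_holomorphic[where \<epsilon> = "coeff c", OF coeff_holomorphic[OF c(1)]]])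
  define D where "D = {w \<in> im c. lin_comb (coeff c) q w \<in> - {0}} \<union> ball z0 \<rho>"
  have "open {w \<in> im c. lin_comb (coeff c) q w \<in> - {0}}"
    using continuous_open_preimage[OF cont open_im[OF c(1)] open_Compl[OF closed_singleton[of 0]]] by (simp add: vimage_def Int_def)
  then have oD: "open D" unfolding D_def by auto
  have Dim: "D \<subseteq> im c" using c(2) ball_subset_cball unfolding D_def by blast
  have cD: "cball z0 \<rho> \<subseteq> D"
  proof
    fix w assume w: "w \<in> cball z0 \<rho>"
    show "w \<in> D"
    proof (cases "lin_comb (coeff c) q w = 0")
      case True then show ?thesis using uniq[OF w] a(1) by (auto simp: D_def)
    next
      case False then show ?thesis using w c(2) unfolding D_def by blast
    qed
  qed
  have "\<exists>s. s holomorphic_on D \<and> (\<forall>w\<in>D. (w - a) * qd_of e v c (chart_param c w) = s w * qd_of e q c (chart_param c w))"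
  proof (rule simple_pole_quotient[OF qd_of_in qd_of_nonzero[OF q] qd_of_in v c(1) oD Dim])
    show "a \<in> D" using a(1) by (simp add: D_def)
    show "qd_of e q c (chart_param c a) = 0" using a(2) by (simp add: qd_of_coeff)
    show "w = a" if "w \<in> D" "qd_of e q c (chart_param c w) = 0" for w
      using that uniq[of w] unfolding D_def qd_of_coeff by auto
  qed
  then obtain s where s: "s holomorphic_on D" "\<And>w. w \<in> D \<Longrightarrow> (w - a) * lin_comb (coeff c) v w = s w * lin_comb (coeff c) q w"
    unfolding qd_of_coeff by blast
  have "s holomorphic_on cball z0 \<rho>" by (rule holomorphic_on_subset[OF s(1) cD])
  then show ?thesis using s(2) cD
    by (intro exI[of _ s]) (auto intro: holomorphic_on_imp_continuous_on holomorphic_on_subset)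
qed

lemma pairing_density_coeff:
  "pairing_density (qd_of e q) (qd_of e v) (qd_of e w) c (chart_param c z) =
     lin_comb (coeff c) v z * cnj (lin_comb (coeff c) w z) / (4 * complex_of_real (cmod (lin_comb (coeff c) q z)))"
  by (simp add: pairing_density_def qd_of_coeff)

text \<open>Each piece is settled by \<open>pairing_disc_smooth\<close> or
  \<open>pairing_piece_smooth\<close>, according to whether it is centred at a zero; the finitely
  many radii have a common lower bound.\<close>

lemma pairing_smooth:
  assumes P: "vghol B x r P" and Y1: "vghol B x r Y\<^sub>1" and Y2: "vghol B x r Y\<^sub>2" and r: "r > 0" and PS: "\<And>z. z \<in> ball x r \<Longrightarrow> P z \<in> S"
    and T: "\<And>z. z \<in> ball x r \<Longrightarrow> Y\<^sub>1 z \<in> tangent_space S (P z)" "\<And>z. z \<in> ball x r \<Longrightarrow> Y\<^sub>2 z \<in> tangent_space S (P z)"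
  shows "\<exists>r'>0. (\<forall>z\<in>ball x r'. surface_integrable A (pairing_density (qd_of e (P z)) (qd_of e (Y\<^sub>1 z)) (qd_of e (Y\<^sub>2 z)))) \<and>
     (\<forall>m. C_upto m UNIV (ball x r') (\<lambda>z. pairing X A (qd_of e (P z)) (qd_of e (Y\<^sub>1 z)) (qd_of e (Y\<^sub>2 z))))"
proof -
  have xr: "x \<in> ball x r" using r by simp
  obtain I \<gamma> \<rho> W where ad: "adapted (P x) I \<gamma> \<rho> W" using adapted_exists[OF PS[OF xr]] by blast
  let ?Z = "zeros (qd_of e (P x))"
  obtain r1 a where r1: "0 < r1" "r1 \<le> r" and a: "\<forall>p\<in>?Z. a p x = snd (\<gamma> p) p \<and>
     (\<forall>z\<in>ball x r1. a p z \<in> ball (snd (\<gamma> p) p) (\<rho> p) \<and> lin_comb (coeff (\<gamma> p)) (P z) (a p z) = 0 \<and>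
       (\<forall>w\<in>cball (snd (\<gamma> p) p) (\<rho> p). lin_comb (coeff (\<gamma> p)) (P z) w = 0 \<longrightarrow> w = a p z))"
    using moving_zeros[OF ad P r PS] by blast
  have pc: "pieces I \<gamma> W" using ad by (simp add: adapted_def)
  have finI: "finite I" using pc by (simp add: pieces_def)
  define F where "F p z w = lin_comb (coeff (\<gamma> p)) (Y\<^sub>1 z) w * cnj (lin_comb (coeff (\<gamma> p)) (Y\<^sub>2 z) w) / (4 * complex_of_real (cmod (lin_comb (coeff (\<gamma> p)) (P z) w)))" for p z w
  have rr: "z \<in> ball x r" if "z \<in> ball x r1" for z using that r1 by auto
  have P1: "vghol B x r1 P" and Y11: "vghol B x r1 Y\<^sub>1" and Y21: "vghol B x r1 Y\<^sub>2"
    using vghol_mono[OF P] vghol_mono[OF Y1] vghol_mono[OF Y2] r1 by auto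
  have "\<exists>r'>0. (\<forall>z\<in>ball x r'. set_integrable lborel (W p) (F p z)) \<and> (\<forall>m. C_upto m UNIV (ball x r') (\<lambda>z. set_lebesgue_integral lborel (W p) (F p z)))" if p: "p \<in> I" for p
  proof -
    have pr: "\<gamma> p \<in> A" "\<rho> p > 0" "cball (snd (\<gamma> p) p) (\<rho> p) \<subseteq> im (\<gamma> p)" "W p \<subseteq> ball (snd (\<gamma> p) p) (\<rho> p)" "W p \<in> sets borel"
      and zz: "\<And>z. z \<in> cball (snd (\<gamma> p) p) (\<rho> p) \<Longrightarrow> lin_comb (coeff (\<gamma> p)) (P x) z = 0 \<Longrightarrow> p \<in> ?Z"
      using ad p unfolding adapted_def by blast+
    have hol: "coeff (\<gamma> p) j holomorphic_on im (\<gamma> p)" for j by (rule coeff_holomorphic[OF pr(1)])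
    show ?thesis
    proof (cases "p \<in> ?Z")
      case False
      have coc: "continuous_on (cball (snd (\<gamma> p) p) (\<rho> p)) (coeff (\<gamma> p) j)" for j
        by (rule continuous_on_subset[OF holomorphic_on_imp_continuous_on[OF hol] pr(3)])
      have sub: "W p \<subseteq> cball (snd (\<gamma> p) p) (\<rho> p)" using pr(4) ball_subset_cball by blast
      show ?thesis unfolding F_def
        by (rule pairing_piece_smooth[OF compact_cball coc pr(5) sub r P Y1 Y2]) (use zz False in blast)
    next
      case True
      have Wp: "W p = ball (snd (\<gamma> p) p) (\<rho> p)" using ad True by (simp add: adapted_def)
      show ?thesis unfolding F_def Wp
      proof (rule pairing_disc_smooth[OF open_im[OF pr(1)] pr(3,2) hol r1(1) P1 Y11 Y21, where a = "a p"])
        show "a p x = snd (\<gamma> p) p" using a True by blast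
        show "a p z \<in> ball (snd (\<gamma> p) p) (\<rho> p)" "lin_comb (coeff (\<gamma> p)) (P z) (a p z) = 0" if "z \<in> ball x r1" for z using a True that by blast+
        show uq: "w = a p z" if "z \<in> ball x r1" "w \<in> cball (snd (\<gamma> p) p) (\<rho> p)" "lin_comb (coeff (\<gamma> p)) (P z) w = 0" for z w using a True that by blast
        fix z Y assume z: "z \<in> ball x r1" and Y: "Y \<in> {Y\<^sub>1, Y\<^sub>2}"
        have "quotient_at_most_simple_poles A (qd_of e (Y z)) (qd_of e (P z))"
          using Y T rr[OF z] PS simple_poles by blast
        then show "\<exists>s. continuous_on (cball (snd (\<gamma> p) p) (\<rho> p)) s \<and> s holomorphic_on ball (snd (\<gamma> p) p) (\<rho> p) \<and>
            (\<forall>w\<in>cball (snd (\<gamma> p) p) (\<rho> p). (w - a p z) * lin_comb (coeff (\<gamma> p)) (Y z) w = s w * lin_comb (coeff (\<gamma> p)) (P z) w)"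
          by (rule pole_function[OF pr(1,3) PS[OF rr[OF z]]]) (use a True z in blast)+
      qed
    qed
  qed
  then have "\<exists>r'>0. \<forall>p\<in>I. (\<forall>z\<in>ball x r'. set_integrable lborel (W p) (F p z)) \<and> (\<forall>m. C_upto m UNIV (ball x r') (\<lambda>z. set_lebesgue_integral lborel (W p) (F p z)))"
  proof (intro finite_common_radius[OF finI])
    fix p and s s' :: real
    assume *: "(\<forall>z\<in>ball x s. set_integrable lborel (W p) (F p z)) \<and> (\<forall>m. C_upto m UNIV (ball x s) (\<lambda>z. set_lebesgue_integral lborel (W p) (F p z)))" and "s' \<le> s"
    then have "ball x s' \<subseteq> ball x s" by auto
    then show "(\<forall>z\<in>ball x s'. set_integrable lborel (W p) (F p z)) \<and> (\<forall>m. C_upto m UNIV (ball x s') (\<lambda>z. set_lebesgue_integral lborel (W p) (F p z)))"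
      using * C_upto_mono[of _ UNIV "ball x s" _ "ball x s'" UNIV] by blast
  qed
  then obtain r' where r': "r' > 0" and int: "\<And>p z. p \<in> I \<Longrightarrow> z \<in> ball x r' \<Longrightarrow> set_integrable lborel (W p) (F p z)"
     and sm: "\<And>p m. p \<in> I \<Longrightarrow> C_upto m UNIV (ball x r') (\<lambda>z. set_lebesgue_integral lborel (W p) (F p z))" by blast
  have Feq: "pairing_density (qd_of e (P z)) (qd_of e (Y\<^sub>1 z)) (qd_of e (Y\<^sub>2 z)) (\<gamma> p) (chart_param (\<gamma> p) w) = F p z w" for p z w
    unfolding F_def by (rule pairing_density_coeff)
  have i': "set_integrable lborel (W p) (\<lambda>w. pairing_density (qd_of e (P z)) (qd_of e (Y\<^sub>1 z)) (qd_of e (Y\<^sub>2 z)) (\<gamma> p) (chart_param (\<gamma> p) w))" if "p \<in> I" "z \<in> ball x r'" for p z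
    unfolding Feq using int[OF that] .
  have "surface_integrable A (pairing_density (qd_of e (P z)) (qd_of e (Y\<^sub>1 z)) (qd_of e (Y\<^sub>2 z)))" if "z \<in> ball x r'" for z
    by (rule surface_integrable_pieces[OF pc density_pairing[OF qd_of_in qd_of_in qd_of_in] i'[OF _ that]])
  moreover have "C_upto m UNIV (ball x r') (\<lambda>z. pairing X A (qd_of e (P z)) (qd_of e (Y\<^sub>1 z)) (qd_of e (Y\<^sub>2 z)))" for m
  proof (rule C_upto_cong[OF coord_open_open[OF open_ball]])
    show "C_upto m UNIV (ball x r') (\<lambda>z. \<Sum>p\<in>I. set_lebesgue_integral lborel (W p) (F p z))"
      by (rule C_upto_sum[OF coord_open_open[OF open_ball] finI sm])
    fix z assume z: "z \<in> ball x r'"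
    show "(\<Sum>p\<in>I. set_lebesgue_integral lborel (W p) (F p z)) = pairing X A (qd_of e (P z)) (qd_of e (Y\<^sub>1 z)) (qd_of e (Y\<^sub>2 z))"
      unfolding pairing_def using surface_integral_pieces[OF pc density_pairing[OF qd_of_in qd_of_in qd_of_in] i'[OF _ z]] unfolding Feq by simp
  qed
  ultimately show ?thesis using r' by blast
qed

end

section \<open>The Levi form of the norm\<close>

context stratum
begin

text \<open>\<open>\<bar>\<phi>\<bar>\<close> is four times the pairing density of \<phi> with
  itself, also at the zeros, where both are 0.\<close>

lemma density_norm: "density (\<lambda>c p. complex_of_real (cmod (qd_of e y c p)))"
proof -
  have eq: "complex_of_real (cmod (qd_of e y c p)) = 4 * pairing_density (qd_of e y) (qd_of e y) (qd_of e y) c p" for c p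
    unfolding pairing_density_def complex_norm_square[symmetric] by (cases "qd_of e y c p = 0") (auto simp: power2_eq_square)
  have d: "density (pairing_density (qd_of e y) (qd_of e y) (qd_of e y))" by (rule density_pairing[OF qd_of_in qd_of_in qd_of_in])
  show ?thesis unfolding density_def eq
  proof (intro conjI ballI)
    fix c d p assume "c \<in> A" "d \<in> A" "p \<in> dom c \<inter> dom d"
    from density_eq[OF d this] show "4 * pairing_density (qd_of e y) (qd_of e y) (qd_of e y) c p = of_real ((cmod (deriv (tr c d) (snd c p)))\<^sup>2) * (4 * pairing_density (qd_of e y) (qd_of e y) (qd_of e y) d p)"
      by simp
  next
    fix c assume "c \<in> A"
    then have "(\<lambda>z. 4 * (indicator (im c) z *\<^sub>R pairing_density (qd_of e y) (qd_of e y) (qd_of e y) c (chart_param c z))) \<in> borel_measurable borel"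
      using d unfolding density_def by (intro borel_measurable_times borel_measurable_const) blast
    then show "(\<lambda>z. indicator (im c) z *\<^sub>R (4 * pairing_density (qd_of e y) (qd_of e y) (qd_of e y) c (chart_param c z))) \<in> borel_measurable borel"
      by (simp add: scaleR_conv_of_real mult.left_commute)
  qed
qed

text \<open>Makes smoothness of the norm an instance of \<open>pairing_smooth\<close>.\<close>

lemma norm_eq_pairing: "complex_of_real (qd_norm X A (qd_of e q)) = 4 * pairing X A (qd_of e q) (qd_of e q) (qd_of e q)"
proof -
  have eq: "complex_of_real (cmod (qd_of e q c p)) = 4 * pairing_density (qd_of e q) (qd_of e q) (qd_of e q) c p" for c p
    unfolding pairing_density_def complex_norm_square[symmetric] by (cases "qd_of e q c p = 0") (auto simp: power2_eq_square)
  show ?thesis unfolding qd_norm_def pairing_def surface_integral_of_real[symmetric] eq surface_integral_mult ..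
qed

text \<open>The piecewise first and second derivatives are summed, each piece staying fixed in its
  coordinate: for second derivatives at the single parameter \<open>x\<close> an integrable bound of
  \<open>\<psi> / \<phi>\<close> at \<open>x\<close> is enough.\<close>

lemma norm_Levi_form:
  assumes P: "vghol B x r P" and r: "r > 0" and PS: "\<And>z. z \<in> ball x r \<Longrightarrow> P z \<in> S"
    and T: "\<And>v. vderiv v P x \<in> tangent_space S (P x)"
    and int: "\<And>v w. surface_integrable A (pairing_density (qd_of e (P x)) (qd_of e (vderiv v P x)) (qd_of e (vderiv w P x)))"
  shows "\<exists>G. (\<forall>z\<in>ball x r. \<forall>v. ((\<lambda>t. complex_of_real (qd_norm X A (qd_of e (P (z + t *\<^sub>R v))))) has_vector_derivative G v z + cnj (G v z)) (at 0) \<and>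
       G (\<i> *s v) z = - \<i> * G v z) \<and>
     (\<forall>w. \<exists>\<kappa>. \<forall>v. ((\<lambda>t. G w (x + t *\<^sub>R v)) has_vector_derivative
         pairing X A (qd_of e (P x)) (qd_of e (vderiv v P x)) (qd_of e (vderiv w P x)) + \<kappa> v) (at 0) \<and> \<kappa> (\<i> *s v) = - \<i> * \<kappa> v)"
proof -
  have xr: "x \<in> ball x r" using r by simp
  obtain I \<gamma> \<rho> W where ad: "adapted (P x) I \<gamma> \<rho> W" using adapted_exists[OF PS[OF xr]] by blast
  let ?Z = "zeros (qd_of e (P x))"
  define c where "c p = snd (\<gamma> p) p" for p
  have pc: "pieces I \<gamma> W" using ad by (simp add: adapted_def)
  have finI: "finite I" using pc by (simp add: pieces_def)
  have pr: "\<gamma> p \<in> A" "\<rho> p > 0" "cball (c p) (\<rho> p) \<subseteq> im (\<gamma> p)" "W p \<subseteq> ball (c p) (\<rho> p)" "W p \<in> sets borel"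
     "\<And>z. z \<in> cball (c p) (\<rho> p) \<Longrightarrow> lin_comb (coeff (\<gamma> p)) (P x) z = 0 \<Longrightarrow> p \<in> ?Z \<and> z = c p" if "p \<in> I" for p
    using ad that unfolding adapted_def c_def by blast+
  have zc: "lin_comb (coeff (\<gamma> p)) (P x) (c p) = 0" if "p \<in> ?Z" for p using ad that unfolding adapted_def c_def by blast
  have coc: "continuous_on (cball (c p) (\<rho> p)) (coeff (\<gamma> p) j)" if "p \<in> I" for p j
    by (rule continuous_on_subset[OF holomorphic_on_imp_continuous_on[OF coeff_holomorphic[OF pr(1)[OF that]]] pr(3)[OF that]])
  have "\<exists>E. E > 0 \<and> (\<forall>j. \<forall>z\<in>cball (c p) (\<rho> p). cmod (coeff (\<gamma> p) j z) \<le> E)" if "p \<in> I" for p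
    using lin_comb_bounded_on_compact[where \<epsilon> = "coeff (\<gamma> p)", OF compact_cball coc[OF that]] by metis
  then obtain E where E: "\<And>p. p \<in> I \<Longrightarrow> E p > 0 \<and> (\<forall>j. \<forall>z\<in>cball (c p) (\<rho> p). cmod (coeff (\<gamma> p) j z) \<le> E p)" by metis
  have fp: "family_piece (coeff (\<gamma> p)) (cball (c p) (\<rho> p)) (W p) (E p)" if "p \<in> I" for p
    using coc[OF that] pr(4,5)[OF that] E[OF that] by unfold_locales (auto simp: subset_iff)
  define M where "M p = restrict_space lborel (W p)" for p
  have fin: "finite {w \<in> W p. lin_comb (coeff (\<gamma> p)) q w = 0}" if "p \<in> I" "q \<in> S" for p q
  proof (rule finite_subset[OF _ finite_zeros_chart[OF qd_of_in qd_of_nonzero[OF that(2)] pr(1)[OF that(1)]]])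
    have "W p \<subseteq> im (\<gamma> p)" using pr(3,4)[OF that(1)] ball_subset_cball by blast
    then show "{w \<in> W p. lin_comb (coeff (\<gamma> p)) q w = 0} \<subseteq> {z \<in> im (\<gamma> p). qd_of e q (\<gamma> p) (chart_param (\<gamma> p) z) = 0}"
      unfolding qd_of_coeff by blast
  qed
  have Nsum: "complex_of_real (qd_norm X A (qd_of e q)) = (\<Sum>p\<in>I. \<integral>w. complex_of_real (cmod (lin_comb (coeff (\<gamma> p)) q w)) \<partial>M p)" for q
  proof -
    have i: "set_integrable lborel (W p) (\<lambda>z. complex_of_real (cmod (qd_of e q (\<gamma> p) (chart_param (\<gamma> p) z))))" if p: "p \<in> I" for p
    proof -
      interpret fpp: family_piece "coeff (\<gamma> p)" "cball (c p) (\<rho> p)" "W p" "E p" by (rule fp[OF p])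
      have "integrable fpp.M (\<lambda>w. complex_of_real (cmod (lin_comb (coeff (\<gamma> p)) q w)))"
      proof (rule fpp.bounded_integrable)
        show "cmod (complex_of_real (cmod (lin_comb (coeff (\<gamma> p)) q w))) \<le> of_nat (CARD('n)) * (norm q * E p)" if "w \<in> W p" for w
          using lin_comb_bound[of q "norm q" "coeff (\<gamma> p)" w "E p"] Finite_Cartesian_Product.norm_nth_le[of q] E[OF p] fpp.W that by (auto simp: subset_iff)
      qed measurable
      then show ?thesis unfolding qd_of_coeff set_integrable_restrict(1)[OF pr(5)[OF p]] .
    qed
    show ?thesis
      unfolding qd_norm_def surface_integral_of_real[symmetric]
    proof (rule trans[OF surface_integral_pieces[OF pc density_norm]])
      show "set_integrable lborel (W p) (\<lambda>z. complex_of_real (cmod (qd_of e q (\<gamma> p) (chart_param (\<gamma> p) z))))" if "p \<in> I" for p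
        by (rule i[OF that])
      show "(\<Sum>p\<in>I. set_lebesgue_integral lborel (W p) (\<lambda>z. complex_of_real (cmod (qd_of e q (\<gamma> p) (chart_param (\<gamma> p) z))))) =
        (\<Sum>p\<in>I. \<integral>w. complex_of_real (cmod (lin_comb (coeff (\<gamma> p)) q w)) \<partial>M p)"
        by (rule sum.cong[OF refl]) (simp add: qd_of_coeff M_def set_integrable_restrict(2)[OF pr(5)] del: integral_complex_of_real)
    qed
  qed
  define g where "g p v z = (\<integral>w. lin_comb (coeff (\<gamma> p)) (P z) w * cnj (lin_comb (coeff (\<gamma> p)) (vderiv v P z) w) / (2 * complex_of_real (cmod (lin_comb (coeff (\<gamma> p)) (P z) w))) \<partial>M p)" for p v z
  define G where "G v z = (\<Sum>p\<in>I. g p v z)" for v z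
  have first: "((\<lambda>t. complex_of_real (qd_norm X A (qd_of e (P (z + t *\<^sub>R v))))) has_vector_derivative G v z + cnj (G v z)) (at 0)" if z: "z \<in> ball x r" for z v
  proof -
    have "((\<lambda>t. \<Sum>p\<in>I. \<integral>w. complex_of_real (cmod (lin_comb (coeff (\<gamma> p)) (P (z + t *\<^sub>R v)) w)) \<partial>M p) has_vector_derivative (\<Sum>p\<in>I. g p v z + cnj (g p v z))) (at 0)"
    proof (rule has_vector_derivative_sum)
      fix p assume p: "p \<in> I"
      show "((\<lambda>t. \<integral>w. complex_of_real (cmod (lin_comb (coeff (\<gamma> p)) (P (z + t *\<^sub>R v)) w)) \<partial>M p) has_vector_derivative g p v z + cnj (g p v z)) (at 0)"
        using family_piece.norm_first_derivative[OF fp[OF p] P z fin[OF p PS[OF z]], of v] unfolding g_def M_def .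
    qed
    then show ?thesis unfolding Nsum G_def by (simp add: sum.distrib)
  qed
  have Gi: "G (\<i> *s v) z = - \<i> * G v z" if z: "z \<in> ball x r" for z v
  proof -
    have "g p (\<i> *s v) z = - \<i> * g p v z" for p
    proof -
      have e: "lin_comb (coeff (\<gamma> p)) (P z) w * cnj (lin_comb (coeff (\<gamma> p)) (vderiv (\<i> *s v) P z) w) / (2 * complex_of_real (cmod (lin_comb (coeff (\<gamma> p)) (P z) w))) =
         - \<i> * (lin_comb (coeff (\<gamma> p)) (P z) w * cnj (lin_comb (coeff (\<gamma> p)) (vderiv v P z) w) / (2 * complex_of_real (cmod (lin_comb (coeff (\<gamma> p)) (P z) w))))" for w
        unfolding vderiv_smult[OF P z] lin_comb_smult by simp
      show ?thesis unfolding g_def e by (rule integral_mult_right_zero)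
    qed
    then show ?thesis unfolding G_def by (simp add: sum_distrib_left)
  qed
  have second: "\<exists>\<kappa>. \<forall>v. ((\<lambda>t. G w (x + t *\<^sub>R v)) has_vector_derivative
         pairing X A (qd_of e (P x)) (qd_of e (vderiv v P x)) (qd_of e (vderiv w P x)) + \<kappa> v) (at 0) \<and> \<kappa> (\<i> *s v) = - \<i> * \<kappa> v" for w
  proof -
    define B' where "B' = max B (B / (r - r / 2) * norm w)"
    have r2: "r / 2 > 0" using r by simp
    have P2: "vghol B' x (r/2) P" by (rule vghol_mono[OF P]) (use r in \<open>auto simp: B'_def\<close>)
    have Y2: "vghol B' x (r/2) (vderiv w P)" by (rule vghol_mono[OF vghol_vderiv[OF P, of "r/2"]]) (use r in \<open>auto simp: B'_def\<close>)
    define H where "H p v = (\<integral>y. lin_comb (coeff (\<gamma> p)) (vderiv v P x) y * cnj (lin_comb (coeff (\<gamma> p)) (vderiv w P x) y) / (4 * complex_of_real (cmod (lin_comb (coeff (\<gamma> p)) (P x) y))) \<partial>M p)" for p v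
    have Hsum: "pairing X A (qd_of e (P x)) (qd_of e (vderiv v P x)) (qd_of e (vderiv w P x)) = (\<Sum>p\<in>I. H p v)" for v
    proof -
      have i: "set_integrable lborel (W p) (\<lambda>z. pairing_density (qd_of e (P x)) (qd_of e (vderiv v P x)) (qd_of e (vderiv w P x)) (\<gamma> p) (chart_param (\<gamma> p) z))" if p: "p \<in> I" for p
        by (rule set_integrable_subset[of _ "im (\<gamma> p)"])
           (use int[of v w] pr(1,5)[OF p] pc p in \<open>auto simp: surface_integrable_def pieces_def\<close>)
      show ?thesis unfolding pairing_def
        by (rule trans[OF surface_integral_pieces[OF pc density_pairing[OF qd_of_in qd_of_in qd_of_in] i]], assumption, rule sum.cong[OF refl]) (simp add: H_def M_def set_integrable_restrict(2)[OF pr(5)] pairing_density_coeff)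
    qed
    have "\<exists>\<kappa>. (\<forall>v. ((\<lambda>t. g p w (x + t *\<^sub>R v)) has_vector_derivative H p v + \<kappa> v) (at 0)) \<and> (\<forall>v. \<kappa> (\<i> *s v) = - \<i> * \<kappa> v)" if p: "p \<in> I" for p
    proof -
      interpret fpp: family_piece "coeff (\<gamma> p)" "cball (c p) (\<rho> p)" "W p" "E p" by (rule fp[OF p])
      \<comment> \<open>The majorant of the quotient: a constant on a piece without zeros, a
        multiple of \<open>1 / cmod (y - c p)\<close> on a disc about a zero.\<close>
      have "\<exists>K. integrable fpp.M K \<and> (\<forall>y\<in>W p. lin_comb (coeff (\<gamma> p)) (P x) y \<noteq> 0 \<longrightarrow> cmod (lin_comb (coeff (\<gamma> p)) (vderiv w P x) y) \<le> K y * cmod (lin_comb (coeff (\<gamma> p)) (P x) y))"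
      proof (cases "p \<in> ?Z")
        case False
        have nz: "lin_comb (coeff (\<gamma> p)) (P x) y \<noteq> 0" if "y \<in> cball (c p) (\<rho> p)" for y using pr(6)[OF p that] False by blast
        obtain \<delta> where \<delta>: "\<delta> > 0" "\<And>y. y \<in> cball (c p) (\<rho> p) \<Longrightarrow> \<delta> \<le> cmod (lin_comb (coeff (\<gamma> p)) (P x) y)"
          using compact_nonzero_lower_bound[OF compact_cball lin_comb_continuous[where \<epsilon> = "coeff (\<gamma> p)", OF coc[OF p]] nz] by metis
        define C where "C = of_nat (CARD('n)) * (norm (vderiv w P x) * E p)"
        have C: "cmod (lin_comb (coeff (\<gamma> p)) (vderiv w P x) y) \<le> C" if "y \<in> W p" for y
          unfolding C_def using E[OF p] fpp.W that by (intro lin_comb_bound Finite_Cartesian_Product.norm_nth_le) (auto simp: subset_iff)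
        show ?thesis
        proof (intro exI[of _ "\<lambda>_. C / \<delta>"] conjI ballI impI)
          show "integrable fpp.M (\<lambda>_. C / \<delta>)" by (rule finite_measure.integrable_const[OF fpp.finite_measure_M])
          fix y assume y: "y \<in> W p"
          have "C \<ge> 0" using C[OF y] norm_ge_zero order_trans by blast
          have "cmod (lin_comb (coeff (\<gamma> p)) (vderiv w P x) y) \<le> C / \<delta> * \<delta>" using C[OF y] \<delta>(1) by simp
          also have "\<dots> \<le> C / \<delta> * cmod (lin_comb (coeff (\<gamma> p)) (P x) y)"
            using \<delta>(1) \<delta>(2)[of y] y fpp.W \<open>C \<ge> 0\<close> by (intro mult_left_mono) auto
          finally show "cmod (lin_comb (coeff (\<gamma> p)) (vderiv w P x) y) \<le> C / \<delta> * cmod (lin_comb (coeff (\<gamma> p)) (P x) y)" .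
        qed
      next
        case True
        have cin: "c p \<in> ball (c p) (\<rho> p)" using pr(2)[OF p] by simp
        obtain s where s: "continuous_on (cball (c p) (\<rho> p)) s"
          "\<And>y. y \<in> cball (c p) (\<rho> p) \<Longrightarrow> (y - c p) * lin_comb (coeff (\<gamma> p)) (vderiv w P x) y = s y * lin_comb (coeff (\<gamma> p)) (P x) y"
          using pole_function[OF pr(1,3)[OF p] PS[OF xr] simple_poles[OF PS[OF xr] T[of w]] cin zc[OF True]] pr(6)[OF p] by blast
        have "bounded (s ` cball (c p) (\<rho> p))" by (intro compact_imp_bounded compact_continuous_image s(1)) auto
        then obtain S0 where "\<forall>y\<in>s ` cball (c p) (\<rho> p). cmod y \<le> S0" unfolding bounded_iff by blast
        then have S0: "cmod (s y) \<le> S0" if "y \<in> cball (c p) (\<rho> p)" for y using that by blast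
        show ?thesis
        proof (intro exI[of _ "\<lambda>y. S0 * (1 / cmod (y - c p))"] conjI ballI impI)
          have "set_integrable lborel (W p) (\<lambda>y. 1 / cmod (y - c p))"
            by (rule set_integrable_subset[OF integrable_inverse_norm[OF pr(2)[OF p]]]) (use pr(4,5)[OF p] in auto)
          then have "integrable fpp.M (\<lambda>y. 1 / cmod (y - c p))"
            unfolding set_integrable_def using pr(5)[OF p] by (subst integrable_restrict_space) auto
          then show "integrable fpp.M (\<lambda>y. S0 * (1 / cmod (y - c p)))" by (rule integrable_mult_right)
          fix y assume y: "y \<in> W p" "lin_comb (coeff (\<gamma> p)) (P x) y \<noteq> 0"
          then have yc: "y \<in> cball (c p) (\<rho> p)" "cmod (y - c p) > 0" using fpp.W zc[OF True] by auto
          have "cmod (y - c p) * cmod (lin_comb (coeff (\<gamma> p)) (vderiv w P x) y) = cmod (s y) * cmod (lin_comb (coeff (\<gamma> p)) (P x) y)"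
            using s(2)[OF yc(1)] by (metis norm_mult)
          also have "\<dots> \<le> S0 * cmod (lin_comb (coeff (\<gamma> p)) (P x) y)" using S0[OF yc(1)] by (rule mult_right_mono) simp
          finally show "cmod (lin_comb (coeff (\<gamma> p)) (vderiv w P x) y) \<le> S0 * (1 / cmod (y - c p)) * cmod (lin_comb (coeff (\<gamma> p)) (P x) y)"
            using yc(2) by (simp add: field_simps)
        qed
      qed
      then obtain K where K: "integrable fpp.M K" "\<And>y. y \<in> W p \<Longrightarrow> lin_comb (coeff (\<gamma> p)) (P x) y \<noteq> 0 \<Longrightarrow> cmod (lin_comb (coeff (\<gamma> p)) (vderiv w P x) y) \<le> K y * cmod (lin_comb (coeff (\<gamma> p)) (P x) y)"
        by blast
      show ?thesis
        using fpp.norm_second_derivative[OF P2 Y2 r2 fin[OF p PS[OF xr]] K] unfolding g_def H_def M_def .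
    qed
    then obtain \<kappa> where \<kappa>: "\<And>p v. p \<in> I \<Longrightarrow> ((\<lambda>t. g p w (x + t *\<^sub>R v)) has_vector_derivative H p v + \<kappa> p v) (at 0)" "\<And>p v. p \<in> I \<Longrightarrow> \<kappa> p (\<i> *s v) = - \<i> * \<kappa> p v"
      by metis
    show ?thesis
    proof (intro exI[of _ "\<lambda>v. \<Sum>p\<in>I. \<kappa> p v"] allI conjI)
      fix v
      have "((\<lambda>t. \<Sum>p\<in>I. g p w (x + t *\<^sub>R v)) has_vector_derivative (\<Sum>p\<in>I. H p v + \<kappa> p v)) (at 0)"
        by (rule has_vector_derivative_sum) (rule \<kappa>(1))
      then show "((\<lambda>t. G w (x + t *\<^sub>R v)) has_vector_derivative pairing X A (qd_of e (P x)) (qd_of e (vderiv v P x)) (qd_of e (vderiv w P x)) + (\<Sum>p\<in>I. \<kappa> p v)) (at 0)"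
        unfolding G_def Hsum by (simp add: sum.distrib)
      show "(\<Sum>p\<in>I. \<kappa> p (\<i> *s v)) = - \<i> * (\<Sum>p\<in>I. \<kappa> p v)" using \<kappa>(2) by (simp add: sum_distrib_left)
    qed
  qed
  show ?thesis using first Gi second by (intro exI[of _ G]) blast
qed

end

section \<open>Coordinates on a stratum\<close>

lemma bounded_linear_smult: "bounded_linear (\<lambda>c::complex. c *s (u::complex^'n::finite))"
proof (rule bounded_linear_intro)
  show "norm (c *s u) \<le> norm c * norm u" for c by (simp add: norm_vec_smult)
qed (auto simp: vec_eq_iff algebra_simps)

lemma has_derivative_vec:
  fixes f :: "'b::real_normed_vector \<Rightarrow> complex^'m::finite"
  assumes "\<And>j. ((\<lambda>x. f x $ j) has_derivative (\<lambda>h. D h $ j)) (at a)"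
  shows "(f has_derivative D) (at a)"
proof -
  have "((\<lambda>x. \<Sum>j\<in>UNIV. f x $ j *s axis j 1) has_derivative (\<lambda>h. \<Sum>j\<in>UNIV. D h $ j *s axis j 1)) (at a)"
    by (intro has_derivative_sum bounded_linear.has_derivative[OF bounded_linear_smult] assms)
  then show ?thesis by (simp add: basis_expansion)
qed

lemma holo_map_derivative:
  fixes F :: "complex^'n::finite \<Rightarrow> complex^'m::finite"
  assumes "holo_map F V" "y \<in> V"
  obtains D where "(F has_derivative D) (at y)" "\<And>a v. D (a *s v) = a *s D v"
proof -
  have "\<exists>D. ((\<lambda>x. F x $ j) has_derivative D) (at y) \<and> (\<forall>a v. D (a *s v) = a * D v)" for j
    using assms unfolding holo_map_def holo_fun_def by blast
  then obtain D where D: "\<And>j. ((\<lambda>x. F x $ j) has_derivative D j) (at y) \<and> (\<forall>a v. D j (a *s v) = a * D j v)" by metis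
  show ?thesis
  proof (rule that[of "\<lambda>h. \<chi> j. D j h"])
    show "(F has_derivative (\<lambda>h. \<chi> j. D j h)) (at y)" by (rule has_derivative_vec) (use D in simp)
    show "(\<chi> j. D j (a *s v)) = a *s (\<chi> j. D j v)" for a v using D by (simp add: vec_eq_iff)
  qed
qed

definition proj :: "'n set \<Rightarrow> complex^'n::finite \<Rightarrow> complex^'n" where
  "proj K v = (\<chi> j. if j \<in> K then v $ j else 0)"

lemma proj_in: "proj K v \<in> coord_subspace K" by (simp add: proj_def coord_subspace_def)
lemma proj_id: "v \<in> coord_subspace K \<Longrightarrow> proj K v = v" by (auto simp: proj_def coord_subspace_def vec_eq_iff)
lemma proj_add: "proj K (v + w) = proj K v + proj K w" by (simp add: proj_def vec_eq_iff)
lemma proj_diff: "proj K (v - w) = proj K v - proj K w" by (simp add: proj_def vec_eq_iff)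
lemma proj_smult: "proj K (a *s v) = a *s proj K v" by (simp add: proj_def vec_eq_iff)
lemma norm_proj: "norm (proj K v) \<le> norm v" by (rule norm_le_componentwise_cart) (simp add: proj_def)

text \<open>Turns the inverse chart into a family over a ball of the whole space that is constant in
  the directions outside \<open>K\<close>. The ball is chosen by continuity at \<open>x\<close> so
  that \<open>norm (G x) + 1\<close> is a bound.\<close>

lemma proj_family:
  fixes G :: "complex^'n::finite \<Rightarrow> complex^'m::finite"
  assumes V: "open V" and G: "holo_map G V" and x: "x \<in> V" "x \<in> coord_subspace K"
  obtains r B where "r > 0" "\<And>z. z \<in> ball x r \<Longrightarrow> proj K z \<in> V" "vghol B x r (\<lambda>z. G (proj K z))"
    "\<And>z. z \<in> ball x r \<Longrightarrow> \<exists>D. (G has_derivative D) (at (proj K z)) \<and> (\<forall>a v. D (a *s v) = a *s D v) \<and> (\<forall>v. vderiv v (\<lambda>z. G (proj K z)) z = D (proj K v))"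
proof -
  obtain r0 where r0: "r0 > 0" "ball x r0 \<subseteq> V" by (rule openE[OF V x(1)])
  obtain D0 where "(G has_derivative D0) (at x)" by (rule holo_map_derivative[OF G x(1)])
  then have "isCont G x" by (rule has_derivative_continuous)
  then obtain r1 where r1: "r1 > 0" "\<And>y. dist y x < r1 \<Longrightarrow> dist (G y) (G x) < 1"
    unfolding continuous_at_eps_delta using zero_less_one by blast
  define r where "r = min r0 r1"
  have r: "r > 0" using r0 r1 by (simp add: r_def)
  have pb: "proj K z \<in> ball x r" if "z \<in> ball x r" for z
  proof -
    have "dist x (proj K z) = norm (proj K (x - z))" by (simp add: dist_norm proj_diff proj_id[OF x(2)])
    also have "\<dots> \<le> dist x z" using norm_proj by (simp add: dist_norm)
    finally show ?thesis using that by simp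
  qed
  have pV: "proj K z \<in> V" if "z \<in> ball x r" for z using pb[OF that] r0(2) by (auto simp: r_def)
  have fd: "\<exists>D. (G has_derivative D) (at (proj K (z + s *s v))) \<and> (\<forall>a v. D (a *s v) = a *s D v) \<and>
      (\<forall>j. ((\<lambda>s. G (proj K (z + s *s v)) $ j) has_field_derivative D (proj K v) $ j) (at s))"
    if sv: "z + s *s v \<in> ball x r" for z s v
  proof -
    obtain D where D: "(G has_derivative D) (at (proj K (z + s *s v)))" "\<And>a v. D (a *s v) = a *s D v"
      using holo_map_derivative[OF G pV[OF sv]] by blast
    have "((\<lambda>s. proj K z + s *s proj K v) has_derivative (\<lambda>h. 0 + h *s proj K v)) (at s)"
      by (intro has_derivative_add has_derivative_const bounded_linear_imp_has_derivative bounded_linear_smult)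
    then have "((\<lambda>s. proj K (z + s *s v)) has_derivative (\<lambda>h. h *s proj K v)) (at s)"
      by (simp add: proj_add proj_smult)
    from has_derivative_compose[OF this D(1)]
    have "((\<lambda>s. G (proj K (z + s *s v))) has_derivative (\<lambda>h. h *s D (proj K v))) (at s)" by (simp add: D(2))
    from bounded_linear.has_derivative[OF bounded_linear_vec_nth this]
    have "((\<lambda>s. G (proj K (z + s *s v)) $ j) has_field_derivative D (proj K v) $ j) (at s)" for j
      unfolding has_field_derivative_def by (simp add: mult_commute_abs)
    then show ?thesis using D by blast
  qed
  show ?thesis
  proof (rule that[OF r pV])
    show "vghol (norm (G x) + 1) x r (\<lambda>z. G (proj K z))" unfolding vghol_def
    proof (intro allI gholI)
      fix j z assume "z \<in> ball x r"
      then have "dist (proj K z) x < r1" using pb[of z] by (auto simp: r_def dist_commute)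
      then have "norm (G (proj K z) - G x) < 1" using r1(2) by (simp add: dist_norm)
      then have "norm (G (proj K z)) \<le> norm (G x) + 1" using norm_triangle_ineq2[of "G (proj K z)" "G x"] by linarith
      then show "cmod (G (proj K z) $ j) \<le> norm (G x) + 1" using Finite_Cartesian_Product.norm_nth_le[of "G (proj K z)" j] by linarith
    next
      fix j z v
      show "(\<lambda>s. G (proj K (z + s *s v)) $ j) holomorphic_on {s. z + s *s v \<in> ball x r}"
      proof (rule holomorphic_onI)
        fix s assume "s \<in> {s. z + s *s v \<in> ball x r}"
        then have "z + s *s v \<in> ball x r" by simp
        from fd[OF this] show "(\<lambda>s. G (proj K (z + s *s v)) $ j) field_differentiable (at s within {s. z + s *s v \<in> ball x r})"
          using field_differentiable_at_within field_differentiable_def by blast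
      qed
    qed
    fix z assume z: "z \<in> ball x r"
    obtain D where D: "(G has_derivative D) (at (proj K z))" "\<And>a v. D (a *s v) = a *s D v"
      using holo_map_derivative[OF G pV[OF z]] by blast
    have "vderiv v (\<lambda>z. G (proj K z)) z = D (proj K v)" for v
    proof -
      obtain D' where D': "(G has_derivative D') (at (proj K z))" "\<And>j. ((\<lambda>s. G (proj K (z + s *s v)) $ j) has_field_derivative D' (proj K v) $ j) (at 0)"
        using fd[of z 0 v] z by auto
      have "D' = D" using D(1) D'(1) by (rule has_derivative_unique[rotated])
      then show ?thesis unfolding vderiv_def hderiv_def using DERIV_imp_deriv[OF D'(2)] by (simp add: vec_eq_iff)
    qed
    then show "\<exists>D. (G has_derivative D) (at (proj K z)) \<and> (\<forall>a v. D (a *s v) = a *s D v) \<and> (\<forall>v. vderiv v (\<lambda>z. G (proj K z)) z = D (proj K v))"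
      using D by blast
  qed
qed

lemma has_vector_derivative_vec:
  fixes f :: "real \<Rightarrow> complex^'m::finite"
  assumes "\<And>j. ((\<lambda>t. f t $ j) has_vector_derivative d $ j) (at a)"
  shows "(f has_vector_derivative d) (at a)"
  unfolding has_vector_derivative_def by (rule has_derivative_vec) (use assms in \<open>simp add: has_vector_derivative_def\<close>)

lemma vghol_real_derivative:
  assumes "vghol B x r P" "z \<in> ball x r"
  shows "((\<lambda>t. P (z + t *\<^sub>R v)) has_vector_derivative vderiv v P z) (at 0)"
  by (rule has_vector_derivative_vec) (simp add: vderiv_def ghol_real_derivative[OF vghol_ghol[OF assms(1)] assms(2)])

lemma has_derivative_dir:
  fixes F :: "complex^'n::finite \<Rightarrow> complex^'m::finite"
  assumes "(F has_derivative D) (at q)"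
  shows "((\<lambda>t. F (q + t *\<^sub>R v)) has_vector_derivative D v) (at 0)"
proof -
  have "((\<lambda>t::real. q + t *\<^sub>R v) has_derivative (\<lambda>t. t *\<^sub>R v)) (at 0)" by (auto intro!: derivative_eq_intros)
  then have "((\<lambda>t. F (q + t *\<^sub>R v)) has_derivative (\<lambda>t. D (t *\<^sub>R v))) (at 0)"
    using has_derivative_compose[of "\<lambda>t. q + t *\<^sub>R v" "\<lambda>t. t *\<^sub>R v" 0 UNIV F D] assms by simp
  then show ?thesis unfolding has_vector_derivative_def
    using linear_scale[OF has_derivative_linear[OF assms]] by simp
qed

lemma tangent_space_zero: "tangent_space {q} q \<subseteq> {0}"
proof
  fix v assume "v \<in> tangent_space {q} q"
  then obtain \<gamma> where g: "\<forall>\<^sub>F t in nhds 0. \<gamma> t = q" "(\<gamma> has_vector_derivative v) (at (0::real))"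
    by (auto simp: tangent_space_def)
  have "((\<lambda>t. q) has_vector_derivative v) (at (0::real))"
    by (rule iffD1[OF has_vector_derivative_cong_nhds[OF g(1)] g(2)])
  then show "v \<in> {0}" using vector_derivative_unique_at[OF _ has_vector_derivative_const] by blast
qed

locale adapted_coordinates =
  fixes S :: "(complex^'n::finite) set" and K :: "'n set" and U :: "(complex^'n) set" and F :: "complex^'n \<Rightarrow> complex^'n"
  assumes chart: "adapted_chart S K U F"
begin

abbreviation G :: "complex^'n \<Rightarrow> complex^'n" where "G \<equiv> inv_into U F"
abbreviation D :: "(complex^'n) set" where "D \<equiv> F ` (S \<inter> U)"

lemma D_eq: "D = F ` U \<inter> coord_subspace K" and open_U: "open U" and open_V: "open (F ` U)" and inj_F: "inj_on F U"
  and holo_F: "holo_map F U" and holo_G: "holo_map G (F ` U)"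
  using chart by (auto simp: adapted_chart_def)

lemma coord_open_D: "coord_open K D"
  unfolding D_eq by (rule coord_open_Int_subspace[OF open_V])

lemma G_in: "y \<in> D \<Longrightarrow> G y \<in> S \<inter> U"
proof -
  assume "y \<in> D"
  then obtain q where "q \<in> S \<inter> U" "y = F q" by blast
  then show "G y \<in> S \<inter> U" using inv_into_f_f[OF inj_F] by auto
qed

text \<open>The curves \<open>G (proj K (z + t *\<^sub>R v))\<close> lie in \<open>S\<close>, so the
  derivatives of the family are tangent vectors in the sense of curves, for every \<open>v\<close>
  and not only for those in \<open>coord_subspace K\<close>.\<close>

lemma local_family:
  assumes x: "x \<in> D"
  obtains r B where "r > 0" "vghol B x r (\<lambda>z. G (proj K z))" "\<And>z. z \<in> ball x r \<Longrightarrow> G (proj K z) \<in> S"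
    "\<And>z v. z \<in> ball x r \<Longrightarrow> vderiv v (\<lambda>z. G (proj K z)) z \<in> tangent_space S (G (proj K z))"
    "\<And>z v. z \<in> ball x r \<Longrightarrow> z \<in> D \<Longrightarrow> v \<in> coord_subspace K \<Longrightarrow> dir_deriv G v z = vderiv v (\<lambda>z. G (proj K z)) z"
    "\<And>z. z \<in> ball x r \<Longrightarrow> linear (\<lambda>v. vderiv v (\<lambda>z. G (proj K z)) z)"
proof -
  have xV: "x \<in> F ` U" "x \<in> coord_subspace K" using x unfolding D_eq by auto
  obtain r B where r: "r > 0" "\<And>z. z \<in> ball x r \<Longrightarrow> proj K z \<in> F ` U" and vg: "vghol B x r (\<lambda>z. G (proj K z))"
    and dr: "\<And>z. z \<in> ball x r \<Longrightarrow> \<exists>D. (G has_derivative D) (at (proj K z)) \<and> (\<forall>a v. D (a *s v) = a *s D v) \<and> (\<forall>v. vderiv v (\<lambda>z. G (proj K z)) z = D (proj K v))"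
    using proj_family[OF open_V holo_G xV] by blast
  have inS: "G (proj K z) \<in> S" if "z \<in> ball x r" for z
  proof -
    have "proj K z \<in> D" unfolding D_eq using r(2)[OF that] proj_in by blast
    then show ?thesis using G_in by blast
  qed
  show ?thesis
  proof (rule that[OF r(1) vg inS])
    fix z v assume z: "z \<in> ball x r"
    show "vderiv v (\<lambda>z. G (proj K z)) z \<in> tangent_space S (G (proj K z))"
      unfolding tangent_space_def
    proof (intro CollectI exI[of _ "\<lambda>t. G (proj K (z + t *\<^sub>R v))"] conjI)
      show "((\<lambda>t. G (proj K (z + t *\<^sub>R v))) has_vector_derivative vderiv v (\<lambda>z. G (proj K z)) z) (at 0)"
        by (rule vghol_real_derivative[OF vg z])
      obtain \<delta> where "\<delta> > 0" "\<And>t. \<bar>t\<bar> < \<delta> \<Longrightarrow> z + t *\<^sub>R v \<in> ball x r" using shift_in_open[OF open_ball z] by metis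
      then show "\<forall>\<^sub>F t in nhds (0::real). G (proj K (z + t *\<^sub>R v)) \<in> S"
        unfolding eventually_nhds_metric by (intro exI[of _ \<delta>]) (use inS in \<open>auto simp: dist_real_def\<close>)
    qed simp
  next
    fix z v assume z: "z \<in> ball x r" "z \<in> D" and v: "v \<in> coord_subspace K"
    have pz: "proj K z = z" by (rule proj_id) (use z(2) in \<open>simp add: D_eq\<close>)
    obtain D' where D': "(G has_derivative D') (at z)" "\<And>v. vderiv v (\<lambda>z. G (proj K z)) z = D' (proj K v)"
      using dr[OF z(1)] unfolding pz by blast
    show "dir_deriv G v z = vderiv v (\<lambda>z. G (proj K z)) z"
      unfolding D'(2) proj_id[OF v] by (rule dir_deriv_eqI[OF has_derivative_dir[OF D'(1)]])
  next
    fix z assume "z \<in> ball x r"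
    then obtain D' where D': "(G has_derivative D') (at (proj K z))" "\<And>v. vderiv v (\<lambda>z. G (proj K z)) z = D' (proj K v)"
      using dr by blast
    have "linear (proj K :: complex^'n \<Rightarrow> complex^'n)" by (rule linearI) (simp_all add: proj_def vec_eq_iff)
    from linear_compose[OF this has_derivative_linear[OF D'(1)]]
    show "linear (\<lambda>v. vderiv v (\<lambda>z. G (proj K z)) z)" by (simp add: D'(2) comp_def)
  qed
qed

text \<open>Differentiate \<open>G (F (\<gamma> t)) = \<gamma> t\<close> along a curve representing
  \<open>v\<close>. The components of \<open>F (\<gamma> t)\<close> outside \<open>K\<close> vanish
  for small \<open>t\<close>, hence so do their derivatives.\<close>

lemma tangent_coordinates:
  assumes q: "q \<in> S \<inter> U" and v: "v \<in> tangent_space S q"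
  shows "dir_deriv F v q \<in> coord_subspace K" "dir_deriv G (dir_deriv F v q) (F q) = v"
proof -
  obtain \<gamma> where \<gamma>: "\<gamma> 0 = q" "\<forall>\<^sub>F t in nhds 0. \<gamma> t \<in> S" "(\<gamma> has_vector_derivative v) (at 0)"
    using v by (auto simp: tangent_space_def)
  have qU: "q \<in> U" using q by simp
  obtain DF where DF: "(F has_derivative DF) (at q)" by (rule holo_map_derivative[OF holo_F qU])
  obtain DG where DG: "(G has_derivative DG) (at (F q))" by (rule holo_map_derivative[OF holo_G imageI[OF qU]])
  have dF: "dir_deriv F v q = DF v" by (rule dir_deriv_eqI[OF has_derivative_dir[OF DF]])
  have lin: "linear DF" "linear DG" by (rule has_derivative_linear[OF DF], rule has_derivative_linear[OF DG])
  have cont: "isCont \<gamma> 0" using \<gamma>(3) by (rule has_vector_derivative_continuous)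
  then have "(\<gamma> \<longlongrightarrow> q) (nhds 0)" by (simp add: continuous_at tendsto_nhds_iff \<gamma>(1))
  then have evU: "\<forall>\<^sub>F t in nhds 0. \<gamma> t \<in> U" using open_U qU by (rule topological_tendstoD)
  have Fg: "((\<lambda>t. F (\<gamma> t)) has_vector_derivative DF v) (at 0)"
    using has_derivative_compose[of \<gamma> "\<lambda>t. t *\<^sub>R v" 0 UNIV F DF] \<gamma>(3) DF \<gamma>(1) linear_scale[OF lin(1)]
    unfolding has_vector_derivative_def by simp
  have Gg: "((\<lambda>t. G (F (\<gamma> t))) has_vector_derivative DG (DF v)) (at 0)"
    using has_derivative_compose[of "\<lambda>t. F (\<gamma> t)" "\<lambda>t. t *\<^sub>R DF v" 0 UNIV G DG] Fg DG \<gamma>(1) linear_scale[OF lin(2)]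
    unfolding has_vector_derivative_def by simp
  have "\<forall>\<^sub>F t in nhds 0. G (F (\<gamma> t)) = \<gamma> t" using evU by eventually_elim (rule inv_into_f_f[OF inj_F])
  then have "(\<gamma> has_vector_derivative DG (DF v)) (at 0)" by (rule iffD1[OF has_vector_derivative_cong_nhds Gg])
  then have "DG (DF v) = v" using \<gamma>(3) vector_derivative_unique_at by blast
  then show "dir_deriv G (dir_deriv F v q) (F q) = v"
    unfolding dF using dir_deriv_eqI[OF has_derivative_dir[OF DG]] by simp
  show "dir_deriv F v q \<in> coord_subspace K"
    unfolding dF coord_subspace_def
  proof (intro CollectI allI impI)
    fix j assume j: "j \<notin> K"
    have "((\<lambda>t. F (\<gamma> t) $ j) has_vector_derivative DF v $ j) (at 0)"
      by (rule bounded_linear.has_vector_derivative[OF bounded_linear_vec_nth Fg])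
    moreover have "\<forall>\<^sub>F t in nhds 0. F (\<gamma> t) $ j = 0"
      using evU \<gamma>(2)
    proof eventually_elim
      case (elim t)
      then have "F (\<gamma> t) \<in> D" by blast
      then show ?case using j unfolding D_eq coord_subspace_def by blast
    qed
    ultimately have "((\<lambda>t. 0) has_vector_derivative DF v $ j) (at (0::real))" by (rule iffD1[OF has_vector_derivative_cong_nhds, rotated])
    then show "DF v $ j = 0" using vector_derivative_unique_at[OF _ has_vector_derivative_const] by blast
  qed
qed

end

section \<open>The Kaehler form\<close>

text \<open>Smoothness on a stratum is checked on local extensions that are smooth on open subsets
  of the whole space.\<close>

lemma C_infinity_locally:
  assumes D: "coord_open K D"
    and "\<And>x. x \<in> D \<Longrightarrow> \<exists>V k. open V \<and> x \<in> V \<and> (\<forall>m. C_upto m UNIV V k) \<and> (\<forall>z\<in>D \<inter> V. f z = k z)"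
  shows "C_infinity K D f"
  unfolding C_infinity_def
proof (intro allI C_upto_local)
  fix m x assume "x \<in> D"
  then obtain V k where V: "open V" "x \<in> V" "C_upto m UNIV V k" "\<forall>z\<in>D \<inter> V. f z = k z" using assms(2) by meson
  have "C_upto m K (D \<inter> V) k" by (rule C_upto_mono[OF V(3)]) auto
  then have "C_upto m K (D \<inter> V) f" by (rule C_upto_cong[OF coord_open_Int[OF D V(1)], rotated]) (use V(4) in simp)
  then show "\<exists>V. open V \<and> x \<in> V \<and> C_upto m K (D \<inter> V) f" using V by blast
qed

lemma axis_smult: "axis k a = a *s (axis k 1 :: complex^'n::finite)"
  by (simp add: vec_eq_iff axis_def)

lemma axis_coord_subspace: "k \<in> K \<Longrightarrow> axis k a \<in> coord_subspace K"
  by (auto simp: coord_subspace_def axis_def)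

lemma coord_subspace_expansion:
  assumes "v \<in> coord_subspace K" shows "v = (\<Sum>k\<in>K. v $ k *s (axis k 1 :: complex^'n::finite))"
proof -
  have "v $ j = (\<Sum>k\<in>K. v $ k * axis k 1 $ j)" for j
  proof (cases "j \<in> K")
    case True
    have "(\<Sum>k\<in>K. v $ k * (axis k 1 :: complex^'n) $ j) = (\<Sum>k\<in>K. if k = j then v $ j else 0)"
      by (rule sum.cong[OF refl]) (auto simp: axis_def)
    then show ?thesis using True by simp
  next
    case False
    have "(\<Sum>k\<in>K. v $ k * (axis k 1 :: complex^'n) $ j) = 0"
      by (rule sum.neutral) (use False in \<open>auto simp: axis_def\<close>)
    then show ?thesis using assms False by (simp add: coord_subspace_def)
  qed
  then show ?thesis unfolding vec_eq_iff sum_component vector_smult_component by (rule allI)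
qed

lemma C_infinity_dir_deriv:
  assumes "C_infinity K D f" "v \<in> coord_subspace K"
  shows "C_infinity K D (dir_deriv f v)"
  unfolding C_infinity_def using assms C_upto.simps(2) unfolding C_infinity_def by blast

lemma C_infinity_differentiable:
  assumes "C_infinity K D f" "v \<in> coord_subspace K" "x \<in> D"
  shows "((\<lambda>t. f (x + t *\<^sub>R v)) has_vector_derivative dir_deriv f v x) (at 0)"
proof (rule differentiable_dir_deriv)
  have "C_upto (Suc 0) K D f" using assms(1) by (simp only: C_infinity_def)
  then show "(\<lambda>t. f (x + t *\<^sub>R v)) differentiable at 0" using assms(2,3) by simp
qed

lemma dir_deriv3_commute:
  fixes f :: "complex^'n::finite \<Rightarrow> real"
  assumes f: "C_infinity K D f" and D: "coord_open K D" and x: "x \<in> D"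
    and "u \<in> coord_subspace K" "v \<in> coord_subspace K" "w \<in> coord_subspace K"
  shows "dir_deriv (dir_deriv (dir_deriv f u) v) w x = dir_deriv (dir_deriv (dir_deriv f v) u) w x"
    and "dir_deriv (dir_deriv (dir_deriv f u) v) w x = dir_deriv (dir_deriv (dir_deriv f u) w) v x"
proof -
  have C: "C_upto 2 K D f" using f by (simp only: C_infinity_def)
  show "dir_deriv (dir_deriv (dir_deriv f u) v) w x = dir_deriv (dir_deriv (dir_deriv f v) u) w x"
    by (rule dir_deriv_cong(2)[OF D dir_deriv_commute[OF C D _ assms(4,5)] x assms(6)])
  have C': "C_upto 2 K D (dir_deriv f u)" using C_infinity_dir_deriv[OF f assms(4)] by (simp only: C_infinity_def)
  show "dir_deriv (dir_deriv (dir_deriv f u) v) w x = dir_deriv (dir_deriv (dir_deriv f u) w) v x"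
    by (rule dir_deriv_commute[OF C' D x assms(5,6)])
qed

text \<open>A form of the shape \<open>d d\<^sup>c f\<close> is closed since third derivatives of \<open>f\<close> commute.\<close>

lemma closed_ddc:
  fixes f :: "complex^'n::finite \<Rightarrow> real"
  assumes f: "C_infinity K D f" and D: "coord_open K D" and x: "x \<in> D"
    and \<beta>: "\<And>v w z. v \<in> coord_subspace K \<Longrightarrow> w \<in> coord_subspace K \<Longrightarrow> z \<in> D \<Longrightarrow>
      \<beta> v w z = (dir_deriv (dir_deriv f (\<i> *s w)) v z - dir_deriv (dir_deriv f w) (\<i> *s v) z) / 4"
    and u: "u \<in> coord_subspace K" and v: "v \<in> coord_subspace K" and w: "w \<in> coord_subspace K"
  shows "dir_deriv (\<beta> v w) u x - dir_deriv (\<beta> u w) v x + dir_deriv (\<beta> u v) w x = 0"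
proof -
  define T where "T a b c = dir_deriv (dir_deriv (dir_deriv f a) b) c x" for a b c
  have b: "dir_deriv (\<beta> b c) a x = (T (\<i> *s c) b a - T c (\<i> *s b) a) / 4"
    if a: "a \<in> coord_subspace K" and b: "b \<in> coord_subspace K" and c: "c \<in> coord_subspace K" for a b c
  proof -
    note J = coord_subspace_smult[of _ K \<i>]
    have d: "((\<lambda>t. dir_deriv (dir_deriv f c) b (x + t *\<^sub>R a)) has_vector_derivative T c b a) (at 0)"
      if "b \<in> coord_subspace K" "c \<in> coord_subspace K" for b c
      unfolding T_def by (rule C_infinity_differentiable[OF C_infinity_dir_deriv[OF C_infinity_dir_deriv[OF f that(2)] that(1)] a x])
    have "((\<lambda>t. (dir_deriv (dir_deriv f (\<i> *s c)) b (x + t *\<^sub>R a) - dir_deriv (dir_deriv f c) (\<i> *s b) (x + t *\<^sub>R a)) / 4)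
      has_vector_derivative (T (\<i> *s c) b a - T c (\<i> *s b) a) / 4) (at 0)"
      by (intro has_vector_derivative_divide has_vector_derivative_diff d J b c)
    then have "dir_deriv (\<lambda>z. (dir_deriv (dir_deriv f (\<i> *s c)) b z - dir_deriv (dir_deriv f c) (\<i> *s b) z) / 4) a x = (T (\<i> *s c) b a - T c (\<i> *s b) a) / 4"
      by (rule dir_deriv_eqI)
    then show ?thesis using dir_deriv_cong(2)[OF D \<beta>[OF b c] x a] by simp
  qed
  have T1: "T a b c = T b a c" and T2: "T a b c = T a c b"
    if "a \<in> coord_subspace K" "b \<in> coord_subspace K" "c \<in> coord_subspace K" for a b c
    unfolding T_def by (fact dir_deriv3_commute[OF f D x that])+
  note J = coord_subspace_smult[of _ K \<i>]
  \<comment> \<open>The six third derivatives cancel in three pairs; in each pair the same vector,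
    one of \<open>u\<close>, \<open>v\<close>, \<open>w\<close>, is multiplied by
    \<open>\<i>\<close>.\<close>
  show ?thesis
    unfolding b[OF u v w] b[OF v u w] b[OF w u v]
    using T2[OF J[OF w] u v] T1[OF w J[OF v] u] T2[OF J[OF v] w u] T1[OF w J[OF u] v] T2[OF J[OF u] w v] T1[OF v J[OF u] w]
    by (simp add: diff_divide_distrib)
qed

section \<open>Sesquilinear expansion of the pairing\<close>

context stratum
begin

abbreviation "H q v w \<equiv> pairing X A (qd_of e q) (qd_of e v) (qd_of e w)"
abbreviation "N q \<equiv> qd_norm X A (qd_of e q)"
abbreviation "pairing_integrable q v w \<equiv> surface_integrable A (pairing_density (qd_of e q) (qd_of e v) (qd_of e w))"

lemma qd_of_add: "qd_of e (u + v) c p = qd_of e u c p + qd_of e v c p"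
  by (simp add: qd_of_def algebra_simps sum.distrib)

lemma qd_of_smult: "qd_of e (a *s v) c p = a * qd_of e v c p"
  by (simp add: qd_of_def sum_distrib_left mult.assoc)

lemma pairing_smult: "H q (a *s v) w = a * H q v w"
proof -
  have "pairing_density (qd_of e q) (qd_of e (a *s v)) (qd_of e w) = (\<lambda>c p. a * pairing_density (qd_of e q) (qd_of e v) (qd_of e w) c p)"
    by (simp add: pairing_density_def qd_of_smult fun_eq_iff)
  then show ?thesis by (simp add: pairing_def surface_integral_mult)
qed

lemma pairing_cnj: "H q w v = cnj (H q v w)"
proof -
  have "pairing_density (qd_of e q) (qd_of e w) (qd_of e v) = (\<lambda>c p. cnj (pairing_density (qd_of e q) (qd_of e v) (qd_of e w) c p))"
    by (simp add: pairing_density_def fun_eq_iff mult.commute)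
  then show ?thesis by (simp add: pairing_def surface_integral_cnj)
qed

lemma pairing_density_add: "pairing_density (qd_of e q) (qd_of e (u + v)) (qd_of e w) =
    (\<lambda>c p. pairing_density (qd_of e q) (qd_of e u) (qd_of e w) c p + pairing_density (qd_of e q) (qd_of e v) (qd_of e w) c p)"
  by (simp add: pairing_density_def qd_of_add fun_eq_iff algebra_simps add_divide_distrib)

lemma pairing_add: "pairing_integrable q u w \<Longrightarrow> pairing_integrable q v w \<Longrightarrow> H q (u + v) w = H q u w + H q v w"
  unfolding pairing_def pairing_density_add by (rule surface_integral_add)

lemma pairing_zero: "H q 0 w = 0"
  using pairing_smult[of q 0 0 w] by (simp only: vector_smult_lzero mult_zero_left)

text \<open>Integrability is carried through the induction because additivity of the integral
  depends on it.\<close>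

lemma pairing_sum:
  assumes "finite I" "\<And>k. k \<in> I \<Longrightarrow> pairing_integrable q (E k) w"
  shows "H q (\<Sum>k\<in>I. a k *s E k) w = (\<Sum>k\<in>I. a k * H q (E k) w) \<and> pairing_integrable q (\<Sum>k\<in>I. a k *s E k) w"
  using assms
proof (induction rule: finite_induct)
  case empty
  show ?case using pairing_zero[of q w] by (simp add: qd_of_zero pairing_density_def surface_integrable_zero)
next
  case (insert k I)
  then have i: "pairing_integrable q (E k) w" "H q (\<Sum>k\<in>I. a k *s E k) w = (\<Sum>k\<in>I. a k * H q (E k) w)"
    "pairing_integrable q (\<Sum>k\<in>I. a k *s E k) w" by auto
  have "pairing_density (qd_of e q) (qd_of e (a k *s E k)) (qd_of e w) = (\<lambda>c p. a k * pairing_density (qd_of e q) (qd_of e (E k)) (qd_of e w) c p)"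
    by (simp add: pairing_density_def qd_of_smult fun_eq_iff)
  then have j: "pairing_integrable q (a k *s E k) w" using i(1) by (simp add: surface_integrable_def)
  have "pairing_integrable q (a k *s E k + (\<Sum>k\<in>I. a k *s E k)) w"
    using j i(3) unfolding pairing_density_add surface_integrable_def by (auto intro: set_integral_add)
  then show ?case using insert(1,2) pairing_add[OF j i(3)] i(2) by (simp add: pairing_smult)
qed

lemma pairing_sum2:
  assumes "finite I" "\<And>k l. k \<in> I \<Longrightarrow> l \<in> I \<Longrightarrow> pairing_integrable q (E k) (E l)"
  shows "H q (\<Sum>k\<in>I. a k *s E k) (\<Sum>l\<in>I. b l *s E l) = (\<Sum>k\<in>I. \<Sum>l\<in>I. H q (E k) (E l) * a k * cnj (b l))"
proof -
  have r: "H q (E k) (\<Sum>l\<in>I. b l *s E l) = (\<Sum>l\<in>I. cnj (b l) * H q (E k) (E l))" if k: "k \<in> I" for k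
  proof -
    have "H q (E k) (\<Sum>l\<in>I. b l *s E l) = cnj (H q (\<Sum>l\<in>I. b l *s E l) (E k))" by (rule pairing_cnj)
    also have "\<dots> = (\<Sum>l\<in>I. cnj (b l) * cnj (H q (E l) (E k)))" using pairing_sum[OF assms(1), of q E "E k" b] assms(2) k by simp
    also have "\<dots> = (\<Sum>l\<in>I. cnj (b l) * H q (E k) (E l))" unfolding pairing_cnj[symmetric] ..
    finally show ?thesis .
  qed
  have i: "pairing_integrable q (E k) (\<Sum>l\<in>I. b l *s E l)" if k: "k \<in> I" for k
  proof -
    have "pairing_integrable q (\<Sum>l\<in>I. b l *s E l) (E k)" using pairing_sum[OF assms(1), of q E "E k" b] assms(2) k by blast
    moreover have "pairing_density (qd_of e q) (qd_of e (E k)) (qd_of e (\<Sum>l\<in>I. b l *s E l)) =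
       (\<lambda>c p. cnj (pairing_density (qd_of e q) (qd_of e (\<Sum>l\<in>I. b l *s E l)) (qd_of e (E k)) c p))"
      by (simp add: pairing_density_def fun_eq_iff mult.commute)
    ultimately show ?thesis by (simp add: surface_integrable_def set_integrable_def flip: complex_cnj_scaleR)
  qed
  have "H q (\<Sum>k\<in>I. a k *s E k) (\<Sum>l\<in>I. b l *s E l) = (\<Sum>k\<in>I. a k * H q (E k) (\<Sum>l\<in>I. b l *s E l))"
    using pairing_sum[of I q E "\<Sum>l\<in>I. b l *s E l" a, OF assms(1) i] by blast
  also have "\<dots> = (\<Sum>k\<in>I. \<Sum>l\<in>I. H q (E k) (E l) * a k * cnj (b l))"
    by (rule sum.cong[OF refl]) (simp add: r sum_distrib_left mult_ac)
  finally show ?thesis .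
qed

end

section \<open>The pairing and the norm in an adapted chart\<close>

locale stratum_coordinates = stratum X A e S + adapted_coordinates S K U F
  for X :: "'a topology" and A :: "'a chart set" and e :: "'n::finite \<Rightarrow> 'a differential"
    and S :: "(complex^'n) set" and K :: "'n set" and U :: "(complex^'n) set" and F :: "complex^'n \<Rightarrow> complex^'n" +
  assumes scaling: "a \<noteq> 0 \<Longrightarrow> q \<in> S \<Longrightarrow> a *s q \<in> S"
begin

abbreviation Q :: "complex^'n \<Rightarrow> complex^'n" where "Q z \<equiv> G (proj K z)"

lemma Q_D: "z \<in> D \<Longrightarrow> Q z = G z"
  unfolding D_eq by (simp add: proj_id)

text \<open>By invariance under scaling the curve \<open>(1 + t) q\<close> stays in the stratum for
  \<open>\<bar>t\<bar> < 1\<close>. So the pairing of a differential with itself, a quarter of the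
  norm, falls under \<open>pairing_smooth\<close>.\<close>

lemma radial_tangent:
  assumes "q \<in> S" shows "q \<in> tangent_space S q"
  unfolding tangent_space_def
proof (intro CollectI exI[of _ "\<lambda>t::real. q + t *\<^sub>R q"] conjI)
  show "((\<lambda>t. q + t *\<^sub>R q) has_vector_derivative q) (at (0::real))" by (auto intro!: derivative_eq_intros)
  have "q + t *\<^sub>R q \<in> S" if "\<bar>t\<bar> < 1" for t :: real
  proof -
    have "q $ j + t *\<^sub>R q $ j = complex_of_real (1 + t) * q $ j" for j by (simp add: scaleR_conv_of_real algebra_simps)
    then have "q + t *\<^sub>R q = complex_of_real (1 + t) *s q"
      by (simp only: vec_eq_iff vector_add_component vector_scaleR_component vector_smult_component simp_thms)
    moreover have "complex_of_real (1 + t) \<noteq> 0" using that by (simp only: of_real_eq_0_iff)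
    ultimately show ?thesis using scaling assms by metis
  qed
  then show "\<forall>\<^sub>F t in nhds (0::real). q + t *\<^sub>R q \<in> S"
    unfolding eventually_nhds_metric by (intro exI[of _ 1]) (auto simp: dist_real_def)
qed simp

definition local_parameter :: "complex^'n \<Rightarrow> real \<Rightarrow> real \<Rightarrow> bool" where
  "local_parameter x r B \<longleftrightarrow> r > 0 \<and> vghol B x r Q \<and> (\<forall>z\<in>ball x r. Q z \<in> S \<and> (\<forall>v. vderiv v Q z \<in> tangent_space S (Q z)) \<and>
     (z \<in> D \<longrightarrow> (\<forall>v\<in>coord_subspace K. dir_deriv G v z = vderiv v Q z)) \<and> linear (\<lambda>v. vderiv v Q z))"

lemma local_parameter_exists:
  assumes x: "x \<in> D" obtains r B where "local_parameter x r B"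
proof (rule local_family[OF x])
  fix r B assume "r > 0" "vghol B x r Q" "\<And>z. z \<in> ball x r \<Longrightarrow> Q z \<in> S"
    "\<And>z v. z \<in> ball x r \<Longrightarrow> vderiv v Q z \<in> tangent_space S (Q z)"
    "\<And>z v. z \<in> ball x r \<Longrightarrow> z \<in> D \<Longrightarrow> v \<in> coord_subspace K \<Longrightarrow> dir_deriv G v z = vderiv v Q z"
    "\<And>z. z \<in> ball x r \<Longrightarrow> linear (\<lambda>v. vderiv v Q z)"
  then have "local_parameter x r B" unfolding local_parameter_def by (intro conjI ballI allI impI)
  then show thesis by (rule that)
qed

lemma local_parameterD:
  assumes "local_parameter x r B"
  shows "r > 0" "vghol B x r Q" "z \<in> ball x r \<Longrightarrow> Q z \<in> S" "z \<in> ball x r \<Longrightarrow> vderiv v Q z \<in> tangent_space S (Q z)"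
    "z \<in> ball x r \<Longrightarrow> z \<in> D \<Longrightarrow> v \<in> coord_subspace K \<Longrightarrow> dir_deriv G v z = vderiv v Q z"
    "z \<in> ball x r \<Longrightarrow> linear (\<lambda>v. vderiv v Q z)"
  using assms unfolding local_parameter_def by meson+

text \<open>\<open>Q\<close> and its derivatives are holomorphic families of differentials and of
  tangent vectors, the input of \<open>pairing_smooth\<close>; on \<open>D\<close> these derivatives
  are those of the inverse chart.\<close>

lemma pullback_local:
  assumes x: "x \<in> D"
  shows "\<exists>V. open V \<and> x \<in> V \<and> (\<forall>z\<in>V. pairing_integrable (Q z) (vderiv v Q z) (vderiv w Q z)) \<and>
     (\<forall>m. C_upto m UNIV V (\<lambda>z. H (Q z) (vderiv v Q z) (vderiv w Q z))) \<and>
     (\<forall>v\<in>coord_subspace K. \<forall>z\<in>D \<inter> V. dir_deriv G v z = vderiv v Q z)"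
proof -
  obtain r B where "local_parameter x r B" by (rule local_parameter_exists[OF x])
  note r = local_parameterD(1)[OF this] and Q = local_parameterD(2-4)[OF this] and d = local_parameterD(5)[OF this]
  define B' where "B' = max B (max (B / (r - r / 2) * norm v) (B / (r - r / 2) * norm w))"
  have r2: "r / 2 > 0" "r / 2 < r" using r by auto
  have sub: "z \<in> ball x r" if "z \<in> ball x (r/2)" for z using that r by simp
  have "vghol B' x (r/2) Q" "vghol B' x (r/2) (vderiv v Q)" "vghol B' x (r/2) (vderiv w Q)"
    using r2 by (auto simp: B'_def intro: vghol_mono[OF Q(1)] vghol_mono[OF vghol_vderiv[OF Q(1) r2(2)]])
  from pairing_smooth[OF this r2(1) Q(2)[OF sub] Q(3)[OF sub] Q(3)[OF sub]]
  obtain r' where r': "r' > 0" "\<forall>z\<in>ball x r'. pairing_integrable (Q z) (vderiv v Q z) (vderiv w Q z)"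
     "\<forall>m. C_upto m UNIV (ball x r') (\<lambda>z. H (Q z) (vderiv v Q z) (vderiv w Q z))" by blast
  have "C_upto m UNIV (ball x (min r r')) (\<lambda>z. H (Q z) (vderiv v Q z) (vderiv w Q z))" for m
    by (rule C_upto_mono[OF r'(3)[rule_format]]) auto
  then show ?thesis using r r' d by (intro exI[of _ "ball x (min r r')"]) auto
qed

lemma pullback_smooth:
  assumes "v \<in> coord_subspace K" "w \<in> coord_subspace K"
  shows "C_infinity K D (pullback_form U F H v w)"
proof (rule C_infinity_locally[OF coord_open_D])
  fix x assume "x \<in> D"
  from pullback_local[OF this, of v w]
  obtain V where V: "open V" "x \<in> V" "\<forall>m. C_upto m UNIV V (\<lambda>z. H (Q z) (vderiv v Q z) (vderiv w Q z))"
    "\<And>v z. v \<in> coord_subspace K \<Longrightarrow> z \<in> D \<inter> V \<Longrightarrow> dir_deriv G v z = vderiv v Q z" by blast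
  have "pullback_form U F H v w z = H (Q z) (vderiv v Q z) (vderiv w Q z)" if "z \<in> D \<inter> V" for z
    unfolding pullback_form_def V(4)[OF assms(1) that] V(4)[OF assms(2) that] using Q_D[of z] that by simp
  then show "\<exists>V k. open V \<and> x \<in> V \<and> (\<forall>m. C_upto m UNIV V k) \<and> (\<forall>z\<in>D \<inter> V. pullback_form U F H v w z = k z)"
    using V(1-3) by (intro exI[of _ V] exI[of _ "\<lambda>z. H (Q z) (vderiv v Q z) (vderiv w Q z)"]) simp
qed

lemma pullback_Im_smooth:
  assumes "v \<in> coord_subspace K" "w \<in> coord_subspace K"
  shows "C_infinity K D (pullback_form U F (\<lambda>q v w. Im (H q v w)) v w)"
proof -
  have "pullback_form U F (\<lambda>q v w. Im (H q v w)) v w = (\<lambda>z. Im (pullback_form U F H v w z))"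
    by (simp add: pullback_form_def fun_eq_iff)
  then show ?thesis using pullback_smooth[OF assms] C_upto_bounded_linear[OF bounded_linear_Im coord_open_D]
    by (simp add: C_infinity_def)
qed

lemma norm_smooth: "C_infinity K D (N \<circ> G)"
proof (rule C_infinity_locally[OF coord_open_D])
  fix x assume x: "x \<in> D"
  obtain r B where "local_parameter x r B" by (rule local_parameter_exists[OF x])
  note r = local_parameterD(1)[OF this] and Q = local_parameterD(2-3)[OF this]
  from pairing_smooth[OF Q(1) Q(1) Q(1) r Q(2) radial_tangent[OF Q(2)] radial_tangent[OF Q(2)]]
  obtain r' where r': "r' > 0" "\<forall>m. C_upto m UNIV (ball x r') (\<lambda>z. H (Q z) (Q z) (Q z))" by blast
  have "C_upto m UNIV (ball x r') (\<lambda>z. Re (4 * H (Q z) (Q z) (Q z)))" for m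
    by (rule C_upto_bounded_linear[OF bounded_linear_compose[OF bounded_linear_Re bounded_linear_mult_right] coord_open_open[OF open_ball] r'(2)[rule_format]])
  moreover have "(N \<circ> G) z = Re (4 * H (Q z) (Q z) (Q z))" if "z \<in> D" for z
    unfolding Q_D[OF that] norm_eq_pairing[symmetric] by simp
  ultimately show "\<exists>V k. open V \<and> x \<in> V \<and> (\<forall>m. C_upto m UNIV V k) \<and> (\<forall>z\<in>D \<inter> V. (N \<circ> G) z = k z)"
    using r'(1) by (intro exI[of _ "ball x r'"] exI[of _ "\<lambda>z. Re (4 * H (Q z) (Q z) (Q z))"]) simp
qed

text \<open>Every tangent vector at \<open>q\<close> is the value of a constant coordinate field, so
  statements about the pulled back form transfer to tangent vectors.\<close>

lemma tangent_vector:
  assumes q: "q \<in> S \<inter> U" and v: "v \<in> tangent_space S q"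
  shows "F q \<in> D" "Q (F q) = q" "vderiv (dir_deriv F v q) Q (F q) = v"
proof -
  show D: "F q \<in> D" using q by blast
  show "Q (F q) = q" unfolding Q_D[OF D] using inv_into_f_f[OF inj_F] q by blast
  obtain V where V: "F q \<in> V" "\<forall>v\<in>coord_subspace K. \<forall>z\<in>D \<inter> V. dir_deriv G v z = vderiv v Q z"
    using pullback_local[OF D, of 0 0] by meson
  have "dir_deriv G (dir_deriv F v q) (F q) = vderiv (dir_deriv F v q) Q (F q)"
    by (rule V(2)[rule_format, OF tangent_coordinates(1)[OF q v] IntI[OF D V(1)]])
  then show "vderiv (dir_deriv F v q) Q (F q) = v" unfolding tangent_coordinates(2)[OF q v] ..
qed

lemma tangent_pairing_integrable:
  assumes q: "q \<in> S \<inter> U" and v: "v \<in> tangent_space S q" and w: "w \<in> tangent_space S q"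
  shows "pairing_integrable q v w"
proof -
  obtain V where "F q \<in> V" "\<forall>z\<in>V. pairing_integrable (Q z) (vderiv (dir_deriv F v q) Q z) (vderiv (dir_deriv F w q) Q z)"
    using pullback_local[OF tangent_vector(1)[OF q v], of "dir_deriv F v q" "dir_deriv F w q"] by meson
  then have "pairing_integrable (Q (F q)) (vderiv (dir_deriv F v q) Q (F q)) (vderiv (dir_deriv F w q) Q (F q))" by blast
  then show ?thesis unfolding tangent_vector(2,3)[OF q v] tangent_vector(3)[OF q w] .
qed

text \<open>\<open>\<Gamma> v z\<close> is the part of the differential of \<open>N\<close> that is
  antilinear in \<open>v\<close>, the derivative of type (0,1). The last clause splits its
  derivative at \<open>x\<close> into a linear part, the pairing, and an antilinear remainder
  \<kappa>.\<close>

definition norm_dbar :: "complex^'n \<Rightarrow> real \<Rightarrow> (complex^'n \<Rightarrow> complex^'n \<Rightarrow> complex) \<Rightarrow> bool" where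
  "norm_dbar x r \<Gamma> \<longleftrightarrow> r > 0 \<and>
    (\<forall>z\<in>D \<inter> ball x r. \<forall>v\<in>coord_subspace K.
       ((\<lambda>t. complex_of_real (N (G (z + t *\<^sub>R v)))) has_vector_derivative \<Gamma> v z + cnj (\<Gamma> v z)) (at 0)) \<and>
    (\<forall>z\<in>D \<inter> ball x r. \<forall>v. \<Gamma> (\<i> *s v) z = - \<i> * \<Gamma> v z) \<and>
    (\<forall>w. \<exists>\<kappa>. \<forall>v. ((\<lambda>t. \<Gamma> w (x + t *\<^sub>R v)) has_vector_derivative H (G x) (vderiv v Q x) (vderiv w Q x) + \<kappa> v) (at 0) \<and> \<kappa> (\<i> *s v) = - \<i> * \<kappa> v)"

lemma norm_dbarD:
  assumes "norm_dbar x r \<Gamma>"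
  shows "r > 0" "z \<in> D \<inter> ball x r \<Longrightarrow> v \<in> coord_subspace K \<Longrightarrow>
       ((\<lambda>t. complex_of_real (N (G (z + t *\<^sub>R v)))) has_vector_derivative \<Gamma> v z + cnj (\<Gamma> v z)) (at 0)"
    "z \<in> D \<inter> ball x r \<Longrightarrow> \<Gamma> (\<i> *s v) z = - \<i> * \<Gamma> v z"
    "\<exists>\<kappa>. \<forall>v. ((\<lambda>t. \<Gamma> w (x + t *\<^sub>R v)) has_vector_derivative H (G x) (vderiv v Q x) (vderiv w Q x) + \<kappa> v) (at 0) \<and> \<kappa> (\<i> *s v) = - \<i> * \<kappa> v"
  using assms unfolding norm_dbar_def by meson+

lemma norm_dbar_exists:
  assumes x: "x \<in> D"
  obtains r \<Gamma> where "norm_dbar x r \<Gamma>"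
proof -
  obtain r B where "local_parameter x r B" by (rule local_parameter_exists[OF x])
  note r = local_parameterD(1)[OF this] and Q = local_parameterD(2-4)[OF this]
  have xr: "x \<in> ball x r" using r by simp
  have int: "pairing_integrable (Q x) (vderiv v Q x) (vderiv w Q x)" for v w using pullback_local[OF x, of v w] by meson
  obtain \<Gamma> where \<Gamma>: "\<forall>z\<in>ball x r. \<forall>v. ((\<lambda>t. complex_of_real (N (Q (z + t *\<^sub>R v)))) has_vector_derivative \<Gamma> v z + cnj (\<Gamma> v z)) (at 0) \<and>
       \<Gamma> (\<i> *s v) z = - \<i> * \<Gamma> v z"
     "\<forall>w. \<exists>\<kappa>. \<forall>v. ((\<lambda>t. \<Gamma> w (x + t *\<^sub>R v)) has_vector_derivative H (Q x) (vderiv v Q x) (vderiv w Q x) + \<kappa> v) (at 0) \<and> \<kappa> (\<i> *s v) = - \<i> * \<kappa> v"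
    using norm_Levi_form[OF Q(1) r Q(2) Q(3)[OF xr] int] by blast
  have "norm_dbar x r \<Gamma>" unfolding norm_dbar_def
  proof (intro conjI ballI allI)
    show "r > 0" by (rule r)
  next
    fix z v assume z: "z \<in> D \<inter> ball x r" and v: "v \<in> coord_subspace K"
    have "((\<lambda>t. complex_of_real (N (Q (z + t *\<^sub>R v)))) has_vector_derivative \<Gamma> v z + cnj (\<Gamma> v z)) (at 0)" using \<Gamma>(1) z by blast
    then show "((\<lambda>t. complex_of_real (N (G (z + t *\<^sub>R v)))) has_vector_derivative \<Gamma> v z + cnj (\<Gamma> v z)) (at 0)"
      using dir_deriv_cong(1)[OF coord_open_D _ _ v, where f="\<lambda>z. complex_of_real (N (Q z))" and g="\<lambda>z. complex_of_real (N (G z))"] Q_D z by simp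
  next
    show "\<Gamma> (\<i> *s v) z = - \<i> * \<Gamma> v z" if "z \<in> D \<inter> ball x r" for z v using \<Gamma>(1) that by blast
  next
    show "\<exists>\<kappa>. \<forall>v. ((\<lambda>t. \<Gamma> w (x + t *\<^sub>R v)) has_vector_derivative H (G x) (vderiv v Q x) (vderiv w Q x) + \<kappa> v) (at 0) \<and> \<kappa> (\<i> *s v) = - \<i> * \<kappa> v" for w
      by (rule \<Gamma>(2)[rule_format, unfolded Q_D[OF x]])
  qed
  then show thesis by (rule that)
qed

lemma vderiv_Q_smult:
  assumes "x \<in> D" shows "vderiv (a *s v) Q x = a *s vderiv v Q x"
proof -
  obtain r B where "local_parameter x r B" by (rule local_parameter_exists[OF assms])
  note r = local_parameterD(1,2)[OF this]
  show ?thesis by (rule vderiv_smult[OF r(2)]) (use r(1) in simp)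
qed

text \<open>The combination in \<open>wirtinger_bar\<close> keeps the antilinear part \<Gamma> of
  the first derivative, and the one in \<open>wirtinger\<close> keeps the linear part of the second,
  so \<kappa> drops out.\<close>

lemma wirtinger_norm:
  assumes x: "x \<in> D" and k: "k \<in> K" and l: "l \<in> K"
  shows "wirtinger k (wirtinger_bar l (\<lambda>\<zeta>. complex_of_real (N (G \<zeta>)))) x = H (G x) (vderiv (axis k 1) Q x) (vderiv (axis l 1) Q x)"
proof -
  obtain r \<Gamma> where "norm_dbar x r \<Gamma>" by (rule norm_dbar_exists[OF x])
  note r = norm_dbarD(1)[OF this] and \<Gamma> = norm_dbarD(2-4)[OF this]
  let ?N = "\<lambda>\<zeta>. complex_of_real (N (G \<zeta>))"
  have D': "coord_open K (D \<inter> ball x r)" by (rule coord_open_Int[OF coord_open_D open_ball])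
  have x': "x \<in> D \<inter> ball x r" using x r by simp
  have wb: "wirtinger_bar l ?N z = \<Gamma> (axis l 1) z" if z: "z \<in> D \<inter> ball x r" for z
  proof -
    have d: "dir_deriv ?N (axis l a) z = \<Gamma> (axis l a) z + cnj (\<Gamma> (axis l a) z)" for a
      by (rule dir_deriv_eqI[OF \<Gamma>(1)[OF z axis_coord_subspace[OF l]]])
    have "\<Gamma> (axis l \<i>) z = - \<i> * \<Gamma> (axis l 1) z" unfolding axis_smult[of l \<i>] by (rule \<Gamma>(2)[OF z])
    then show ?thesis unfolding wirtinger_bar_def d by (simp add: algebra_simps)
  qed
  obtain \<kappa> where \<kappa>: "\<And>v. ((\<lambda>t. \<Gamma> (axis l 1) (x + t *\<^sub>R v)) has_vector_derivative H (G x) (vderiv v Q x) (vderiv (axis l 1) Q x) + \<kappa> v) (at 0)"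
     "\<And>v. \<kappa> (\<i> *s v) = - \<i> * \<kappa> v" using \<Gamma>(3) by meson
  have d: "dir_deriv (wirtinger_bar l ?N) (axis k a) x = H (G x) (vderiv (axis k a) Q x) (vderiv (axis l 1) Q x) + \<kappa> (axis k a)" for a
    using dir_deriv_cong(2)[OF D' wb x' axis_coord_subspace[OF k]] dir_deriv_eqI[OF \<kappa>(1)] by simp
  show ?thesis unfolding wirtinger_def d unfolding axis_smult[of k \<i>] \<kappa>(2) vderiv_Q_smult[OF x] pairing_smult by (simp add: algebra_simps)
qed

end

context stratum_coordinates
begin

text \<open>\<open>v\<close> and \<open>w\<close> are expanded in the coordinate frame; by
  sesquilinearity the pairing becomes the sum in \<open>del_delbar\<close>, with the mixed
  derivatives of \<open>N\<close> as coefficients.\<close>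

lemma del_delbar_norm:
  assumes q: "q \<in> S \<inter> U" and v: "v \<in> tangent_space S q" and w: "w \<in> tangent_space S q"
  shows "complex_of_real (Im (H q v w)) = \<i> / 2 * del_delbar K U F N q v w"
proof -
  define x where "x = F q"
  have x: "x \<in> D" "G x = q" using tangent_vector(1,2)[OF q v] Q_D unfolding x_def by auto
  have lin: "linear (\<lambda>v. vderiv v Q x)"
  proof -
    obtain r B where "local_parameter x r B" by (rule local_parameter_exists[OF x(1)])
    note r = local_parameterD(1,6)[OF this]
    show ?thesis by (rule r(2)) (use r(1) in simp)
  qed
  let ?E = "\<lambda>k. vderiv (axis k 1) Q x"
  have ex: "(\<Sum>k\<in>K. dir_deriv F v q $ k *s ?E k) = v" if v: "v \<in> tangent_space S q" for v
  proof -
    have "v = vderiv (dir_deriv F v q) Q x" using tangent_vector(3)[OF q v] by (simp add: x_def)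
    also have "\<dots> = vderiv (\<Sum>k\<in>K. dir_deriv F v q $ k *s axis k 1) Q x"
      by (subst coord_subspace_expansion[OF tangent_coordinates(1)[OF q v], symmetric]) (rule refl)
    also have "\<dots> = (\<Sum>k\<in>K. dir_deriv F v q $ k *s ?E k)" unfolding linear_sum[OF lin] vderiv_Q_smult[OF x(1)] ..
    finally show ?thesis by simp
  qed
  have int: "pairing_integrable q (?E k) (?E l)" for k l
  proof -
    obtain V where "x \<in> V" "\<forall>z\<in>V. pairing_integrable (Q z) (vderiv (axis k 1) Q z) (vderiv (axis l 1) Q z)"
      using pullback_local[OF x(1), of "axis k 1" "axis l 1"] by meson
    then have "pairing_integrable (Q x) (?E k) (?E l)" by blast
    then show ?thesis unfolding Q_D[OF x(1)] x(2) .
  qed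
  have "(\<Sum>k\<in>K. \<Sum>l\<in>K. wirtinger k (wirtinger_bar l (\<lambda>\<zeta>. complex_of_real (N (G \<zeta>)))) (F q) * (dir_deriv F v q $ k) * cnj (dir_deriv F w q $ l)) =
    (\<Sum>k\<in>K. \<Sum>l\<in>K. H q (?E k) (?E l) * (dir_deriv F v q $ k) * cnj (dir_deriv F w q $ l))"
    by (intro sum.cong refl) (simp add: wirtinger_norm[OF x(1)] x(2) x_def[symmetric])
  also have "\<dots> = H q v w" unfolding pairing_sum2[OF finite int, symmetric] ex[OF v] ex[OF w] ..
  finally have sum: "(\<Sum>k\<in>K. \<Sum>l\<in>K. wirtinger k (wirtinger_bar l (\<lambda>\<zeta>. complex_of_real (N (G \<zeta>)))) (F q) * (dir_deriv F v q $ k) * cnj (dir_deriv F w q $ l)) = H q v w" .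
  \<comment> \<open>The factor \<open>\<i> / 2\<close> of the theorem is the inverse of the factor
    \<open>- 2 * \<i>\<close> in the convention for \<open>del_delbar\<close>.\<close>
  have "\<i> / 2 * (- 2 * \<i> * c) = c" for c :: complex by (simp add: complex_eq_iff)
  then show ?thesis unfolding del_delbar_def sum by (rule sym)
qed

text \<open>With \<open>?h\<close> the pairing, the two second derivatives are
  \<open>2 * Im ?h + 2 * Im (\<kappa> v)\<close> and
  \<open>- 2 * Im ?h + 2 * Im (\<kappa> v)\<close>; the remainder \<kappa> cancels and the
  difference \<open>4 * Im ?h\<close> accounts for the division by 4.\<close>

lemma pullback_Im_ddc:
  assumes v: "v \<in> coord_subspace K" and w: "w \<in> coord_subspace K" and x: "x \<in> D"
  shows "pullback_form U F (\<lambda>q v w. Im (H q v w)) v w x =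
    (dir_deriv (dir_deriv (N \<circ> G) (\<i> *s w)) v x - dir_deriv (dir_deriv (N \<circ> G) w) (\<i> *s v) x) / 4"
proof -
  obtain r \<Gamma> where "norm_dbar x r \<Gamma>" by (rule norm_dbar_exists[OF x])
  note r = norm_dbarD(1)[OF this] and \<Gamma> = norm_dbarD(2-4)[OF this]
  note J = coord_subspace_smult[of _ K \<i>]
  have D': "coord_open K (D \<inter> ball x r)" by (rule coord_open_Int[OF coord_open_D open_ball])
  have x': "x \<in> D \<inter> ball x r" using x r by simp
  have N1: "dir_deriv (N \<circ> G) u z = 2 * Re (\<Gamma> u z)" if "z \<in> D \<inter> ball x r" "u \<in> coord_subspace K" for z u
    using bounded_linear.has_vector_derivative[OF bounded_linear_Re \<Gamma>(1)[OF that]] by (intro dir_deriv_eqI) (simp add: comp_def)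
  have N2: "dir_deriv (N \<circ> G) (\<i> *s u) z = 2 * Im (\<Gamma> u z)" if "z \<in> D \<inter> ball x r" "u \<in> coord_subspace K" for z u
    using N1[OF that(1) J[OF that(2)]] \<Gamma>(2)[OF that(1)] by simp
  obtain \<kappa> where \<kappa>: "\<And>v. ((\<lambda>t. \<Gamma> w (x + t *\<^sub>R v)) has_vector_derivative H (G x) (vderiv v Q x) (vderiv w Q x) + \<kappa> v) (at 0)"
     "\<And>v. \<kappa> (\<i> *s v) = - \<i> * \<kappa> v" using \<Gamma>(3) by meson
  let ?h = "H (G x) (vderiv v Q x) (vderiv w Q x)"
  have "dir_deriv (dir_deriv (N \<circ> G) (\<i> *s w)) v x = 2 * Im (?h + \<kappa> v)"
  proof -
    have "dir_deriv (\<lambda>z. 2 * Im (\<Gamma> w z)) v x = 2 * Im (?h + \<kappa> v)"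
      by (rule dir_deriv_eqI[OF bounded_linear.has_vector_derivative[OF bounded_linear_compose[OF bounded_linear_mult_right bounded_linear_Im] \<kappa>(1)]])
    then show ?thesis using dir_deriv_cong(2)[OF D' N2[OF _ w] x' v] by simp
  qed
  moreover have "dir_deriv (dir_deriv (N \<circ> G) w) (\<i> *s v) x = 2 * Re (\<i> * ?h - \<i> * \<kappa> v)"
  proof -
    have "dir_deriv (\<lambda>z. 2 * Re (\<Gamma> w z)) (\<i> *s v) x = 2 * Re (H (G x) (vderiv (\<i> *s v) Q x) (vderiv w Q x) + \<kappa> (\<i> *s v))"
      by (rule dir_deriv_eqI[OF bounded_linear.has_vector_derivative[OF bounded_linear_compose[OF bounded_linear_mult_right bounded_linear_Re] \<kappa>(1)]])
    then show ?thesis using dir_deriv_cong(2)[OF D' N1[OF _ w] x' J[OF v]] by (simp add: \<kappa>(2) vderiv_Q_smult[OF x] pairing_smult)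
  qed
  moreover have "pullback_form U F (\<lambda>q v w. Im (H q v w)) v w x = Im ?h"
  proof -
    obtain V where V: "x \<in> V" "\<forall>v\<in>coord_subspace K. \<forall>z\<in>D \<inter> V. dir_deriv G v z = vderiv v Q z"
      using pullback_local[OF x, of 0 0] by meson
    show ?thesis unfolding pullback_form_def V(2)[rule_format, OF v IntI[OF x V(1)]] V(2)[rule_format, OF w IntI[OF x V(1)]] ..
  qed
  ultimately show ?thesis by simp
qed

lemma pullback_Im_closed:
  assumes "x \<in> D" "u \<in> coord_subspace K" "v \<in> coord_subspace K" "w \<in> coord_subspace K"
  shows "dir_deriv (pullback_form U F (\<lambda>q v w. Im (H q v w)) v w) u x
    - dir_deriv (pullback_form U F (\<lambda>q v w. Im (H q v w)) u w) v x
    + dir_deriv (pullback_form U F (\<lambda>q v w. Im (H q v w)) u v) w x = 0"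
  by (rule closed_ddc[OF norm_smooth coord_open_D assms(1) pullback_Im_ddc assms(2-4)])

end

section \<open>The stratum of the zero differential and the conclusion\<close>

lemma dir_deriv_zero: "dir_deriv f 0 x = 0"
  by (rule dir_deriv_eqI) simp

text \<open>For the stratum with one point: a nonempty set with at most one point is open only in
  trivial directions, so \<open>coord_subspace K\<close> reduces to 0.\<close>

lemma coord_open_singleton:
  assumes D: "coord_open K D" "D \<subseteq> {x}" "y \<in> D" and v: "v \<in> coord_subspace K"
  shows "v = 0"
proof -
  obtain \<delta> where \<delta>: "\<delta> > 0" "\<And>t::real. dist t 0 < \<delta> \<Longrightarrow> y + t *\<^sub>R v \<in> D"
    using coord_open_eventually[OF D(1,3) v] unfolding eventually_nhds_metric by blast
  have "y + (\<delta> / 2) *\<^sub>R v \<in> D" using \<delta>(1) by (intro \<delta>(2)) (simp add: dist_real_def)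
  then have "y + (\<delta> / 2) *\<^sub>R v = y" using D(2,3) by blast
  then show ?thesis using \<delta>(1) by simp
qed

text \<open>All admissible directions are 0, and along the direction 0 every function is
  constant.\<close>

lemma C_infinity_singleton:
  assumes D: "coord_open K D" "D \<subseteq> {x}"
  shows "C_infinity K D (f :: complex^'n::finite \<Rightarrow> 'b::real_normed_vector)"
  unfolding C_infinity_def
proof
  fix m
  have c: "continuous_on D f" for f :: "complex^'n \<Rightarrow> 'b"
    by (rule continuous_on_subset[OF _ D(2)]) simp
  show "C_upto m K D f"
  proof (induction m arbitrary: f)
    case 0 then show ?case by (simp add: c)
  next
    case (Suc m)
    have "(\<lambda>t::real. f (y + t *\<^sub>R v)) differentiable at 0" if "y \<in> D" "v \<in> coord_subspace K" for y v
      using coord_open_singleton[OF D that] by simp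
    then show ?case using Suc.IH c by simp
  qed
qed

lemma (in adapted_coordinates) point_C_infinity:
  assumes "S \<subseteq> {q}" shows "C_infinity K D f"
  by (rule C_infinity_singleton[OF coord_open_D, of "F q"]) (use assms in blast)

lemma (in adapted_coordinates) point_coord:
  assumes "S \<subseteq> {q}" "x \<in> D" "v \<in> coord_subspace K" shows "v = 0"
  by (rule coord_open_singleton[OF coord_open_D _ assms(2,3), of "F q"]) (use assms(1) in blast)

theorem theorem5p3:
  fixes X :: "'a topology" and A :: "'a chart set" and g :: nat
    and e :: "'n::finite \<Rightarrow> 'a differential"
    and \<S> :: "(complex^'n) set set" and S :: "(complex^'n) set"
    and N :: "complex^'n \<Rightarrow> real"
    and h :: "complex^'n \<Rightarrow> complex^'n \<Rightarrow> complex^'n \<Rightarrow> complex"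
    and \<omega> :: "complex^'n \<Rightarrow> complex^'n \<Rightarrow> complex^'n \<Rightarrow> real"
  defines "N \<equiv> \<lambda>q. qd_norm X A (qd_of e q)"
    and "h \<equiv> \<lambda>q v w. pairing X A (qd_of e q) (qd_of e v) (qd_of e w)"
    and "\<omega> \<equiv> \<lambda>q v w. Im (h q v w)"
  assumes "compact_riemann_surface X A" and "has_genus X g" and "g \<ge> 2"
    and "qd_basis A e"
    and "qd_stratification X A e \<S>" and "S \<in> \<S>"
  shows
    "(\<forall>q\<in>S.
        (\<forall>v\<in>tangent_space S q. \<forall>w\<in>tangent_space S q.
           surface_integrable A (pairing_density (qd_of e q) (qd_of e v) (qd_of e w))) \<and>
        positive_hermitian_on (tangent_space S q) (h q)) \<and>
     (smooth_function S N \<and>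
      (\<forall>K U F. adapted_chart S K U F \<longrightarrow>
        (\<forall>q\<in>S \<inter> U. \<forall>v\<in>tangent_space S q. \<forall>w\<in>tangent_space S q.
           complex_of_real (\<omega> q v w) = \<i> / 2 * del_delbar K U F N q v w)) \<and>
      closed_two_form S \<omega>) \<and>
     kaehler_structure S h"
proof -
  have sub: "complex_submanifold S"
    using assms(8,9) by (simp add: qd_stratification_def analytic_stratification_def)
  have "(\<forall>q\<in>S. \<forall>v\<in>tangent_space S q. \<forall>w\<in>tangent_space S q.
           surface_integrable A (pairing_density (qd_of e q) (qd_of e v) (qd_of e w))) \<and>
        (\<forall>q\<in>S. positive_hermitian_on (tangent_space S q) (h q)) \<and> smooth_function S N \<and>
      (\<forall>K U F. adapted_chart S K U F \<longrightarrow>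
        (\<forall>q\<in>S \<inter> U. \<forall>v\<in>tangent_space S q. \<forall>w\<in>tangent_space S q.
           complex_of_real (\<omega> q v w) = \<i> / 2 * del_delbar K U F N q v w)) \<and>
      smooth_form S h \<and> closed_two_form S \<omega>"
  proof (cases "0 \<in> S")
    case True
    have "{0} \<in> \<S>" using assms(8) by (simp add: qd_stratification_def)
    moreover have "\<forall>S\<in>\<S>. \<forall>T\<in>\<S>. S \<inter> closure T \<noteq> {} \<longrightarrow> S \<subseteq> closure T"
      using assms(8) unfolding qd_stratification_def analytic_stratification_def by (elim conjE)
    moreover have "S \<inter> closure {0} \<noteq> {}" using True by auto
    ultimately have "S \<subseteq> closure {0}" using assms(9) by blast
    then have S: "S = {0}" using True by auto
    \<comment> \<open>The only tangent vector of a one-point stratum is 0, so all assertions reduce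
      to forms evaluated at 0.\<close>
    have T: "v = 0" if "q \<in> S" "v \<in> tangent_space S q" for q v
      using tangent_space_zero[of 0] that unfolding S by auto
    have zero: "qd_of e 0 = (\<lambda>c p. 0)" by (simp add: qd_of_def)
    have pd: "pairing_density \<phi> (\<lambda>c p. 0) \<psi> = (\<lambda>c p. 0)" for \<phi> \<psi> :: "'a differential" by (simp add: pairing_density_def)
    have h0: "h q 0 w = 0" for q w
      by (simp add: h_def pairing_def zero pd surface_integral_def set_lebesgue_integral_def)
    have ac: "adapted_coordinates S K U F" if "adapted_chart S K U F" for K U F using that by unfold_locales
    note C = adapted_coordinates.point_C_infinity[OF ac equalityD1[OF S]]
    note z = adapted_coordinates.point_coord[OF ac equalityD1[OF S]]
    show ?thesis
    proof (intro conjI ballI allI impI)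
      fix q v w assume q: "q \<in> S" and v: "v \<in> tangent_space S q"
      show "surface_integrable A (pairing_density (qd_of e q) (qd_of e v) (qd_of e w))"
        unfolding T[OF q v] zero pd by (simp add: surface_integrable_def set_integrable_def)
    next
      fix q assume q: "q \<in> S"
      show "positive_hermitian_on (tangent_space S q) (h q)"
        unfolding positive_hermitian_on_def
      proof (intro conjI ballI allI impI)
        fix u v w assume u: "u \<in> tangent_space S q" and v: "v \<in> tangent_space S q" and w: "w \<in> tangent_space S q"
        show "h q (u + v) w = h q u w + h q v w" unfolding T[OF q u] T[OF q v] by (simp add: h0)
        show "h q w v = cnj (h q v w)" unfolding T[OF q w] T[OF q v] by (simp add: h0)
        show "h q (a *s v) w = a * h q v w" for a unfolding T[OF q v] by (simp add: h0)
        show "Im (h q v v) = 0" unfolding T[OF q v] by (simp add: h0)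
        show "Re (h q v v) > 0" if "v \<noteq> 0" using T[OF q v] that by simp
      qed
    next
      show "smooth_function S N" unfolding smooth_function_def using C by blast
    next
      fix K :: "'n set" and U F q v w assume q: "q \<in> S \<inter> U" and v: "v \<in> tangent_space S q"
      have "v = 0" using T q v by blast
      then show "complex_of_real (\<omega> q v w) = \<i> / 2 * del_delbar K U F N q v w"
        by (simp add: \<omega>_def h0 del_delbar_def dir_deriv_zero)
    next
      show "smooth_form S h" unfolding smooth_form_def using C by blast
      show "closed_two_form S \<omega>" unfolding closed_two_form_def smooth_form_def
      proof (intro conjI allI impI ballI)
        fix K U F \<zeta> u v w
        assume ch: "adapted_chart S K U F" and x: "\<zeta> \<in> F ` (S \<inter> U)" and c: "u \<in> coord_subspace K" "v \<in> coord_subspace K" "w \<in> coord_subspace K"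
        show "dir_deriv (pullback_form U F \<omega> v w) u \<zeta> - dir_deriv (pullback_form U F \<omega> u w) v \<zeta> + dir_deriv (pullback_form U F \<omega> u v) w \<zeta> = 0"
          unfolding z[OF ch x c(1)] z[OF ch x c(2)] z[OF ch x c(3)] dir_deriv_zero by simp
      qed (rule C)
    qed
  next
    case False
    interpret stratum X A e S
    proof
      show "compact_riemann_surface X A" "qd_basis A e" by (fact assms)+
      have symbols: "\<forall>S\<in>\<S>. \<forall>q\<in>S. \<forall>r\<in>S. q \<noteq> 0 \<longrightarrow> r \<noteq> 0 \<longrightarrow> symbol X A (qd_of e q) = symbol X A (qd_of e r)"
        using assms(8) unfolding qd_stratification_def by (elim conjE)
      have poles: "\<forall>S\<in>\<S>. \<forall>q\<in>S. q \<noteq> 0 \<longrightarrow> (\<forall>v\<in>tangent_space S q. quotient_at_most_simple_poles A (qd_of e v) (qd_of e q))"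
        using assms(8) unfolding qd_stratification_def by (elim conjE)
      show nz: "q \<noteq> 0" if "q \<in> S" for q using False that by blast
      show "symbol X A (qd_of e q) = symbol X A (qd_of e q')" if "q \<in> S" "q' \<in> S" for q q'
        using symbols assms(9) that nz by blast
      show "quotient_at_most_simple_poles A (qd_of e v) (qd_of e q)" if "q \<in> S" "v \<in> tangent_space S q" for q v
        using poles assms(9) that nz by blast
    qed
    have scaling: "a *s q \<in> S" if "a \<noteq> 0" "q \<in> S" for a q
    proof -
      have "\<forall>S\<in>\<S>. \<forall>a q. a \<noteq> 0 \<longrightarrow> q \<in> S \<longrightarrow> a *s q \<in> S"
        using assms(8) unfolding qd_stratification_def by (elim conjE)
      then show ?thesis using assms(9) that by blast
    qed
    have sc: "stratum_coordinates X A e S K U F" if "adapted_chart S K U F" for K U F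
      using that scaling by unfold_locales
    have int: "pairing_integrable q v w" if q: "q \<in> S" and v: "v \<in> tangent_space S q" and w: "w \<in> tangent_space S q" for q v w
    proof -
      obtain K U F where "q \<in> U" "adapted_chart S K U F" using sub q unfolding complex_submanifold_def by blast
      then show ?thesis using q by (intro stratum_coordinates.tangent_pairing_integrable[OF sc _ v w]) simp_all
    qed
    show ?thesis
    proof (intro conjI ballI allI impI)
      show "pairing_integrable q v w" if "q \<in> S" "v \<in> tangent_space S q" "w \<in> tangent_space S q" for q v w by (rule int[OF that])
    next
      fix q assume q: "q \<in> S"
      show "positive_hermitian_on (tangent_space S q) (h q)"
        unfolding positive_hermitian_on_def h_def
      proof (intro conjI ballI allI impI)
        show "H q (u + v) w = H q u w + H q v w" if "u \<in> tangent_space S q" "v \<in> tangent_space S q" "w \<in> tangent_space S q" for u v w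
          by (rule pairing_add[OF int[OF q that(1,3)] int[OF q that(2,3)]])
        show "H q (a *s v) w = a * H q v w" for a v w by (rule pairing_smult)
        show "H q w v = cnj (H q v w)" for v w by (rule pairing_cnj)
        show "Im (H q v v) = 0" "Re (H q v v) > 0" if v: "v \<in> tangent_space S q" "v \<noteq> 0" for v
          using pairing_positive[OF qd_of_in qd_of_nonzero[OF q] qd_of_in _ int[OF q v(1) v(1)]] v(2)
          unfolding qd_of_eq_zero_iff by simp_all
      qed
    next
      show "smooth_function S N" unfolding smooth_function_def N_def
        using stratum_coordinates.norm_smooth[OF sc] by blast
    next
      show "complex_of_real (\<omega> q v w) = \<i> / 2 * del_delbar K U F N q v w"
        if "adapted_chart S K U F" "q \<in> S \<inter> U" "v \<in> tangent_space S q" "w \<in> tangent_space S q" for K U F q v w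
        unfolding N_def \<omega>_def h_def by (rule stratum_coordinates.del_delbar_norm[OF sc[OF that(1)] that(2-4)])
    next
      show "smooth_form S h" unfolding smooth_form_def h_def
        using stratum_coordinates.pullback_smooth[OF sc] by blast
      show "closed_two_form S \<omega>" unfolding closed_two_form_def smooth_form_def \<omega>_def h_def
      proof (intro conjI allI impI ballI)
        show "C_infinity K (F ` (S \<inter> U)) (pullback_form U F (\<lambda>q v w. Im (H q v w)) v w)"
          if "adapted_chart S K U F" "v \<in> coord_subspace K" "w \<in> coord_subspace K" for K U F v w
          by (rule stratum_coordinates.pullback_Im_smooth[OF sc[OF that(1)] that(2,3)])
      qed (rule stratum_coordinates.pullback_Im_closed[OF sc])
    qed
  qed
  then show ?thesis using sub unfolding kaehler_structure_def \<omega>_def by blast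
qed

end
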